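(* Let $H$ be a hereditary artin algebra with a Dynkin ext-quiver $Q_H$. Then the Coxeter order $|C_H|$ for $H$ is independent of the orientation of $Q_H$ and is given, according to the type of the underlying valued graph $\overline{Q}_H$, by: $|C_H|=n+1$ for $\mathbb A_n$; $2n$ for $\mathbb B_n$; $2n$ for $\mathbb C_n$; $2(n-1)$ for $\mathbb D_n$; $12$ for $\mathbb E_6$; $18$ for $\mathbb E_7$; $30$ for $\mathbb E_8$; $12$ for $\mathbb F_4$; $6$ for $\mathbb G_2$.
   Context: $R$ is a commutative artinian ring; artin algebras are artin $R$-algebras; $\mathrm{mod}\,H$ is the category of finitely generated left $H$-modules. The ext-quiver $Q_H$ has vertices $1,\dots,n$ corresponding to the non-isomorphic simple modules $S_1,\dots,S_n$, with an arrow $i\to j$ iff $\mathrm{Ext}^1_H(S_i,S_j)\ne0$, carrying the valuation $(\dim_{\mathrm{End}(S_j)}\mathrm{Ext}^1_H(S_i,S_j),\ \dim\mathrm{Ext}^1_H(S_i,S_j)_{\mathrm{End}(S_i)})$. The underlying valued graph of a valued quiver without 2-cycles forgets orientations: an arrow $x\to y$ with valuation $(a,b)$ gives an edge $x-y$ labelled $(a,b)$, equivalently $y-x$ labelled $(b,a)$ (label $(1,1)$ omitted). $Q_H$ is a Dynkin quiver if it has no 2-cycle and its underlying valued graph is isomorphic to one of: $\mathbb A_n$ ($n\ge1$): path $1-2-\cdots-n$; $\mathbb B_n$ ($n\ge2$): path $1-2-\cdots-n$ with $1-2$ labelled $(1,2)$; $\mathbb C_n$ ($n\ge3$): the same path with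 $1-2$ labelled $(2,1)$; $\mathbb D_n$ ($n\ge4$): edges $1-3$, $2-3$, $3-4-\cdots-n$; $\mathbb E_n$ ($n=6,7,8$): edges $1-2-3-5-6-\cdots-n$ and $3-4$; $\mathbb F_4$: path $1-2-3-4$ with $2-3$ labelled $(1,2)$; $\mathbb G_2$: $1-2$ labelled $(1,3)$. For a module $M$, $\underline{\dim}M\in K_0(\mathrm{mod}\,H)$ is the vector of multiplicities of $S_1,\dots,S_n$ as composition factors of $M$. With $P_i$, $I_i$ the projective cover and the injective envelope of $S_i$, the Coxeter transformation $C_H$ is the automorphism of $K_0(\mathrm{mod}\,H)$ with $C_H(\underline{\dim}P_i)=-\underline{\dim}I_i$ for all $i$. The Coxeter order $|C_H|$ is the (finite) order of $C_H$. *)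

theory Defs
  imports "HOL-Algebra.Module" "HOL-Algebra.Ideal" "HOL-Analysis.Finite_Cartesian_Product"
begin

section \<open>Left modules over a not necessarily commutative ring\<close>

text \<open>
  The locale \<open>module\<close> of the library assumes a commutative ring of scalars. We keep its record type
  (the fields \<open>mult\<close> and \<open>one\<close> of a module are irrelevant) and its locale \<open>submodule\<close>, which makes no
  assumption on the scalars.
\<close>

locale left_module = R?: ring R + M?: abelian_group M for R (structure) and M (structure) +
  assumes smult_closed [simp, intro]:
      "\<lbrakk>a \<in> carrier R; x \<in> carrier M\<rbrakk> \<Longrightarrow> a \<odot>\<^bsub>M\<^esub> x \<in> carrier M"
    and smult_l_distr:
      "\<lbrakk>a \<in> carrier R; b \<in> carrier R; x \<in> carrier M\<rbrakk> \<Longrightarrow>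
        (a \<oplus> b) \<odot>\<^bsub>M\<^esub> x = a \<odot>\<^bsub>M\<^esub> x \<oplus>\<^bsub>M\<^esub> b \<odot>\<^bsub>M\<^esub> x"
    and smult_r_distr:
      "\<lbrakk>a \<in> carrier R; x \<in> carrier M; y \<in> carrier M\<rbrakk> \<Longrightarrow>
        a \<odot>\<^bsub>M\<^esub> (x \<oplus>\<^bsub>M\<^esub> y) = a \<odot>\<^bsub>M\<^esub> x \<oplus>\<^bsub>M\<^esub> a \<odot>\<^bsub>M\<^esub> y"
    and smult_assoc1:
      "\<lbrakk>a \<in> carrier R; b \<in> carrier R; x \<in> carrier M\<rbrakk> \<Longrightarrow>
        (a \<otimes> b) \<odot>\<^bsub>M\<^esub> x = a \<odot>\<^bsub>M\<^esub> (b \<odot>\<^bsub>M\<^esub> x)"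
    and smult_one [simp]:
      "x \<in> carrier M \<Longrightarrow> \<one> \<odot>\<^bsub>M\<^esub> x = x"

definition finitely_generated :: "('r, 'x) ring_scheme \<Rightarrow> ('r, 'm, 'y) module_scheme \<Rightarrow> bool" where
  "finitely_generated H M \<longleftrightarrow>
    (\<exists>A. finite A \<and> A \<subseteq> carrier M \<and> (\<forall>U. submodule U H M \<and> A \<subseteq> U \<longrightarrow> U = carrier M))"

definition fg_module :: "('r, 'x) ring_scheme \<Rightarrow> ('r, 'm) module \<Rightarrow> bool" where
  "fg_module H M \<longleftrightarrow> left_module H M \<and> finitely_generated H M"

definition regular_module :: "('h, 'x) ring_scheme \<Rightarrow> ('h, 'h) module" where
  "regular_module H =
    \<lparr>carrier = carrier H, mult = mult H, one = \<one>\<^bsub>H\<^esub>, zero = \<zero>\<^bsub>H\<^esub>, add = add H, smult = mult H\<rparr>"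

definition quot_module :: "('r, 'm) module \<Rightarrow> 'm set \<Rightarrow> ('r, 'm set) module" where
  "quot_module M U =
    \<lparr>carrier = a_rcosets\<^bsub>M\<^esub> U, mult = undefined, one = undefined, zero = U, add = set_add M,
     smult = (\<lambda>r X. \<Union>x\<in>X. U +>\<^bsub>M\<^esub> (r \<odot>\<^bsub>M\<^esub> x))\<rparr>"

definition Hom :: "('r, 'x) ring_scheme \<Rightarrow> ('r, 'm) module \<Rightarrow> ('r, 'k) module \<Rightarrow> ('m \<Rightarrow> 'k) set" where
  "Hom H M N = {f \<in> carrier M \<rightarrow>\<^sub>E carrier N.
     (\<forall>x\<in>carrier M. \<forall>y\<in>carrier M. f (x \<oplus>\<^bsub>M\<^esub> y) = f x \<oplus>\<^bsub>N\<^esub> f y) \<and>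
     (\<forall>r\<in>carrier H. \<forall>x\<in>carrier M. f (r \<odot>\<^bsub>M\<^esub> x) = r \<odot>\<^bsub>N\<^esub> f x)}"

definition isomorphic_modules ::
    "('r, 'x) ring_scheme \<Rightarrow> ('r, 'm) module \<Rightarrow> ('r, 'k) module \<Rightarrow> bool" where
  "isomorphic_modules H M N \<longleftrightarrow> (\<exists>f \<in> Hom H M N. bij_betw f (carrier M) (carrier N))"

definition End_ring :: "('r, 'x) ring_scheme \<Rightarrow> ('r, 'm) module \<Rightarrow> ('m \<Rightarrow> 'm) ring" where
  "End_ring H M =
    \<lparr>carrier = Hom H M M, mult = compose (carrier M), one = (\<lambda>x\<in>carrier M. x),
     zero = (\<lambda>x\<in>carrier M. \<zero>\<^bsub>M\<^esub>), add = (\<lambda>f g. \<lambda>x\<in>carrier M. f x \<oplus>\<^bsub>M\<^esub> g x)\<rparr>"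

text \<open>Right modules over \<open>D\<close> are left modules over the opposite ring.\<close>

definition opposite_ring :: "'d ring \<Rightarrow> 'd ring" where
  "opposite_ring D = D\<lparr>mult := (\<lambda>x y. y \<otimes>\<^bsub>D\<^esub> x)\<rparr>"

definition is_basis :: "'d ring \<Rightarrow> ('d, 'v) module \<Rightarrow> 'v set \<Rightarrow> bool" where
  "is_basis D V B \<longleftrightarrow> finite B \<and> B \<subseteq> carrier V \<and>
    (\<forall>v\<in>carrier V. \<exists>!c. c \<in> B \<rightarrow>\<^sub>E carrier D \<and> v = (\<Oplus>\<^bsub>V\<^esub>b\<in>B. c b \<odot>\<^bsub>V\<^esub> b))"

text \<open>Only used for finite dimensional spaces over division rings.\<close>

definition vdim :: "'d ring \<Rightarrow> ('d, 'v) module \<Rightarrow> nat" where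
  "vdim D V = card (SOME B. is_basis D V B)"


section \<open>Hereditary artin algebras\<close>

definition artinian_cring :: "('r, 'x) ring_scheme \<Rightarrow> bool" where
  "artinian_cring R \<longleftrightarrow> cring R \<and>
    (\<forall>J :: nat \<Rightarrow> 'r set. (\<forall>k. ideal (J k) R \<and> J (Suc k) \<subseteq> J k) \<longrightarrow> (\<exists>m. \<forall>k\<ge>m. J k = J m))"

text \<open>The locale \<open>algebra\<close> of the library only covers commutative algebras.\<close>

definition artin_algebra :: "('r, 'x) ring_scheme \<Rightarrow> ('r, 'h) module \<Rightarrow> bool" where
  "artin_algebra R H \<longleftrightarrow> artinian_cring R \<and> ring H \<and> left_module R H \<and>
    (\<forall>r\<in>carrier R. \<forall>x\<in>carrier H. \<forall>y\<in>carrier H.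
       (r \<odot>\<^bsub>H\<^esub> x) \<otimes>\<^bsub>H\<^esub> y = r \<odot>\<^bsub>H\<^esub> (x \<otimes>\<^bsub>H\<^esub> y) \<and>
       x \<otimes>\<^bsub>H\<^esub> (r \<odot>\<^bsub>H\<^esub> y) = r \<odot>\<^bsub>H\<^esub> (x \<otimes>\<^bsub>H\<^esub> y)) \<and>
    finitely_generated R H"

text \<open>
  Every finitely generated left \<open>H\<close>-module is isomorphic to a quotient of some \<open>H\<^sup>k\<close>. If the elements
  of \<open>H\<^sup>k\<close> are represented as functions on \<open>{..<k}\<close>, the elements of such a quotient are sets of
  functions from \<open>nat\<close> to the type of \<open>H\<close>. Hence the type below contains a copy of each object of
  \<open>mod H\<close>, and quantifying over the finitely generated modules of this type is the same as
  quantifying over all objects of \<open>mod H\<close>.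
\<close>

type_synonym 'h fg_universe = "('h, (nat \<Rightarrow> 'h) set) module"

definition projective_module :: "('h, 'x) ring_scheme \<Rightarrow> ('h, 'm) module \<Rightarrow> bool" where
  "projective_module H P \<longleftrightarrow> fg_module H P \<and>
    (\<forall>(X :: 'h fg_universe) (Y :: 'h fg_universe). fg_module H X \<and> fg_module H Y \<longrightarrow>
      (\<forall>g \<in> Hom H X Y. \<forall>f \<in> Hom H P Y. g ` carrier X = carrier Y \<longrightarrow>
        (\<exists>h \<in> Hom H P X. \<forall>p\<in>carrier P. g (h p) = f p)))"

definition injective_module :: "('h, 'x) ring_scheme \<Rightarrow> ('h, 'm) module \<Rightarrow> bool" where
  "injective_module H I \<longleftrightarrow> fg_module H I \<and>
    (\<forall>(X :: 'h fg_universe) (Y :: 'h fg_universe). fg_module H X \<and> fg_module H Y \<longrightarrow>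
      (\<forall>g \<in> Hom H X Y. \<forall>f \<in> Hom H X I. inj_on g (carrier X) \<longrightarrow>
        (\<exists>h \<in> Hom H Y I. \<forall>x\<in>carrier X. h (g x) = f x)))"

definition hereditary :: "('h, 'x) ring_scheme \<Rightarrow> bool" where
  "hereditary H \<longleftrightarrow> (\<forall>L. submodule L H (regular_module H) \<longrightarrow>
     projective_module H ((regular_module H)\<lparr>carrier := L\<rparr>))"

definition projective_cover :: "('h, 'x) ring_scheme \<Rightarrow> ('h, 'p) module \<Rightarrow> ('h, 'm) module \<Rightarrow> bool" where
  "projective_cover H P M \<longleftrightarrow> projective_module H P \<and>
    (\<exists>f \<in> Hom H P M. f ` carrier P = carrier M \<and>
      (\<forall>U. submodule U H P \<and> f ` U = carrier M \<longrightarrow> U = carrier P))"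

definition injective_envelope :: "('h, 'x) ring_scheme \<Rightarrow> ('h, 'i) module \<Rightarrow> ('h, 'm) module \<Rightarrow> bool" where
  "injective_envelope H I M \<longleftrightarrow> injective_module H I \<and>
    (\<exists>f \<in> Hom H M I. inj_on f (carrier M) \<and>
      (\<forall>U. submodule U H I \<and> U \<inter> f ` carrier M = {\<zero>\<^bsub>I\<^esub>} \<longrightarrow> U = {\<zero>\<^bsub>I\<^esub>}))"


section \<open>Simple modules and dimension vectors\<close>

definition simple_module :: "('h, 'x) ring_scheme \<Rightarrow> ('h, 'm) module \<Rightarrow> bool" where
  "simple_module H M \<longleftrightarrow> left_module H M \<and> carrier M \<noteq> {\<zero>\<^bsub>M\<^esub>} \<and>
    (\<forall>U. submodule U H M \<longrightarrow> U = {\<zero>\<^bsub>M\<^esub>} \<or> U = carrier M)"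

definition complete_simples :: "('h, 'x) ring_scheme \<Rightarrow> ('n \<Rightarrow> ('h, 's) module) \<Rightarrow> bool" where
  "complete_simples H S \<longleftrightarrow>
    (\<forall>i. simple_module H (S i)) \<and>
    (\<forall>i j. isomorphic_modules H (S i) (S j) \<longrightarrow> i = j) \<and>
    (\<forall>T :: 'h fg_universe. simple_module H T \<longrightarrow> (\<exists>i. isomorphic_modules H T (S i)))"

text \<open>A composition series is a chain \<open>0 = c 0 \<subset> c 1 \<subset> \<dots> \<subset> c l = M\<close>.\<close>

definition series_factor :: "('h, 'm) module \<Rightarrow> (nat \<Rightarrow> 'm set) \<Rightarrow> nat \<Rightarrow> ('h, 'm set) module" where
  "series_factor M c k = quot_module (M\<lparr>carrier := c (Suc k)\<rparr>) (c k)"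

definition composition_series ::
    "('h, 'x) ring_scheme \<Rightarrow> ('h, 'm) module \<Rightarrow> (nat \<Rightarrow> 'm set) \<Rightarrow> nat \<Rightarrow> bool" where
  "composition_series H M c l \<longleftrightarrow>
    c 0 = {\<zero>\<^bsub>M\<^esub>} \<and> c l = carrier M \<and>
    (\<forall>k\<le>l. submodule (c k) H M) \<and>
    (\<forall>k<l. c k \<subseteq> c (Suc k) \<and> simple_module H (series_factor M c k))"

text \<open>By the Jordan-Hoelder theorem the multiplicity does not depend on the series that is chosen.\<close>

definition multiplicity_in ::
    "('h, 'x) ring_scheme \<Rightarrow> ('h, 's) module \<Rightarrow> ('h, 'm) module \<Rightarrow> nat" where
  "multiplicity_in H T M =
    (let (c, l) = (SOME (c, l). composition_series H M c l)
     in card {k. k < l \<and> isomorphic_modules H (series_factor M c k) T})"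

text \<open>\<open>K\<^sub>0(mod H)\<close> is identified with the group of integer vectors indexed by the simple modules.\<close>

definition dim_vector ::
    "('h, 'x) ring_scheme \<Rightarrow> ('n \<Rightarrow> ('h, 's) module) \<Rightarrow> ('h, 'm) module \<Rightarrow> int ^ 'n" where
  "dim_vector H S M = (\<chi> i. int (multiplicity_in H (S i) M))"


section \<open>The first extension group\<close>

text \<open>
  For every module \<open>M\<close> there is the exact sequence \<open>0 \<rightarrow> \<Omega> M \<rightarrow> F M \<rightarrow> M \<rightarrow> 0\<close>, where \<open>F M\<close> is the free
  module on the underlying set of \<open>M\<close>, whose elements are the finitely supported functions from \<open>M\<close>
  to \<open>H\<close>, and \<open>F M \<rightarrow> M\<close> is the \<open>H\<close>-linear map that sends each basis element to itself. The group
  \<open>Ext\<^sup>1(M, N)\<close> is the first cohomology of \<open>Hom(_, N)\<close> on a projective resolution starting with \<open>F M\<close>,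
  that is, the cokernel of the restriction map from \<open>Hom(F M, N)\<close> to \<open>Hom(\<Omega> M, N)\<close>.
\<close>

definition free_module :: "('h, 'x) ring_scheme \<Rightarrow> ('h, 'm) module \<Rightarrow> ('h, 'm \<Rightarrow> 'h) module" where
  "free_module H M =
    \<lparr>carrier = {c \<in> carrier M \<rightarrow>\<^sub>E carrier H. finite {x \<in> carrier M. c x \<noteq> \<zero>\<^bsub>H\<^esub>}},
     mult = undefined, one = undefined,
     zero = (\<lambda>x\<in>carrier M. \<zero>\<^bsub>H\<^esub>),
     add = (\<lambda>c d. \<lambda>x\<in>carrier M. c x \<oplus>\<^bsub>H\<^esub> d x),
     smult = (\<lambda>r c. \<lambda>x\<in>carrier M. r \<otimes>\<^bsub>H\<^esub> c x)\<rparr>"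

definition free_eval :: "('h, 'x) ring_scheme \<Rightarrow> ('h, 'm) module \<Rightarrow> ('m \<Rightarrow> 'h) \<Rightarrow> 'm" where
  "free_eval H M c = (\<Oplus>\<^bsub>M\<^esub>x\<in>{x \<in> carrier M. c x \<noteq> \<zero>\<^bsub>H\<^esub>}. c x \<odot>\<^bsub>M\<^esub> x)"

definition syzygy :: "('h, 'x) ring_scheme \<Rightarrow> ('h, 'm) module \<Rightarrow> ('h, 'm \<Rightarrow> 'h) module" where
  "syzygy H M = (free_module H M)\<lparr>carrier :=
     {c \<in> carrier (free_module H M). free_eval H M c = \<zero>\<^bsub>M\<^esub>}\<rparr>"

text \<open>The map induced on the syzygy by an endomorphism \<open>f\<close> of \<open>M\<close>: it sends the basis element \<open>x\<close> of
  \<open>F M\<close> to the basis element \<open>f x\<close>, so it lifts \<open>f\<close>.\<close>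

definition syzygy_map ::
    "('h, 'x) ring_scheme \<Rightarrow> ('h, 'm) module \<Rightarrow> ('m \<Rightarrow> 'm) \<Rightarrow> ('m \<Rightarrow> 'h) \<Rightarrow> ('m \<Rightarrow> 'h)" where
  "syzygy_map H M f = (\<lambda>c\<in>carrier (syzygy H M). \<lambda>y\<in>carrier M.
     (\<Oplus>\<^bsub>H\<^esub>x\<in>{x \<in> carrier M. c x \<noteq> \<zero>\<^bsub>H\<^esub> \<and> f x = y}. c x))"

definition Hom_module ::
    "('h, 'x) ring_scheme \<Rightarrow> ('h, 'm) module \<Rightarrow> ('h, 'k) module \<Rightarrow>
     ('d \<Rightarrow> ('m \<Rightarrow> 'k) \<Rightarrow> ('m \<Rightarrow> 'k)) \<Rightarrow> ('d, 'm \<Rightarrow> 'k) module" where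
  "Hom_module H M N act =
    \<lparr>carrier = Hom H M N, mult = undefined, one = undefined,
     zero = (\<lambda>x\<in>carrier M. \<zero>\<^bsub>N\<^esub>),
     add = (\<lambda>f g. \<lambda>x\<in>carrier M. f x \<oplus>\<^bsub>N\<^esub> g x),
     smult = act\<rparr>"

definition extendable_homs ::
    "('h, 'x) ring_scheme \<Rightarrow> ('h, 'm) module \<Rightarrow> ('h, 'k) module \<Rightarrow> (('m \<Rightarrow> 'h) \<Rightarrow> 'k) set" where
  "extendable_homs H M N =
    (\<lambda>\<phi>. restrict \<phi> (carrier (syzygy H M))) ` Hom H (free_module H M) N"

text \<open>\<open>Ext\<^sup>1(M, N)\<close> as a left module over \<open>End N\<close>, and as a right module over \<open>End M\<close>.\<close>

definition Ext1_left ::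
    "('h, 'x) ring_scheme \<Rightarrow> ('h, 'm) module \<Rightarrow> ('h, 'k) module \<Rightarrow>
     ('k \<Rightarrow> 'k, (('m \<Rightarrow> 'h) \<Rightarrow> 'k) set) module" where
  "Ext1_left H M N =
    quot_module
      (Hom_module H (syzygy H M) N (\<lambda>g \<phi>. compose (carrier (syzygy H M)) g \<phi>))
      (extendable_homs H M N)"

definition Ext1_right ::
    "('h, 'x) ring_scheme \<Rightarrow> ('h, 'm) module \<Rightarrow> ('h, 'k) module \<Rightarrow>
     ('m \<Rightarrow> 'm, (('m \<Rightarrow> 'h) \<Rightarrow> 'k) set) module" where
  "Ext1_right H M N =
    quot_module
      (Hom_module H (syzygy H M) N
        (\<lambda>f \<phi>. compose (carrier (syzygy H M)) \<phi> (syzygy_map H M f)))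
      (extendable_homs H M N)"


section \<open>Valued quivers and Dynkin types\<close>

text \<open>\<open>(x, (a, b), y)\<close> is an arrow from \<open>x\<close> to \<open>y\<close> with valuation \<open>(a, b)\<close>.\<close>

type_synonym 'v valued_quiver = "('v \<times> (nat \<times> nat) \<times> 'v) set"

definition ext_quiver ::
    "('h, 'x) ring_scheme \<Rightarrow> ('n \<Rightarrow> ('h, 's) module) \<Rightarrow> 'n valued_quiver" where
  "ext_quiver H S = {(i, (a, b), j) | i a b j.
     carrier (Ext1_left H (S i) (S j)) \<noteq> {\<zero>\<^bsub>Ext1_left H (S i) (S j)\<^esub>} \<and>
     a = vdim (End_ring H (S j)) (Ext1_left H (S i) (S j)) \<and>
     b = vdim (opposite_ring (End_ring H (S i))) (Ext1_right H (S i) (S j))}"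

text \<open>A valued graph is a set of triples \<open>(x, (a, b), y)\<close> that with each such triple contains
  \<open>(y, (b, a), x)\<close>.\<close>

definition underlying_graph :: "'v valued_quiver \<Rightarrow> 'v valued_quiver" where
  "underlying_graph Q = {(x, (a, b), y) | x a b y. (x, (a, b), y) \<in> Q \<or> (y, (b, a), x) \<in> Q}"

definition has_2_cycle :: "'v valued_quiver \<Rightarrow> bool" where
  "has_2_cycle Q \<longleftrightarrow> (\<exists>x y v w. (x, v, y) \<in> Q \<and> (y, w, x) \<in> Q)"

datatype dynkin_type =
  TypeA nat | TypeB nat | TypeC nat | TypeD nat | TypeE nat | TypeF4 | TypeG2

fun valid_type :: "dynkin_type \<Rightarrow> bool" where
  "valid_type (TypeA n) \<longleftrightarrow> n \<ge> 1"
| "valid_type (TypeB n) \<longleftrightarrow> n \<ge> 2"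
| "valid_type (TypeC n) \<longleftrightarrow> n \<ge> 3"
| "valid_type (TypeD n) \<longleftrightarrow> n \<ge> 4"
| "valid_type (TypeE n) \<longleftrightarrow> n \<in> {6, 7, 8}"
| "valid_type TypeF4 \<longleftrightarrow> True"
| "valid_type TypeG2 \<longleftrightarrow> True"

fun type_rank :: "dynkin_type \<Rightarrow> nat" where
  "type_rank (TypeA n) = n"
| "type_rank (TypeB n) = n"
| "type_rank (TypeC n) = n"
| "type_rank (TypeD n) = n"
| "type_rank (TypeE n) = n"
| "type_rank TypeF4 = 4"
| "type_rank TypeG2 = 2"

text \<open>The edges \<open>k - k + 1\<close> with label \<open>(1, 1)\<close> for \<open>m \<le> k < n\<close>.\<close>

definition path_edges :: "nat \<Rightarrow> nat \<Rightarrow> nat valued_quiver" where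
  "path_edges m n = {(k, (1, 1), Suc k) | k. m \<le> k \<and> k < n}"

fun type_edges :: "dynkin_type \<Rightarrow> nat valued_quiver" where
  "type_edges (TypeA n) = path_edges 1 n"
| "type_edges (TypeB n) = {(1, (1, 2), 2)} \<union> path_edges 2 n"
| "type_edges (TypeC n) = {(1, (2, 1), 2)} \<union> path_edges 2 n"
| "type_edges (TypeD n) = {(1, (1, 1), 3), (2, (1, 1), 3)} \<union> path_edges 3 n"
| "type_edges (TypeE n) =
     {(1, (1, 1), 2), (2, (1, 1), 3), (3, (1, 1), 4), (3, (1, 1), 5)} \<union> path_edges 5 n"
| "type_edges TypeF4 = {(1, (1, 1), 2), (2, (1, 2), 3), (3, (1, 1), 4)}"
| "type_edges TypeG2 = {(1, (1, 3), 2)}"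

definition dynkin_graph :: "dynkin_type \<Rightarrow> nat valued_quiver" where
  "dynkin_graph X = underlying_graph (type_edges X)"

definition dynkin_quiver_of_type :: "'v valued_quiver \<Rightarrow> dynkin_type \<Rightarrow> bool" where
  "dynkin_quiver_of_type Q X \<longleftrightarrow> valid_type X \<and> \<not> has_2_cycle Q \<and>
    (\<exists>\<sigma> :: 'v \<Rightarrow> nat. bij_betw \<sigma> UNIV {1..type_rank X} \<and>
      (\<forall>x a b y. (x, (a, b), y) \<in> underlying_graph Q \<longleftrightarrow>
        (\<sigma> x, (a, b), \<sigma> y) \<in> dynkin_graph X))"


section \<open>The Coxeter transformation\<close>

definition coxeter_transformation ::
    "('h, 'x) ring_scheme \<Rightarrow> ('n::finite \<Rightarrow> ('h, 's) module) \<Rightarrow> ('n \<Rightarrow> ('h, 'p) module) \<Rightarrow>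
     ('n \<Rightarrow> ('h, 'i) module) \<Rightarrow> int ^ 'n \<Rightarrow> int ^ 'n" where
  "coxeter_transformation H S P I =
    (THE C. (\<forall>x y. C (x + y) = C x + C y) \<and> bij C \<and>
       (\<forall>i. C (dim_vector H S (P i)) = - dim_vector H S (I i)))"

text \<open>The value 0 stands for infinite order.\<close>

definition map_order :: "('a \<Rightarrow> 'a) \<Rightarrow> nat" where
  "map_order C = (if \<exists>k>0. C ^^ k = id then LEAST k. k > 0 \<and> C ^^ k = id else 0)"

end

theory Submission
  imports Defs "HOL-Analysis.Cartesian_Space"
begin

text \<open>
  Over a hereditary algebra the radical of \<open>P i\<close> is projective and the socle quotient of \<open>I i\<close> is injective.
  Counting composition factors therefore expresses the dimension vectors of the \<open>P i\<close> and the \<open>I i\<close> by the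
  valuations \<open>(a i j, b i j)\<close> of the ext-quiver, and \<open>C x = y\<close> becomes
  \<open>y k + x k = (\<Sum>j. a j k * x j) + (\<Sum>j. b k j * y j)\<close> for all \<open>k\<close>. On a tree one can choose heights that drop by one
  along each arrow. Read along these heights, an orbit of \<open>C\<close> is a solution of the mesh relations
  \<open>u k (t + 1) + u k (t - 1) = (\<Sum>j. w j k * u j t)\<close>, where \<open>w\<close> depends on the underlying valued graph only, and
  \<open>C ^ m = 1\<close> iff every solution has the period \<open>2 m\<close>. The relations determine a solution from its component at the end
  of an arm, on which they impose a linear recurrence with cyclotomic characteristic polynomial. This yields the
  period, and explicit solutions built from a periodic impulse show that it cannot be shortened.
\<close>

section \<open>Abelian groups with operators\<close>

text \<open>\<open>Hom (P k) (I j)\<close> is acted on by \<open>End (P k)\<close> only, whereas the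
  valuations are dimensions over endomorphism rings of simple modules and their opposites. So all
  groups are measured by length, as abelian groups with operators; precomposition reverses products,
  hence no more than additivity of each operator is assumed. The relation for projectives is the
  Euler characteristic of Hom and Ext into \<open>S k\<close>, summed along a composition series of
  \<open>P i\<close>, whose members are projective because they are isomorphic to left ideals. The
  relation for injectives comes from restricting \<open>Hom (P k) (I j)\<close> to the kernel
  \<open>K\<close> of the cover of \<open>S k\<close>: the maps that vanish on \<open>K\<close> are
  those into the socle \<open>S j\<close>, and \<open>Hom K (I j)\<close> is counted along a
  composition series of \<open>I j\<close>, where \<open>Hom K (S i)\<close> is the extension group.
  The encoding adds obstacles: projectivity and injectivity are tested on modules of one type, the
  extension group is built from a huge free module, dimensions and multiplicities are read off
  chosen bases and series. Finite length rests on the descending chain condition over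
  \<open>R\<close> and on heredity, which makes left ideals finitely generated.\<close>

locale operator_group = abelian_group V
  for D :: "('d, 'x) ring_scheme" and V :: "('d, 'v) module" (structure) +
  assumes smult_closed [simp, intro]: "\<lbrakk>d \<in> carrier D; x \<in> carrier V\<rbrakk> \<Longrightarrow> d \<odot> x \<in> carrier V"
    and smult_add: "\<lbrakk>d \<in> carrier D; x \<in> carrier V; y \<in> carrier V\<rbrakk> \<Longrightarrow> d \<odot> (x \<oplus> y) = d \<odot> x \<oplus> d \<odot> y"
begin

lemma smult_zero [simp]: "d \<in> carrier D \<Longrightarrow> d \<odot> \<zero> = \<zero>"
  by (metis add.l_cancel_one' smult_add smult_closed r_zero zero_closed)

lemma smult_neg: "\<lbrakk>d \<in> carrier D; x \<in> carrier V\<rbrakk> \<Longrightarrow> d \<odot> (\<ominus> x) = \<ominus> (d \<odot> x)"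
  by (metis a_inv_closed l_neg minus_equality smult_add smult_closed smult_zero)

lemma submoduleI:
  assumes "U \<subseteq> carrier V" "\<zero> \<in> U" "\<And>x. x \<in> U \<Longrightarrow> \<ominus> x \<in> U"
    "\<And>x y. x \<in> U \<Longrightarrow> y \<in> U \<Longrightarrow> x \<oplus> y \<in> U"
    "\<And>d x. d \<in> carrier D \<Longrightarrow> x \<in> U \<Longrightarrow> d \<odot> x \<in> U"
  shows "submodule U D V"
  using assms by (intro submodule.intro subgroup.intro) (simp_all add: submodule_axioms_def a_inv_def)

lemma submoduleD:
  assumes "submodule U D V"
  shows "U \<subseteq> carrier V" "\<zero> \<in> U" "\<And>x. x \<in> U \<Longrightarrow> \<ominus> x \<in> U"
    "\<And>x y. x \<in> U \<Longrightarrow> y \<in> U \<Longrightarrow> x \<oplus> y \<in> U"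
    "\<And>d x. d \<in> carrier D \<Longrightarrow> x \<in> U \<Longrightarrow> d \<odot> x \<in> U"
    "\<And>x. x \<in> U \<Longrightarrow> x \<in> carrier V"
proof -
  have s: "subgroup U (add_monoid V)" using assms by (rule submodule.axioms)
  show "U \<subseteq> carrier V" using subgroup.subset[OF s] by simp
  then show "\<And>x. x \<in> U \<Longrightarrow> x \<in> carrier V" by auto
  show "\<zero> \<in> U" using subgroup.one_closed[OF s] by simp
  show "\<And>x. x \<in> U \<Longrightarrow> \<ominus> x \<in> U" using subgroup.m_inv_closed[OF s] by (simp add: a_inv_def)
  show "\<And>x y. x \<in> U \<Longrightarrow> y \<in> U \<Longrightarrow> x \<oplus> y \<in> U" using subgroup.m_closed[OF s] by simp
  show "\<And>d x. d \<in> carrier D \<Longrightarrow> x \<in> U \<Longrightarrow> d \<odot> x \<in> U" using submodule.smult_closed[OF assms] .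
qed

lemma submodule_carrier: "submodule (carrier V) D V"
  by (rule submoduleI) auto

lemma submodule_zero: "submodule {\<zero>} D V"
  by (rule submoduleI) auto

lemma minus_self [simp]: "x \<in> carrier V \<Longrightarrow> x \<ominus> x = \<zero>"
  by (simp add: a_minus_def r_neg)

lemma minus_eq_zeroD: "\<lbrakk>x \<ominus> y = \<zero>; x \<in> carrier V; y \<in> carrier V\<rbrakk> \<Longrightarrow> x = y"
  by (metis a_inv_closed a_minus_def minus_equality minus_minus)

lemma minus_add_cancel [simp]: "\<lbrakk>x \<in> carrier V; y \<in> carrier V\<rbrakk> \<Longrightarrow> x \<ominus> y \<oplus> y = x"
  by (simp add: a_minus_def a_assoc l_neg)

lemma submodule_minus:
  assumes "submodule U D V" "x \<in> U" "y \<in> U" shows "x \<ominus> y \<in> U"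
  using submoduleD[OF assms(1)] assms by (simp add: a_minus_def)

lemma sub_operator_group:
  assumes "submodule U D V"
  shows "operator_group D (V\<lparr>carrier := U\<rparr>)"
proof -
  note U = submoduleD[OF assms]
  have "abelian_group (V\<lparr>carrier := U\<rparr>)"
    using U l_neg by (intro abelian_groupI) (simp_all add: subset_iff a_ac, metis a_comm l_neg)
  then show ?thesis
    using U by (intro operator_group.intro operator_group_axioms.intro) (auto simp: smult_add)
qed

lemma a_inv_sub:
  assumes "submodule U D V" "x \<in> U"
  shows "a_inv (V\<lparr>carrier := U\<rparr>) x = \<ominus> x"
proof -
  interpret S: operator_group D "V\<lparr>carrier := U\<rparr>" by (rule sub_operator_group) fact
  note U = submoduleD[OF assms(1)]
  have "\<ominus> x \<oplus> x = \<zero>" using assms U by (simp add: l_neg)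
  then show ?thesis using S.minus_equality[of "\<ominus> x" x] assms U by simp
qed

lemma submodule_sub_iff:
  assumes "submodule U D V"
  shows "submodule W D (V\<lparr>carrier := U\<rparr>) \<longleftrightarrow> submodule W D V \<and> W \<subseteq> U"
proof -
  interpret S: operator_group D "V\<lparr>carrier := U\<rparr>" by (rule sub_operator_group) fact
  note U = submoduleD[OF assms]
  show ?thesis
  proof
    assume W: "submodule W D (V\<lparr>carrier := U\<rparr>)"
    note W' = S.submoduleD[OF W]
    have "\<ominus> x \<in> W" if "x \<in> W" for x
      using W'(3)[OF that] W'(1) that a_inv_sub[OF assms] by auto
    then show "submodule W D V \<and> W \<subseteq> U" using W' U
      by (auto intro!: submoduleI)
  next
    assume W: "submodule W D V \<and> W \<subseteq> U"
    then have W': "submodule W D V" "W \<subseteq> U" by auto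
    note W'' = submoduleD[OF W'(1)]
    show "submodule W D (V\<lparr>carrier := U\<rparr>)"
      using W' W'' by (intro S.submoduleI) (auto simp: a_inv_sub[OF assms] subset_iff)
  qed
qed

end

lemma left_module_operator_group:
  fixes V :: "('d, 'v) module"
  shows "left_module D V \<Longrightarrow> operator_group D V"
  by (simp add: left_module_def left_module_axioms_def operator_group_def operator_group_axioms_def)

lemma left_moduleI':
  assumes "ring D" "operator_group D V"
    and "\<And>a b x. \<lbrakk>a \<in> carrier D; b \<in> carrier D; x \<in> carrier V\<rbrakk> \<Longrightarrow>
       (a \<oplus>\<^bsub>D\<^esub> b) \<odot>\<^bsub>V\<^esub> x = a \<odot>\<^bsub>V\<^esub> x \<oplus>\<^bsub>V\<^esub> b \<odot>\<^bsub>V\<^esub> x"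
    and "\<And>a b x. \<lbrakk>a \<in> carrier D; b \<in> carrier D; x \<in> carrier V\<rbrakk> \<Longrightarrow>
       (a \<otimes>\<^bsub>D\<^esub> b) \<odot>\<^bsub>V\<^esub> x = a \<odot>\<^bsub>V\<^esub> (b \<odot>\<^bsub>V\<^esub> x)"
    and "\<And>x. x \<in> carrier V \<Longrightarrow> \<one>\<^bsub>D\<^esub> \<odot>\<^bsub>V\<^esub> x = x"
  shows "left_module D V"
  using assms
  by (simp add: left_module_def left_module_axioms_def operator_group_def operator_group_axioms_def)

lemma sub_left_module:
  fixes V :: "('d, 'v) module"
  assumes "left_module D V" "submodule U D V"
  shows "left_module D (V\<lparr>carrier := U\<rparr>)"
proof -
  interpret V: left_module D V by fact
  interpret O: operator_group D V by (rule left_module_operator_group) fact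
  note U = O.submoduleD[OF assms(2)]
  show ?thesis
    using U by (intro left_moduleI' O.sub_operator_group assms V.R.ring_axioms)
      (auto simp: V.smult_l_distr V.smult_assoc1)
qed

subsection \<open>Semilinear maps\<close>

text \<open>Scalars are matched in both directions and without a ring homomorphism: each scalar on
  one side is imitated by some scalar on the other. That is just enough for images and preimages of
  submodules to be submodules, and it fits \<open>End P\<close> acting through its effect on
  \<open>S\<close>, where an endomorphism of \<open>S\<close> may have many lifts.\<close>

definition semilinear ::
    "('d, 'x) ring_scheme \<Rightarrow> ('d, 'v) module \<Rightarrow> ('e, 'y) ring_scheme \<Rightarrow> ('e, 'w) module \<Rightarrow>
     ('v \<Rightarrow> 'w) \<Rightarrow> bool" where
  "semilinear D V E W f \<longleftrightarrow> f \<in> carrier V \<rightarrow> carrier W \<and>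
     (\<forall>x\<in>carrier V. \<forall>y\<in>carrier V. f (x \<oplus>\<^bsub>V\<^esub> y) = f x \<oplus>\<^bsub>W\<^esub> f y) \<and>
     (\<forall>d\<in>carrier D. \<exists>e\<in>carrier E. \<forall>x\<in>carrier V. f (d \<odot>\<^bsub>V\<^esub> x) = e \<odot>\<^bsub>W\<^esub> f x) \<and>
     (\<forall>e\<in>carrier E. \<exists>d\<in>carrier D. \<forall>x\<in>carrier V. f (d \<odot>\<^bsub>V\<^esub> x) = e \<odot>\<^bsub>W\<^esub> f x)"

locale semilinear_map = V: operator_group D V + W: operator_group E W
  for D :: "('d, 'x) ring_scheme" and V :: "('d, 'v) module"
    and E :: "('e, 'y) ring_scheme" and W :: "('e, 'w) module" +
  fixes f
  assumes f: "semilinear D V E W f"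
begin

definition "ker = {x \<in> carrier V. f x = \<zero>\<^bsub>W\<^esub>}"

lemma closed [simp, intro]: "x \<in> carrier V \<Longrightarrow> f x \<in> carrier W"
  using f by (auto simp: semilinear_def)

lemma add: "x \<in> carrier V \<Longrightarrow> y \<in> carrier V \<Longrightarrow> f (x \<oplus>\<^bsub>V\<^esub> y) = f x \<oplus>\<^bsub>W\<^esub> f y"
  using f by (auto simp: semilinear_def)

lemma left: "d \<in> carrier D \<Longrightarrow> \<exists>e\<in>carrier E. \<forall>x\<in>carrier V. f (d \<odot>\<^bsub>V\<^esub> x) = e \<odot>\<^bsub>W\<^esub> f x"
  using f unfolding semilinear_def by blast

lemma right: "e \<in> carrier E \<Longrightarrow> \<exists>d\<in>carrier D. \<forall>x\<in>carrier V. f (d \<odot>\<^bsub>V\<^esub> x) = e \<odot>\<^bsub>W\<^esub> f x"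
  using f unfolding semilinear_def by blast

lemma zero [simp]: "f \<zero>\<^bsub>V\<^esub> = \<zero>\<^bsub>W\<^esub>"
  by (metis V.r_zero V.zero_closed W.add.l_cancel_one' add closed)

lemma neg: "x \<in> carrier V \<Longrightarrow> f (\<ominus>\<^bsub>V\<^esub> x) = \<ominus>\<^bsub>W\<^esub> f x"
  by (metis V.a_inv_closed V.l_neg W.minus_equality add closed zero)

lemma minus: "x \<in> carrier V \<Longrightarrow> y \<in> carrier V \<Longrightarrow> f (x \<ominus>\<^bsub>V\<^esub> y) = f x \<ominus>\<^bsub>W\<^esub> f y"
  by (simp add: a_minus_def add neg)

lemma preimage:
  assumes "submodule B E W"
  shows "submodule {x \<in> carrier V. f x \<in> B} D V"
proof (rule V.submoduleI)
  note B = W.submoduleD[OF assms]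
  fix d x assume "d \<in> carrier D" "x \<in> {x \<in> carrier V. f x \<in> B}"
  moreover obtain e where "e \<in> carrier E" "\<forall>x\<in>carrier V. f (d \<odot>\<^bsub>V\<^esub> x) = e \<odot>\<^bsub>W\<^esub> f x"
    using left \<open>d \<in> carrier D\<close> by blast
  ultimately show "d \<odot>\<^bsub>V\<^esub> x \<in> {x \<in> carrier V. f x \<in> B}" using B(5) by simp
qed (use W.submoduleD[OF assms] in \<open>auto simp: neg add\<close>)

lemma ker_submodule: "submodule ker D V"
proof -
  have "ker = {x \<in> carrier V. f x \<in> {\<zero>\<^bsub>W\<^esub>}}" by (auto simp: ker_def)
  then show ?thesis using preimage[OF W.submodule_zero] by simp
qed

lemma image:
  assumes "submodule A D V"
  shows "submodule (f ` A) E W"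
proof (rule W.submoduleI)
  note A = V.submoduleD[OF assms]
  show "f ` A \<subseteq> carrier W" using A by auto
  show "\<zero>\<^bsub>W\<^esub> \<in> f ` A" using A(2) by (intro image_eqI[of _ f "\<zero>\<^bsub>V\<^esub>"]) auto
  fix x assume "x \<in> f ` A"
  then obtain a where a: "a \<in> A" "x = f a" by auto
  then have "\<ominus>\<^bsub>W\<^esub> x = f (\<ominus>\<^bsub>V\<^esub> a)" using A(6) neg by simp
  then show "\<ominus>\<^bsub>W\<^esub> x \<in> f ` A" using A(3)[OF a(1)] by simp
  fix y assume "y \<in> f ` A"
  then obtain b where b: "b \<in> A" "y = f b" by auto
  then have "x \<oplus>\<^bsub>W\<^esub> y = f (a \<oplus>\<^bsub>V\<^esub> b)" using A(6) a add by simp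
  then show "x \<oplus>\<^bsub>W\<^esub> y \<in> f ` A" using A(4)[OF a(1) b(1)] by simp
next
  note A = V.submoduleD[OF assms]
  fix e x assume e: "e \<in> carrier E" and "x \<in> f ` A"
  then obtain a where a: "a \<in> A" "x = f a" by auto
  obtain d where d: "d \<in> carrier D" "\<forall>x\<in>carrier V. f (d \<odot>\<^bsub>V\<^esub> x) = e \<odot>\<^bsub>W\<^esub> f x"
    using right[OF e] by auto
  then have "e \<odot>\<^bsub>W\<^esub> x = f (d \<odot>\<^bsub>V\<^esub> a)" using a A(6) by simp
  then show "e \<odot>\<^bsub>W\<^esub> x \<in> f ` A" using A(5)[OF d(1) a(1)] by simp
qed

lemma inj_iff: "inj_on f (carrier V) \<longleftrightarrow> ker = {\<zero>\<^bsub>V\<^esub>}"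
proof
  assume "inj_on f (carrier V)"
  then have "x = \<zero>\<^bsub>V\<^esub>" if "x \<in> carrier V" "f x = \<zero>\<^bsub>W\<^esub>" for x
    using that inj_onD[of f "carrier V" x "\<zero>\<^bsub>V\<^esub>"] by simp
  then show "ker = {\<zero>\<^bsub>V\<^esub>}" unfolding ker_def using V.zero_closed zero by blast
next
  assume k: "ker = {\<zero>\<^bsub>V\<^esub>}"
  show "inj_on f (carrier V)"
  proof (rule inj_onI)
    fix x y assume xy: "x \<in> carrier V" "y \<in> carrier V" "f x = f y"
    then have "f (x \<ominus>\<^bsub>V\<^esub> y) = \<zero>\<^bsub>W\<^esub>" by (simp add: minus)
    then have "x \<ominus>\<^bsub>V\<^esub> y \<in> ker" using xy by (simp add: ker_def)
    then show "x = y" using k xy V.minus_eq_zeroD by auto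
  qed
qed

text \<open>The modular law in the form that bounds lengths: between nested submodules nothing grows
  if neither the part in the kernel nor the image grows.\<close>

lemma eqI:
  assumes "submodule A D V" "submodule B D V" "A \<subseteq> B" "A \<inter> ker = B \<inter> ker" "f ` A = f ` B"
  shows "A = B"
proof
  show "B \<subseteq> A"
  proof
    note A = V.submoduleD[OF assms(1)] and B = V.submoduleD[OF assms(2)]
    fix b assume b: "b \<in> B"
    then obtain a where a: "a \<in> A" "f b = f a" using assms(5) by (metis image_iff)
    have "b \<ominus>\<^bsub>V\<^esub> a \<in> B \<inter> ker"
      using a b assms(3) V.submodule_minus[OF assms(2), of b a] A(6) B(6) closed[of b]
      by (auto simp: ker_def minus)
    then have "b \<ominus>\<^bsub>V\<^esub> a \<in> A" using assms(4) by auto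
    then have "b \<ominus>\<^bsub>V\<^esub> a \<oplus>\<^bsub>V\<^esub> a \<in> A" using a A by auto
    then show "b \<in> A" using a b A(6) B(6) by simp
  qed
qed fact

end

section \<open>Homomorphisms as extensional functions\<close>

lemma HomD:
  assumes "f \<in> Hom H M N"
  shows "f \<in> carrier M \<rightarrow>\<^sub>E carrier N" "f \<in> carrier M \<rightarrow> carrier N" "f \<in> extensional (carrier M)"
    "\<And>x. x \<in> carrier M \<Longrightarrow> f x \<in> carrier N"
    "\<And>x y. \<lbrakk>x \<in> carrier M; y \<in> carrier M\<rbrakk> \<Longrightarrow> f (x \<oplus>\<^bsub>M\<^esub> y) = f x \<oplus>\<^bsub>N\<^esub> f y"
    "\<And>r x. \<lbrakk>r \<in> carrier H; x \<in> carrier M\<rbrakk> \<Longrightarrow> f (r \<odot>\<^bsub>M\<^esub> x) = r \<odot>\<^bsub>N\<^esub> f x"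
  using assms by (auto simp: Hom_def PiE_def)

lemma HomI:
  assumes "\<And>x. x \<in> carrier M \<Longrightarrow> f x \<in> carrier N"
    "\<And>x y. \<lbrakk>x \<in> carrier M; y \<in> carrier M\<rbrakk> \<Longrightarrow> x \<oplus>\<^bsub>M\<^esub> y \<in> carrier M \<Longrightarrow> f (x \<oplus>\<^bsub>M\<^esub> y) = f x \<oplus>\<^bsub>N\<^esub> f y"
    "\<And>r x. \<lbrakk>r \<in> carrier H; x \<in> carrier M\<rbrakk> \<Longrightarrow> r \<odot>\<^bsub>M\<^esub> x \<in> carrier M \<Longrightarrow> f (r \<odot>\<^bsub>M\<^esub> x) = r \<odot>\<^bsub>N\<^esub> f x"
    "operator_group H M"
  shows "restrict f (carrier M) \<in> Hom H M N"
proof -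
  interpret operator_group H M by fact
  show ?thesis using assms(1-3) by (auto simp: Hom_def)
qed

lemma Hom_eqI:
  "\<lbrakk>f \<in> Hom H M N; g \<in> Hom H M N'; \<And>x. x \<in> carrier M \<Longrightarrow> f x = g x\<rbrakk> \<Longrightarrow> f = g"
  by (rule extensionalityI[OF HomD(3) HomD(3)])

lemma Hom_semilinear: "f \<in> Hom H M N \<Longrightarrow> semilinear H M H N f"
  using HomD[of f H M N] unfolding semilinear_def by blast

lemma Hom_semilinear_map:
  "\<lbrakk>operator_group H M; operator_group H N; f \<in> Hom H M N\<rbrakk> \<Longrightarrow> semilinear_map H M H N f"
  by (simp add: semilinear_map_def semilinear_map_axioms_def Hom_semilinear)

lemma Hom_compose:
  assumes "f \<in> Hom H M N" "g \<in> Hom H N L" "operator_group H M"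
  shows "compose (carrier M) g f \<in> Hom H M L"
  unfolding compose_def using HomD[OF assms(1)] HomD[OF assms(2)] assms(3)
  by (intro HomI) auto

lemma Hom_id: "operator_group H M \<Longrightarrow> (\<lambda>x\<in>carrier M. x) \<in> Hom H M M"
  by (intro HomI) auto

lemma Hom_zero: "\<lbrakk>operator_group H M; operator_group H N\<rbrakk> \<Longrightarrow> (\<lambda>x\<in>carrier M. \<zero>\<^bsub>N\<^esub>) \<in> Hom H M N"
  by (intro HomI) (auto simp: operator_group.smult_zero operator_group_def abelian_group_def abelian_monoid.zero_closed abelian_monoid.r_zero)

lemma Hom_restrict:
  assumes "f \<in> Hom H M N" "submodule U H M" "operator_group H M"
  shows "restrict f U \<in> Hom H (M\<lparr>carrier := U\<rparr>) N"
proof -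
  interpret operator_group H M by fact
  note U = submoduleD[OF assms(2)]
  show ?thesis
    using HomD[OF assms(1)] U HomI[OF _ _ _ sub_operator_group[OF assms(2)], of f N] by auto
qed

lemma Hom_codomain:
  assumes "f \<in> Hom H M N" "f ` carrier M \<subseteq> U"
  shows "f \<in> Hom H M (N\<lparr>carrier := U\<rparr>)"
  using assms by (auto simp: Hom_def)

lemma Hom_codomain_sub: "\<lbrakk>f \<in> Hom H M (N\<lparr>carrier := U\<rparr>); U \<subseteq> carrier N\<rbrakk> \<Longrightarrow> f \<in> Hom H M N"
  by (auto simp: Hom_def)

text \<open>The map on \<open>N\<close> is \<open>g\<close> at an arbitrarily chosen preimage. The
  choice \<open>s\<close> is not linear, but \<open>g\<close> is constant on the fibres of
  \<open>p\<close>, so additivity and linearity of the result can be checked with any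
  representatives.\<close>

lemma Hom_factor:
  assumes "operator_group H M" "operator_group H N" "operator_group H L"
    and p: "p \<in> Hom H M N" "p ` carrier M = carrier N"
    and g: "g \<in> Hom H M L" "\<And>x. x \<in> carrier M \<Longrightarrow> p x = \<zero>\<^bsub>N\<^esub> \<Longrightarrow> g x = \<zero>\<^bsub>L\<^esub>"
  shows "\<exists>h\<in>Hom H N L. \<forall>x\<in>carrier M. h (p x) = g x"
proof -
  interpret M: operator_group H M by fact
  interpret N: operator_group H N by fact
  interpret L: operator_group H L by fact
  interpret p: semilinear_map H M H N p by (rule Hom_semilinear_map) fact+
  interpret g: semilinear_map H M H L g by (rule Hom_semilinear_map) fact+
  define s where "s y = (SOME x. x \<in> carrier M \<and> p x = y)" for y
  have s: "s y \<in> carrier M" "p (s y) = y" if "y \<in> carrier N" for y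
  proof -
    have "\<exists>x. x \<in> carrier M \<and> p x = y" using that p(2) by (metis imageE)
    from someI_ex[OF this] show "s y \<in> carrier M" "p (s y) = y" unfolding s_def by auto
  qed
  have gp: "g x = g y" if "x \<in> carrier M" "y \<in> carrier M" "p x = p y" for x y
  proof -
    have "p (x \<ominus>\<^bsub>M\<^esub> y) = \<zero>\<^bsub>N\<^esub>" using that by (simp add: p.minus)
    then have "g (x \<ominus>\<^bsub>M\<^esub> y) = \<zero>\<^bsub>L\<^esub>" using g(2) that by simp
    then show ?thesis using that L.minus_eq_zeroD by (simp add: g.minus)
  qed
  have "(\<lambda>y\<in>carrier N. g (s y)) \<in> Hom H N L"
  proof (rule HomI)
    fix x y assume "x \<in> carrier N" "y \<in> carrier N"
    then show "g (s (x \<oplus>\<^bsub>N\<^esub> y)) = g (s x) \<oplus>\<^bsub>L\<^esub> g (s y)"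
      using s by (subst g.add[symmetric]) (auto intro!: gp simp: p.add)
  next
    fix r x assume "r \<in> carrier H" "x \<in> carrier N"
    then show "g (s (r \<odot>\<^bsub>N\<^esub> x)) = r \<odot>\<^bsub>L\<^esub> g (s x)"
      using s by (subst HomD(6)[OF g(1), symmetric]) (auto intro!: gp simp: HomD(6)[OF p(1)])
  qed (use s in \<open>auto intro: N.operator_group_axioms\<close>)
  moreover have "\<forall>x\<in>carrier M. (\<lambda>y\<in>carrier N. g (s y)) (p x) = g x"
    using s by (auto intro!: gp)
  ultimately show ?thesis by blast
qed

subsection \<open>Quotients\<close>

context operator_group
begin

context
  fixes U assumes U: "submodule U D V"
begin

lemma abelian_subgroup_sub: "abelian_subgroup U V"
  using abelian_subgroupI3[of U V] submodule.axioms(1)[OF U] abelian_group_axioms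
  by (simp add: additive_subgroup_def)

text \<open>The scalar action of \<open>quot_module\<close> is a union over all representatives of a
  coset; all the cosets united here coincide, since \<open>U\<close> is stable under
  \<open>r\<close>.\<close>

lemma quot_smult:
  assumes "r \<in> carrier D" "v \<in> carrier V"
  shows "r \<odot>\<^bsub>quot_module V U\<^esub> (U +> v) = U +> (r \<odot> v)"
proof -
  interpret S: abelian_subgroup U V by (rule abelian_subgroup_sub)
  note U' = submoduleD[OF U]
  have eq: "U +> (r \<odot> x) = U +> (r \<odot> v)" if x: "x \<in> U +> v" for x
  proof -
    obtain u where u: "u \<in> U" "x = u \<oplus> v" using x by (auto simp: a_r_coset_def')
    then have "r \<odot> x = r \<odot> u \<oplus> r \<odot> v" using assms U' by (simp add: smult_add)
    then have "r \<odot> x \<in> U +> (r \<odot> v)" using U'(5)[OF assms(1) u(1)] by (auto simp: a_r_coset_def')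
    then show ?thesis using a_repr_independence[OF _ _ submodule.axioms(1)[OF U]] assms by simp
  qed
  have "v \<in> U +> v" using S.a_rcos_self assms by simp
  then have "(\<Union>x\<in>U +> v. U +> (r \<odot> x)) = U +> (r \<odot> v)" using SUP_eq_const[of "U +> v"] eq by blast
  then show ?thesis by (simp add: quot_module_def)
qed

lemma quot_add:
  assumes "x \<in> carrier V" "y \<in> carrier V"
  shows "(U +> x) \<oplus>\<^bsub>quot_module V U\<^esub> (U +> y) = U +> (x \<oplus> y)"
  using abelian_subgroup.a_rcos_sum[OF abelian_subgroup_sub assms] by (simp add: quot_module_def)

lemma quot_carrier: "carrier (quot_module V U) = (\<lambda>x. U +> x) ` carrier V"
  by (auto simp: quot_module_def A_RCOSETS_def')

lemma quot_zero: "\<zero>\<^bsub>quot_module V U\<^esub> = U" "U +> \<zero> = U"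
  using submoduleD[OF U] by (auto simp: quot_module_def)

lemma quot_eq_zero_iff: "x \<in> carrier V \<Longrightarrow> U +> x = U \<longleftrightarrow> x \<in> U"
  using abelian_subgroup.a_rcos_self[OF abelian_subgroup_sub, of x]
    a_coset_join2[OF _ submodule.axioms(1)[OF U], of x] by auto

lemma quot_operator_group: "operator_group D (quot_module V U)"
proof -
  note U' = submoduleD[OF U]
  have "abelian_group (quot_module V U)"
  proof (rule abelian_groupI)
    let ?Q = "quot_module V U"
    show "\<zero>\<^bsub>?Q\<^esub> \<in> carrier ?Q" unfolding quot_carrier using quot_zero zero_closed by (metis image_eqI)
    fix x y assume "x \<in> carrier ?Q" "y \<in> carrier ?Q"
    then obtain v w where v: "v \<in> carrier V" "x = U +> v" "w \<in> carrier V" "y = U +> w"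
      by (auto simp: quot_carrier)
    then show "x \<oplus>\<^bsub>?Q\<^esub> y \<in> carrier ?Q" "x \<oplus>\<^bsub>?Q\<^esub> y = y \<oplus>\<^bsub>?Q\<^esub> x"
      by (auto simp: quot_carrier quot_add a_comm)
    have "(U +> \<zero>) \<oplus>\<^bsub>?Q\<^esub> (U +> v) = U +> v" using v by (subst quot_add) simp_all
    then show "\<zero>\<^bsub>?Q\<^esub> \<oplus>\<^bsub>?Q\<^esub> x = x" using v by (simp add: quot_zero)
    have "(U +> (\<ominus> v)) \<oplus>\<^bsub>?Q\<^esub> x = \<zero>\<^bsub>?Q\<^esub>" using v by (simp add: quot_add l_neg quot_zero)
    moreover have "U +> (\<ominus> v) \<in> carrier ?Q" using v by (simp add: quot_carrier)
    ultimately show "\<exists>y\<in>carrier ?Q. y \<oplus>\<^bsub>?Q\<^esub> x = \<zero>\<^bsub>?Q\<^esub>" by blast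
    fix z assume "z \<in> carrier ?Q"
    then obtain u where "u \<in> carrier V" "z = U +> u" by (auto simp: quot_carrier)
    then show "x \<oplus>\<^bsub>?Q\<^esub> y \<oplus>\<^bsub>?Q\<^esub> z = x \<oplus>\<^bsub>?Q\<^esub> (y \<oplus>\<^bsub>?Q\<^esub> z)"
      using v by (simp add: quot_add a_assoc)
  qed
  then show ?thesis
    by (intro operator_group.intro operator_group_axioms.intro)
      (auto simp: quot_carrier quot_add quot_smult smult_add)
qed

lemma quot_proj: "(\<lambda>x\<in>carrier V. U +> x) \<in> Hom D V (quot_module V U)"
  by (intro HomI operator_group_axioms) (auto simp: quot_carrier quot_add quot_smult)

lemma quot_proj_image: "(\<lambda>x\<in>carrier V. U +> x) ` carrier V = carrier (quot_module V U)"
  by (auto simp: quot_carrier)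

lemma quot_proj_ker: "{x \<in> carrier V. (\<lambda>x\<in>carrier V. U +> x) x = \<zero>\<^bsub>quot_module V U\<^esub>} = U"
  using submoduleD(1)[OF U] by (auto simp: quot_zero quot_eq_zero_iff)

end

end

text \<open>The module axioms are identities, hence inherited by images. For quotients, and later
  for the extension group over \<open>End N\<close>, it remains to exhibit an operator group and a
  surjection onto it.\<close>

lemma surj_left_module:
  assumes "left_module D V" "operator_group D W" "f \<in> Hom D V W" "f ` carrier V = carrier W"
  shows "left_module D W"
proof -
  interpret V: left_module D V by fact
  interpret W: operator_group D W by fact
  note f = HomD[OF assms(3)]
  have ex: "\<exists>v\<in>carrier V. x = f v" if "x \<in> carrier W" for x using assms(4) that by auto
  show ?thesis
  proof (rule left_moduleI'[OF V.R.ring_axioms assms(2)])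
    fix a b x assume h: "a \<in> carrier D" "b \<in> carrier D" "x \<in> carrier W"
    then obtain v where "v \<in> carrier V" "x = f v" using ex by auto
    then show "(a \<oplus>\<^bsub>D\<^esub> b) \<odot>\<^bsub>W\<^esub> x = a \<odot>\<^bsub>W\<^esub> x \<oplus>\<^bsub>W\<^esub> b \<odot>\<^bsub>W\<^esub> x"
      "(a \<otimes>\<^bsub>D\<^esub> b) \<odot>\<^bsub>W\<^esub> x = a \<odot>\<^bsub>W\<^esub> (b \<odot>\<^bsub>W\<^esub> x)"
      using h by (simp_all flip: f(5) f(6) add: V.smult_l_distr V.smult_assoc1)
  next
    fix x assume "x \<in> carrier W"
    then obtain v where "v \<in> carrier V" "x = f v" using ex by auto
    then show "\<one>\<^bsub>D\<^esub> \<odot>\<^bsub>W\<^esub> x = x" by (simp flip: f(6))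
  qed
qed

lemma quot_left_module:
  assumes "left_module D V" "submodule U D V"
  shows "left_module D (quot_module V U)"
  using assms operator_group.quot_operator_group operator_group.quot_proj
    operator_group.quot_proj_image surj_left_module left_module_operator_group by metis

section \<open>Length\<close>

definition chain_of :: "('d, 'x) ring_scheme \<Rightarrow> ('d, 'v) module \<Rightarrow> (nat \<Rightarrow> 'v set) \<Rightarrow> nat \<Rightarrow> bool" where
  "chain_of D V c n \<longleftrightarrow> (\<forall>k\<le>n. submodule (c k) D V) \<and> (\<forall>k<n. c k \<subset> c (Suc k))"

definition height_on :: "('d, 'x) ring_scheme \<Rightarrow> ('d, 'v) module \<Rightarrow> ('v set \<Rightarrow> nat) \<Rightarrow> nat \<Rightarrow> bool" where
  "height_on D V h n \<longleftrightarrow>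
     (\<forall>A B. submodule A D V \<longrightarrow> submodule B D V \<longrightarrow> A \<subset> B \<longrightarrow> h A < h B) \<and>
     (\<forall>A. submodule A D V \<longrightarrow> h A \<le> n)"

text \<open>A chain bounds the length from below and a strictly monotone bounded function bounds it
  from above; the length is the number on which two such certificates agree. Uniqueness is then
  immediate, and additivity amounts to combining certificates.\<close>

definition len :: "('d, 'x) ring_scheme \<Rightarrow> ('d, 'v) module \<Rightarrow> nat \<Rightarrow> bool" where
  "len D V n \<longleftrightarrow> (\<exists>c. chain_of D V c n) \<and> (\<exists>h. height_on D V h n)"

lemma chain_height:
  assumes "chain_of D V c n" "height_on D V h m" "k \<le> n"
  shows "k \<le> h (c k)" "h (c k) + (n - k) \<le> h (c n)"
proof -
  have step: "h (c j) < h (c (Suc j))" if "j < n" for j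
    using assms that unfolding chain_of_def height_on_def by (meson Suc_leI less_imp_le_nat)
  show "k \<le> h (c k)" using assms(3)
  proof (induction k)
    case (Suc k) then show ?case using step[of k] by simp
  qed simp
  have "h (c (n - j)) + j \<le> h (c n)" if "j \<le> n" for j using that
  proof (induction j)
    case (Suc j)
    then show ?case using step[of "n - Suc j"] by (simp add: Suc_diff_Suc)
  qed simp
  from this[of "n - k"] show "h (c k) + (n - k) \<le> h (c n)" using assms(3) by simp
qed

lemma chain_le_height:
  assumes "chain_of D V c n" "height_on D V h m" shows "n \<le> m"
  using chain_height(1)[OF assms, of n] assms unfolding chain_of_def height_on_def
  by (meson dual_order.trans le_refl)

lemma len_unique: "len D V n \<Longrightarrow> len D V m \<Longrightarrow> n = m"
  unfolding len_def using chain_le_height by (metis le_antisym)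

lemma chain_extend:
  assumes "chain_of D V c n" "submodule A D V" "c n \<subset> A"
  shows "chain_of D V (c(Suc n := A)) (Suc n)"
  using assms unfolding chain_of_def by (auto simp: less_Suc_eq le_Suc_eq)

context operator_group
begin

text \<open>Any bounded height limits the lengths of chains, so for each \<open>A\<close> there is a
  longest chain ending inside \<open>A\<close>. Its length is again a height, as such a chain can be
  continued by a strictly larger \<open>B\<close>, and the value of this height at the top is
  attained.\<close>

lemma height_imp_len:
  assumes "height_on D V h m"
  shows "\<exists>n. len D V n"
proof -
  define L where "L A = {n. \<exists>c. chain_of D V c n \<and> c n \<subseteq> A}" for A
  have bnd: "n \<le> m" if "n \<in> L A" for n A
    using that chain_le_height[OF _ assms] unfolding L_def by blast
  then have fin: "finite (L A)" for A by (meson finite_nat_set_iff_bounded_le)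
  have ne: "0 \<in> L A" if "submodule A D V" for A
    unfolding L_def chain_of_def using submodule_zero submoduleD(2)[OF that]
    by (auto intro!: exI[of _ "\<lambda>_. {\<zero>}"])
  define n where "n = Max (L (carrier V))"
  have "n \<in> L (carrier V)" unfolding n_def using fin ne submodule_carrier by (intro Max_in) auto
  then obtain c where "chain_of D V c n" unfolding L_def by auto
  moreover have "height_on D V (\<lambda>A. Max (L A)) n"
    unfolding height_on_def
  proof (intro conjI allI impI)
    fix A B assume AB: "submodule A D V" "submodule B D V" "A \<subset> B"
    obtain N where N: "N = Max (L A)" by simp
    have "N \<in> L A" unfolding N using fin ne[OF AB(1)] by (intro Max_in) auto
    then obtain c where c: "chain_of D V c N" "c N \<subseteq> A" unfolding L_def by auto
    then have "chain_of D V (c(Suc N := B)) (Suc N)" using chain_extend[of D V c N B] AB by auto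
    then have "Suc N \<in> L B" unfolding L_def by (metis (mono_tags, lifting) fun_upd_same mem_Collect_eq order_refl)
    then show "Max (L A) < Max (L B)" unfolding N[symmetric] using fin[of B] by (meson Max_ge Suc_le_eq)
  next
    fix A assume A: "submodule A D V"
    have "L A \<subseteq> L (carrier V)" using submoduleD(1)[OF A] unfolding L_def by auto
    then show "Max (L A) \<le> n" unfolding n_def using fin ne[OF A] by (intro Max_mono) auto
  qed
  ultimately show ?thesis unfolding len_def by blast
qed

lemma len_sub_ex:
  assumes "len D V n" "submodule U D V"
  shows "\<exists>a. len D (V\<lparr>carrier := U\<rparr>) a"
proof -
  interpret S: operator_group D "V\<lparr>carrier := U\<rparr>" by (rule sub_operator_group) fact
  obtain h where h: "height_on D V h n" using assms(1) unfolding len_def by auto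
  have "height_on D (V\<lparr>carrier := U\<rparr>) h n"
    using h unfolding height_on_def by (simp add: submodule_sub_iff[OF assms(2)])
  then show ?thesis by (rule S.height_imp_len)
qed

lemma len_zero_module: "carrier V = {\<zero>} \<Longrightarrow> len D V 0"
  unfolding len_def
proof (intro conjI exI)
  assume "carrier V = {\<zero>}"
  then have *: "A = {\<zero>}" if "submodule A D V" for A using submoduleD(1,2)[OF that] by auto
  show "chain_of D V (\<lambda>_. {\<zero>}) 0" by (simp add: chain_of_def submodule_zero)
  show "height_on D V (\<lambda>_. 0) 0" unfolding height_on_def using * by (metis psubset_eq le_refl)
qed

lemma len_0D: assumes "len D V 0" shows "carrier V = {\<zero>}"
proof (rule ccontr)
  assume "carrier V \<noteq> {\<zero>}"
  then have "{\<zero>} \<subset> carrier V" by auto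
  moreover obtain h where "height_on D V h 0" using assms unfolding len_def by auto
  ultimately show False unfolding height_on_def using submodule_zero submodule_carrier
    by (metis le_zero_eq less_nat_zero_code)
qed

lemma len_one:
  assumes "carrier V \<noteq> {\<zero>}" "\<And>A. submodule A D V \<Longrightarrow> A = {\<zero>} \<or> A = carrier V"
  shows "len D V 1"
  unfolding len_def
proof (intro conjI exI)
  show "chain_of D V (\<lambda>k. if k = 0 then {\<zero>} else carrier V) 1"
    unfolding chain_of_def using submodule_zero submodule_carrier assms(1) by auto
  show "height_on D V (\<lambda>A. if A = {\<zero>} then 0 else 1) 1"
    unfolding height_on_def using assms(2) submoduleD(2) by (auto simp: psubset_eq)
qed

text \<open>If the chain is as long as the height allows, then \<open>h (c k) = k\<close>. No value
  is left for a submodule below \<open>c 0\<close>, above \<open>c n\<close> or strictly between two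
  neighbours.\<close>

lemma len_maximal_chain:
  assumes "len D V n"
  obtains c where "chain_of D V c n" "c 0 = {\<zero>}" "c n = carrier V"
    "\<And>k A. \<lbrakk>k < n; submodule A D V; c k \<subseteq> A; A \<subseteq> c (Suc k)\<rbrakk> \<Longrightarrow> A = c k \<or> A = c (Suc k)"
proof -
  obtain c h where c: "chain_of D V c n" and h: "height_on D V h n" using assms unfolding len_def by auto
  have hn: "h A \<le> n" if "submodule A D V" for A using h that unfolding height_on_def by auto
  have sm: "h A < h B" if "submodule A D V" "submodule B D V" "A \<subset> B" for A B
    using h that unfolding height_on_def by auto
  have cs: "submodule (c k) D V" if "k \<le> n" for k using c that unfolding chain_of_def by auto
  have hc: "h (c k) = k" if "k \<le> n" for k
    using chain_height[OF c h that] hn[OF cs, of n] that by auto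
  have "c 0 = {\<zero>}"
  proof (rule ccontr)
    assume "c 0 \<noteq> {\<zero>}"
    then have "{\<zero>} \<subset> c 0" using submoduleD(2)[OF cs[of 0]] by auto
    then show False using sm[OF submodule_zero cs[of 0]] hc[of 0] by simp
  qed
  moreover have "c n = carrier V"
  proof (rule ccontr)
    assume "c n \<noteq> carrier V"
    then have "c n \<subset> carrier V" using submoduleD(1)[OF cs[of n]] by auto
    then show False using sm[OF cs[of n] submodule_carrier] hc[of n] hn[OF submodule_carrier] by simp
  qed
  moreover have "A = c k \<or> A = c (Suc k)"
    if "k < n" "submodule A D V" "c k \<subseteq> A" "A \<subseteq> c (Suc k)" for k A
  proof (rule ccontr)
    assume "\<not> ?thesis"
    then have "c k \<subset> A" "A \<subset> c (Suc k)" using that by auto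
    then have "h (c k) < h A" "h A < h (c (Suc k))" using sm that cs by auto
    then show False using hc[of k] hc[of "Suc k"] that(1) by simp
  qed
  ultimately show ?thesis using that c by blast
qed

end

context semilinear_map
begin

lemma len_add:
  assumes surj: "f ` carrier V = carrier W"
    and "len D (V\<lparr>carrier := ker\<rparr>) a" "len E W b"
  shows "len D V (a + b)"
proof -
  obtain ca ha cb hb where ca: "chain_of D (V\<lparr>carrier := ker\<rparr>) ca a"
    and ha: "height_on D (V\<lparr>carrier := ker\<rparr>) ha a"
    and cb: "chain_of E W cb b" and hb: "height_on E W hb b"
    using assms unfolding len_def by auto
  note sub = V.submodule_sub_iff[OF ker_submodule]
  define g where "g B = {x \<in> carrier V. f x \<in> B}" for B
  have gmono: "g A \<subset> g B" if A: "submodule A E W" and B: "submodule B E W" and AB: "A \<subset> B" for A B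
  proof -
    from psubset_imp_ex_mem[OF AB] obtain y where "y \<in> B" "y \<notin> A" by auto
    moreover then obtain x where "x \<in> carrier V" "f x = y"
      using surj W.submoduleD(6)[OF B] by (metis imageE)
    ultimately show ?thesis using AB unfolding g_def by auto
  qed
  have kg: "ker \<subseteq> g B" if "submodule B E W" for B
    using W.submoduleD(2)[OF that] unfolding g_def ker_def by auto
  have gs: "submodule (g B) D V" if "submodule B E W" for B
    unfolding g_def by (rule preimage[OF that])
  \<comment> \<open>The chain of the kernel is continued by the preimages of the chain of
    \<open>W\<close>. The preimage of \<open>cb 0\<close> is skipped, because it contains the kernel
    and may coincide with \<open>ca a\<close>.\<close>
  define c where "c k = (if k \<le> a then ca k else g (cb (k - a)))" for k
  have cas: "submodule (ca k) D V \<and> ca k \<subseteq> ker" if "k \<le> a" for k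
    using ca that sub unfolding chain_of_def by auto
  have cbs: "submodule (cb k) E W" if "k \<le> b" for k
    using cb that unfolding chain_of_def by auto
  have "chain_of D V c (a + b)"
    unfolding chain_of_def
  proof (intro conjI allI impI)
    fix k assume "k \<le> a + b" then show "submodule (c k) D V"
      unfolding c_def using cas gs cbs by auto
  next
    fix k assume k: "k < a + b"
    consider "k < a" | "k = a" | "k > a" by linarith
    then show "c k \<subset> c (Suc k)"
    proof cases
      case 1 then show ?thesis using ca unfolding c_def chain_of_def by auto
    next
      case 2
      then have "ker \<subseteq> g (cb 0)" "g (cb 0) \<subset> g (cb 1)"
        using kg gmono cbs cb k unfolding chain_of_def by auto
      then show ?thesis using 2 cas[of a] unfolding c_def by auto
    next
      case 3
      then have "cb (k - a) \<subset> cb (Suc (k - a))" "k - a < b" using cb k unfolding chain_of_def by auto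
      then show ?thesis using 3 gmono[OF cbs cbs] unfolding c_def by (simp add: Suc_diff_le)
    qed
  qed
  moreover have "height_on D V (\<lambda>A. ha (A \<inter> ker) + hb (f ` A)) (a + b)"
    unfolding height_on_def
  proof (intro conjI allI impI)
    have s: "submodule (A \<inter> ker) D (V\<lparr>carrier := ker\<rparr>)" if "submodule A D V" for A
      using V.submoduleD[OF that] V.submoduleD[OF ker_submodule]
      by (auto simp: sub intro!: V.submoduleI)
    fix A assume A: "submodule A D V"
    show "ha (A \<inter> ker) + hb (f ` A) \<le> a + b"
      using ha hb s[OF A] image[OF A] unfolding height_on_def by (intro add_mono) auto
    fix B assume B: "submodule B D V" "A \<subset> B"
    have 1: "A \<inter> ker \<subset> B \<inter> ker \<Longrightarrow> ha (A \<inter> ker) < ha (B \<inter> ker)"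
      using ha s A B unfolding height_on_def by auto
    have 2: "f ` A \<subset> f ` B \<Longrightarrow> hb (f ` A) < hb (f ` B)"
      using hb image A B unfolding height_on_def by auto
    have "A \<inter> ker \<subset> B \<inter> ker \<or> f ` A \<subset> f ` B"
      using eqI[OF A B(1)] B(2) by blast
    moreover have "A \<inter> ker \<subseteq> B \<inter> ker" "f ` A \<subseteq> f ` B" using B by auto
    ultimately show "ha (A \<inter> ker) + hb (f ` A) < ha (B \<inter> ker) + hb (f ` B)"
      using 1 2 by (metis add_less_le_mono add_le_less_mono add_less_mono le_less psubsetI less_or_eq_imp_le)
  qed
  ultimately show ?thesis unfolding len_def by blast
qed

text \<open>Taking preimages under a surjection is strictly monotone, so a height of
  \<open>V\<close> induces one of \<open>W\<close>.\<close>

lemma len_surj_ex: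
  assumes surj: "f ` carrier V = carrier W" and "len D V n"
  shows "\<exists>b. len E W b"
proof -
  obtain h where h: "height_on D V h n" using assms unfolding len_def by auto
  have "height_on E W (\<lambda>B. h {x \<in> carrier V. f x \<in> B}) n"
    unfolding height_on_def
  proof (intro conjI allI impI)
    fix A assume A: "submodule A E W"
    show "h {x \<in> carrier V. f x \<in> A} \<le> n" using h preimage[OF A] unfolding height_on_def by auto
    fix B assume B: "submodule B E W" "A \<subset> B"
    then obtain y where "y \<in> B" "y \<notin> A" using psubset_imp_ex_mem by auto
    moreover then obtain x where "x \<in> carrier V" "f x = y"
      using surj W.submoduleD(6)[OF B(1)] by (metis imageE)
    ultimately have "{x \<in> carrier V. f x \<in> A} \<subset> {x \<in> carrier V. f x \<in> B}" using B by auto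
    then show "h {x \<in> carrier V. f x \<in> A} < h {x \<in> carrier V. f x \<in> B}"
      using h preimage[OF A] preimage[OF B(1)] unfolding height_on_def by auto
  qed
  then show ?thesis by (rule W.height_imp_len)
qed

lemma len_surj:
  assumes "f ` carrier V = carrier W" "len D V n"
  obtains a b where "len D (V\<lparr>carrier := ker\<rparr>) a" "len E W b" "n = a + b"
  using len_surj_ex[OF assms] V.len_sub_ex[OF assms(2) ker_submodule] len_add[OF assms(1)]
    len_unique[OF assms(2)] by metis

lemma len_bij:
  assumes "bij_betw f (carrier V) (carrier W)"
  shows "len D V n \<longleftrightarrow> len E W n"
proof -
  have "ker = {\<zero>\<^bsub>V\<^esub>}" using assms inj_iff by (simp add: bij_betw_def)
  then have 0: "len D (V\<lparr>carrier := ker\<rparr>) 0"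
    using operator_group.len_zero_module[OF V.sub_operator_group[OF ker_submodule]] by simp
  have s: "f ` carrier V = carrier W" using assms by (simp add: bij_betw_def)
  show ?thesis
  proof
    assume n: "len D V n"
    obtain b where b: "len E W b" using len_surj_ex[OF s n] by auto
    then have "n = 0 + b" using len_add[OF s 0 b] len_unique[OF n] by simp
    then show "len E W n" using b by simp
  qed (use len_add[OF s 0] in auto)
qed

end

context operator_group
begin

lemma len_sub_quot:
  assumes "submodule U D V" "len D (V\<lparr>carrier := U\<rparr>) a" "len D (quot_module V U) b"
  shows "len D V (a + b)"
proof -
  interpret p: semilinear_map D V D "quot_module V U" "\<lambda>x\<in>carrier V. U +> x"
    by (intro Hom_semilinear_map operator_group_axioms quot_operator_group quot_proj assms)
  have "p.ker = U" unfolding p.ker_def by (rule quot_proj_ker[OF assms(1)])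
  then show ?thesis using p.len_add[OF quot_proj_image[OF assms(1)]] assms by simp
qed

lemma quot_simple:
  assumes U: "submodule U D V" "U \<noteq> carrier V"
    "\<And>A. \<lbrakk>submodule A D V; U \<subseteq> A\<rbrakk> \<Longrightarrow> A = U \<or> A = carrier V"
  shows "carrier (quot_module V U) \<noteq> {\<zero>\<^bsub>quot_module V U\<^esub>}"
    "\<And>B. submodule B D (quot_module V U) \<Longrightarrow> B = {\<zero>\<^bsub>quot_module V U\<^esub>} \<or> B = carrier (quot_module V U)"
proof -
  let ?p = "\<lambda>x\<in>carrier V. U +> x" and ?Q = "quot_module V U"
  interpret p: semilinear_map D V D ?Q ?p
    by (intro Hom_semilinear_map operator_group_axioms quot_operator_group quot_proj U)
  have k: "p.ker = U" unfolding p.ker_def by (rule quot_proj_ker[OF U(1)])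
  have s: "?p ` carrier V = carrier ?Q" by (rule quot_proj_image[OF U(1)])
  show "carrier ?Q \<noteq> {\<zero>\<^bsub>?Q\<^esub>}"
  proof
    assume "carrier ?Q = {\<zero>\<^bsub>?Q\<^esub>}"
    then have "p.ker = carrier V" unfolding p.ker_def using p.closed by blast
    then show False using k U(2) by simp
  qed
  fix B assume B: "submodule B D ?Q"
  let ?A = "{x \<in> carrier V. ?p x \<in> B}"
  have A: "submodule ?A D V" by (rule p.preimage[OF B])
  have z: "x \<in> carrier V \<and> ?p x = \<zero>\<^bsub>?Q\<^esub>" if "x \<in> U" for x using k that unfolding p.ker_def by blast
  have UA: "U \<subseteq> ?A"
  proof
    fix x assume "x \<in> U"
    then show "x \<in> ?A" using z[of x] p.W.submoduleD(2)[OF B] by (metis (mono_tags, lifting) mem_Collect_eq)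
  qed
  have im: "?p ` ?A = B"
  proof
    show "?p ` ?A \<subseteq> B" by (auto simp del: restrict_apply)
    show "B \<subseteq> ?p ` ?A"
    proof
      fix b assume b: "b \<in> B"
      then have "b \<in> ?p ` carrier V" using s p.W.submoduleD(6)[OF B] by blast
      then obtain x where "x \<in> carrier V" "b = ?p x" by blast
      then show "b \<in> ?p ` ?A" using b by blast
    qed
  qed
  have im0: "?p ` U = {\<zero>\<^bsub>?Q\<^esub>}"
  proof
    show "?p ` U \<subseteq> {\<zero>\<^bsub>?Q\<^esub>}" by (rule image_subsetI) (use z in blast)
    have "?p \<zero> \<in> ?p ` U" using submoduleD(2)[OF U(1)] by (rule imageI)
    then show "{\<zero>\<^bsub>?Q\<^esub>} \<subseteq> ?p ` U" by (simp only: p.zero insert_subset empty_subsetI simp_thms)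
  qed
  from U(3)[OF A UA] show "B = {\<zero>\<^bsub>?Q\<^esub>} \<or> B = carrier ?Q"
  proof
    assume "?A = U"
    with im im0 have "B = {\<zero>\<^bsub>?Q\<^esub>}" by (simp only:)
    then show ?thesis ..
  next
    assume "?A = carrier V"
    with im s have "B = carrier ?Q" by (simp only:)
    then show ?thesis ..
  qed
qed

end

lemma len_composition_series:
  fixes M :: "('h, 'm) module"
  assumes "left_module H M" "len H M n"
  shows "\<exists>c. composition_series H M c n"
proof -
  interpret M: operator_group H M by (rule left_module_operator_group) fact
  obtain c where c: "chain_of H M c n" "c 0 = {\<zero>\<^bsub>M\<^esub>}" "c n = carrier M"
    and max: "\<And>k A. \<lbrakk>k < n; submodule A H M; c k \<subseteq> A; A \<subseteq> c (Suc k)\<rbrakk> \<Longrightarrow> A = c k \<or> A = c (Suc k)"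
    using M.len_maximal_chain[OF assms(2)] by metis
  have cs: "submodule (c k) H M" if "k \<le> n" for k using c that unfolding chain_of_def by auto
  have "c k \<subseteq> c (Suc k) \<and> simple_module H (series_factor M c k)" if k: "k < n" for k
  proof -
    have lt: "c k \<subset> c (Suc k)" using c k unfolding chain_of_def by auto
    note iff = M.submodule_sub_iff[OF cs[of "Suc k"]]
    have lm: "left_module H (M\<lparr>carrier := c (Suc k)\<rparr>)" using sub_left_module[OF assms(1)] cs k by simp
    interpret S: operator_group H "M\<lparr>carrier := c (Suc k)\<rparr>" by (rule left_module_operator_group[OF lm])
    have sub: "submodule (c k) H (M\<lparr>carrier := c (Suc k)\<rparr>)" using iff cs k lt by auto
    show ?thesis unfolding simple_module_def series_factor_def
      using quot_left_module[OF lm sub] S.quot_simple[OF sub] lt max[OF k] iff k by auto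
  qed
  then show ?thesis using c cs unfolding composition_series_def by blast
qed

section \<open>Free modules and lifting\<close>

text \<open>The sum is taken over the support, as the index set may be infinite. With
  \<open>s\<close> the identity it is literally the sum in \<open>free_eval\<close>.\<close>

definition lin_comb ::
    "('h, 'x) ring_scheme \<Rightarrow> ('h, 'm) module \<Rightarrow> 'a set \<Rightarrow> ('a \<Rightarrow> 'm) \<Rightarrow> ('a \<Rightarrow> 'h) \<Rightarrow> 'm" where
  "lin_comb H M A s c = (\<Oplus>\<^bsub>M\<^esub>x\<in>{x \<in> A. c x \<noteq> \<zero>\<^bsub>H\<^esub>}. c x \<odot>\<^bsub>M\<^esub> s x)"

definition unit_vec :: "('h, 'x) ring_scheme \<Rightarrow> 'a set \<Rightarrow> 'a \<Rightarrow> 'a \<Rightarrow> 'h" where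
  "unit_vec H A a = (\<lambda>x\<in>A. if x = a then \<one>\<^bsub>H\<^esub> else \<zero>\<^bsub>H\<^esub>)"

text \<open>The linear extension of a map given on basis elements. A free module depends on the
  carrier of its argument only, so below \<open>M\<lparr>carrier := A\<rparr>\<close> names the free
  module on a mere subset \<open>A\<close>, which is no submodule in general.\<close>

definition lin_hom ::
    "('h, 'x) ring_scheme \<Rightarrow> ('h, 'a) module \<Rightarrow> ('h, 'm) module \<Rightarrow> ('a \<Rightarrow> 'm) \<Rightarrow> ('a \<Rightarrow> 'h) \<Rightarrow> 'm" where
  "lin_hom H X M s = (\<lambda>c\<in>carrier (free_module H X). lin_comb H M (carrier X) s c)"

lemma free_eval_eq: "free_eval H M c = lin_comb H M (carrier M) (\<lambda>x. x) c"
  by (simp add: free_eval_def lin_comb_def)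

lemma free_carrier:
  "c \<in> carrier (free_module H X) \<longleftrightarrow>
    c \<in> carrier X \<rightarrow>\<^sub>E carrier H \<and> finite {x \<in> carrier X. c x \<noteq> \<zero>\<^bsub>H\<^esub>}"
  by (simp add: free_module_def)

lemma free_simps:
  "\<zero>\<^bsub>free_module H X\<^esub> = (\<lambda>x\<in>carrier X. \<zero>\<^bsub>H\<^esub>)"
  "c \<oplus>\<^bsub>free_module H X\<^esub> d = (\<lambda>x\<in>carrier X. c x \<oplus>\<^bsub>H\<^esub> d x)"
  "r \<odot>\<^bsub>free_module H X\<^esub> c = (\<lambda>x\<in>carrier X. r \<otimes>\<^bsub>H\<^esub> c x)"
  by (simp_all add: free_module_def)

lemma regular_simps:
  "carrier (regular_module H) = carrier H" "\<zero>\<^bsub>regular_module H\<^esub> = \<zero>\<^bsub>H\<^esub>"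
  "x \<oplus>\<^bsub>regular_module H\<^esub> y = x \<oplus>\<^bsub>H\<^esub> y" "x \<odot>\<^bsub>regular_module H\<^esub> y = x \<otimes>\<^bsub>H\<^esub> y"
  by (simp_all add: regular_module_def)

lemma finsum_regular: "finsum (regular_module H) = finsum H"
proof -
  have "carrier (add_monoid (regular_module H)) = carrier H" "mult (add_monoid (regular_module H)) = add H"
    "one (add_monoid (regular_module H)) = \<zero>\<^bsub>H\<^esub>"
    by (simp_all add: regular_module_def)
  then show ?thesis unfolding finsum_def finprod_def by (simp only: partial_object.simps monoid.simps)
qed

lemma regular_left_module:
  assumes "ring H" shows "left_module H (regular_module H)"
proof -
  interpret ring H by fact
  have "abelian_group (regular_module H)"
    by (rule abelian_groupI) (auto simp: regular_simps a_ac intro!: bexI[of _ "\<ominus>\<^bsub>H\<^esub> x" for x] l_neg)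
  then have "operator_group H (regular_module H)"
    by (intro operator_group.intro operator_group_axioms.intro) (auto simp: regular_simps r_distr)
  then show ?thesis
    by (intro left_moduleI' ring_axioms) (auto simp: regular_simps l_distr m_assoc)
qed

context ring
begin

lemma free_closed:
  assumes "c \<in> carrier (free_module R X)" "d \<in> carrier (free_module R X)"
  shows "c \<oplus>\<^bsub>free_module R X\<^esub> d \<in> carrier (free_module R X)"
proof -
  have "{x \<in> carrier X. (\<lambda>x\<in>carrier X. c x \<oplus> d x) x \<noteq> \<zero>}
      \<subseteq> {x \<in> carrier X. c x \<noteq> \<zero>} \<union> {x \<in> carrier X. d x \<noteq> \<zero>}"
    by auto
  then have "finite {x \<in> carrier X. (\<lambda>x\<in>carrier X. c x \<oplus> d x) x \<noteq> \<zero>}"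
    by (rule finite_subset) (use assms in \<open>simp add: free_carrier\<close>)
  then show ?thesis using assms unfolding free_carrier free_simps by auto
qed

lemma free_smult_closed:
  assumes "r \<in> carrier R" "c \<in> carrier (free_module R X)"
  shows "r \<odot>\<^bsub>free_module R X\<^esub> c \<in> carrier (free_module R X)"
proof -
  have "{x \<in> carrier X. (\<lambda>x\<in>carrier X. r \<otimes> c x) x \<noteq> \<zero>} \<subseteq> {x \<in> carrier X. c x \<noteq> \<zero>}"
    using assms(1) by auto
  then have "finite {x \<in> carrier X. (\<lambda>x\<in>carrier X. r \<otimes> c x) x \<noteq> \<zero>}"
    by (rule finite_subset) (use assms in \<open>simp add: free_carrier\<close>)
  then show ?thesis using assms unfolding free_carrier free_simps by auto
qed

lemma free_left_module: "left_module R (free_module R X)"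
proof -
  let ?F = "free_module R X"
  have z: "\<zero>\<^bsub>?F\<^esub> \<in> carrier ?F" by (simp add: free_carrier free_simps)
  have app: "c x \<in> carrier R" if "c \<in> carrier ?F" "x \<in> carrier X" for c x
    using that by (auto simp: free_carrier)
  have ext: "(\<lambda>x\<in>carrier X. c x) = c" if "c \<in> carrier ?F" for c
    using that by (auto simp: free_carrier)
  have "abelian_group ?F"
  proof (rule abelian_groupI)
    fix c assume c: "c \<in> carrier ?F"
    show "\<zero>\<^bsub>?F\<^esub> \<oplus>\<^bsub>?F\<^esub> c = c"
      using app[OF c] ext[OF c] by (simp add: free_simps cong: restrict_cong)
    have "(\<ominus> \<one>) \<odot>\<^bsub>?F\<^esub> c \<oplus>\<^bsub>?F\<^esub> c = \<zero>\<^bsub>?F\<^esub>"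
      using app[OF c] by (simp add: free_simps l_minus l_neg cong: restrict_cong)
    then show "\<exists>d\<in>carrier ?F. d \<oplus>\<^bsub>?F\<^esub> c = \<zero>\<^bsub>?F\<^esub>" using free_smult_closed[OF _ c] by blast
  next
    fix c d assume "c \<in> carrier ?F" "d \<in> carrier ?F"
    then show "c \<oplus>\<^bsub>?F\<^esub> d = d \<oplus>\<^bsub>?F\<^esub> c"
      using app by (simp add: free_simps a_comm cong: restrict_cong)
  next
    fix c d e assume "c \<in> carrier ?F" "d \<in> carrier ?F" "e \<in> carrier ?F"
    then show "c \<oplus>\<^bsub>?F\<^esub> d \<oplus>\<^bsub>?F\<^esub> e = c \<oplus>\<^bsub>?F\<^esub> (d \<oplus>\<^bsub>?F\<^esub> e)"
      using app by (simp add: free_simps a_assoc cong: restrict_cong)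
  qed (simp_all add: z free_closed)
  then have "operator_group R ?F"
    using app by (intro operator_group.intro operator_group_axioms.intro free_smult_closed)
      (simp_all add: free_simps r_distr cong: restrict_cong)
  then show ?thesis
    using app ext by (intro left_moduleI' ring_axioms)
      (simp_all add: free_simps l_distr m_assoc cong: restrict_cong)
qed

lemma unit_vec_closed: "unit_vec R (carrier X) a \<in> carrier (free_module R X)"
proof -
  have "{x \<in> carrier X. unit_vec R (carrier X) a x \<noteq> \<zero>} \<subseteq> {a}" by (auto simp: unit_vec_def)
  then show ?thesis unfolding free_carrier by (auto simp: unit_vec_def intro: finite_subset)
qed

end

locale lmod = left_module R M for R :: "('h, 'x) ring_scheme" (structure) and M :: "('h, 'm) module" (structure)
begin

lemma og: "operator_group R M" by (rule left_module_operator_group) (rule left_module_axioms)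

lemma smult_zero_left [simp]: "x \<in> carrier M \<Longrightarrow> \<zero> \<odot>\<^bsub>M\<^esub> x = \<zero>\<^bsub>M\<^esub>"
  by (metis M.add.l_cancel_one' R.r_zero R.zero_closed smult_closed smult_l_distr)

lemma lin_comb_superset:
  assumes "finite B" "{x \<in> A. c x \<noteq> \<zero>} \<subseteq> B" "B \<subseteq> A" "\<And>x. x \<in> A \<Longrightarrow> c x \<in> carrier R"
    "\<And>x. x \<in> A \<Longrightarrow> s x \<in> carrier M"
  shows "lin_comb R M A s c = (\<Oplus>\<^bsub>M\<^esub>x\<in>B. c x \<odot>\<^bsub>M\<^esub> s x)"
  unfolding lin_comb_def using assms
  by (intro M.add.finprod_mono_neutral_cong_left) (auto simp: subset_iff)

lemma lin_comb_closed:
  assumes "\<And>x. x \<in> A \<Longrightarrow> c x \<in> carrier R" "\<And>x. x \<in> A \<Longrightarrow> s x \<in> carrier M"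
  shows "lin_comb R M A s c \<in> carrier M"
  unfolding lin_comb_def using assms by (intro M.finsum_closed) auto

lemma lin_hom_Hom:
  assumes s: "\<And>x. x \<in> carrier X \<Longrightarrow> s x \<in> carrier M"
  shows "lin_hom R X M s \<in> Hom R (free_module R X) M"
  unfolding lin_hom_def
proof (rule HomI)
  let ?F = "free_module R X" and ?L = "lin_comb R M (carrier X) s"
  show "operator_group R ?F" by (intro left_module_operator_group R.free_left_module)
  have app: "c x \<in> carrier R" if "c \<in> carrier ?F" "x \<in> carrier X" for c x
    using that by (auto simp: free_carrier)
  show "?L c \<in> carrier M" if "c \<in> carrier ?F" for c
    using app[OF that] s by (rule lin_comb_closed)
  let ?S = "\<lambda>c. {x \<in> carrier X. c x \<noteq> \<zero>}"
  fix c d assume c: "c \<in> carrier ?F" and d: "d \<in> carrier ?F"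
  let ?B = "?S c \<union> ?S d"
  have B: "finite ?B" "?B \<subseteq> carrier X" using c d by (auto simp: free_carrier)
  have e: "?L e = (\<Oplus>\<^bsub>M\<^esub>x\<in>?B. e x \<odot>\<^bsub>M\<^esub> s x)" if "e \<in> carrier ?F" "?S e \<subseteq> ?B" for e
    using that B s app by (intro lin_comb_superset) auto
  have "?L (c \<oplus>\<^bsub>?F\<^esub> d) = (\<Oplus>\<^bsub>M\<^esub>x\<in>?B. (c \<oplus>\<^bsub>?F\<^esub> d) x \<odot>\<^bsub>M\<^esub> s x)"
    using c d by (intro e R.free_closed) (auto simp: free_simps)
  also have "\<dots> = (\<Oplus>\<^bsub>M\<^esub>x\<in>?B. c x \<odot>\<^bsub>M\<^esub> s x \<oplus>\<^bsub>M\<^esub> d x \<odot>\<^bsub>M\<^esub> s x)"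
    using app[OF c] app[OF d] s B(2)
    by (intro M.finsum_cong') (auto simp: free_simps smult_l_distr)
  also have "\<dots> = (\<Oplus>\<^bsub>M\<^esub>x\<in>?B. c x \<odot>\<^bsub>M\<^esub> s x) \<oplus>\<^bsub>M\<^esub> (\<Oplus>\<^bsub>M\<^esub>x\<in>?B. d x \<odot>\<^bsub>M\<^esub> s x)"
    using app[OF c] app[OF d] s B(2) by (intro M.finsum_addf) auto
  finally show "?L (c \<oplus>\<^bsub>?F\<^esub> d) = ?L c \<oplus>\<^bsub>M\<^esub> ?L d" using e[OF c] e[OF d] by simp
next
  let ?F = "free_module R X" and ?L = "lin_comb R M (carrier X) s"
  fix r c assume r: "r \<in> carrier R" and c: "c \<in> carrier ?F"
  have app: "c x \<in> carrier R" if "x \<in> carrier X" for x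
    using c that by (auto simp: free_carrier)
  let ?B = "{x \<in> carrier X. c x \<noteq> \<zero>}"
  have B: "finite ?B" using c by (auto simp: free_carrier)
  have "?L (r \<odot>\<^bsub>?F\<^esub> c) = (\<Oplus>\<^bsub>M\<^esub>x\<in>?B. (r \<odot>\<^bsub>?F\<^esub> c) x \<odot>\<^bsub>M\<^esub> s x)"
    using r app s B by (intro lin_comb_superset) (auto simp: free_simps)
  also have "\<dots> = (\<Oplus>\<^bsub>M\<^esub>x\<in>?B. r \<odot>\<^bsub>M\<^esub> (c x \<odot>\<^bsub>M\<^esub> s x))"
    using r app s by (intro M.finsum_cong') (auto simp: free_simps smult_assoc1)
  also have "\<dots> = r \<odot>\<^bsub>M\<^esub> (\<Oplus>\<^bsub>M\<^esub>x\<in>?B. c x \<odot>\<^bsub>M\<^esub> s x)"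
  proof -
    have "(\<Oplus>\<^bsub>M\<^esub>x\<in>C. r \<odot>\<^bsub>M\<^esub> (c x \<odot>\<^bsub>M\<^esub> s x)) = r \<odot>\<^bsub>M\<^esub> (\<Oplus>\<^bsub>M\<^esub>x\<in>C. c x \<odot>\<^bsub>M\<^esub> s x)"
      if "finite C" "C \<subseteq> carrier X" for C
      using that
    proof (induction C rule: finite_induct)
      case empty then show ?case using r operator_group.smult_zero[OF og] by simp
    next
      case (insert x C)
      then have "(\<Oplus>\<^bsub>M\<^esub>x\<in>C. c x \<odot>\<^bsub>M\<^esub> s x) \<in> carrier M" "c x \<odot>\<^bsub>M\<^esub> s x \<in> carrier M"
        using app s by (auto intro!: M.finsum_closed)
      then show ?case using insert r app s by (simp add: Pi_def subset_iff smult_r_distr)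
    qed
    then show ?thesis using B by simp
  qed
  finally show "?L (r \<odot>\<^bsub>?F\<^esub> c) = r \<odot>\<^bsub>M\<^esub> ?L c" by (simp add: lin_comb_def)
qed

lemma lin_comb_unit:
  assumes "s a \<in> carrier M" "a \<in> A"
  shows "lin_comb R M A s (unit_vec R A a) = s a"
proof (cases "\<one> = \<zero>")
  \<comment> \<open>Over the zero ring the unit vector has empty support, but then \<open>M\<close>
    is zero and the empty sum is still correct.\<close>
  case True
  then have "x = \<zero>\<^bsub>M\<^esub>" if "x \<in> carrier M" for x using that by (metis smult_one smult_zero_left)
  moreover have "{x \<in> A. unit_vec R A a x \<noteq> \<zero>} = {}" using True by (auto simp: unit_vec_def)
  ultimately show ?thesis using assms unfolding lin_comb_def by (simp only: M.finsum_empty)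
next
  case False
  then have "{x \<in> A. unit_vec R A a x \<noteq> \<zero>} = {a}" using assms by (auto simp: unit_vec_def)
  then show ?thesis using assms unfolding lin_comb_def by (simp add: unit_vec_def)
qed

end

lemma lmodI: "left_module H M \<Longrightarrow> lmod H M"
  by (simp add: lmod_def)

lemma Hom_lin_comb:
  assumes "left_module H M" "left_module H N" "g \<in> Hom H M N"
    and "\<And>x. x \<in> A \<Longrightarrow> c x \<in> carrier H" "\<And>x. x \<in> A \<Longrightarrow> s x \<in> carrier M"
    and fin: "finite {x \<in> A. c x \<noteq> \<zero>\<^bsub>H\<^esub>}"
  shows "g (lin_comb H M A s c) = lin_comb H N A (\<lambda>x. g (s x)) c"
proof -
  interpret M: lmod H M by (rule lmodI) fact
  interpret N: lmod H N by (rule lmodI) fact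
  interpret g: semilinear_map H M H N g by (intro Hom_semilinear_map M.og N.og assms)
  note g = HomD[OF assms(3)]
  have "g (\<Oplus>\<^bsub>M\<^esub>x\<in>C. c x \<odot>\<^bsub>M\<^esub> s x) = (\<Oplus>\<^bsub>N\<^esub>x\<in>C. c x \<odot>\<^bsub>N\<^esub> g (s x))"
    if "finite C" "C \<subseteq> A" for C
    using that
  proof (induction C rule: finite_induct)
    case (insert x C)
    then have 1: "(\<Oplus>\<^bsub>M\<^esub>x\<in>C. c x \<odot>\<^bsub>M\<^esub> s x) \<in> carrier M" "c x \<odot>\<^bsub>M\<^esub> s x \<in> carrier M"
      using assms by (auto intro!: M.M.finsum_closed)
    have 2: "(\<lambda>x. c x \<odot>\<^bsub>M\<^esub> s x) \<in> C \<rightarrow> carrier M" "(\<lambda>x. c x \<odot>\<^bsub>N\<^esub> g (s x)) \<in> C \<rightarrow> carrier N"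
      "c x \<odot>\<^bsub>N\<^esub> g (s x) \<in> carrier N"
      using insert assms g(4) by auto
    have "g (\<Oplus>\<^bsub>M\<^esub>x\<in>insert x C. c x \<odot>\<^bsub>M\<^esub> s x) = g (c x \<odot>\<^bsub>M\<^esub> s x) \<oplus>\<^bsub>N\<^esub> g (\<Oplus>\<^bsub>M\<^esub>x\<in>C. c x \<odot>\<^bsub>M\<^esub> s x)"
      using insert 1 2 by (simp add: g.add)
    also have "\<dots> = (\<Oplus>\<^bsub>N\<^esub>x\<in>insert x C. c x \<odot>\<^bsub>N\<^esub> g (s x))"
      using insert 1 2 assms g(6) by simp
    finally show ?case .
  qed simp
  then show ?thesis unfolding lin_comb_def using fin by simp
qed

lemma lin_comb_in_submodule:
  assumes "left_module H M" "submodule U H M"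
    and "\<And>x. x \<in> A \<Longrightarrow> c x \<in> carrier H" "\<And>x. x \<in> A \<Longrightarrow> s x \<in> U"
    and fin: "finite {x \<in> A. c x \<noteq> \<zero>\<^bsub>H\<^esub>}"
  shows "lin_comb H M A s c \<in> U"
proof -
  interpret M: lmod H M by (rule lmodI) fact
  note U = operator_group.submoduleD[OF M.og assms(2)]
  have "(\<Oplus>\<^bsub>M\<^esub>x\<in>C. c x \<odot>\<^bsub>M\<^esub> s x) \<in> U" if "finite C" "C \<subseteq> A" for C
    using that
  proof (induction C rule: finite_induct)
    case (insert x C)
    then have "(\<lambda>x. c x \<odot>\<^bsub>M\<^esub> s x) \<in> C \<rightarrow> carrier M" "c x \<odot>\<^bsub>M\<^esub> s x \<in> carrier M"
      using assms U(6) by auto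
    then show ?case using insert U(4,5) assms by simp
  qed (simp add: U(2))
  then show ?thesis unfolding lin_comb_def using fin by simp
qed

lemma eval_Hom:
  assumes "ring H" "y \<in> carrier X"
  shows "(\<lambda>c\<in>carrier (free_module H X). c y) \<in> Hom H (free_module H X) (regular_module H)"
  using assms left_module_operator_group[OF ring.free_left_module[OF assms(1)]]
  by (intro HomI) (auto simp: free_simps regular_simps free_carrier)

lemma lin_comb_apply:
  assumes "ring H" "y \<in> carrier Y" "c \<in> carrier (free_module H X)"
    and s: "\<And>x. x \<in> carrier X \<Longrightarrow> s x \<in> carrier (free_module H Y)"
  shows "lin_comb H (free_module H Y) (carrier X) s c y = lin_comb H (regular_module H) (carrier X) (\<lambda>x. s x y) c"
proof -
  interpret ring H by fact
  interpret F: lmod H "free_module H Y" by (rule lmodI, rule free_left_module)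
  have c: "\<And>x. x \<in> carrier X \<Longrightarrow> c x \<in> carrier H" "finite {x \<in> carrier X. c x \<noteq> \<zero>\<^bsub>H\<^esub>}"
    using assms(3) by (auto simp: free_carrier)
  have "lin_comb H (free_module H Y) (carrier X) s c \<in> carrier (free_module H Y)"
    using c s by (intro F.lin_comb_closed)
  then have "lin_comb H (free_module H Y) (carrier X) s c y =
    (\<lambda>c\<in>carrier (free_module H Y). c y) (lin_comb H (free_module H Y) (carrier X) s c)" by simp
  also have "\<dots> = lin_comb H (regular_module H) (carrier X) (\<lambda>x. (\<lambda>c\<in>carrier (free_module H Y). c y) (s x)) c"
    by (rule Hom_lin_comb[OF free_left_module regular_left_module eval_Hom]) (use assms c in auto)
  also have "\<dots> = lin_comb H (regular_module H) (carrier X) (\<lambda>x. s x y) c"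
    unfolding lin_comb_def finsum_regular using c s assms(2)
    by (intro finsum_cong') (auto simp: regular_simps free_carrier)
  finally show ?thesis .
qed

text \<open>Compared coordinate by coordinate: evaluation at \<open>y\<close> is linear, so it
  passes through the sum and leaves the single term \<open>c y\<close>.\<close>

lemma free_expand:
  assumes "ring H" "c \<in> carrier (free_module H X)"
  shows "lin_comb H (free_module H X) (carrier X) (unit_vec H (carrier X)) c = c"
proof -
  interpret ring H by fact
  interpret F: lmod H "free_module H X" by (rule lmodI, rule free_left_module)
  let ?u = "unit_vec H (carrier X)"
  have c: "\<And>x. x \<in> carrier X \<Longrightarrow> c x \<in> carrier H" "finite {x \<in> carrier X. c x \<noteq> \<zero>\<^bsub>H\<^esub>}"
    using assms(2) by (auto simp: free_carrier)
  have "lin_comb H (free_module H X) (carrier X) ?u c \<in> carrier (free_module H X)"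
    using c unit_vec_closed by (intro F.lin_comb_closed)
  moreover have "lin_comb H (free_module H X) (carrier X) ?u c y = c y" if y: "y \<in> carrier X" for y
  proof -
    interpret G: lmod H "regular_module H" by (rule lmodI, rule regular_left_module[OF assms(1)])
    have "lin_comb H (free_module H X) (carrier X) ?u c y =
        lin_comb H (regular_module H) (carrier X) (\<lambda>x. ?u x y) c"
      using y assms unit_vec_closed by (intro lin_comb_apply) auto
    also have "\<dots> = (\<Oplus>\<^bsub>H\<^esub>x\<in>insert y {x \<in> carrier X. c x \<noteq> \<zero>\<^bsub>H\<^esub>}. c x \<otimes>\<^bsub>H\<^esub> ?u x y)"
      using y c by (subst G.lin_comb_superset[of "insert y {x \<in> carrier X. c x \<noteq> \<zero>\<^bsub>H\<^esub>}"])
        (auto simp: finsum_regular regular_simps unit_vec_def)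
    also have "\<dots> = (\<Oplus>\<^bsub>H\<^esub>x\<in>insert y {x \<in> carrier X. c x \<noteq> \<zero>\<^bsub>H\<^esub>}. if y = x then c x else \<zero>\<^bsub>H\<^esub>)"
      using y c by (intro finsum_cong') (auto simp: unit_vec_def)
    also have "\<dots> = c y" using y c by (intro finsum_singleton) auto
    finally show ?thesis .
  qed
  ultimately show ?thesis using assms(2) unfolding free_carrier
    by (intro extensionalityI[of _ "carrier X"]) (auto simp: PiE_def)
qed

section \<open>Finite generation\<close>

definition generates :: "('h, 'x) ring_scheme \<Rightarrow> ('h, 'm) module \<Rightarrow> 'm set \<Rightarrow> bool" where
  "generates H M A \<longleftrightarrow> finite A \<and> A \<subseteq> carrier M \<and> (\<forall>U. submodule U H M \<and> A \<subseteq> U \<longrightarrow> U = carrier M)"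

lemma fg_module_iff: "fg_module H M \<longleftrightarrow> left_module H M \<and> (\<exists>A. generates H M A)"
  by (simp add: fg_module_def finitely_generated_def generates_def)

lemma generates_surj:
  assumes "operator_group H M" "operator_group H N" "f \<in> Hom H M N" "f ` carrier M = carrier N"
    "generates H M A"
  shows "generates H N (f ` A)"
  unfolding generates_def
proof (intro conjI allI impI)
  interpret f: semilinear_map H M H N f by (intro Hom_semilinear_map assms)
  show "finite (f ` A)" "f ` A \<subseteq> carrier N" using assms(4,5) unfolding generates_def by auto
  fix U assume U: "submodule U H N \<and> f ` A \<subseteq> U"
  have "A \<subseteq> {x \<in> carrier M. f x \<in> U}" using U assms(5) unfolding generates_def by auto
  then have "{x \<in> carrier M. f x \<in> U} = carrier M"
    using f.preimage[of U] U assms(5) unfolding generates_def by blast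
  then have "f ` carrier M \<subseteq> U" by blast
  then have "carrier N \<subseteq> U" unfolding assms(4) .
  then show "U = carrier N" using f.W.submoduleD(1)[of U] U by auto
qed

lemma fg_surj:
  assumes "fg_module H M" "operator_group H N" "f \<in> Hom H M N" "f ` carrier M = carrier N"
  shows "fg_module H N"
  using assms generates_surj[OF _ assms(2-4)] surj_left_module[OF _ assms(2-4)]
  unfolding fg_module_iff by (metis left_module_operator_group)

lemma free_fg:
  assumes "ring H" "finite (carrier X)"
  shows "fg_module H (free_module H X)"
proof -
  interpret ring H by fact
  interpret F: lmod H "free_module H X" by (rule lmodI, rule free_left_module)
  let ?u = "unit_vec H (carrier X)"
  have "generates H (free_module H X) (?u ` carrier X)"
    unfolding generates_def
  proof (intro conjI allI impI)
    show "finite (?u ` carrier X)" using assms by simp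
    show "?u ` carrier X \<subseteq> carrier (free_module H X)" using unit_vec_closed by auto
    fix U assume U: "submodule U H (free_module H X) \<and> ?u ` carrier X \<subseteq> U"
    have "c \<in> U" if c: "c \<in> carrier (free_module H X)" for c
    proof -
      have "lin_comb H (free_module H X) (carrier X) ?u c \<in> U"
        using U c by (intro lin_comb_in_submodule[OF free_left_module]) (auto simp: free_carrier)
      then show ?thesis using free_expand[OF assms(1) c] by simp
    qed
    then show "U = carrier (free_module H X)"
      using operator_group.submoduleD(1)[OF F.og, of U] U by auto
  qed
  then show ?thesis unfolding fg_module_iff using free_left_module by blast
qed

lemma generates_lin_hom:
  assumes "left_module H M" "generates H M A"
  shows "lin_hom H (M\<lparr>carrier := A\<rparr>) M (\<lambda>x. x) ` carrier (free_module H (M\<lparr>carrier := A\<rparr>)) = carrier M"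
proof -
  interpret M: lmod H M by (rule lmodI) fact
  let ?X = "M\<lparr>carrier := A\<rparr>" let ?F = "free_module H ?X" and ?l = "lin_hom H ?X M (\<lambda>x. x)"
  have A: "A \<subseteq> carrier M" using assms by (simp add: generates_def)
  interpret F: lmod H ?F by (rule lmodI, rule M.R.free_left_module)
  have l: "?l \<in> Hom H ?F M" using A by (intro M.lin_hom_Hom) auto
  interpret l: semilinear_map H ?F H M ?l by (intro Hom_semilinear_map F.og M.og l)
  have "submodule (?l ` carrier ?F) H M" by (rule l.image[OF l.V.submodule_carrier])
  moreover have "A \<subseteq> ?l ` carrier ?F"
  proof
    fix a assume "a \<in> A"
    have u: "unit_vec H A a \<in> carrier ?F" using M.R.unit_vec_closed[of ?X a] by simp
    then have "a = ?l (unit_vec H A a)"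
      using M.lin_comb_unit[of "\<lambda>x. x" a A] A \<open>a \<in> A\<close> by (simp add: lin_hom_def subset_iff)
    then show "a \<in> ?l ` carrier ?F" using u by (rule image_eqI)
  qed
  ultimately show ?thesis using assms(2) unfolding generates_def by blast
qed


subsection \<open>Copies in the universe of test modules\<close>

lemma operator_group_copy:
  fixes M :: "('h, 'm) module" and \<iota> :: "'m \<Rightarrow> 'k"
  assumes "operator_group H M" and inj: "inj_on \<iota> (carrier M)"
  obtains M' :: "('h, 'k) module" where "operator_group H M'" "carrier M' = \<iota> ` carrier M"
    "restrict \<iota> (carrier M) \<in> Hom H M M'" "restrict (inv_into (carrier M) \<iota>) (carrier M') \<in> Hom H M' M"
proof -
  interpret M: operator_group H M by fact
  let ?j = "inv_into (carrier M) \<iota>"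
  define M' :: "('h, 'k) module" where "M' = \<lparr>carrier = \<iota> ` carrier M, mult = undefined, one = undefined,
    zero = \<iota> \<zero>\<^bsub>M\<^esub>, add = (\<lambda>x y. \<iota> (?j x \<oplus>\<^bsub>M\<^esub> ?j y)), smult = (\<lambda>r x. \<iota> (r \<odot>\<^bsub>M\<^esub> ?j x))\<rparr>"
  have j: "?j (\<iota> x) = x" if "x \<in> carrier M" for x using inv_into_f_f[OF inj that] .
  have s: "carrier M' = \<iota> ` carrier M" "\<zero>\<^bsub>M'\<^esub> = \<iota> \<zero>\<^bsub>M\<^esub>"
    "\<And>x y. \<lbrakk>x \<in> carrier M; y \<in> carrier M\<rbrakk> \<Longrightarrow> \<iota> x \<oplus>\<^bsub>M'\<^esub> \<iota> y = \<iota> (x \<oplus>\<^bsub>M\<^esub> y)"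
    "\<And>r x. x \<in> carrier M \<Longrightarrow> r \<odot>\<^bsub>M'\<^esub> \<iota> x = \<iota> (r \<odot>\<^bsub>M\<^esub> x)"
    by (simp_all add: M'_def j)
  have "abelian_group M'"
  proof (rule abelian_groupI)
    fix x assume "x \<in> carrier M'"
    then obtain a where a: "a \<in> carrier M" "x = \<iota> a" by (auto simp: s)
    then have "\<iota> (\<ominus>\<^bsub>M\<^esub> a) \<oplus>\<^bsub>M'\<^esub> x = \<zero>\<^bsub>M'\<^esub>" by (simp add: s M.l_neg)
    then show "\<exists>y\<in>carrier M'. y \<oplus>\<^bsub>M'\<^esub> x = \<zero>\<^bsub>M'\<^esub>" using a by (auto simp: s(1))
  qed (auto simp: s M.a_ac)
  then have og: "operator_group H M'"
    by (intro operator_group.intro operator_group_axioms.intro) (auto simp: s M.smult_add)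
  moreover have "restrict \<iota> (carrier M) \<in> Hom H M M'"
    by (intro HomI M.operator_group_axioms) (auto simp: s)
  moreover have "restrict ?j (carrier M') \<in> Hom H M' M"
    by (intro HomI og) (auto simp: s j inj_on_eq_iff[OF inj])
  ultimately show ?thesis using that s(1) by blast
qed

lemma fg_universe_copy:
  fixes M :: "('h, 'm) module"
  assumes "fg_module H M"
  obtains M' :: "'h fg_universe" and f g where "fg_module H M'" "f \<in> Hom H M M'" "g \<in> Hom H M' M"
    "\<And>x. x \<in> carrier M \<Longrightarrow> g (f x) = x" "\<And>y. y \<in> carrier M' \<Longrightarrow> f (g y) = y"
    "f ` carrier M = carrier M'" "g ` carrier M' = carrier M"
proof -
  obtain A where lm: "left_module H M" and A: "generates H M A" using assms by (auto simp: fg_module_iff)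
  have og: "operator_group H M" by (rule left_module_operator_group[OF lm])
  let ?X = "M\<lparr>carrier := A\<rparr>" let ?F = "free_module H ?X" and ?l = "lin_hom H ?X M (\<lambda>x. x)"
  have surj: "?l ` carrier ?F = carrier M" by (rule generates_lin_hom[OF lm A])
  obtain idx :: "'m \<Rightarrow> nat" where idx: "inj_on idx A"
    using A finite_imp_inj_to_nat_seg[of A] unfolding generates_def by auto
  \<comment> \<open>An element is represented by its fibre under the presentation by the free module
    on \<open>A\<close>, the coefficient at \<open>a\<close> being read at position
    \<open>idx a\<close>; the values of \<open>d\<close> at other positions are arbitrary. A member
    of a fibre determines the coefficients and hence the element, and no fibre is empty, whence
    injectivity.\<close>
  define \<iota> where "\<iota> x = {d. \<exists>c\<in>carrier ?F. ?l c = x \<and> (\<forall>a\<in>A. c a = d (idx a))}" for x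
  have inj: "inj_on \<iota> (carrier M)"
  proof (rule inj_onI)
    fix x y assume x: "x \<in> carrier M" and eq: "\<iota> x = \<iota> y"
    have "x \<in> ?l ` carrier ?F" unfolding surj by (rule x)
    then obtain c where c: "c \<in> carrier ?F" "?l c = x" by blast
    have "(\<lambda>n. c (inv_into A idx n)) \<in> \<iota> x" unfolding \<iota>_def
      by (rule CollectI, rule bexI[OF _ c(1)]) (use c(2) idx in simp)
    then obtain c' where c': "c' \<in> carrier ?F" "?l c' = y" "\<forall>a\<in>A. c' a = c (inv_into A idx (idx a))"
      unfolding eq unfolding \<iota>_def by blast
    have "c = c'"
    proof (rule extensionalityI)
      show "c \<in> extensional A" "c' \<in> extensional A"
        using c c' by (auto simp: free_carrier PiE_def)
      show "c a = c' a" if "a \<in> A" for a using c'(3) idx that by simp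
    qed
    then show "x = y" using c c' by simp
  qed
  obtain M' where M': "operator_group H M'" "carrier M' = \<iota> ` carrier M"
    "restrict \<iota> (carrier M) \<in> Hom H M M'" "restrict (inv_into (carrier M) \<iota>) (carrier M') \<in> Hom H M' M"
    using operator_group_copy[OF og inj] by metis
  let ?f = "restrict \<iota> (carrier M)" and ?g = "restrict (inv_into (carrier M) \<iota>) (carrier M')"
  have f: "?f ` carrier M = carrier M'" using M'(2) by auto
  have gf: "?g (?f x) = x" if "x \<in> carrier M" for x using that inj M'(2) by simp
  have fg: "?f (?g y) = y" if "y \<in> carrier M'" for y using that gf f by (metis (no_types, lifting) imageE)
  have g: "?g ` carrier M' = carrier M"
  proof
    show "?g ` carrier M' \<subseteq> carrier M" using HomD(4)[OF M'(4)] by blast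
    show "carrier M \<subseteq> ?g ` carrier M'"
    proof
      fix x assume x: "x \<in> carrier M"
      show "x \<in> ?g ` carrier M'"
        by (rule image_eqI[of _ _ "?f x"]) (use gf[OF x] HomD(4)[OF M'(3) x] in auto)
    qed
  qed
  show ?thesis using that[OF fg_surj[OF assms M'(1,3) f] M'(3,4) gf fg f g] .
qed

subsection \<open>Projective and injective modules\<close>

text \<open>Projectivity is defined with test modules in a fixed universe; the dual basis property makes no reference to them.\<close>

definition dual_basis :: "('h, 'x) ring_scheme \<Rightarrow> ('h, 'q) module \<Rightarrow> bool" where
  "dual_basis H Q \<longleftrightarrow> left_module H Q \<and> (\<exists>A s. finite A \<and> A \<subseteq> carrier Q \<and>
     s \<in> Hom H Q (free_module H (Q\<lparr>carrier := A\<rparr>)) \<and>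
     (\<forall>q\<in>carrier Q. lin_comb H Q A (\<lambda>x. x) (s q) = q))"

text \<open>A free module maps onto \<open>Q\<close>; projectivity should split this map, but its
  test modules must come from the fixed universe. Both modules are replaced by copies there, and the
  lift of the isomorphism \<open>p\<close> from \<open>Q\<close> to its copy is carried back to a
  section.\<close>

lemma projective_dual_basis:
  fixes Q :: "('h, 'q) module"
  assumes "projective_module H Q"
  shows "dual_basis H Q"
proof -
  have fgQ: "fg_module H Q" using assms by (simp add: projective_module_def)
  then obtain A where lm: "left_module H Q" and A: "generates H Q A" by (auto simp: fg_module_iff)
  interpret Q: lmod H Q by (rule lmodI[OF lm])
  let ?X = "Q\<lparr>carrier := A\<rparr>" let ?F = "free_module H ?X" and ?l = "lin_hom H ?X Q (\<lambda>x. x)"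
  interpret F: lmod H ?F by (rule lmodI, rule Q.R.free_left_module)
  have surj: "?l ` carrier ?F = carrier Q" by (rule generates_lin_hom[OF lm A])
  have l: "?l \<in> Hom H ?F Q" using A by (intro Q.lin_hom_Hom) (auto simp: generates_def)
  have "fg_module H ?F" using A by (intro free_fg Q.R.ring_axioms) (simp add: generates_def)
  then obtain F' :: "'h fg_universe" and f g where F': "fg_module H F'" "f \<in> Hom H ?F F'" "g \<in> Hom H F' ?F"
    "g ` carrier F' = carrier ?F"
    by (rule fg_universe_copy) blast
  obtain Q' :: "'h fg_universe" and p q where Q': "fg_module H Q'" "p \<in> Hom H Q Q'" "q \<in> Hom H Q' Q"
    "\<And>x. x \<in> carrier Q \<Longrightarrow> q (p x) = x" "p ` carrier Q = carrier Q'"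
    using fgQ by (rule fg_universe_copy) blast
  have og': "operator_group H F'" "operator_group H Q'"
    using F'(1) Q'(1) by (auto simp: fg_module_def intro: left_module_operator_group)
  let ?t = "compose (carrier F') (compose (carrier ?F) p ?l) g"
  have t: "?t \<in> Hom H F' Q'" by (rule Hom_compose[OF F'(3) Hom_compose[OF l Q'(2) F.og] og'(1)])
  have "?t ` carrier F' = carrier Q'"
  proof -
    have "?t ` carrier F' = p ` ?l ` g ` carrier F'"
      using HomD(4)[OF F'(3)] by (auto simp: compose_def image_iff)
    then show ?thesis using F'(4) surj Q'(5) by simp
  qed
  then obtain h where h: "h \<in> Hom H Q F'" "\<forall>x\<in>carrier Q. ?t (h x) = p x"
    using assms F'(1) Q'(1) t Q'(2) unfolding projective_module_def by blast
  have s: "compose (carrier Q) g h \<in> Hom H Q ?F" by (rule Hom_compose[OF h(1) F'(3) Q.og])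
  have "lin_comb H Q A (\<lambda>x. x) (compose (carrier Q) g h x) = x" if x: "x \<in> carrier Q" for x
  proof -
    have hx: "h x \<in> carrier F'" "g (h x) \<in> carrier ?F" using HomD(4)[OF h(1) x] HomD(4)[OF F'(3)] by auto
    moreover have "?t (h x) = p x" using h(2) x by (rule bspec)
    ultimately have "p (?l (g (h x))) = p x" by (simp add: compose_def)
    then have "?l (g (h x)) = x" using Q'(4) x HomD(4)[OF l hx(2)] by metis
    then show ?thesis using hx x by (simp add: lin_hom_def compose_def)
  qed
  then show ?thesis unfolding dual_basis_def using lm A s unfolding generates_def by blast
qed

text \<open>Each \<open>a\<close> in the finite set \<open>A\<close> is sent to some preimage of
  \<open>f a\<close>, and the coefficients supplied by \<open>s\<close> extend this linearly to
  \<open>Q\<close>. Target modules of every type are thereby reached.\<close>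

lemma dual_basis_lift:
  assumes "dual_basis H Q" "left_module H X" "left_module H Y"
    and g: "g \<in> Hom H X Y" "g ` carrier X = carrier Y" and f: "f \<in> Hom H Q Y"
  obtains h where "h \<in> Hom H Q X" "\<And>q. q \<in> carrier Q \<Longrightarrow> g (h q) = f q"
proof -
  obtain A s where lm: "left_module H Q" and A: "finite A" "A \<subseteq> carrier Q"
    and s: "s \<in> Hom H Q (free_module H (Q\<lparr>carrier := A\<rparr>))"
    and sq: "\<And>q. q \<in> carrier Q \<Longrightarrow> lin_comb H Q A (\<lambda>x. x) (s q) = q"
    using assms(1) unfolding dual_basis_def by blast
  interpret Q: lmod H Q by (rule lmodI[OF lm])
  interpret X: lmod H X by (rule lmodI) fact
  interpret Y: lmod H Y by (rule lmodI) fact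
  let ?X = "Q\<lparr>carrier := A\<rparr>" let ?F = "free_module H ?X"
  define t where "t a = (SOME x. x \<in> carrier X \<and> g x = f a)" for a
  have t: "t a \<in> carrier X" "g (t a) = f a" if "a \<in> A" for a
  proof -
    have "f a \<in> g ` carrier X" using g(2) HomD(4)[OF f] A that by auto
    then have "\<exists>x. x \<in> carrier X \<and> g x = f a" by auto
    from someI_ex[OF this] show "t a \<in> carrier X" "g (t a) = f a" unfolding t_def by auto
  qed
  have l: "lin_hom H ?X X t \<in> Hom H ?F X" using t by (intro X.lin_hom_Hom) auto
  let ?h = "compose (carrier Q) (lin_hom H ?X X t) s"
  have "?h \<in> Hom H Q X" by (rule Hom_compose[OF s l Q.og])
  moreover have "g (?h q) = f q" if q: "q \<in> carrier Q" for q
  proof -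
    have c: "s q \<in> carrier ?F" using HomD(4)[OF s q] .
    then have c': "\<And>x. x \<in> A \<Longrightarrow> s q x \<in> carrier H" "finite {x \<in> A. s q x \<noteq> \<zero>\<^bsub>H\<^esub>}"
      by (auto simp: free_carrier)
    have "g (?h q) = g (lin_comb H X A t (s q))" using q c by (simp add: compose_def lin_hom_def)
    also have "\<dots> = lin_comb H Y A (\<lambda>x. g (t x)) (s q)"
      using c' t by (intro Hom_lin_comb assms)
    also have "\<dots> = lin_comb H Y A (\<lambda>x. f x) (s q)"
      unfolding lin_comb_def using c' t HomD(4)[OF f] A
      by (intro Y.M.finsum_cong') auto
    also have "\<dots> = f (lin_comb H Q A (\<lambda>x. x) (s q))"
      using c' A by (intro Hom_lin_comb[symmetric] lm assms) auto
    finally show ?thesis using sq[OF q] by simp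
  qed
  ultimately show ?thesis using that by blast
qed

text \<open>The coordinates of \<open>q\<close> are those of \<open>f q\<close>, taken with respect
  to the images of \<open>A\<close> under \<open>g\<close>; the condition on \<open>f\<close> and
  \<open>g\<close> describes \<open>Q'\<close> as a retract of \<open>Q\<close>.\<close>

lemma dual_basis_iso:
  assumes "dual_basis H Q" "left_module H Q'" "f \<in> Hom H Q' Q" "g \<in> Hom H Q Q'"
    "\<And>x. x \<in> carrier Q' \<Longrightarrow> g (f x) = x"
  shows "dual_basis H Q'"
proof -
  obtain A s where lm: "left_module H Q" and A: "finite A" "A \<subseteq> carrier Q"
    and s: "s \<in> Hom H Q (free_module H (Q\<lparr>carrier := A\<rparr>))"
    and sq: "\<And>q. q \<in> carrier Q \<Longrightarrow> lin_comb H Q A (\<lambda>x. x) (s q) = q"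
    using assms(1) unfolding dual_basis_def by blast
  interpret Q: lmod H Q by (rule lmodI[OF lm])
  interpret Q': lmod H Q' by (rule lmodI) fact
  let ?X = "Q\<lparr>carrier := A\<rparr>" and ?X' = "Q'\<lparr>carrier := g ` A\<rparr>"
  let ?F = "free_module H ?X" and ?F' = "free_module H ?X'"
  interpret F': lmod H ?F' by (rule lmodI, rule Q.R.free_left_module)
  \<comment> \<open>\<open>g\<close> may identify elements of \<open>A\<close>; the linear map to
    the free module on the image adds up their coefficients.\<close>
  let ?t = "\<lambda>a. unit_vec H (g ` A) (g a)"
  have t: "?t a \<in> carrier ?F'" for a using Q.R.unit_vec_closed[of ?X'] by simp
  have l: "lin_hom H ?X ?F' ?t \<in> Hom H ?F ?F'" using t by (intro F'.lin_hom_Hom) auto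
  let ?s = "compose (carrier Q') (lin_hom H ?X ?F' ?t) (compose (carrier Q') s f)"
  have "?s \<in> Hom H Q' ?F'" by (rule Hom_compose[OF Hom_compose[OF assms(3) s Q'.og] l Q'.og])
  moreover have gA: "g ` A \<subseteq> carrier Q'" using A HomD(4)[OF assms(4)] by auto
  have e: "lin_hom H ?X' Q' (\<lambda>x. x) \<in> Hom H ?F' Q'" using gA by (intro Q'.lin_hom_Hom) auto
  have "lin_comb H Q' (g ` A) (\<lambda>x. x) (?s q) = q" if q: "q \<in> carrier Q'" for q
  proof -
    have fq: "f q \<in> carrier Q" "s (f q) \<in> carrier ?F" using HomD(4)[OF assms(3) q] HomD(4)[OF s] by auto
    then have c': "\<And>x. x \<in> A \<Longrightarrow> s (f q) x \<in> carrier H" "finite {x \<in> A. s (f q) x \<noteq> \<zero>\<^bsub>H\<^esub>}"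
      by (auto simp: free_carrier)
    have sc: "?s q = lin_comb H ?F' A ?t (s (f q))" using fq q by (simp add: compose_def lin_hom_def)
    have sF: "?s q \<in> carrier ?F'" unfolding sc using c' t by (intro F'.lin_comb_closed)
    have "lin_comb H Q' (g ` A) (\<lambda>x. x) (?s q) = lin_hom H ?X' Q' (\<lambda>x. x) (?s q)"
      using sF by (simp add: lin_hom_def)
    also have "\<dots> = lin_comb H Q' A (\<lambda>a. lin_hom H ?X' Q' (\<lambda>x. x) (?t a)) (s (f q))"
      unfolding sc using c' t by (intro Hom_lin_comb[OF F'.left_module_axioms assms(2) e])
    also have "\<dots> = lin_comb H Q' A g (s (f q))"
      unfolding lin_comb_def using c' t gA
      by (intro Q'.M.finsum_cong') (auto simp: lin_hom_def intro!: arg_cong2[of _ _ _ _ "smult Q'"] Q'.lin_comb_unit[where s = "\<lambda>x. x"])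
    also have "\<dots> = g (lin_comb H Q A (\<lambda>x. x) (s (f q)))"
      using c' A by (intro Hom_lin_comb[symmetric] lm assms) auto
    also have "\<dots> = q" using sq[OF fq(1)] assms(5)[OF q] by simp
    finally show ?thesis .
  qed
  ultimately show ?thesis unfolding dual_basis_def using A(1) gA assms(2) by blast
qed

text \<open>Source and target are carried into the universe by isomorphisms, so that extensions
  become available along monomorphisms between finitely generated modules of any type.\<close>

lemma injective_extend:
  assumes "injective_module H I" "fg_module H X" "fg_module H Y"
    and g: "g \<in> Hom H X Y" "inj_on g (carrier X)" and f: "f \<in> Hom H X I"
  obtains h where "h \<in> Hom H Y I" "\<And>x. x \<in> carrier X \<Longrightarrow> h (g x) = f x"
proof -
  obtain X' :: "'a fg_universe" and a b where X': "fg_module H X'" "a \<in> Hom H X X'" "b \<in> Hom H X' X"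
    "\<And>x. x \<in> carrier X \<Longrightarrow> b (a x) = x" "\<And>x. x \<in> carrier X' \<Longrightarrow> a (b x) = x"
    using assms(2) by (rule fg_universe_copy) blast
  obtain Y' :: "'a fg_universe" and p q where Y': "fg_module H Y'" "p \<in> Hom H Y Y'" "q \<in> Hom H Y' Y"
    "\<And>x. x \<in> carrier Y \<Longrightarrow> q (p x) = x"
    using assms(3) by (rule fg_universe_copy) blast
  have og: "operator_group H X" "operator_group H Y" "operator_group H X'" "operator_group H Y'"
    using assms X'(1) Y'(1) by (auto simp: fg_module_def intro: left_module_operator_group)
  let ?g = "compose (carrier X') p (compose (carrier X') g b)"
  have "?g \<in> Hom H X' Y'" by (rule Hom_compose[OF Hom_compose[OF X'(3) g(1) og(3)] Y'(2) og(3)])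
  moreover have "compose (carrier X') f b \<in> Hom H X' I" by (rule Hom_compose[OF X'(3) f og(3)])
  moreover have "inj_on ?g (carrier X')"
  proof (rule inj_onI)
    fix x y assume xy: "x \<in> carrier X'" "y \<in> carrier X'" "?g x = ?g y"
    then have "p (g (b x)) = p (g (b y))" by (simp add: compose_def)
    then have "g (b x) = g (b y)"
      using Y'(4) HomD(4)[OF g(1)] HomD(4)[OF X'(3)] xy by metis
    then have "b x = b y" using g(2) HomD(4)[OF X'(3)] xy by (simp add: inj_on_def)
    then show "x = y" using X'(5) xy by metis
  qed
  ultimately obtain h where h: "h \<in> Hom H Y' I" "\<forall>x\<in>carrier X'. h (?g x) = compose (carrier X') f b x"
    using assms(1) X'(1) Y'(1) unfolding injective_module_def by blast
  have "compose (carrier Y) h p \<in> Hom H Y I" by (rule Hom_compose[OF Y'(2) h(1) og(2)])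
  moreover have "compose (carrier Y) h p (g x) = f x" if x: "x \<in> carrier X" for x
  proof -
    have ax: "a x \<in> carrier X'" using HomD(4)[OF X'(2) x] .
    then have "h (p (g x)) = f x" using h(2) X'(4)[OF x] by (auto simp: compose_def dest!: bspec[of _ _ "a x"])
    then show ?thesis using HomD(4)[OF g(1) x] by (simp add: compose_def)
  qed
  ultimately show ?thesis using that by blast
qed

section \<open>Vector spaces over division rings\<close>

text \<open>Left inverses of all nonzero elements already make a ring with
  \<open>1 \<noteq> 0\<close> a division ring.\<close>

definition division_ring :: "('d, 'x) ring_scheme \<Rightarrow> bool" where
  "division_ring D \<longleftrightarrow> ring D \<and> \<one>\<^bsub>D\<^esub> \<noteq> \<zero>\<^bsub>D\<^esub> \<and>
     (\<forall>d\<in>carrier D. d \<noteq> \<zero>\<^bsub>D\<^esub> \<longrightarrow> (\<exists>e\<in>carrier D. e \<otimes>\<^bsub>D\<^esub> d = \<one>\<^bsub>D\<^esub>))"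

lemma division_ring_len_regular:
  assumes "division_ring D"
  shows "len D (regular_module D) 1"
proof -
  interpret ring D using assms by (simp add: division_ring_def)
  interpret G: lmod D "regular_module D" by (rule lmodI, rule regular_left_module) (rule ring_axioms)
  show ?thesis
  proof (rule operator_group.len_one[OF G.og])
    show "carrier (regular_module D) \<noteq> {\<zero>\<^bsub>regular_module D\<^esub>}"
      using assms one_closed unfolding division_ring_def regular_simps by blast
    fix A assume A: "submodule A D (regular_module D)"
    note A' = operator_group.submoduleD[OF G.og A, unfolded regular_simps]
    show "A = {\<zero>\<^bsub>regular_module D\<^esub>} \<or> A = carrier (regular_module D)"
    proof (rule ccontr)
      assume n: "\<not> ?thesis"
      then obtain d where d: "d \<in> A" "d \<noteq> \<zero>\<^bsub>D\<^esub>" using A'(2) unfolding regular_simps by blast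
      then obtain e where e: "e \<in> carrier D" "e \<otimes>\<^bsub>D\<^esub> d = \<one>\<^bsub>D\<^esub>"
        using assms A'(6) unfolding division_ring_def by blast
      then have "\<one>\<^bsub>D\<^esub> \<in> A" using A'(5)[OF e(1) d(1)] by simp
      then have "x \<in> A" if "x \<in> carrier D" for x using A'(5)[OF that] that by force
      then show False using n A'(1) unfolding regular_simps by blast
    qed
  qed
qed

lemma free_zero_extend:
  assumes "ring D" "a \<notin> A" "c \<in> carrier (free_module D (X\<lparr>carrier := A\<rparr>))"
  shows "(\<lambda>x\<in>insert a A. if x = a then \<zero>\<^bsub>D\<^esub> else c x) \<in> carrier (free_module D (X\<lparr>carrier := insert a A\<rparr>))"
proof -
  interpret ring D by fact
  have "{x \<in> insert a A. (\<lambda>x\<in>insert a A. if x = a then \<zero>\<^bsub>D\<^esub> else c x) x \<noteq> \<zero>\<^bsub>D\<^esub>} \<subseteq> {x \<in> A. c x \<noteq> \<zero>\<^bsub>D\<^esub>}"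
    using assms(2) by auto
  then have "finite {x \<in> insert a A. (\<lambda>x\<in>insert a A. if x = a then \<zero>\<^bsub>D\<^esub> else c x) x \<noteq> \<zero>\<^bsub>D\<^esub>}"
    by (rule finite_subset) (use assms(3) in \<open>simp add: free_carrier\<close>)
  moreover have "(\<lambda>x\<in>insert a A. if x = a then \<zero>\<^bsub>D\<^esub> else c x) \<in> insert a A \<rightarrow>\<^sub>E carrier D"
    using assms(3) by (auto simp: free_carrier)
  ultimately show ?thesis unfolding free_carrier by simp
qed

text \<open>Evaluation at the new coordinate \<open>a\<close> maps onto the regular module, which
  has length 1, and its kernel is the free module on the remaining coordinates.\<close>

lemma len_free:
  assumes "division_ring D" "finite A"
  shows "len D (free_module D (X\<lparr>carrier := A\<rparr>)) (card A)"
  using assms(2)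
proof (induction A rule: finite_induct)
  case empty
  interpret ring D using assms by (simp add: division_ring_def)
  interpret F: lmod D "free_module D (X\<lparr>carrier := {}\<rparr>)" by (rule lmodI, rule free_left_module)
  have "carrier (free_module D (X\<lparr>carrier := {}\<rparr>)) = {\<zero>\<^bsub>free_module D (X\<lparr>carrier := {}\<rparr>)\<^esub>}"
    by (auto simp: free_carrier free_simps restrict_def)
  then show ?case using operator_group.len_zero_module[OF F.og] by simp
next
  case (insert a A)
  interpret ring D using assms by (simp add: division_ring_def)
  let ?X = "X\<lparr>carrier := insert a A\<rparr>" and ?Y = "X\<lparr>carrier := A\<rparr>"
  let ?F = "free_module D ?X" and ?G = "free_module D ?Y"
  let ?e = "\<lambda>c\<in>carrier ?F. c a"
  interpret F: lmod D ?F by (rule lmodI, rule free_left_module)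
  interpret G: lmod D ?G by (rule lmodI, rule free_left_module)
  interpret D: lmod D "regular_module D" by (rule lmodI, rule regular_left_module) (rule ring_axioms)
  have e: "?e \<in> Hom D ?F (regular_module D)" by (rule eval_Hom) (auto intro: ring_axioms)
  interpret e: semilinear_map D ?F D "regular_module D" ?e
    by (intro Hom_semilinear_map F.og D.og e)
  have surj: "?e ` carrier ?F = carrier (regular_module D)"
  proof
    show "carrier (regular_module D) \<subseteq> ?e ` carrier ?F"
    proof
      fix r assume r: "r \<in> carrier (regular_module D)"
      let ?u = "r \<odot>\<^bsub>?F\<^esub> unit_vec D (carrier ?X) a"
      have u: "?u \<in> carrier ?F" using r unit_vec_closed[of ?X a]
        by (intro free_smult_closed) (auto simp: regular_simps)
      have "?u a = r" using r by (simp add: free_simps unit_vec_def regular_simps)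
      then have "r = ?e ?u" using u by (simp only: restrict_apply')
      then show "r \<in> ?e ` carrier ?F" using u by (rule image_eqI)
    qed
    show "?e ` carrier ?F \<subseteq> carrier (regular_module D)" by (rule image_subsetI) (rule e.closed)
  qed
  let ?K = "?F\<lparr>carrier := e.ker\<rparr>"
  have K: "carrier ?K = {c \<in> carrier ?F. c a = \<zero>\<^bsub>D\<^esub>}" by (auto simp: e.ker_def regular_simps)
  have ogK: "operator_group D ?K" by (rule e.V.sub_operator_group[OF e.ker_submodule])
  let ?r = "\<lambda>c\<in>carrier ?K. restrict c A"
  have r: "?r \<in> Hom D ?K ?G"
  proof (rule HomI[OF _ _ _ ogK])
    fix c assume "c \<in> carrier ?K"
    then have "restrict c A \<in> A \<rightarrow>\<^sub>E carrier D" unfolding K free_carrier by auto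
    moreover have "finite {x \<in> A. restrict c A x \<noteq> \<zero>\<^bsub>D\<^esub>}"
      by (rule finite_subset[OF _ insert.hyps(1)]) auto
    ultimately show "restrict c A \<in> carrier ?G" unfolding free_carrier by simp
  next
    fix c d assume "c \<in> carrier ?K" "d \<in> carrier ?K"
    then show "restrict (c \<oplus>\<^bsub>?K\<^esub> d) A = restrict c A \<oplus>\<^bsub>?G\<^esub> restrict d A"
      by (auto simp: free_simps restrict_def)
  next
    fix r c assume "c \<in> carrier ?K"
    then show "restrict (r \<odot>\<^bsub>?K\<^esub> c) A = r \<odot>\<^bsub>?G\<^esub> restrict c A"
      by (auto simp: free_simps restrict_def)
  qed
  interpret r: semilinear_map D ?K D ?G ?r by (intro Hom_semilinear_map ogK G.og r)
  have "bij_betw ?r (carrier ?K) (carrier ?G)"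
  proof (rule bij_betw_imageI)
    show "inj_on ?r (carrier ?K)"
    proof (rule inj_onI)
      fix c d assume c: "c \<in> carrier ?K" and d: "d \<in> carrier ?K" and eq: "?r c = ?r d"
      have eq': "restrict c A = restrict d A" using eq c d by (metis (mono_tags, lifting) restrict_apply')
      show "c = d"
      proof (rule extensionalityI)
        show "c \<in> extensional (insert a A)" "d \<in> extensional (insert a A)"
          using c d unfolding K free_carrier by (auto simp: PiE_def)
        fix x assume "x \<in> insert a A"
        then show "c x = d x" using c d fun_cong[OF eq', of x] unfolding K by auto
      qed
    qed
    show "?r ` carrier ?K = carrier ?G"
    proof
      show "?r ` carrier ?K \<subseteq> carrier ?G" using r.closed by blast
      show "carrier ?G \<subseteq> ?r ` carrier ?K"
      proof
        fix c assume c: "c \<in> carrier ?G"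
        let ?c = "\<lambda>x\<in>insert a A. if x = a then \<zero>\<^bsub>D\<^esub> else c x"
        have "?c \<in> carrier ?F" by (rule free_zero_extend[OF ring_axioms insert.hyps(2) c])
        then have cK: "?c \<in> carrier ?K" unfolding K by simp
        have "restrict ?c A = c"
        proof (rule extensionalityI[of _ A])
          show "c \<in> extensional A" using c unfolding free_carrier by (auto simp: PiE_def)
        qed (use insert.hyps(2) in auto)
        then have "c = ?r ?c" using restrict_apply'[OF cK, of "\<lambda>c. restrict c A"] by (simp only:)
        then show "c \<in> ?r ` carrier ?K" using cK by (rule image_eqI)
      qed
    qed
  qed
  then have "len D ?K (card A)" using r.len_bij insert.IH by simp
  then have "len D ?F (card A + 1)" using e.len_add[OF surj _ division_ring_len_regular[OF assms(1)]] by simp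
  then show ?case using insert.hyps by simp
qed

locale vector_space_lmod = lmod R M for R :: "'h ring" (structure) and M :: "('h, 'm) module" (structure)
begin

lemma ex1_implies_unique: "\<exists>!c. P c \<Longrightarrow> P a \<Longrightarrow> P b \<Longrightarrow> a = b"
  by blast

text \<open>Turns the condition of unique coefficients into an isomorphism from a free module, to
  which \<open>len_free\<close> applies.\<close>

lemma is_basis_iff:
  assumes "finite B" "B \<subseteq> carrier M"
  shows "is_basis R M B \<longleftrightarrow>
    bij_betw (lin_hom R (M\<lparr>carrier := B\<rparr>) M (\<lambda>x. x)) (carrier (free_module R (M\<lparr>carrier := B\<rparr>))) (carrier M)"
proof -
  let ?F = "free_module R (M\<lparr>carrier := B\<rparr>)" and ?l = "lin_hom R (M\<lparr>carrier := B\<rparr>) M (\<lambda>x. x)"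
  have F: "carrier ?F = B \<rightarrow>\<^sub>E carrier R" using assms(1) by (auto simp: free_carrier)
  have l: "?l c = (\<Oplus>\<^bsub>M\<^esub>b\<in>B. c b \<odot>\<^bsub>M\<^esub> b)" if "c \<in> B \<rightarrow>\<^sub>E carrier R" for c
    using that F lin_comb_superset[of B B c "\<lambda>x. x"] assms by (auto simp: lin_hom_def)
  have "?l \<in> Hom R ?F M" using assms(2) by (intro lin_hom_Hom) auto
  then have cl: "?l c \<in> carrier M" if "c \<in> carrier ?F" for c
    using HomD(4) that by metis
  show ?thesis
    unfolding is_basis_def
  proof (intro iffI conjI ballI assms)
    assume b: "finite B \<and> B \<subseteq> carrier M \<and>
      (\<forall>v\<in>carrier M. \<exists>!c. c \<in> B \<rightarrow>\<^sub>E carrier R \<and> v = (\<Oplus>\<^bsub>M\<^esub>b\<in>B. c b \<odot>\<^bsub>M\<^esub> b))"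
    then have ex1: "\<exists>!c. c \<in> carrier ?F \<and> v = ?l c" if "v \<in> carrier M" for v
    proof -
      have "(c \<in> carrier ?F \<and> v = ?l c) = (c \<in> B \<rightarrow>\<^sub>E carrier R \<and> v = (\<Oplus>\<^bsub>M\<^esub>b\<in>B. c b \<odot>\<^bsub>M\<^esub> b))" for c
        using l[of c] F by auto
      moreover have "\<exists>!c. c \<in> B \<rightarrow>\<^sub>E carrier R \<and> v = (\<Oplus>\<^bsub>M\<^esub>b\<in>B. c b \<odot>\<^bsub>M\<^esub> b)"
        using b that by blast
      ultimately show ?thesis by (simp only:)
    qed
    show "bij_betw ?l (carrier ?F) (carrier M)"
    proof (rule bij_betw_imageI)
      show "inj_on ?l (carrier ?F)"
      proof (rule inj_onI)
        fix c d assume cd: "c \<in> carrier ?F" "d \<in> carrier ?F" "?l c = ?l d"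
        show "c = d" by (rule ex1_implies_unique[OF ex1[OF cl[OF cd(1)]]]) (use cd in simp_all)
      qed
      show "?l ` carrier ?F = carrier M"
      proof
        show "?l ` carrier ?F \<subseteq> carrier M" using cl by (rule image_subsetI)
        show "carrier M \<subseteq> ?l ` carrier ?F" 
        proof
          fix v assume "v \<in> carrier M"
          from ex1_implies_ex[OF ex1[OF this]] obtain c where c: "v = ?l c" "c \<in> carrier ?F" by blast
          then show "v \<in> ?l ` carrier ?F" by (rule image_eqI)
        qed
      qed
    qed
  next
    fix v assume b: "bij_betw ?l (carrier ?F) (carrier M)" and v: "v \<in> carrier M"
    then have "v \<in> ?l ` carrier ?F" by (simp add: bij_betw_def)
    then obtain c where c: "c \<in> carrier ?F" "v = ?l c" by blast
    show "\<exists>!c. c \<in> B \<rightarrow>\<^sub>E carrier R \<and> v = (\<Oplus>\<^bsub>M\<^esub>b\<in>B. c b \<odot>\<^bsub>M\<^esub> b)"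
    proof (rule ex1I[of _ c])
      show "c \<in> B \<rightarrow>\<^sub>E carrier R \<and> v = (\<Oplus>\<^bsub>M\<^esub>b\<in>B. c b \<odot>\<^bsub>M\<^esub> b)" using c l F by auto
      fix d assume "d \<in> B \<rightarrow>\<^sub>E carrier R \<and> v = (\<Oplus>\<^bsub>M\<^esub>b\<in>B. d b \<odot>\<^bsub>M\<^esub> b)"
      then have d: "d \<in> carrier ?F" "?l d = ?l c" using c l F by auto
      show "d = c" by (rule inj_onD[OF bij_betw_imp_inj_on[OF b] d(2) d(1) c(1)])
    qed
  qed
qed

lemma len_independent:
  assumes "division_ring R" "finite B" "B \<subseteq> carrier M"
    and inj: "inj_on (lin_hom R (M\<lparr>carrier := B\<rparr>) M (\<lambda>x. x)) (carrier (free_module R (M\<lparr>carrier := B\<rparr>)))"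
    and U: "U = lin_hom R (M\<lparr>carrier := B\<rparr>) M (\<lambda>x. x) ` carrier (free_module R (M\<lparr>carrier := B\<rparr>))"
  shows "submodule U R M" "len R (M\<lparr>carrier := U\<rparr>) (card B)"
proof -
  let ?F = "free_module R (M\<lparr>carrier := B\<rparr>)" and ?l = "lin_hom R (M\<lparr>carrier := B\<rparr>) M (\<lambda>x. x)"
  interpret F: lmod R ?F by (rule lmodI, rule R.free_left_module)
  have l: "?l \<in> Hom R ?F M" using assms(3) by (intro lin_hom_Hom) auto
  interpret l: semilinear_map R ?F R M ?l by (intro Hom_semilinear_map F.og og l)
  show sub: "submodule U R M" unfolding U by (rule l.image[OF l.V.submodule_carrier])
  have ogU: "operator_group R (M\<lparr>carrier := U\<rparr>)" by (rule l.W.sub_operator_group[OF sub])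
  have l': "?l \<in> Hom R ?F (M\<lparr>carrier := U\<rparr>)" by (rule Hom_codomain[OF l]) (simp add: U)
  interpret l': semilinear_map R ?F R "M\<lparr>carrier := U\<rparr>" ?l by (intro Hom_semilinear_map F.og ogU l')
  have "bij_betw ?l (carrier ?F) (carrier (M\<lparr>carrier := U\<rparr>))" using inj U by (simp add: bij_betw_def)
  from iffD1[OF l'.len_bij[OF this] len_free[OF assms(1,2)]] show "len R (M\<lparr>carrier := U\<rparr>) (card B)" .
qed

lemma basis_card:
  assumes "division_ring R" "is_basis R M B"
  shows "len R M (card B)"
proof -
  have B: "finite B" "B \<subseteq> carrier M" using assms(2) by (auto simp: is_basis_def)
  have "M\<lparr>carrier := carrier M\<rparr> = M" by simp
  then show ?thesis
    using len_independent(2)[OF assms(1) B] is_basis_iff[OF B] assms(2) unfolding bij_betw_def by metis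
qed

text \<open>An independent set spans a free submodule whose length is its cardinality, so these
  cardinalities are bounded by \<open>n\<close> and a largest independent set exists. A vector
  outside its span could be added to it.\<close>

lemma basis_exists:
  assumes "division_ring R" "len R M n"
  shows "\<exists>B. is_basis R M B"
proof -
  let ?F = "\<lambda>B. free_module R (M\<lparr>carrier := B\<rparr>)" and ?l = "\<lambda>B. lin_hom R (M\<lparr>carrier := B\<rparr>) M (\<lambda>x. x)"
  define indep where "indep B \<longleftrightarrow> finite B \<and> B \<subseteq> carrier M \<and> inj_on (?l B) (carrier (?F B))" for B
  have bound: "card B \<le> n" if "indep B" for B
  proof -
    let ?U = "?l B ` carrier (?F B)"
    have U: "submodule ?U R M" "len R (M\<lparr>carrier := ?U\<rparr>) (card B)"
      using len_independent[OF assms(1), of B ?U] that unfolding indep_def by auto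
    then obtain c where "chain_of R (M\<lparr>carrier := ?U\<rparr>) c (card B)" unfolding len_def by auto
    then have "chain_of R M c (card B)" unfolding chain_of_def
      by (simp add: operator_group.submodule_sub_iff[OF og U(1)])
    then show ?thesis using assms(2) chain_le_height unfolding len_def by blast
  qed
  have "indep {}"
  proof -
    have "carrier (?F {}) = {\<lambda>_. undefined}" by (auto simp: free_carrier)
    then show ?thesis by (simp add: indep_def)
  qed
  then obtain B where B: "indep B" and max: "\<And>B'. indep B' \<Longrightarrow> card B' \<le> card B"
    using ex_has_greatest_nat[of indep "{}" card "Suc n"] bound by (metis less_Suc_eq_le)
  let ?U = "?l B ` carrier (?F B)"
  have fB: "finite B" "B \<subseteq> carrier M" and inj: "inj_on (?l B) (carrier (?F B))" using B by (auto simp: indep_def)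
  have U: "submodule ?U R M" using len_independent(1)[OF assms(1) fB inj] by simp
  note U' = operator_group.submoduleD[OF og U]
  have FB: "carrier (?F C) = C \<rightarrow>\<^sub>E carrier R" if "finite C" for C using that by (auto simp: free_carrier)
  have lB: "?l C c = (\<Oplus>\<^bsub>M\<^esub>b\<in>C. c b \<odot>\<^bsub>M\<^esub> b)" if "c \<in> carrier (?F C)" "finite C" "C \<subseteq> carrier M" for c C
    using that FB[OF that(2)] lin_comb_superset[of C C c "\<lambda>x. x"] by (auto simp: lin_hom_def)
  have "v \<in> ?U" if v: "v \<in> carrier M" for v
  proof (rule ccontr)
    assume vU: "v \<notin> ?U"
    have BU: "B \<subseteq> ?U"
    proof
      fix b assume b: "b \<in> B"
      have u: "unit_vec R B b \<in> carrier (?F B)" using R.unit_vec_closed[of "M\<lparr>carrier := B\<rparr>" b] by simp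
      then have "b = ?l B (unit_vec R B b)"
        using lin_comb_unit[of "\<lambda>x. x" b B] fB b by (simp add: lin_hom_def subset_iff)
      then show "b \<in> ?U" using u by (rule image_eqI)
    qed
    then have vB: "v \<notin> B" using vU by blast
    let ?C = "insert v B"
    have C: "finite ?C" "?C \<subseteq> carrier M" using fB v by auto
    have lC: "?l ?C \<in> Hom R (?F ?C) M" using C by (intro lin_hom_Hom) auto
    interpret F: lmod R "?F ?C" by (rule lmodI, rule R.free_left_module)
    interpret l: semilinear_map R "?F ?C" R M "?l ?C" by (intro Hom_semilinear_map F.og og lC)
    interpret FB: lmod R "?F B" by (rule lmodI, rule R.free_left_module)
    have lBH: "?l B \<in> Hom R (?F B) M" using fB by (intro lin_hom_Hom) auto
    interpret lB: semilinear_map R "?F B" R M "?l B" by (intro Hom_semilinear_map FB.og og lBH)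
    have "l.ker \<subseteq> {\<zero>\<^bsub>?F ?C\<^esub>}"
    proof
      fix c assume "c \<in> l.ker"
      then have c: "c \<in> carrier (?F ?C)" "?l ?C c = \<zero>\<^bsub>M\<^esub>" by (auto simp: l.ker_def)
      then have cc: "\<And>x. x \<in> ?C \<Longrightarrow> c x \<in> carrier R" using FB C by auto
      let ?d = "restrict c B"
      have d: "?d \<in> carrier (?F B)" using cc FB[OF fB(1)] by auto
      have s: "(\<Oplus>\<^bsub>M\<^esub>b\<in>B. c b \<odot>\<^bsub>M\<^esub> b) = ?l B ?d"
        unfolding lB[OF d fB] using cc fB by (intro M.finsum_cong') auto
      have "\<zero>\<^bsub>M\<^esub> = c v \<odot>\<^bsub>M\<^esub> v \<oplus>\<^bsub>M\<^esub> (\<Oplus>\<^bsub>M\<^esub>b\<in>B. c b \<odot>\<^bsub>M\<^esub> b)"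
        using c(2) lB[OF c(1) C] fB vB v cc by (simp add: Pi_def subset_iff)
      then have e: "c v \<odot>\<^bsub>M\<^esub> v \<oplus>\<^bsub>M\<^esub> ?l B ?d = \<zero>\<^bsub>M\<^esub>" unfolding s by simp
      \<comment> \<open>Otherwise dividing by \<open>c v\<close> would put \<open>v\<close> into the
        span.\<close>
      have cv: "c v = \<zero>"
      proof (rule ccontr)
        assume "c v \<noteq> \<zero>"
        then obtain r where r: "r \<in> carrier R" "r \<otimes> c v = \<one>"
          using assms(1) cc unfolding division_ring_def by blast
        have ld: "?l B ?d \<in> ?U" using d by simp
        have "c v \<odot>\<^bsub>M\<^esub> v = \<ominus>\<^bsub>M\<^esub> ?l B ?d"
          using e M.minus_equality[of "c v \<odot>\<^bsub>M\<^esub> v" "?l B ?d"] cc v lB.closed[OF d] by (simp add: M.a_comm)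
        then have "c v \<odot>\<^bsub>M\<^esub> v \<in> ?U" using U'(3)[OF ld] by simp
        then have "r \<odot>\<^bsub>M\<^esub> (c v \<odot>\<^bsub>M\<^esub> v) \<in> ?U" using U'(5)[OF r(1)] by blast
        then show False using vU r v cc by (simp flip: smult_assoc1)
      qed
      then have "?l B ?d = \<zero>\<^bsub>M\<^esub>" using e v lB.closed[OF d] by simp
      then have z: "?l B ?d = ?l B \<zero>\<^bsub>?F B\<^esub>" by simp
      have d0: "?d = \<zero>\<^bsub>?F B\<^esub>" by (rule inj_onD[OF inj z d FB.M.zero_closed])
      have "c x = \<zero>" if "x \<in> B" for x using fun_cong[OF d0, of x] that by (simp add: free_simps)
      then have "c = \<zero>\<^bsub>?F ?C\<^esub>" using cv c(1) FB[OF C(1)]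
        by (intro extensionalityI[of _ ?C]) (auto simp: free_simps PiE_def)
      then show "c \<in> {\<zero>\<^bsub>?F ?C\<^esub>}" by simp
    qed
    then have "l.ker = {\<zero>\<^bsub>?F ?C\<^esub>}" by (auto simp: l.ker_def)
    then have "indep ?C" unfolding indep_def using l.inj_iff C by simp
    then show False using max[of ?C] fB(1) vB by simp
  qed
  then have "?U = carrier M" using U'(1) by blast
  then show ?thesis using is_basis_iff[OF fB] inj unfolding bij_betw_def by blast
qed

end

text \<open>Whatever basis \<open>SOME\<close> selects, its cardinality is the length. From here on
  the valuations of the ext-quiver can be computed as lengths.\<close>

lemma vdim_len:
  assumes "division_ring D" "left_module D V" "len D V n"
  shows "vdim D V = n"
proof -
  interpret V: vector_space_lmod D V by (intro vector_space_lmod.intro lmodI) fact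
  have "is_basis D V (SOME B. is_basis D V B)" using V.basis_exists[OF assms(1,3)] by (rule someI_ex)
  from V.basis_card[OF assms(1) this] show ?thesis unfolding vdim_def using len_unique[OF assms(3)] by simp
qed

section \<open>Homomorphism groups and endomorphism rings\<close>

lemma Hom_module_simps:
  "carrier (Hom_module H M N act) = Hom H M N"
  "\<zero>\<^bsub>Hom_module H M N act\<^esub> = (\<lambda>x\<in>carrier M. \<zero>\<^bsub>N\<^esub>)"
  "f \<oplus>\<^bsub>Hom_module H M N act\<^esub> g = (\<lambda>x\<in>carrier M. f x \<oplus>\<^bsub>N\<^esub> g x)"
  "d \<odot>\<^bsub>Hom_module H M N act\<^esub> f = act d f"
  by (simp_all add: Hom_module_def)

lemma End_ring_simps:
  "carrier (End_ring H M) = Hom H M M"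
  "\<zero>\<^bsub>End_ring H M\<^esub> = (\<lambda>x\<in>carrier M. \<zero>\<^bsub>M\<^esub>)"
  "\<one>\<^bsub>End_ring H M\<^esub> = (\<lambda>x\<in>carrier M. x)"
  "f \<oplus>\<^bsub>End_ring H M\<^esub> g = (\<lambda>x\<in>carrier M. f x \<oplus>\<^bsub>M\<^esub> g x)"
  "f \<otimes>\<^bsub>End_ring H M\<^esub> g = compose (carrier M) f g"
  by (simp_all add: End_ring_def)

lemma opposite_ring_simps:
  "carrier (opposite_ring D) = carrier D" "\<zero>\<^bsub>opposite_ring D\<^esub> = \<zero>\<^bsub>D\<^esub>" "\<one>\<^bsub>opposite_ring D\<^esub> = \<one>\<^bsub>D\<^esub>"
  "f \<oplus>\<^bsub>opposite_ring D\<^esub> g = f \<oplus>\<^bsub>D\<^esub> g" "f \<otimes>\<^bsub>opposite_ring D\<^esub> g = g \<otimes>\<^bsub>D\<^esub> f"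
  by (simp_all add: opposite_ring_def)

lemma Hom_add:
  assumes "operator_group H M" "operator_group H N" "f \<in> Hom H M N" "g \<in> Hom H M N"
  shows "(\<lambda>x\<in>carrier M. f x \<oplus>\<^bsub>N\<^esub> g x) \<in> Hom H M N"
proof -
  interpret N: operator_group H N by fact
  note f = HomD[OF assms(3)] and g = HomD[OF assms(4)]
  show ?thesis
    using f g by (intro HomI assms(1)) (simp_all add: N.a_ac N.smult_add)
qed

lemma Hom_neg:
  assumes "operator_group H M" "operator_group H N" "f \<in> Hom H M N"
  shows "(\<lambda>x\<in>carrier M. \<ominus>\<^bsub>N\<^esub> f x) \<in> Hom H M N"
proof -
  interpret N: operator_group H N by fact
  note f = HomD[OF assms(3)]
  show ?thesis
    using f by (intro HomI assms(1)) (simp_all add: N.minus_add N.smult_neg)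
qed

lemma Hom_minus:
  assumes "operator_group H M" "operator_group H N" "f \<in> Hom H M N" "g \<in> Hom H M N"
  shows "(\<lambda>x\<in>carrier M. f x \<ominus>\<^bsub>N\<^esub> g x) \<in> Hom H M N"
proof -
  have "(\<lambda>x\<in>carrier M. f x \<ominus>\<^bsub>N\<^esub> g x) =
      (\<lambda>x\<in>carrier M. f x \<oplus>\<^bsub>N\<^esub> (\<lambda>x\<in>carrier M. \<ominus>\<^bsub>N\<^esub> g x) x)"
    by (auto simp: a_minus_def)
  then show ?thesis using Hom_add[OF assms(1,2,3) Hom_neg[OF assms(1,2,4)]] by simp
qed

lemma Hom_module_abelian_group:
  assumes "operator_group H M" "operator_group H N"
  shows "abelian_group (Hom_module H M N act)"
proof -
  interpret M: operator_group H M by fact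
  interpret N: operator_group H N by fact
  show ?thesis
  proof (rule abelian_groupI, unfold Hom_module_simps)
    fix f assume f: "f \<in> Hom H M N"
    show "(\<lambda>x\<in>carrier M. (\<lambda>x\<in>carrier M. \<zero>\<^bsub>N\<^esub>) x \<oplus>\<^bsub>N\<^esub> f x) = f"
      by (rule extensionalityI[OF _ HomD(3)[OF f]]) (use HomD(4)[OF f] in auto)
    show "\<exists>y\<in>Hom H M N. (\<lambda>x\<in>carrier M. y x \<oplus>\<^bsub>N\<^esub> f x) = (\<lambda>x\<in>carrier M. \<zero>\<^bsub>N\<^esub>)"
      using Hom_neg[OF assms f] HomD(4)[OF f]
      by (intro bexI[of _ "\<lambda>x\<in>carrier M. \<ominus>\<^bsub>N\<^esub> f x"]) (auto simp: N.l_neg)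
    fix g assume g: "g \<in> Hom H M N"
    show "(\<lambda>x\<in>carrier M. f x \<oplus>\<^bsub>N\<^esub> g x) \<in> Hom H M N" by (rule Hom_add[OF assms f g])
    show "(\<lambda>x\<in>carrier M. f x \<oplus>\<^bsub>N\<^esub> g x) = (\<lambda>x\<in>carrier M. g x \<oplus>\<^bsub>N\<^esub> f x)"
      using HomD(4)[OF f] HomD(4)[OF g] by (auto simp: N.a_comm intro!: restrict_ext)
    fix h assume h: "h \<in> Hom H M N"
    show "(\<lambda>x\<in>carrier M. (\<lambda>x\<in>carrier M. f x \<oplus>\<^bsub>N\<^esub> g x) x \<oplus>\<^bsub>N\<^esub> h x) =
       (\<lambda>x\<in>carrier M. f x \<oplus>\<^bsub>N\<^esub> (\<lambda>x\<in>carrier M. g x \<oplus>\<^bsub>N\<^esub> h x) x)"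
      using HomD(4)[OF f] HomD(4)[OF g] HomD(4)[OF h] by (auto simp: N.a_assoc intro!: restrict_ext)
  qed (rule Hom_zero[OF assms])
qed

lemma Hom_module_operator_group:
  assumes "operator_group H M" "operator_group H N"
    and "\<And>d f. \<lbrakk>d \<in> carrier D; f \<in> Hom H M N\<rbrakk> \<Longrightarrow> act d f \<in> Hom H M N"
    and "\<And>d f g. \<lbrakk>d \<in> carrier D; f \<in> Hom H M N; g \<in> Hom H M N\<rbrakk> \<Longrightarrow>
      act d (\<lambda>x\<in>carrier M. f x \<oplus>\<^bsub>N\<^esub> g x) = (\<lambda>x\<in>carrier M. act d f x \<oplus>\<^bsub>N\<^esub> act d g x)"
  shows "operator_group D (Hom_module H M N act)"
  using Hom_module_abelian_group[OF assms(1,2)] assms(3,4)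
  by (intro operator_group.intro operator_group_axioms.intro) (auto simp: Hom_module_simps)

lemma post_operator_group:
  assumes "operator_group H M" "operator_group H N"
  shows "operator_group (End_ring H N) (Hom_module H M N (\<lambda>g f. compose (carrier M) g f))"
proof (rule Hom_module_operator_group[OF assms], unfold End_ring_simps)
  fix d f assume d: "d \<in> Hom H N N" and f: "f \<in> Hom H M N"
  show "compose (carrier M) d f \<in> Hom H M N" by (rule Hom_compose[OF f d assms(1)])
  fix g assume g: "g \<in> Hom H M N"
  show "compose (carrier M) d (\<lambda>x\<in>carrier M. f x \<oplus>\<^bsub>N\<^esub> g x) =
      (\<lambda>x\<in>carrier M. compose (carrier M) d f x \<oplus>\<^bsub>N\<^esub> compose (carrier M) d g x)"
    using HomD(5)[OF d] HomD(4)[OF f] HomD(4)[OF g] by (auto simp: compose_def intro!: restrict_ext)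
qed

text \<open>Precomposition is a left action of the opposite of \<open>End P\<close>. Taking
  \<open>End P\<close> itself as a bare set of operators changes no submodule, hence no
  length.\<close>

lemma pre_operator_group:
  assumes P: "operator_group H P" "operator_group H N" "submodule K H P"
    and stable: "\<And>u x. u \<in> Hom H P P \<Longrightarrow> x \<in> K \<Longrightarrow> u x \<in> K"
  shows "operator_group (End_ring H P) (Hom_module H (P\<lparr>carrier := K\<rparr>) N (\<lambda>u f. compose K f u))"
proof -
  let ?K = "P\<lparr>carrier := K\<rparr>"
  have K: "operator_group H ?K" by (rule operator_group.sub_operator_group[OF P(1,3)])
  have c: "compose (carrier ?K) f (restrict u K) = compose K f u" for f u
    by (auto simp: compose_def)
  show ?thesis
  proof (rule Hom_module_operator_group[OF K P(2)], unfold End_ring_simps)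
    fix u f assume u: "u \<in> Hom H P P" and f: "f \<in> Hom H ?K N"
    have "restrict u K \<in> Hom H ?K ?K"
      using Hom_codomain[OF Hom_restrict[OF u P(3,1)], of K] stable[OF u] by auto
    then show "compose K f u \<in> Hom H ?K N" using Hom_compose[OF _ f K] c by metis
    fix g assume g: "g \<in> Hom H ?K N"
    show "compose K (\<lambda>x\<in>carrier ?K. f x \<oplus>\<^bsub>N\<^esub> g x) u =
        (\<lambda>x\<in>carrier ?K. compose K f u x \<oplus>\<^bsub>N\<^esub> compose K g u x)"
      using stable[OF u] by (auto simp: compose_def intro!: restrict_ext)
  qed
qed

lemma End_ring_ring:
  assumes "operator_group H M"
  shows "ring (End_ring H M)"
proof -
  interpret M: operator_group H M by fact
  have ag: "abelian_group (End_ring H M)"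
    by (rule abelian_groupI, unfold End_ring_simps)
      (fact abelian_groupE[OF Hom_module_abelian_group[OF assms assms], unfolded Hom_module_simps])+
  have comp: "compose (carrier M) f g \<in> Hom H M M" if "f \<in> Hom H M M" "g \<in> Hom H M M" for f g
    by (rule Hom_compose[OF that(2,1) assms])
  have app: "f x \<in> carrier M" if "f \<in> Hom H M M" "x \<in> carrier M" for f x
    using HomD(4)[OF that] .
  show ?thesis
  proof (rule ringI[OF ag])
    show "monoid (End_ring H M)"
    proof (rule monoidI, unfold End_ring_simps)
      show "(\<lambda>x\<in>carrier M. x) \<in> Hom H M M" by (rule Hom_id[OF assms])
      fix f assume f: "f \<in> Hom H M M"
      show "compose (carrier M) (\<lambda>x\<in>carrier M. x) f = f" "compose (carrier M) f (\<lambda>x\<in>carrier M. x) = f"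
        by (rule extensionalityI[OF _ HomD(3)[OF f]]; use app[OF f] in \<open>simp add: compose_def\<close>)+
      fix g assume g: "g \<in> Hom H M M"
      show "compose (carrier M) f g \<in> Hom H M M" by (rule comp[OF f g])
      fix h assume h: "h \<in> Hom H M M"
      show "compose (carrier M) (compose (carrier M) f g) h = compose (carrier M) f (compose (carrier M) g h)"
        using app[OF h] by (auto simp: compose_def intro!: restrict_ext)
    qed
    fix f g h assume "f \<in> carrier (End_ring H M)" "g \<in> carrier (End_ring H M)" "h \<in> carrier (End_ring H M)"
    then have h: "f \<in> Hom H M M" "g \<in> Hom H M M" "h \<in> Hom H M M" by (simp_all add: End_ring_simps)
    show "(f \<oplus>\<^bsub>End_ring H M\<^esub> g) \<otimes>\<^bsub>End_ring H M\<^esub> h =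
        f \<otimes>\<^bsub>End_ring H M\<^esub> h \<oplus>\<^bsub>End_ring H M\<^esub> g \<otimes>\<^bsub>End_ring H M\<^esub> h"
      "h \<otimes>\<^bsub>End_ring H M\<^esub> (f \<oplus>\<^bsub>End_ring H M\<^esub> g) =
        h \<otimes>\<^bsub>End_ring H M\<^esub> f \<oplus>\<^bsub>End_ring H M\<^esub> h \<otimes>\<^bsub>End_ring H M\<^esub> g"
      using app h HomD(5)[OF h(3)] by (auto simp: End_ring_simps compose_def intro!: restrict_ext)
  qed
qed

lemma opposite_ring_ring:
  assumes "ring D" shows "ring (opposite_ring D)"
proof -
  interpret ring D by fact
  have ag: "abelian_group (opposite_ring D)"
    using is_abelian_group
    by (simp add: abelian_group_def abelian_monoid_def abelian_group_axioms_def opposite_ring_def)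
  show ?thesis
    by (rule ringI[OF ag]) (auto intro!: monoidI simp: opposite_ring_simps m_assoc l_distr r_distr)
qed

lemma post_left_module:
  assumes "operator_group H M" "operator_group H N"
  shows "left_module (End_ring H N) (Hom_module H M N (\<lambda>g f. compose (carrier M) g f))"
proof -
  interpret N: operator_group H N by fact
  show ?thesis
  proof (rule left_moduleI'[OF End_ring_ring[OF assms(2)] post_operator_group[OF assms]],
      unfold End_ring_simps Hom_module_simps)
    fix f assume f: "f \<in> Hom H M N"
    show "compose (carrier M) (\<lambda>x\<in>carrier N. x) f = f"
      by (rule extensionalityI[OF _ HomD(3)[OF f]]) (use HomD(4)[OF f] in \<open>simp_all add: compose_def\<close>)
    fix a b assume a: "a \<in> Hom H N N" and b: "b \<in> Hom H N N"
    show "compose (carrier M) (\<lambda>x\<in>carrier N. a x \<oplus>\<^bsub>N\<^esub> b x) f =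
        (\<lambda>x\<in>carrier M. compose (carrier M) a f x \<oplus>\<^bsub>N\<^esub> compose (carrier M) b f x)"
      "compose (carrier M) (compose (carrier N) a b) f = compose (carrier M) a (compose (carrier M) b f)"
      using HomD(4)[OF f] by (auto simp: compose_def intro!: restrict_ext)
  qed
qed

section \<open>Simple modules\<close>

lemma simple_moduleD:
  assumes "simple_module H S"
  shows "left_module H S" "operator_group H S" "carrier S \<noteq> {\<zero>\<^bsub>S\<^esub>}"
    "\<And>U. submodule U H S \<Longrightarrow> U = {\<zero>\<^bsub>S\<^esub>} \<or> U = carrier S"
  using assms left_module_operator_group by (auto simp: simple_module_def)

lemma simple_hom_surj:
  assumes "operator_group H M" "simple_module H S" "f \<in> Hom H M S" "x \<in> carrier M" "f x \<noteq> \<zero>\<^bsub>S\<^esub>"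
  shows "f ` carrier M = carrier S"
proof -
  note S = simple_moduleD[OF assms(2)]
  interpret f: semilinear_map H M H S f by (intro Hom_semilinear_map assms S)
  have "submodule (f ` carrier M) H S" by (rule f.image[OF f.V.submodule_carrier])
  then have "f ` carrier M = {\<zero>\<^bsub>S\<^esub>} \<or> f ` carrier M = carrier S" by (rule S(4))
  moreover have "f x \<in> f ` carrier M" using assms(4) by (rule imageI)
  ultimately show ?thesis using assms(5) by auto
qed

lemma simple_hom_inj:
  assumes "operator_group H N" "simple_module H S" "f \<in> Hom H S N" "x \<in> carrier S" "f x \<noteq> \<zero>\<^bsub>N\<^esub>"
  shows "inj_on f (carrier S)"
proof -
  note S = simple_moduleD[OF assms(2)]
  interpret f: semilinear_map H S H N f by (intro Hom_semilinear_map assms S)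
  have "f.ker = {\<zero>\<^bsub>S\<^esub>} \<or> f.ker = carrier S" by (rule S(4)[OF f.ker_submodule])
  then show ?thesis using assms(4,5) f.inj_iff by (auto simp: f.ker_def)
qed

lemma isomorphic_inverse:
  assumes "operator_group H M" "operator_group H N" "f \<in> Hom H M N" "bij_betw f (carrier M) (carrier N)"
  obtains g where "g \<in> Hom H N M" "\<And>x. x \<in> carrier M \<Longrightarrow> g (f x) = x" "\<And>y. y \<in> carrier N \<Longrightarrow> f (g y) = y"
    "bij_betw g (carrier N) (carrier M)"
proof -
  interpret f: semilinear_map H M H N f by (intro Hom_semilinear_map assms)
  have surj: "f ` carrier M = carrier N" using assms(4) by (simp add: bij_betw_def)
  have "f.ker = {\<zero>\<^bsub>M\<^esub>}" using assms(4) f.inj_iff by (simp add: bij_betw_def)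
  then have "(\<lambda>x\<in>carrier M. x) x = \<zero>\<^bsub>M\<^esub>" if "x \<in> carrier M" "f x = \<zero>\<^bsub>N\<^esub>" for x
    using that unfolding f.ker_def by auto
  then obtain g where g: "g \<in> Hom H N M" "\<And>x. x \<in> carrier M \<Longrightarrow> g (f x) = x"
    using Hom_factor[OF assms(1,2,1) assms(3) surj Hom_id[OF assms(1)]] by auto
  have fg: "f (g y) = y" if "y \<in> carrier N" for y
  proof -
    have "y \<in> f ` carrier M" using that surj by simp
    then obtain x where "x \<in> carrier M" "y = f x" by blast
    then show ?thesis using g(2) by simp
  qed
  have "bij_betw g (carrier N) (carrier M)"
    by (rule bij_betw_byWitness[of _ f]) (use fg g(2) HomD(4)[OF g(1)] HomD(4)[OF assms(3)] in auto)
  then show ?thesis using that g fg by blast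
qed

lemma isomorphic_modules_sym:
  "\<lbrakk>operator_group H M; operator_group H N; isomorphic_modules H M N\<rbrakk> \<Longrightarrow> isomorphic_modules H N M"
  unfolding isomorphic_modules_def using isomorphic_inverse by metis

lemma isomorphic_modules_trans:
  assumes "operator_group H M" "isomorphic_modules H M N" "isomorphic_modules H N L"
  shows "isomorphic_modules H M L"
proof -
  obtain f g where f: "f \<in> Hom H M N" "bij_betw f (carrier M) (carrier N)"
    and g: "g \<in> Hom H N L" "bij_betw g (carrier N) (carrier L)"
    using assms unfolding isomorphic_modules_def by blast
  have "bij_betw (compose (carrier M) g f) (carrier M) (carrier L)"
    using bij_betw_compose[OF f(2) g(2)] by simp
  then show ?thesis unfolding isomorphic_modules_def using Hom_compose[OF f(1) g(1) assms(1)] by blast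
qed

lemma simple_iso:
  assumes "simple_module H S" "simple_module H T" "f \<in> Hom H S T" "x \<in> carrier S" "f x \<noteq> \<zero>\<^bsub>T\<^esub>"
  shows "isomorphic_modules H S T"
  unfolding isomorphic_modules_def bij_betw_def
  using simple_hom_inj[OF simple_moduleD(2)[OF assms(2)] assms(1,3-5)]
    simple_hom_surj[OF simple_moduleD(2)[OF assms(1)] assms(2-5)] assms(3) by blast

text \<open>Schur's lemma. The inverse found is two-sided, which serves the endomorphism ring and
  its opposite at once.\<close>

lemma End_simple_division:
  assumes "simple_module H S"
  shows "division_ring (End_ring H S)" "division_ring (opposite_ring (End_ring H S))"
proof -
  note S = simple_moduleD[OF assms]
  interpret S: operator_group H S by (rule S)
  have one: "\<one>\<^bsub>End_ring H S\<^esub> \<noteq> \<zero>\<^bsub>End_ring H S\<^esub>"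
  proof
    assume eq: "\<one>\<^bsub>End_ring H S\<^esub> = \<zero>\<^bsub>End_ring H S\<^esub>"
    have "x = \<zero>\<^bsub>S\<^esub>" if "x \<in> carrier S" for x
      using fun_cong[OF eq, of x] that by (simp add: End_ring_simps)
    then show False using S(3) by auto
  qed
  have inv: "\<exists>g\<in>Hom H S S. compose (carrier S) g f = (\<lambda>x\<in>carrier S. x) \<and> compose (carrier S) f g = (\<lambda>x\<in>carrier S. x)"
    if f: "f \<in> Hom H S S" "f \<noteq> (\<lambda>x\<in>carrier S. \<zero>\<^bsub>S\<^esub>)" for f
  proof -
    have "\<exists>x\<in>carrier S. f x \<noteq> \<zero>\<^bsub>S\<^esub>"
      using f Hom_eqI[OF f(1) Hom_zero[OF S(2) S(2)]] by auto
    then have "bij_betw f (carrier S) (carrier S)"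
      unfolding bij_betw_def using simple_hom_inj[OF S(2) assms f(1)] simple_hom_surj[OF S(2) assms f(1)] by blast
    then obtain g where "g \<in> Hom H S S" "\<And>x. x \<in> carrier S \<Longrightarrow> g (f x) = x" "\<And>y. y \<in> carrier S \<Longrightarrow> f (g y) = y"
      using isomorphic_inverse[OF S(2,2) f(1)] by metis
    then show ?thesis by (intro bexI[of _ g]) (auto simp: compose_def intro!: restrict_ext)
  qed
  show "division_ring (End_ring H S)" "division_ring (opposite_ring (End_ring H S))"
    unfolding division_ring_def opposite_ring_simps
    using End_ring_ring[OF S(2)] opposite_ring_ring[OF End_ring_ring[OF S(2)]] one inv
    by (auto simp: End_ring_simps)
qed

lemma cyclic_Hom:
  assumes "left_module H M" "x \<in> carrier M"
  shows "(\<lambda>r\<in>carrier H. r \<odot>\<^bsub>M\<^esub> x) \<in> Hom H (regular_module H) M"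
proof -
  interpret M: lmod H M by (rule lmodI) fact
  have "operator_group H (regular_module H)"
    by (intro left_module_operator_group regular_left_module M.R.ring_axioms)
  from HomI[OF _ _ _ this, of "\<lambda>r. r \<odot>\<^bsub>M\<^esub> x" M] show ?thesis
    using assms(2) by (simp add: regular_simps M.smult_l_distr M.smult_assoc1)
qed

lemma simple_fg:
  assumes "simple_module H S"
  shows "fg_module H S"
proof -
  note S = simple_moduleD[OF assms]
  interpret S: operator_group H S by (rule S)
  obtain x where x: "x \<in> carrier S" "x \<noteq> \<zero>\<^bsub>S\<^esub>" using S(3) S.zero_closed by blast
  have "generates H S {x}" unfolding generates_def using x S(4) by auto
  then show ?thesis unfolding fg_module_iff using S(1) by blast
qed

lemma simple_transport:
  assumes "simple_module H S" "left_module H T" "f \<in> Hom H S T" "bij_betw f (carrier S) (carrier T)"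
  shows "simple_module H T"
proof -
  note S = simple_moduleD[OF assms(1)]
  have ogT: "operator_group H T" by (rule left_module_operator_group) fact
  interpret f: semilinear_map H S H T f by (intro Hom_semilinear_map assms ogT S)
  have surj: "f ` carrier S = carrier T" using assms(4) by (simp add: bij_betw_def)
  have ker: "f.ker = {\<zero>\<^bsub>S\<^esub>}" using assms(4) f.inj_iff by (simp add: bij_betw_def)
  show ?thesis
    unfolding simple_module_def
  proof (intro conjI allI impI assms(2))
    show "carrier T \<noteq> {\<zero>\<^bsub>T\<^esub>}"
    proof
      assume "carrier T = {\<zero>\<^bsub>T\<^esub>}"
      then have "f.ker = carrier S" unfolding f.ker_def using f.closed by blast
      then show False using ker S(3) by simp
    qed
    fix U assume U: "submodule U H T"
    let ?A = "{x \<in> carrier S. f x \<in> U}"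
    have "U = f ` ?A" using surj f.W.submoduleD(1)[OF U] by auto
    moreover have "?A = {\<zero>\<^bsub>S\<^esub>} \<or> ?A = carrier S" by (rule S(4)[OF f.preimage[OF U]])
    ultimately show "U = {\<zero>\<^bsub>T\<^esub>} \<or> U = carrier T" using surj by auto
  qed
qed

text \<open>\<open>complete_simples\<close> speaks of simple modules of one type; a simple module of
  another type is generated by one element, hence has a copy there.\<close>

lemma complete_simples_iso:
  assumes "complete_simples H S" "simple_module H T"
  shows "\<exists>i. isomorphic_modules H T (S i)"
proof -
  note T = simple_moduleD[OF assms(2)]
  obtain T' :: "'a fg_universe" and f g where T': "fg_module H T'" "f \<in> Hom H T T'" "g \<in> Hom H T' T"
    "\<And>x. x \<in> carrier T \<Longrightarrow> g (f x) = x" "\<And>y. y \<in> carrier T' \<Longrightarrow> f (g y) = y"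
    using simple_fg[OF assms(2)] by (rule fg_universe_copy) blast
  have b: "bij_betw f (carrier T) (carrier T')"
    by (rule bij_betw_byWitness[of _ g]) (use T' HomD(4)[OF T'(2)] HomD(4)[OF T'(3)] in auto)
  have "left_module H T'" using T'(1) by (simp add: fg_module_def)
  then have "simple_module H T'" using simple_transport[OF assms(2) _ T'(2) b] by simp
  then obtain i where "isomorphic_modules H T' (S i)" using assms(1) unfolding complete_simples_def by blast
  moreover have "isomorphic_modules H T T'" using T'(2) b unfolding isomorphic_modules_def by blast
  ultimately show ?thesis using isomorphic_modules_trans[OF T(2)] by blast
qed

section \<open>Finite length\<close>

lemma (in operator_group) submodule_adjoin:
  assumes "submodule U D V" "submodule W D V"
  shows "submodule {u \<oplus> w | u w. u \<in> U \<and> w \<in> W} D V"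
proof -
  note U = submoduleD[OF assms(1)] and W = submoduleD[OF assms(2)]
  show ?thesis
  proof (rule submoduleI)
    show "{u \<oplus> w | u w. u \<in> U \<and> w \<in> W} \<subseteq> carrier V" using U(6) W(6) by auto
    have "\<zero> = \<zero> \<oplus> \<zero>" by simp
    then show "\<zero> \<in> {u \<oplus> w | u w. u \<in> U \<and> w \<in> W}" using U(2) W(2) by blast
    fix x assume "x \<in> {u \<oplus> w | u w. u \<in> U \<and> w \<in> W}"
    then obtain u w where x: "u \<in> U" "w \<in> W" "x = u \<oplus> w" by auto
    have "\<ominus> x = \<ominus> u \<oplus> \<ominus> w" using x U(6) W(6) by (simp add: minus_add)
    then show "\<ominus> x \<in> {u \<oplus> w | u w. u \<in> U \<and> w \<in> W}" using U(3) W(3) x by blast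
    show "d \<odot> x \<in> {u \<oplus> w | u w. u \<in> U \<and> w \<in> W}" if d: "d \<in> carrier D" for d
    proof -
      have "d \<odot> x = d \<odot> u \<oplus> d \<odot> w" using d x U(6) W(6) by (simp add: smult_add)
      then show ?thesis using U(5)[OF d] W(5)[OF d] x by blast
    qed
    fix y assume "y \<in> {u \<oplus> w | u w. u \<in> U \<and> w \<in> W}"
    then obtain u' w' where y: "u' \<in> U" "w' \<in> W" "y = u' \<oplus> w'" by auto
    have "x \<oplus> y = (u \<oplus> u') \<oplus> (w \<oplus> w')" using x y U(6) W(6) by (simp add: a_ac)
    then show "x \<oplus> y \<in> {u \<oplus> w | u w. u \<in> U \<and> w \<in> W}" using U(4) W(4) x y by blast
  qed
qed

context lmod
begin

lemma cyclic_submodule: "x \<in> carrier M \<Longrightarrow> submodule ((\<lambda>r. r \<odot>\<^bsub>M\<^esub> x) ` carrier R) R M"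
proof -
  assume x: "x \<in> carrier M"
  interpret O: operator_group R "regular_module R"
    by (intro left_module_operator_group regular_left_module R.ring_axioms)
  interpret f: semilinear_map R "regular_module R" R M "\<lambda>r\<in>carrier R. r \<odot>\<^bsub>M\<^esub> x"
    by (intro Hom_semilinear_map cyclic_Hom left_module_axioms x og O.operator_group_axioms)
  have "(\<lambda>r. r \<odot>\<^bsub>M\<^esub> x) ` carrier R = (\<lambda>r\<in>carrier R. r \<odot>\<^bsub>M\<^esub> x) ` carrier (regular_module R)"
    by (auto simp: regular_simps)
  then show ?thesis using f.image[OF O.submodule_carrier] by simp
qed

definition adjoin :: "'m set \<Rightarrow> 'm \<Rightarrow> 'm set" where
  "adjoin U x = {u \<oplus>\<^bsub>M\<^esub> w | u w. u \<in> U \<and> w \<in> (\<lambda>r. r \<odot>\<^bsub>M\<^esub> x) ` carrier R}"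

lemma adjoin:
  assumes "submodule U R M" "x \<in> carrier M"
  shows "submodule (adjoin U x) R M" "U \<subseteq> adjoin U x" "x \<in> adjoin U x"
    "\<And>y. y \<in> adjoin U x \<Longrightarrow> \<exists>u\<in>U. \<exists>r\<in>carrier R. y = u \<oplus>\<^bsub>M\<^esub> r \<odot>\<^bsub>M\<^esub> x"
proof -
  note U = operator_group.submoduleD[OF og assms(1)]
  show "submodule (adjoin U x) R M"
    unfolding adjoin_def by (rule operator_group.submodule_adjoin[OF og assms(1) cyclic_submodule[OF assms(2)]])
  have "u = u \<oplus>\<^bsub>M\<^esub> \<zero> \<odot>\<^bsub>M\<^esub> x" if "u \<in> U" for u using that assms(2) U(6) by simp
  then show "U \<subseteq> adjoin U x" unfolding adjoin_def by blast
  have "x = \<zero>\<^bsub>M\<^esub> \<oplus>\<^bsub>M\<^esub> \<one> \<odot>\<^bsub>M\<^esub> x" using assms(2) by simp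
  then show "x \<in> adjoin U x" unfolding adjoin_def using U(2) by blast
  show "\<exists>u\<in>U. \<exists>r\<in>carrier R. y = u \<oplus>\<^bsub>M\<^esub> r \<odot>\<^bsub>M\<^esub> x" if "y \<in> adjoin U x" for y
    using that unfolding adjoin_def by blast
qed

end

definition dcc_below :: "('d, 'x) ring_scheme \<Rightarrow> ('d, 'v) module \<Rightarrow> 'v set \<Rightarrow> bool" where
  "dcc_below D V U \<longleftrightarrow> (\<forall>J :: nat \<Rightarrow> 'v set.
     (\<forall>k. submodule (J k) D V \<and> J k \<subseteq> U \<and> J (Suc k) \<subseteq> J k) \<longrightarrow> (\<exists>m. \<forall>k\<ge>m. J k = J m))"

lemma decseq_subset: "(\<And>k. J (Suc k) \<subseteq> J k) \<Longrightarrow> m \<le> k \<Longrightarrow> J k \<subseteq> (J m :: 'a set)" for J :: "nat \<Rightarrow> 'a set"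
  by (rule lift_Suc_antimono_le)

lemma (in operator_group) submodule_Int:
  assumes "submodule U D V" "submodule W D V" shows "submodule (U \<inter> W) D V"
  using submoduleD[OF assms(1)] submoduleD[OF assms(2)] by (intro submoduleI) auto

text \<open>A descending chain in \<open>U + R x\<close> is controlled by two chains: its
  intersections with \<open>U\<close>, and the ideals \<open>L k\<close> of those \<open>r\<close>
  for which \<open>r x\<close> lies in \<open>J k + U\<close>. Once both are stationary, so is
  \<open>J\<close>.\<close>

lemma dcc_adjoin:
  fixes M :: "('r, 'm) module"
  assumes art: "artinian_cring R" and "left_module R M" "submodule U R M" "x \<in> carrier M" "dcc_below R M U"
  shows "dcc_below R M (lmod.adjoin R M U x)"
  unfolding dcc_below_def
proof (intro allI impI)
  interpret M: lmod R M by (rule lmodI) fact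
  interpret R: cring R using art by (simp add: artinian_cring_def)
  interpret O: operator_group R M by (rule M.og)
  note U = O.submoduleD[OF assms(3)]
  note ad = M.adjoin[OF assms(3,4)]
  fix J :: "nat \<Rightarrow> 'm set"
  assume J: "\<forall>k. submodule (J k) R M \<and> J k \<subseteq> M.adjoin U x \<and> J (Suc k) \<subseteq> J k"
  then have Js: "submodule (J k) R M" and Jd: "J (Suc k) \<subseteq> J k" for k by auto
  note J' = O.submoduleD[OF Js]
  have "\<exists>m. \<forall>k\<ge>m. J k \<inter> U = J m \<inter> U"
    using assms(5) unfolding dcc_below_def
    by (rule spec[of _ "\<lambda>k. J k \<inter> U", THEN mp]) (use Jd O.submodule_Int[OF Js assms(3)] in auto)
  then obtain m1 where m1: "\<And>k. k \<ge> m1 \<Longrightarrow> J k \<inter> U = J m1 \<inter> U" by blast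
  define L where "L k = {r \<in> carrier R. \<exists>u\<in>U. r \<odot>\<^bsub>M\<^esub> x \<oplus>\<^bsub>M\<^esub> u \<in> J k}" for k
  have "ideal (L k) R" for k
  proof (rule idealI[OF M.R.ring_axioms])
    have cl: "a \<otimes>\<^bsub>R\<^esub> r \<in> L k" if r: "r \<in> L k" and a: "a \<in> carrier R" for a r
    proof -
      obtain u where u: "r \<in> carrier R" "u \<in> U" "r \<odot>\<^bsub>M\<^esub> x \<oplus>\<^bsub>M\<^esub> u \<in> J k" using r unfolding L_def by auto
      have "a \<odot>\<^bsub>M\<^esub> (r \<odot>\<^bsub>M\<^esub> x \<oplus>\<^bsub>M\<^esub> u) = (a \<otimes>\<^bsub>R\<^esub> r) \<odot>\<^bsub>M\<^esub> x \<oplus>\<^bsub>M\<^esub> a \<odot>\<^bsub>M\<^esub> u"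
        using u a assms(4) U(6) by (simp add: M.smult_r_distr M.smult_assoc1)
      then show ?thesis using J'(5)[OF a u(3)] U(5)[OF a u(2)] u(1) a unfolding L_def by auto
    qed
    then show "a \<otimes>\<^bsub>R\<^esub> r \<in> L k" if "r \<in> L k" "a \<in> carrier R" for a r
      using that by blast
    show "r \<otimes>\<^bsub>R\<^esub> a \<in> L k" if "r \<in> L k" "a \<in> carrier R" for a r
    proof -
      have "r \<in> carrier R" using that(1) by (simp add: L_def)
      then show ?thesis using cl[OF that] R.m_comm[OF that(2)] by simp
    qed
    have add: "r \<oplus>\<^bsub>R\<^esub> s \<in> L k" if r: "r \<in> L k" and s: "s \<in> L k" for r s
    proof -
      obtain u where u: "r \<in> carrier R" "u \<in> U" "r \<odot>\<^bsub>M\<^esub> x \<oplus>\<^bsub>M\<^esub> u \<in> J k" using r unfolding L_def by auto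
      obtain v where v: "s \<in> carrier R" "v \<in> U" "s \<odot>\<^bsub>M\<^esub> x \<oplus>\<^bsub>M\<^esub> v \<in> J k" using s unfolding L_def by auto
      have "(r \<odot>\<^bsub>M\<^esub> x \<oplus>\<^bsub>M\<^esub> u) \<oplus>\<^bsub>M\<^esub> (s \<odot>\<^bsub>M\<^esub> x \<oplus>\<^bsub>M\<^esub> v) = (r \<oplus>\<^bsub>R\<^esub> s) \<odot>\<^bsub>M\<^esub> x \<oplus>\<^bsub>M\<^esub> (u \<oplus>\<^bsub>M\<^esub> v)"
        using u v assms(4) U(6) by (simp add: M.smult_l_distr M.M.a_ac)
      then show ?thesis using J'(4)[OF u(3) v(3)] U(4)[OF u(2) v(2)] u(1) v(1) unfolding L_def by auto
    qed
    have "\<zero>\<^bsub>R\<^esub> \<in> L k" unfolding L_def using J'(2) U(2) assms(4) by (auto intro!: bexI[of _ "\<zero>\<^bsub>M\<^esub>"])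
    moreover have "\<ominus>\<^bsub>R\<^esub> r \<in> L k" if "r \<in> L k" for r
      using cl[OF that, of "\<ominus>\<^bsub>R\<^esub> \<one>\<^bsub>R\<^esub>"] that unfolding L_def by (simp add: M.R.l_minus)
    ultimately show "subgroup (L k) (add_monoid R)"
      using add by (intro subgroup.intro) (auto simp: L_def a_inv_def)
  qed
  moreover have "L (Suc k) \<subseteq> L k" for k using Jd[of k] unfolding L_def by auto
  ultimately obtain m2 where m2: "\<And>k. k \<ge> m2 \<Longrightarrow> L k = L m2"
    using art unfolding artinian_cring_def by meson
  define m where "m = max m1 m2"
  have "J m \<subseteq> J k" if "k \<ge> m" for k
  proof
    fix y assume y: "y \<in> J m"
    then obtain u r where ur: "u \<in> U" "r \<in> carrier R" "y = u \<oplus>\<^bsub>M\<^esub> r \<odot>\<^bsub>M\<^esub> x" using J ad(4) by blast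
    have c: "u \<in> carrier M" "r \<odot>\<^bsub>M\<^esub> x \<in> carrier M" using ur U(6) assms(4) by auto
    have "y = r \<odot>\<^bsub>M\<^esub> x \<oplus>\<^bsub>M\<^esub> u" using ur c by (simp add: M.M.a_comm)
    then have "r \<in> L m" unfolding L_def using y ur by auto
    also have "L m = L k" using m2[of m] m2[of k] that unfolding m_def by auto
    finally obtain v where v: "v \<in> U" "r \<odot>\<^bsub>M\<^esub> x \<oplus>\<^bsub>M\<^esub> v \<in> J k" unfolding L_def by auto
    then have vm: "r \<odot>\<^bsub>M\<^esub> x \<oplus>\<^bsub>M\<^esub> v \<in> J m" using decseq_subset[of J m k] Jd that by blast
    have cv: "v \<in> carrier M" using v U(6) by auto
    \<comment> \<open>The element of \<open>J k\<close> with the same coefficient \<open>r\<close>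
      differs from \<open>y\<close> by an element of \<open>U\<close>, and this difference is caught
      by the intersections with \<open>U\<close>.\<close>
    have e: "y \<ominus>\<^bsub>M\<^esub> (r \<odot>\<^bsub>M\<^esub> x \<oplus>\<^bsub>M\<^esub> v) = u \<ominus>\<^bsub>M\<^esub> v"
      using c cv unfolding ur(3) a_minus_def
      by (simp add: M.M.minus_add M.M.a_ac M.M.r_neg2 M.M.r_neg1 M.M.r_neg)
    have "u \<ominus>\<^bsub>M\<^esub> v \<in> J m" using O.submodule_minus[OF Js y vm] e by simp
    then have "u \<ominus>\<^bsub>M\<^esub> v \<in> J m \<inter> U" using O.submodule_minus[OF assms(3) ur(1) v(1)] by simp
    also have "J m \<inter> U = J k \<inter> U" using m1[of m] m1[of k] that unfolding m_def by auto
    finally have "y \<ominus>\<^bsub>M\<^esub> (r \<odot>\<^bsub>M\<^esub> x \<oplus>\<^bsub>M\<^esub> v) \<in> J k" using e by simp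
    then have "y \<ominus>\<^bsub>M\<^esub> (r \<odot>\<^bsub>M\<^esub> x \<oplus>\<^bsub>M\<^esub> v) \<oplus>\<^bsub>M\<^esub> (r \<odot>\<^bsub>M\<^esub> x \<oplus>\<^bsub>M\<^esub> v) \<in> J k" using J'(4) v(2) by blast
    then show "y \<in> J k" using J'(6)[OF y] J'(6)[OF vm] by simp
  qed
  then show "\<exists>m. \<forall>k\<ge>m. J k = J m" using decseq_subset[of J] Jd by (metis subset_antisym)
qed

lemma dcc_fg:
  fixes M :: "('r, 'm) module"
  assumes art: "artinian_cring R" and "left_module R M" "generates R M A"
  shows "dcc_below R M (carrier M)"
proof -
  interpret M: lmod R M by (rule lmodI) fact
  interpret O: operator_group R M by (rule M.og)
  have A: "finite A" "A \<subseteq> carrier M" using assms(3) by (auto simp: generates_def)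
  then have "\<exists>U. submodule U R M \<and> A \<subseteq> U \<and> dcc_below R M U"
  proof (induction A rule: finite_induct)
    case empty
    have "J k = {\<zero>\<^bsub>M\<^esub>}" if "submodule (J k) R M" "J k \<subseteq> {\<zero>\<^bsub>M\<^esub>}" for J :: "nat \<Rightarrow> 'm set" and k
      using O.submoduleD(2)[OF that(1)] that(2) by auto
    then have "dcc_below R M {\<zero>\<^bsub>M\<^esub>}" unfolding dcc_below_def by metis
    then show ?case using O.submodule_zero by blast
  next
    case (insert x A)
    then obtain U where U: "submodule U R M" "A \<subseteq> U" "dcc_below R M U" by auto
    then show ?case using M.adjoin[OF U(1), of x] dcc_adjoin[OF art assms(2) U(1) _ U(3), of x] insert.prems
      by (intro exI[of _ "M.adjoin U x"]) auto
  qed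
  then show ?thesis using assms(3) unfolding generates_def by blast
qed

lemma wf_minimal: "wf r \<Longrightarrow> x \<in> Q \<Longrightarrow> \<exists>z\<in>Q. \<forall>y. (y, z) \<in> r \<longrightarrow> y \<notin> Q"
  by (metis wfE_min)

text \<open>The ascending condition yields a maximal submodule \<open>A\<close> of finite length. If
  \<open>A\<close> were proper, the descending condition would give a minimal \<open>B\<close> above
  it; the quotient of \<open>B\<close> by \<open>A\<close> is simple, so \<open>B\<close> would have
  finite length too.\<close>

lemma finite_length_of_chain_conditions:
  assumes og: "operator_group H M"
    and dcc: "wf {(A, B). submodule A H M \<and> submodule B H M \<and> A \<subset> B}"
    and acc: "wf {(B, A). submodule A H M \<and> submodule B H M \<and> A \<subset> B}"
  shows "\<exists>n. len H M n"
proof -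
  interpret M: operator_group H M by fact
  let ?G = "{A. submodule A H M \<and> (\<exists>n. len H (M\<lparr>carrier := A\<rparr>) n)}"
  have "len H (M\<lparr>carrier := {\<zero>\<^bsub>M\<^esub>}\<rparr>) 0"
    using operator_group.len_zero_module[OF M.sub_operator_group[OF M.submodule_zero]] by simp
  then have "{\<zero>\<^bsub>M\<^esub>} \<in> ?G" using M.submodule_zero by blast
  from wf_minimal[OF acc this] obtain A where A: "A \<in> ?G"
    and A': "\<forall>B. (B, A) \<in> {(B, A). submodule A H M \<and> submodule B H M \<and> A \<subset> B} \<longrightarrow> B \<notin> ?G" by (rule bexE)
  have Amax: "B \<notin> ?G" if "submodule A H M" "submodule B H M" "A \<subset> B" for B using A' that by simp
  have As: "submodule A H M" using A by simp
  have "A = carrier M"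
  proof (rule ccontr)
    assume "A \<noteq> carrier M"
    then have "carrier M \<in> {B. submodule B H M \<and> A \<subset> B}" using M.submodule_carrier M.submoduleD(1)[OF As] by auto
    from wf_minimal[OF dcc this] obtain B where B: "B \<in> {B. submodule B H M \<and> A \<subset> B}"
      and B': "\<forall>C. (C, B) \<in> {(A, B). submodule A H M \<and> submodule B H M \<and> A \<subset> B} \<longrightarrow> C \<notin> {B. submodule B H M \<and> A \<subset> B}"
      by (rule bexE)
    have Bmin: "\<not> A \<subset> C" if "submodule C H M" "submodule B H M" "C \<subset> B" for C using B' that by simp
    have Bs: "submodule B H M" "A \<subset> B" using B by auto
    let ?B = "M\<lparr>carrier := B\<rparr>"
    interpret B: operator_group H ?B by (rule M.sub_operator_group[OF Bs(1)])
    have AB: "submodule A H ?B" using M.submodule_sub_iff[OF Bs(1)] As Bs by auto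
    have max: "C = A \<or> C = carrier ?B" if "submodule C H ?B" "A \<subseteq> C" for C
      using that Bmin[of C] Bs M.submodule_sub_iff[OF Bs(1), of C] by auto
    have "len H (quot_module ?B A) 1"
      using B.quot_simple[OF AB _ max] Bs by (intro operator_group.len_one[OF B.quot_operator_group[OF AB]]) auto
    moreover obtain n where "len H (M\<lparr>carrier := A\<rparr>) n" using A by auto
    ultimately have "len H ?B (n + 1)" using B.len_sub_quot[OF AB, of n 1] by simp
    then show False using Amax[of B] As Bs by auto
  qed
  then show ?thesis using A by auto
qed

text \<open>Adjoining one generator to a submodule of finite length adds a quotient of the regular
  module.\<close>

lemma fg_finite_length:
  assumes H: "len H (regular_module H) n" and "fg_module H M"
  shows "\<exists>n. len H M n"
proof -
  obtain A where lm: "left_module H M" and A: "generates H M A" using assms(2) by (auto simp: fg_module_iff)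
  interpret M: lmod H M by (rule lmodI) (rule lm)
  interpret O: operator_group H M by (rule M.og)
  interpret reg: operator_group H "regular_module H"
    by (intro left_module_operator_group regular_left_module M.R.ring_axioms)
  have "finite A" "A \<subseteq> carrier M" using A by (auto simp: generates_def)
  then have "\<exists>U. submodule U H M \<and> A \<subseteq> U \<and> (\<exists>n. len H (M\<lparr>carrier := U\<rparr>) n)"
  proof (induction A rule: finite_induct)
    case empty
    have "len H (M\<lparr>carrier := {\<zero>\<^bsub>M\<^esub>}\<rparr>) 0"
      using operator_group.len_zero_module[OF O.sub_operator_group[OF O.submodule_zero]] by simp
    then show ?case using O.submodule_zero by blast
  next
    case (insert x A)
    then obtain U m where U: "submodule U H M" "A \<subseteq> U" "len H (M\<lparr>carrier := U\<rparr>) m" by auto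
    have x: "x \<in> carrier M" using insert.prems by simp
    let ?W = "M.adjoin U x" let ?M = "M\<lparr>carrier := ?W\<rparr>"
    note W = M.adjoin[OF U(1) x]
    interpret W: operator_group H ?M by (rule O.sub_operator_group[OF W(1)])
    have UW: "submodule U H ?M" using O.submodule_sub_iff[OF W(1)] U W by auto
    note ogQ = W.quot_operator_group[OF UW]
    have "(\<lambda>r\<in>carrier H. r \<odot>\<^bsub>M\<^esub> x) \<in> Hom H (regular_module H) M" by (rule cyclic_Hom[OF lm x])
    then have c: "(\<lambda>r\<in>carrier H. r \<odot>\<^bsub>M\<^esub> x) \<in> Hom H (regular_module H) ?M"
      using O.submoduleD(5)[OF W(1) _ W(3)] by (intro Hom_codomain) (auto simp: regular_simps)
    let ?p = "\<lambda>y\<in>carrier ?M. U +>\<^bsub>?M\<^esub> y"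
    let ?f = "compose (carrier (regular_module H)) ?p (\<lambda>r\<in>carrier H. r \<odot>\<^bsub>M\<^esub> x)"
    have f: "?f \<in> Hom H (regular_module H) (quot_module ?M U)"
      by (rule Hom_compose[OF c W.quot_proj[OF UW] reg.operator_group_axioms])
    interpret f: semilinear_map H "regular_module H" H "quot_module ?M U" ?f
      by (intro Hom_semilinear_map reg.operator_group_axioms ogQ f)
    have surj: "?f ` carrier (regular_module H) = carrier (quot_module ?M U)"
    proof
      show "?f ` carrier (regular_module H) \<subseteq> carrier (quot_module ?M U)" by (rule image_subsetI) (rule f.closed)
      show "carrier (quot_module ?M U) \<subseteq> ?f ` carrier (regular_module H)"
      proof
        fix X assume "X \<in> carrier (quot_module ?M U)"
        then obtain y where y: "y \<in> ?W" "X = U +>\<^bsub>?M\<^esub> y" using W.quot_carrier[OF UW] by auto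
        then obtain u r where ur: "u \<in> U" "r \<in> carrier H" "y = u \<oplus>\<^bsub>M\<^esub> r \<odot>\<^bsub>M\<^esub> x" using W(4) by blast
        have rx: "r \<odot>\<^bsub>M\<^esub> x \<in> ?W" using O.submoduleD(5)[OF W(1) ur(2) W(3)] .
        have "U +>\<^bsub>?M\<^esub> (u \<oplus>\<^bsub>?M\<^esub> r \<odot>\<^bsub>M\<^esub> x) = (U +>\<^bsub>?M\<^esub> u) \<oplus>\<^bsub>quot_module ?M U\<^esub> (U +>\<^bsub>?M\<^esub> (r \<odot>\<^bsub>M\<^esub> x))"
          using W.quot_add[OF UW, of u "r \<odot>\<^bsub>M\<^esub> x"] rx ur W(2) by auto
        also have "U +>\<^bsub>?M\<^esub> u = \<zero>\<^bsub>quot_module ?M U\<^esub>"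
          using W.quot_eq_zero_iff[OF UW, of u] W.quot_zero[OF UW] ur(1) W(2) by auto
        also have "\<zero>\<^bsub>quot_module ?M U\<^esub> \<oplus>\<^bsub>quot_module ?M U\<^esub> (U +>\<^bsub>?M\<^esub> (r \<odot>\<^bsub>M\<^esub> x)) = U +>\<^bsub>?M\<^esub> (r \<odot>\<^bsub>M\<^esub> x)"
          using rx W.quot_carrier[OF UW] by (intro f.W.l_zero) auto
        finally have "X = ?f r" using y ur rx by (simp add: compose_def regular_simps)
        then show "X \<in> ?f ` carrier (regular_module H)" using ur(2) by (intro image_eqI) (auto simp: regular_simps)
      qed
    qed
    obtain b where b: "len H (quot_module ?M U) b" using f.len_surj_ex[OF surj H] by auto
    have "len H ?M (m + b)" using W.len_sub_quot[OF UW _ b, of m] U(3) by simp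
    then show ?case using W U(2) by blast
  qed
  then obtain U where "submodule U H M" "A \<subseteq> U" and len: "\<exists>n. len H (M\<lparr>carrier := U\<rparr>) n" by blast
  then have "U = carrier M" using A unfolding generates_def by blast
  then show ?thesis using len by simp
qed

text \<open>Left ideals are \<open>R\<close>-submodules of \<open>H\<close>, so the descending chain
  condition comes from \<open>R\<close>. The ascending one is supplied by heredity:
  \<open>projective_module\<close> includes finite generation, so the union of an ascending chain of
  left ideals is reached at a finite stage.\<close>

lemma hereditary_artin_finite_length:
  fixes R :: "'r ring" and H :: "('r, 'h) module"
  assumes "artin_algebra R H" "hereditary H"
  shows "\<exists>n. len H (regular_module H) n"
proof -
  have art: "artinian_cring R" and ring: "ring H" and lm: "left_module R H"
    and comm: "\<And>r x y. \<lbrakk>r \<in> carrier R; x \<in> carrier H; y \<in> carrier H\<rbrakk> \<Longrightarrow>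
       (r \<odot>\<^bsub>H\<^esub> x) \<otimes>\<^bsub>H\<^esub> y = r \<odot>\<^bsub>H\<^esub> (x \<otimes>\<^bsub>H\<^esub> y)"
    and fg: "finitely_generated R H"
    using assms(1) by (auto simp: artin_algebra_def)
  interpret ring H by fact
  interpret RH: lmod R H by (rule lmodI) fact
  interpret reg: operator_group H "regular_module H"
    by (intro left_module_operator_group regular_left_module ring)
  note regD = reg.submoduleD[unfolded regular_simps]
  have "dcc_below R H (carrier H)"
    using dcc_fg[OF art lm] fg unfolding finitely_generated_def generates_def by blast
  then have dcc: "\<exists>m. \<forall>k\<ge>m. J k = J m" if "\<And>k. submodule (J k) R H" "\<And>k. J (Suc k) \<subseteq> J k" for J :: "nat \<Rightarrow> 'h set"
    using that operator_group.submoduleD(1)[OF RH.og that(1)] unfolding dcc_below_def by blast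
  have neg: "\<ominus>\<^bsub>regular_module H\<^esub> x = \<ominus>\<^bsub>H\<^esub> x" if "x \<in> carrier H" for x
    using reg.minus_equality[of "\<ominus>\<^bsub>H\<^esub> x" x] that by (simp add: regular_simps l_neg)
  have sub: "submodule A R H" if A: "submodule A H (regular_module H)" for A
  proof (rule operator_group.submoduleI[OF RH.og])
    note A' = regD[OF A]
    show "A \<subseteq> carrier H" "\<zero>\<^bsub>H\<^esub> \<in> A" by fact+
    show "\<ominus>\<^bsub>H\<^esub> x \<in> A" if "x \<in> A" for x using A'(3)[OF that] neg A'(6)[OF that] by simp
    show "x \<oplus>\<^bsub>H\<^esub> y \<in> A" if "x \<in> A" "y \<in> A" for x y using A'(4) that .
    fix r x assume r: "r \<in> carrier R" and x: "x \<in> A"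
    have "r \<odot>\<^bsub>H\<^esub> x = (r \<odot>\<^bsub>H\<^esub> \<one>\<^bsub>H\<^esub>) \<otimes>\<^bsub>H\<^esub> x" using r A'(6)[OF x] comm by simp
    then show "r \<odot>\<^bsub>H\<^esub> x \<in> A" using A'(5)[OF _ x] r by simp
  qed
  show ?thesis
  proof (rule finite_length_of_chain_conditions[OF reg.operator_group_axioms])
    show "wf {(A, B). submodule A H (regular_module H) \<and> submodule B H (regular_module H) \<and> A \<subset> B}"
      unfolding wf_iff_no_infinite_down_chain
    proof (rule notI, erule exE)
      fix f assume f0: "\<forall>i. (f (Suc i), f i) \<in> {(A, B). submodule A H (regular_module H) \<and> submodule B H (regular_module H) \<and> A \<subset> B}"
      then have f: "\<And>i. submodule (f i) H (regular_module H)" "\<And>i. f (Suc i) \<subset> f i" by simp_all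
      have "f (Suc i) \<subseteq> f i" for i using f(2)[of i] by blast
      from dcc[of f, OF sub[OF f(1)] this] have "\<exists>m. f (Suc m) = f m" by (metis le_SucI order_refl)
      then show False using f(2) by (metis psubset_eq)
    qed
    show "wf {(B, A). submodule A H (regular_module H) \<and> submodule B H (regular_module H) \<and> A \<subset> B}"
      unfolding wf_iff_no_infinite_down_chain
    proof (rule notI, erule exE)
      fix f assume f0: "\<forall>i. (f (Suc i), f i) \<in> {(B, A). submodule A H (regular_module H) \<and> submodule B H (regular_module H) \<and> A \<subset> B}"
      then have f: "\<And>i. submodule (f i) H (regular_module H)" "\<And>i. f i \<subset> f (Suc i)" by simp_all
      have "f i \<subseteq> f (Suc i)" for i using f(2)[of i] by blast
      then have mono: "f i \<subseteq> f j" if "i \<le> j" for i j using lift_Suc_mono_le[of f i j] that by blast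
      note f' = regD[OF f(1)]
      have U: "submodule (\<Union>i. f i) H (regular_module H)"
      proof (rule reg.submoduleI, unfold regular_simps)
        fix x y assume "x \<in> (\<Union>i. f i)" "y \<in> (\<Union>i. f i)"
        then obtain i j where "x \<in> f i" "y \<in> f j" by auto
        then have "x \<in> f (max i j)" "y \<in> f (max i j)" using mono[of i "max i j"] mono[of j "max i j"] by auto
        then show "x \<oplus>\<^bsub>H\<^esub> y \<in> (\<Union>i. f i)" using f'(4) by blast
      next
        show "(\<Union>i. f i) \<subseteq> carrier H" using f'(6) by blast
        show "\<zero>\<^bsub>H\<^esub> \<in> (\<Union>i. f i)" using f'(2)[of 0] by blast
        fix x assume "x \<in> (\<Union>i. f i)"
        then obtain i where i: "x \<in> f i" by auto
        show "\<ominus>\<^bsub>regular_module H\<^esub> x \<in> (\<Union>i. f i)" using f'(3)[OF i] by blast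
        show "d \<otimes>\<^bsub>H\<^esub> x \<in> (\<Union>i. f i)" if "d \<in> carrier H" for d using f'(5)[OF that i] by blast
      qed
      then have "fg_module H ((regular_module H)\<lparr>carrier := \<Union>i. f i\<rparr>)"
        using assms(2) unfolding hereditary_def projective_module_def by blast
      then obtain A where A: "generates H ((regular_module H)\<lparr>carrier := \<Union>i. f i\<rparr>) A" by (auto simp: fg_module_iff)
      then have "finite A" "A \<subseteq> (\<Union>i. f i)" by (auto simp: generates_def)
      then have "\<exists>n. A \<subseteq> f n"
      proof (induction A rule: finite_induct)
        case (insert x A)
        then obtain n i where "A \<subseteq> f n" "x \<in> f i" by auto
        then have "insert x A \<subseteq> f (max n i)" using mono[of n "max n i"] mono[of i "max n i"] by auto
        then show ?case by blast
      qed auto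
      then obtain n where n: "A \<subseteq> f n" by blast
      have "submodule (f n) H ((regular_module H)\<lparr>carrier := \<Union>i. f i\<rparr>)"
        using reg.submodule_sub_iff[OF U] f(1) by blast
      then have "f n = (\<Union>i. f i)" using A[unfolded generates_def, THEN conjunct2, THEN conjunct2, rule_format, of "f n"] n by simp
      then show False using f(2)[of n] by blast
    qed
  qed
qed

section \<open>Projective covers of simple modules over hereditary rings\<close>

locale simple_cover =
  fixes H :: "('h, 'x) ring_scheme" and P :: "('h, 'p) module" and S :: "('h, 's) module" and \<pi>
  assumes hered: "hereditary H" and simple: "simple_module H S" and proj: "projective_module H P"
    and \<pi>: "\<pi> \<in> Hom H P S" "\<pi> ` carrier P = carrier S"
    and superfluous: "\<And>U. submodule U H P \<Longrightarrow> \<pi> ` U = carrier S \<Longrightarrow> U = carrier P"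
begin

definition K where "K = {x \<in> carrier P. \<pi> x = \<zero>\<^bsub>S\<^esub>}"

lemma P_left_module: "left_module H P" and P_fg: "fg_module H P"
  using proj by (auto simp: projective_module_def fg_module_def)

lemma P_og: "operator_group H P"
  by (rule left_module_operator_group[OF P_left_module])

sublocale P: lmod H P by (rule lmodI[OF P_left_module])
sublocale OP: operator_group H P by (rule P_og)

lemma ringH: "ring H" by (rule P.R.ring_axioms)

lemma S_og: "operator_group H S" by (rule simple_moduleD[OF simple])

sublocale pi: semilinear_map H P H S \<pi>
  by (intro Hom_semilinear_map P_og S_og \<pi>)

lemma K_eq: "K = pi.ker" by (simp add: K_def pi.ker_def)

lemma K_submodule: "submodule K H P" unfolding K_eq by (rule pi.ker_submodule)

lemma K_neq: "K \<noteq> carrier P"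
proof
  assume "K = carrier P"
  then have "\<pi> x = \<zero>\<^bsub>S\<^esub>" if "x \<in> carrier P" for x using that by (auto simp: K_def)
  then have "carrier S \<subseteq> {\<zero>\<^bsub>S\<^esub>}" unfolding \<pi>(2)[symmetric] by blast
  then show False using simple_moduleD(3)[OF simple] pi.W.zero_closed by blast
qed

lemma K_maximal:
  assumes "submodule U H P" "U \<noteq> carrier P"
  shows "U \<subseteq> K"
proof -
  have "\<pi> ` U = {\<zero>\<^bsub>S\<^esub>}"
    using simple_moduleD(4)[OF simple pi.image[OF assms(1)]] superfluous[OF assms(1)] assms(2) by blast
  then show ?thesis unfolding K_def using OP.submoduleD(6)[OF assms(1)] by blast
qed

lemma K_max_cover:
  assumes "submodule U H P" "K \<subseteq> U" shows "U = K \<or> U = carrier P"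
  using K_maximal[OF assms(1)] assms(2) by blast

text \<open>If \<open>f\<close> did not vanish on \<open>K\<close>, it would map \<open>K\<close>
  onto \<open>T\<close>; then \<open>P\<close> would be the sum of \<open>K\<close> and the kernel
  of \<open>f\<close>, both of which are contained in \<open>K\<close>.\<close>

lemma Hom_simple_vanish:
  assumes "simple_module H T" "f \<in> Hom H P T" "x \<in> K"
  shows "f x = \<zero>\<^bsub>T\<^esub>"
proof -
  note T = simple_moduleD[OF assms(1)]
  interpret f: semilinear_map H P H T f by (intro Hom_semilinear_map P_og T assms)
  show ?thesis
  proof (rule ccontr)
    assume n: "f x \<noteq> \<zero>\<^bsub>T\<^esub>"
    have x: "x \<in> carrier P" using assms(3) by (simp add: K_def)
    have "f.ker \<noteq> carrier P" using n x by (auto simp: f.ker_def)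
    then have kK: "f.ker \<subseteq> K" by (rule K_maximal[OF f.ker_submodule])
    have "f ` K = carrier T" using T(4)[OF f.image[OF K_submodule]] n assms(3) by blast
    then have "y \<in> K" if y: "y \<in> carrier P" for y
    proof -
      have "f y \<in> f ` K" using \<open>f ` K = carrier T\<close> f.closed[OF y] by simp
      then obtain k where k: "k \<in> K" "f y = f k" by blast
      have kc: "k \<in> carrier P" using k by (simp add: K_def)
      have "y \<ominus>\<^bsub>P\<^esub> k \<in> f.ker" using k y kc f.W.minus_self by (simp add: f.ker_def f.minus)
      then have "y \<ominus>\<^bsub>P\<^esub> k \<oplus>\<^bsub>P\<^esub> k \<in> K" using kK k OP.submoduleD(4)[OF K_submodule] by blast
      then show ?thesis using y kc by simp
    qed
    then show False using K_neq by (auto simp: K_def)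
  qed
qed

lemma End_stable: "\<lbrakk>u \<in> Hom H P P; x \<in> K\<rbrakk> \<Longrightarrow> u x \<in> K"
proof -
  assume u: "u \<in> Hom H P P" and x: "x \<in> K"
  have "compose (carrier P) \<pi> u x = \<zero>\<^bsub>S\<^esub>"
    by (rule Hom_simple_vanish[OF simple Hom_compose[OF u \<pi>(1) P_og] x])
  then show "u x \<in> K" using x HomD(4)[OF u] by (simp add: K_def compose_def)
qed

text \<open>An element outside \<open>K\<close> generates \<open>P\<close>, so \<open>P\<close> is a
  quotient of the regular module; as \<open>P\<close> is projective, the quotient map splits and
  \<open>P\<close> becomes a left ideal up to isomorphism.\<close>

lemma regular_embedding:
  obtains s where "s \<in> Hom H P (regular_module H)" "inj_on s (carrier P)"
proof -
  obtain x where x: "x \<in> carrier P" "x \<notin> K" using K_neq unfolding K_def by blast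
  let ?c = "\<lambda>r\<in>carrier H. r \<odot>\<^bsub>P\<^esub> x"
  have c: "?c \<in> Hom H (regular_module H) P" by (rule cyclic_Hom[OF P_left_module x(1)])
  have lr: "left_module H (regular_module H)" by (rule regular_left_module[OF ringH])
  interpret c: semilinear_map H "regular_module H" H P ?c
    by (intro Hom_semilinear_map left_module_operator_group[OF lr] P_og c)
  have "?c \<one>\<^bsub>H\<^esub> = x" using x(1) by simp
  moreover have "?c \<one>\<^bsub>H\<^esub> \<in> ?c ` carrier (regular_module H)" by (rule imageI) (simp add: regular_simps)
  ultimately have xi: "x \<in> ?c ` carrier (regular_module H)" by (simp only:)
  have surj: "?c ` carrier (regular_module H) = carrier P"
    using K_maximal[OF c.image[OF c.V.submodule_carrier]] xi x(2) by blast
  obtain s where s: "s \<in> Hom H P (regular_module H)" "\<And>q. q \<in> carrier P \<Longrightarrow> ?c (s q) = (\<lambda>x\<in>carrier P. x) q"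
    using dual_basis_lift[OF projective_dual_basis[OF proj] lr P_left_module c surj Hom_id[OF P_og]] by blast
  have "inj_on s (carrier P)"
  proof (rule inj_onI)
    fix a b assume ab: "a \<in> carrier P" "b \<in> carrier P" "s a = s b"
    have A: "?c (s a) = a" by (rule trans[OF s(2)[OF ab(1)] restrict_apply'[OF ab(1)]])
    have B: "?c (s b) = b" by (rule trans[OF s(2)[OF ab(2)] restrict_apply'[OF ab(2)]])
    show "a = b" by (rule trans[OF trans[OF A[symmetric] arg_cong[of _ _ ?c, OF ab(3)]] B])
  qed
  then show ?thesis using that s(1) by blast
qed

text \<open>Heredity speaks of left ideals only; the embedding of \<open>P\<close> into the regular
  module turns submodules of \<open>P\<close> into left ideals.\<close>

lemma sub_dual_basis:
  assumes "submodule U H P"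
  shows "dual_basis H (P\<lparr>carrier := U\<rparr>)"
proof -
  obtain s where s: "s \<in> Hom H P (regular_module H)" "inj_on s (carrier P)" by (rule regular_embedding)
  have lr: "left_module H (regular_module H)" by (rule regular_left_module[OF ringH])
  have og: "operator_group H (regular_module H)" by (rule left_module_operator_group[OF lr])
  interpret s: semilinear_map H P H "regular_module H" s by (intro Hom_semilinear_map og P_og s)
  let ?U = "P\<lparr>carrier := U\<rparr>" and ?L = "(regular_module H)\<lparr>carrier := s ` U\<rparr>"
  have L: "submodule (s ` U) H (regular_module H)" by (rule s.image[OF assms])
  have ogU: "operator_group H ?U" by (rule OP.sub_operator_group[OF assms])
  have ogL: "operator_group H ?L" by (rule s.W.sub_operator_group[OF L])
  have r: "restrict s U \<in> Hom H ?U ?L"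
    by (rule Hom_codomain[OF Hom_restrict[OF s(1) assms P_og]]) auto
  have "inj_on s U" using s(2) OP.submoduleD(1)[OF assms] inj_on_subset by blast
  then have "bij_betw (restrict s U) (carrier ?U) (carrier ?L)" by (auto simp: bij_betw_def inj_on_def)
  then obtain g where g: "g \<in> Hom H ?L ?U" "\<And>x. x \<in> carrier ?U \<Longrightarrow> g (restrict s U x) = x"
    using isomorphic_inverse[OF ogU ogL r] by metis
  have "dual_basis H ?L" using hered L unfolding hereditary_def by (intro projective_dual_basis) blast
  then show ?thesis using dual_basis_iso[OF _ sub_left_module[OF P_left_module assms] r g(1) g(2)] by blast
qed

lemma P_dual_basis: "dual_basis H P" by (rule projective_dual_basis[OF proj])

lemma K_left_module: "left_module H (P\<lparr>carrier := K\<rparr>)"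
  by (rule sub_left_module[OF P_left_module K_submodule])

lemma K_og: "operator_group H (P\<lparr>carrier := K\<rparr>)"
  by (rule left_module_operator_group[OF K_left_module])

lemma K_fg: "fg_module H (P\<lparr>carrier := K\<rparr>)"
proof -
  obtain s where s: "s \<in> Hom H P (regular_module H)" "inj_on s (carrier P)" by (rule regular_embedding)
  have og: "operator_group H (regular_module H)"
    by (rule left_module_operator_group[OF regular_left_module[OF ringH]])
  interpret s: semilinear_map H P H "regular_module H" s by (intro Hom_semilinear_map og P_og s)
  let ?L = "(regular_module H)\<lparr>carrier := s ` K\<rparr>"
  have L: "submodule (s ` K) H (regular_module H)" by (rule s.image[OF K_submodule])
  have ogL: "operator_group H ?L" by (rule s.W.sub_operator_group[OF L])
  have r: "restrict s K \<in> Hom H (P\<lparr>carrier := K\<rparr>) ?L"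
    by (rule Hom_codomain[OF Hom_restrict[OF s(1) K_submodule P_og]]) auto
  have "inj_on s K" using s(2) OP.submoduleD(1)[OF K_submodule] inj_on_subset by blast
  then have "bij_betw (restrict s K) (carrier (P\<lparr>carrier := K\<rparr>)) (carrier ?L)" by (auto simp: bij_betw_def inj_on_def)
  then obtain g where g: "g \<in> Hom H ?L (P\<lparr>carrier := K\<rparr>)" "bij_betw g (carrier ?L) (carrier (P\<lparr>carrier := K\<rparr>))"
    using isomorphic_inverse[OF K_og ogL r] by metis
  have "fg_module H ?L" using hered L unfolding hereditary_def projective_module_def by blast
  then show ?thesis using fg_surj[OF _ K_og g(1)] g(2) by (simp add: bij_betw_def)
qed

end

lemma projective_cover_simple_cover:
  assumes "hereditary H" "simple_module H S" "projective_cover H P S"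
  obtains \<pi> where "simple_cover H P S \<pi>"
proof -
  have P: "projective_module H P" using assms(3) unfolding projective_cover_def by (rule conjunct1)
  obtain \<pi> where p: "\<pi> \<in> Hom H P S" "\<pi> ` carrier P = carrier S"
    "\<forall>U. submodule U H P \<and> \<pi> ` U = carrier S \<longrightarrow> U = carrier P"
    using assms(3) unfolding projective_cover_def by blast
  have "simple_cover H P S \<pi>"
    by (rule simple_cover.intro[OF assms(1,2) P p(1,2)]) (use p(3) in blast)
  then show ?thesis by (rule that)
qed

section \<open>The first extension group from an arbitrary projective presentation\<close>

text \<open>\<open>\<theta>\<close> lifts \<open>F S \<rightarrow> S\<close> to \<open>M\<close> and \<open>\<sigma>\<close> lifts \<open>\<epsilon>\<close> to \<open>F S\<close>; the differences \<open>\<theta> \<sigma> - 1\<close> and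
  \<open>\<sigma> \<theta> - 1\<close> therefore take their values in the kernels.\<close>

locale presentation =
  fixes H :: "('h, 'x) ring_scheme" and M :: "('h, 'p) module" and S :: "('h, 's) module"
    and N :: "('h, 'k) module" and \<epsilon>
  assumes M_dual: "dual_basis H M" and S_lm: "left_module H S" and N_lm: "left_module H N"
    and \<epsilon>: "\<epsilon> \<in> Hom H M S" "\<epsilon> ` carrier M = carrier S"
begin

lemma M_lm: "left_module H M" using M_dual by (simp add: dual_basis_def)

sublocale M: lmod H M by (rule lmodI[OF M_lm])
sublocale S: lmod H S by (rule lmodI[OF S_lm])
sublocale N: lmod H N by (rule lmodI[OF N_lm])
sublocale OM: operator_group H M by (rule M.og)
sublocale OS: operator_group H S by (rule S.og)
sublocale ON: operator_group H N by (rule N.og)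

abbreviation "F \<equiv> free_module H S"
abbreviation "\<Omega> \<equiv> syzygy H S"
definition "L = {x \<in> carrier M. \<epsilon> x = \<zero>\<^bsub>S\<^esub>}"
abbreviation "KM \<equiv> M\<lparr>carrier := L\<rparr>"
definition "ev = lin_hom H S S (\<lambda>x. x)"

sublocale F: lmod H F by (rule lmodI, rule M.R.free_left_module)
sublocale OF: operator_group H F by (rule F.og)

lemma ev: "ev \<in> Hom H F S" unfolding ev_def by (rule S.lin_hom_Hom)

sublocale eps: semilinear_map H M H S \<epsilon> by (intro Hom_semilinear_map M.og S.og \<epsilon>)
sublocale ev: semilinear_map H F H S ev by (intro Hom_semilinear_map F.og S.og ev)

lemma ev_eq: "c \<in> carrier F \<Longrightarrow> ev c = free_eval H S c"
  by (simp add: ev_def lin_hom_def free_eval_eq)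

lemma ev_surj: "ev ` carrier F = carrier S"
proof
  show "ev ` carrier F \<subseteq> carrier S" by (rule image_subsetI) (rule ev.closed)
  show "carrier S \<subseteq> ev ` carrier F"
  proof
    fix x assume x: "x \<in> carrier S"
    have u: "unit_vec H (carrier S) x \<in> carrier F" by (rule M.R.unit_vec_closed)
    then have "x = ev (unit_vec H (carrier S) x)"
      using S.lin_comb_unit[of "\<lambda>x. x" x "carrier S"] x by (simp add: ev_def lin_hom_def)
    then show "x \<in> ev ` carrier F" using u by (rule image_eqI)
  qed
qed

lemma Omega_eq: "carrier \<Omega> = ev.ker" "\<Omega> = F\<lparr>carrier := ev.ker\<rparr>"
  by (simp_all add: syzygy_def ev.ker_def ev_eq cong: conj_cong)

lemma Omega_submodule: "submodule (carrier \<Omega>) H F" unfolding Omega_eq(1) by (rule ev.ker_submodule)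

lemma Omega_og: "operator_group H \<Omega>"
  unfolding Omega_eq(2) by (rule OF.sub_operator_group[OF ev.ker_submodule])

lemma L_eq: "L = eps.ker" by (simp add: L_def eps.ker_def)

lemma L_submodule: "submodule L H M" unfolding L_eq by (rule eps.ker_submodule)

lemma L_og: "operator_group H KM" by (rule OM.sub_operator_group[OF L_submodule])

text \<open>\<open>F\<close> has one basis element for each element of \<open>S\<close> and may have
  infinite rank, which is beyond \<open>dual_basis\<close>; the lift is therefore prescribed on
  basis elements.\<close>

lemma theta_ex: "\<exists>\<theta>. \<theta> \<in> Hom H F M \<and> (\<forall>c\<in>carrier F. \<epsilon> (\<theta> c) = ev c)"
proof -
  define t where "t x = (SOME y. y \<in> carrier M \<and> \<epsilon> y = x)" for x
  have t: "t x \<in> carrier M" "\<epsilon> (t x) = x" if "x \<in> carrier S" for x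
  proof -
    have "\<exists>y. y \<in> carrier M \<and> \<epsilon> y = x" using that \<epsilon>(2) by (metis imageE)
    from someI_ex[OF this] show "t x \<in> carrier M" "\<epsilon> (t x) = x" unfolding t_def by auto
  qed
  have "\<epsilon> (lin_hom H S M t c) = ev c" if c: "c \<in> carrier F" for c
  proof -
    have c': "\<And>x. x \<in> carrier S \<Longrightarrow> c x \<in> carrier H" "finite {x \<in> carrier S. c x \<noteq> \<zero>\<^bsub>H\<^esub>}"
      using c by (auto simp: free_carrier)
    have "\<epsilon> (lin_comb H M (carrier S) t c) = lin_comb H S (carrier S) (\<lambda>x. \<epsilon> (t x)) c"
      using c' t by (intro Hom_lin_comb M_lm S_lm \<epsilon>)
    also have "\<dots> = lin_comb H S (carrier S) (\<lambda>x. x) c"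
      unfolding lin_comb_def using c' t by (intro S.M.finsum_cong') auto
    finally show ?thesis using c by (simp add: lin_hom_def ev_def)
  qed
  moreover have "lin_hom H S M t \<in> Hom H F M" using t by (intro M.lin_hom_Hom)
  ultimately show ?thesis by blast
qed

definition "\<theta> = (SOME \<theta>. \<theta> \<in> Hom H F M \<and> (\<forall>c\<in>carrier F. \<epsilon> (\<theta> c) = ev c))"

lemma theta: "\<theta> \<in> Hom H F M" "\<And>c. c \<in> carrier F \<Longrightarrow> \<epsilon> (\<theta> c) = ev c"
  using someI_ex[OF theta_ex] unfolding \<theta>_def by auto

lemma sigma_ex: "\<exists>\<sigma>. \<sigma> \<in> Hom H M F \<and> (\<forall>x\<in>carrier M. ev (\<sigma> x) = \<epsilon> x)"
proof -
  obtain h where "h \<in> Hom H M F" "\<And>q. q \<in> carrier M \<Longrightarrow> ev (h q) = \<epsilon> q"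
    using dual_basis_lift[OF M_dual F.left_module_axioms S_lm ev ev_surj \<epsilon>(1)] by blast
  then show ?thesis by blast
qed

definition "\<sigma> = (SOME \<sigma>. \<sigma> \<in> Hom H M F \<and> (\<forall>x\<in>carrier M. ev (\<sigma> x) = \<epsilon> x))"

lemma sigma: "\<sigma> \<in> Hom H M F" "\<And>x. x \<in> carrier M \<Longrightarrow> ev (\<sigma> x) = \<epsilon> x"
  using someI_ex[OF sigma_ex] unfolding \<sigma>_def by auto

lemma theta_L: "c \<in> carrier \<Omega> \<Longrightarrow> \<theta> c \<in> L" "c \<in> carrier F \<Longrightarrow> \<theta> c \<in> carrier M"
  using theta HomD(4)[OF theta(1)] by (auto simp: L_def Omega_eq(1) ev.ker_def)

lemma sigma_Omega: "x \<in> L \<Longrightarrow> \<sigma> x \<in> carrier \<Omega>" "x \<in> carrier M \<Longrightarrow> \<sigma> x \<in> carrier F"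
  using sigma HomD(4)[OF sigma(1)] by (auto simp: L_def Omega_eq(1) ev.ker_def)

lemma LM: "x \<in> L \<Longrightarrow> x \<in> carrier M" by (simp add: L_def)
lemma OmF: "c \<in> carrier \<Omega> \<Longrightarrow> c \<in> carrier F" by (simp add: Omega_eq(1) ev.ker_def)

text \<open>Two maps to \<open>M\<close> with the same composite to \<open>S\<close> differ by a map
  to \<open>L\<close>, where \<open>\<psi>\<close> is defined. Applied to the identity and
  \<open>\<theta> \<sigma>\<close>, and to two lifts of one map to \<open>S\<close>, this produces
  extensions to a whole module.\<close>

lemma Hom_difference:
  assumes "operator_group H X" "f \<in> Hom H X M" "g \<in> Hom H X M" "\<And>x. x \<in> carrier X \<Longrightarrow> \<epsilon> (f x) = \<epsilon> (g x)"
    and "\<psi> \<in> Hom H KM N"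
  shows "(\<lambda>x\<in>carrier X. \<psi> (f x \<ominus>\<^bsub>M\<^esub> g x)) \<in> Hom H X N"
    "\<And>x. x \<in> carrier X \<Longrightarrow> f x \<ominus>\<^bsub>M\<^esub> g x \<in> L"
proof -
  show d: "f x \<ominus>\<^bsub>M\<^esub> g x \<in> L" if "x \<in> carrier X" for x
    using HomD(4)[OF assms(2) that] HomD(4)[OF assms(3) that] assms(4)[OF that] by (simp add: L_def eps.minus)
  have "(\<lambda>x\<in>carrier X. f x \<ominus>\<^bsub>M\<^esub> g x) \<in> Hom H X KM"
    using d by (intro Hom_codomain Hom_minus assms M.og) auto
  from Hom_compose[OF this assms(5,1)]
  show "(\<lambda>x\<in>carrier X. \<psi> (f x \<ominus>\<^bsub>M\<^esub> g x)) \<in> Hom H X N"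
    by (simp add: compose_def cong: restrict_cong)
qed

lemma Hom_difference_free:
  assumes "operator_group H X" "f \<in> Hom H X F" "g \<in> Hom H X F" "\<And>x. x \<in> carrier X \<Longrightarrow> ev (f x) = ev (g x)"
    and "\<phi> \<in> Hom H \<Omega> N"
  shows "(\<lambda>x\<in>carrier X. \<phi> (f x \<ominus>\<^bsub>F\<^esub> g x)) \<in> Hom H X N"
    "\<And>x. x \<in> carrier X \<Longrightarrow> f x \<ominus>\<^bsub>F\<^esub> g x \<in> carrier \<Omega>"
proof -
  show d: "f x \<ominus>\<^bsub>F\<^esub> g x \<in> carrier \<Omega>" if "x \<in> carrier X" for x
    using HomD(4)[OF assms(2) that] HomD(4)[OF assms(3) that] assms(4)[OF that]
    by (simp add: Omega_eq(1) ev.ker_def ev.minus)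
  have "(\<lambda>x\<in>carrier X. f x \<ominus>\<^bsub>F\<^esub> g x) \<in> Hom H X \<Omega>"
    unfolding Omega_eq(2) using d Omega_eq(1) by (intro Hom_codomain Hom_minus assms F.og) auto
  from Hom_compose[OF this assms(5,1)]
  show "(\<lambda>x\<in>carrier X. \<phi> (f x \<ominus>\<^bsub>F\<^esub> g x)) \<in> Hom H X N"
    by (simp add: compose_def cong: restrict_cong)
qed

abbreviation "ext \<equiv> extendable_homs H S N"

lemma extI:
  assumes "\<eta> \<in> Hom H F N" "\<phi> \<in> extensional (carrier \<Omega>)" "\<And>c. c \<in> carrier \<Omega> \<Longrightarrow> \<phi> c = \<eta> c"
  shows "\<phi> \<in> ext"
proof -
  have "\<phi> = restrict \<eta> (carrier \<Omega>)" using assms by (auto intro!: extensionalityI)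
  then show ?thesis unfolding extendable_homs_def using assms(1) by blast
qed

lemma extD:
  assumes "\<phi> \<in> ext"
  obtains \<eta> where "\<eta> \<in> Hom H F N" "\<phi> = restrict \<eta> (carrier \<Omega>)"
  using assms unfolding extendable_homs_def by blast

lemma ext_Hom: "\<phi> \<in> ext \<Longrightarrow> \<phi> \<in> Hom H \<Omega> N"
proof -
  assume "\<phi> \<in> ext"
  then obtain \<eta> where "\<eta> \<in> Hom H F N" "\<phi> = restrict \<eta> (carrier \<Omega>)" by (rule extD)
  then show ?thesis using Hom_restrict[of \<eta> H F N, OF _ Omega_submodule F.og] Omega_eq by simp
qed

abbreviation "G act \<equiv> Hom_module H \<Omega> N act"

lemma ext_submodule:
  assumes og: "operator_group D (G act)"
    and act: "\<And>d \<phi>. \<lbrakk>d \<in> carrier D; \<phi> \<in> ext\<rbrakk> \<Longrightarrow> act d \<phi> \<in> ext"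
  shows "submodule ext D (G act)"
proof -
  interpret G: operator_group D "G act" by (rule og)
  have neg: "\<ominus>\<^bsub>G act\<^esub> \<phi> = (\<lambda>c\<in>carrier \<Omega>. \<ominus>\<^bsub>N\<^esub> \<phi> c)" if f: "\<phi> \<in> Hom H \<Omega> N" for \<phi>
    using Hom_neg[OF Omega_og N.og f] f HomD(4)[OF f]
    by (intro G.minus_equality) (auto simp: Hom_module_simps N.M.l_neg)
  show ?thesis
  proof (rule G.submoduleI, unfold Hom_module_simps)
    show "ext \<subseteq> Hom H \<Omega> N" using ext_Hom by auto
    show "(\<lambda>x\<in>carrier \<Omega>. \<zero>\<^bsub>N\<^esub>) \<in> ext"
      by (rule extI[OF Hom_zero[OF F.og N.og]]) (auto dest: OmF)
    fix \<phi> assume f: "\<phi> \<in> ext"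
    then obtain \<eta> where c: "\<eta> \<in> Hom H F N" "\<phi> = restrict \<eta> (carrier \<Omega>)" by (rule extD)
    show "\<ominus>\<^bsub>G act\<^esub> \<phi> \<in> ext"
      unfolding neg[OF ext_Hom[OF f]]
      by (rule extI[OF Hom_neg[OF F.og N.og c(1)]]) (auto simp: c(2) dest: OmF)
    fix \<phi>' assume f': "\<phi>' \<in> ext"
    then obtain \<eta>' where c': "\<eta>' \<in> Hom H F N" "\<phi>' = restrict \<eta>' (carrier \<Omega>)" by (rule extD)
    show "(\<lambda>x\<in>carrier \<Omega>. \<phi> x \<oplus>\<^bsub>N\<^esub> \<phi>' x) \<in> ext"
      by (rule extI[OF Hom_add[OF F.og N.og c(1) c'(1)]]) (auto simp: c(2) c'(2) dest: OmF)
  qed (rule act)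
qed

lemma compose_theta: "\<psi> \<in> Hom H KM N \<Longrightarrow> compose (carrier \<Omega>) \<psi> \<theta> \<in> Hom H \<Omega> N"
proof -
  assume p: "\<psi> \<in> Hom H KM N"
  have "restrict \<theta> (carrier \<Omega>) \<in> Hom H \<Omega> M"
    using Hom_restrict[OF theta(1) Omega_submodule F.og] Omega_eq by simp
  then have "restrict \<theta> (carrier \<Omega>) \<in> Hom H \<Omega> KM" using theta_L(1) by (intro Hom_codomain) auto
  from Hom_compose[OF this p Omega_og] show ?thesis by (simp add: compose_def cong: restrict_cong)
qed

text \<open>\<open>\<psi>\<close> is \<open>\<phi>\<close> after \<open>\<sigma>\<close>. What then
  remains of \<open>\<phi>\<close> is \<open>\<phi>\<close> after
  \<open>1 - \<sigma> \<theta>\<close>, which is defined on all of \<open>F\<close>, hence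
  extendable.\<close>

lemma class_surj:
  assumes p: "\<phi> \<in> Hom H \<Omega> N"
  obtains \<psi> where "\<psi> \<in> Hom H KM N" "(\<lambda>c\<in>carrier \<Omega>. \<phi> c \<ominus>\<^bsub>N\<^esub> \<psi> (\<theta> c)) \<in> ext"
proof -
  let ?\<psi> = "\<lambda>x\<in>L. \<phi> (\<sigma> x)"
  have "restrict \<sigma> L \<in> Hom H KM F" by (rule Hom_restrict[OF sigma(1) L_submodule M.og])
  then have "restrict \<sigma> L \<in> Hom H KM \<Omega>" unfolding Omega_eq(2)
    using sigma_Omega(1) Omega_eq(1) by (intro Hom_codomain) auto
  from Hom_compose[OF this p L_og] have psi: "?\<psi> \<in> Hom H KM N" by (simp add: compose_def cong: restrict_cong)
  interpret p: semilinear_map H \<Omega> H N \<phi> by (intro Hom_semilinear_map Omega_og N.og p)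
  let ?st = "compose (carrier F) \<sigma> \<theta>"
  have st: "?st \<in> Hom H F F" by (rule Hom_compose[OF theta(1) sigma(1) F.og])
  have e: "ev ((\<lambda>c\<in>carrier F. c) c) = ev (?st c)" if "c \<in> carrier F" for c
    using that sigma(2) theta theta_L(2) by (simp add: compose_def)
  note d = Hom_difference_free[OF F.og Hom_id[OF F.og] st e p]
  have "(\<lambda>c\<in>carrier \<Omega>. \<phi> c \<ominus>\<^bsub>N\<^esub> ?\<psi> (\<theta> c)) \<in> ext"
  proof (rule extI[OF d(1)])
    fix c assume c: "c \<in> carrier \<Omega>"
    note t = theta_L(1)[OF c] and cF = OmF[OF c]
    have s: "\<sigma> (\<theta> c) \<in> carrier \<Omega>" by (rule sigma_Omega(1)[OF t])
    have "c \<ominus>\<^bsub>F\<^esub> \<sigma> (\<theta> c) = c \<ominus>\<^bsub>\<Omega>\<^esub> \<sigma> (\<theta> c)"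
      using OF.a_inv_sub[OF Omega_submodule s] unfolding a_minus_def by (simp add: Omega_eq(2) ev.ker_def)
    then show "(\<lambda>c\<in>carrier \<Omega>. \<phi> c \<ominus>\<^bsub>N\<^esub> ?\<psi> (\<theta> c)) c =
        (\<lambda>x\<in>carrier F. \<phi> ((\<lambda>c\<in>carrier F. c) x \<ominus>\<^bsub>F\<^esub> ?st x)) c"
      using c cF t p.minus[OF c s] by (simp add: compose_def)
  qed auto
  then show ?thesis using that psi by blast
qed

text \<open>Given an extension \<open>\<eta>\<close> to \<open>F\<close>, \<open>\<psi>\<close>
  splits as \<open>\<eta>\<close> after \<open>\<sigma>\<close> plus \<open>\<psi>\<close> after
  \<open>1 - \<theta> \<sigma>\<close>; both summands are defined on all of
  \<open>M\<close>.\<close>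

lemma class_ker:
  assumes p: "\<psi> \<in> Hom H KM N"
  shows "compose (carrier \<Omega>) \<psi> \<theta> \<in> ext \<longleftrightarrow> (\<exists>\<eta>\<in>Hom H M N. \<psi> = restrict \<eta> L)"
proof
  assume "\<exists>\<eta>\<in>Hom H M N. \<psi> = restrict \<eta> L"
  then obtain \<eta> where c: "\<eta> \<in> Hom H M N" "\<psi> = restrict \<eta> L" by blast
  show "compose (carrier \<Omega>) \<psi> \<theta> \<in> ext"
    by (rule extI[OF Hom_compose[OF theta(1) c(1) F.og]])
      (auto simp: compose_def c(2) theta_L(1) dest: OmF)
next
  assume "compose (carrier \<Omega>) \<psi> \<theta> \<in> ext"
  then obtain \<eta> where c: "\<eta> \<in> Hom H F N" "compose (carrier \<Omega>) \<psi> \<theta> = restrict \<eta> (carrier \<Omega>)" by (rule extD)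
  interpret p: semilinear_map H KM H N \<psi> by (intro Hom_semilinear_map L_og N.og p)
  let ?ts = "compose (carrier M) \<theta> \<sigma>"
  have ts: "?ts \<in> Hom H M M" by (rule Hom_compose[OF sigma(1) theta(1) M.og])
  have e: "\<epsilon> ((\<lambda>c\<in>carrier M. c) x) = \<epsilon> (?ts x)" if "x \<in> carrier M" for x
    using that sigma theta sigma_Omega(2) by (simp add: compose_def)
  note d = Hom_difference[OF M.og Hom_id[OF M.og] ts e p]
  let ?\<eta> = "\<lambda>x\<in>carrier M. compose (carrier M) \<eta> \<sigma> x \<oplus>\<^bsub>N\<^esub>
    (\<lambda>x\<in>carrier M. \<psi> ((\<lambda>c\<in>carrier M. c) x \<ominus>\<^bsub>M\<^esub> ?ts x)) x"
  have "?\<eta> \<in> Hom H M N" by (rule Hom_add[OF M.og N.og Hom_compose[OF sigma(1) c(1) M.og] d(1)])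
  moreover have "\<psi> = restrict ?\<eta> L"
  proof (rule extensionalityI)
    show "\<psi> \<in> extensional L" using HomD(3)[OF p] by simp
    fix x assume x: "x \<in> L"
    note s = sigma_Omega(1)[OF x] and xM = LM[OF x]
    note t = theta_L(1)[OF s]
    have "\<eta> (\<sigma> x) = \<psi> (\<theta> (\<sigma> x))" using fun_cong[OF c(2), of "\<sigma> x"] s by (simp add: compose_def)
    moreover have "x \<ominus>\<^bsub>M\<^esub> \<theta> (\<sigma> x) = x \<ominus>\<^bsub>KM\<^esub> \<theta> (\<sigma> x)"
      using OM.a_inv_sub[OF L_submodule t] unfolding a_minus_def by simp
    moreover have "\<psi> x = \<psi> (\<theta> (\<sigma> x)) \<oplus>\<^bsub>N\<^esub> (\<psi> x \<ominus>\<^bsub>N\<^esub> \<psi> (\<theta> (\<sigma> x)))"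
      using p.closed[of x] p.closed[of "\<theta> (\<sigma> x)"] x t
      by (simp add: a_minus_def N.M.a_ac N.M.r_neg1 N.M.r_neg2 N.M.r_neg)
    ultimately show "\<psi> x = restrict ?\<eta> L x"
      using x xM p.minus[of x "\<theta> (\<sigma> x)"] t by (simp add: compose_def)
  qed auto
  ultimately show "\<exists>\<eta>\<in>Hom H M N. \<psi> = restrict \<eta> L" by blast
qed

text \<open>The connecting map from \<open>Hom(L, N)\<close> to the extension group. The left and
  the right version of this group have the same cosets and differ in the scalar action only, so
  \<open>act\<close> is left open.\<close>

definition "cls act \<psi> = ext +>\<^bsub>G act\<^esub> compose (carrier \<Omega>) \<psi> \<theta>"

context
  fixes D :: "('d, 'y) ring_scheme" and act
  assumes Gog: "operator_group D (G act)" and esub: "submodule ext D (G act)"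
begin

interpretation GG: operator_group D "G act" by (rule Gog)

lemma cls_closed: "\<psi> \<in> Hom H KM N \<Longrightarrow> cls act \<psi> \<in> carrier (quot_module (G act) ext)"
  unfolding cls_def GG.quot_carrier[OF esub] using compose_theta by (auto simp: Hom_module_simps)

lemma cls_add:
  assumes "\<psi> \<in> Hom H KM N" "\<psi>' \<in> Hom H KM N"
  shows "cls act (\<lambda>x\<in>L. \<psi> x \<oplus>\<^bsub>N\<^esub> \<psi>' x) = cls act \<psi> \<oplus>\<^bsub>quot_module (G act) ext\<^esub> cls act \<psi>'"
proof -
  have "compose (carrier \<Omega>) (\<lambda>x\<in>L. \<psi> x \<oplus>\<^bsub>N\<^esub> \<psi>' x) \<theta> =
      compose (carrier \<Omega>) \<psi> \<theta> \<oplus>\<^bsub>G act\<^esub> compose (carrier \<Omega>) \<psi>' \<theta>"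
    by (auto simp: Hom_module_simps compose_def theta_L(1) intro!: restrict_ext)
  then show ?thesis
    unfolding cls_def using GG.quot_add[OF esub] compose_theta assms by (simp add: Hom_module_simps)
qed

lemma coset_eqI:
  assumes "\<phi> \<in> Hom H \<Omega> N" "\<phi>' \<in> Hom H \<Omega> N" "(\<lambda>c\<in>carrier \<Omega>. \<phi> c \<ominus>\<^bsub>N\<^esub> \<phi>' c) \<in> ext"
  shows "ext +>\<^bsub>G act\<^esub> \<phi> = ext +>\<^bsub>G act\<^esub> \<phi>'"
proof -
  let ?d = "\<lambda>c\<in>carrier \<Omega>. \<phi> c \<ominus>\<^bsub>N\<^esub> \<phi>' c"
  have "\<phi> = ?d \<oplus>\<^bsub>G act\<^esub> \<phi>'"
    using HomD(4)[OF assms(1)] HomD(4)[OF assms(2)]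
    by (intro extensionalityI[OF HomD(3)[OF assms(1)]]) (auto simp: Hom_module_simps)
  then have "\<phi> \<in> ext +>\<^bsub>G act\<^esub> \<phi>'" using assms(3) by (auto simp: a_r_coset_def')
  then show ?thesis
    using GG.a_repr_independence[of \<phi> ext \<phi>'] assms(2) submodule.axioms(1)[OF esub]
    by (simp add: Hom_module_simps)
qed

lemma cls_surj: "cls act ` Hom H KM N = carrier (quot_module (G act) ext)"
proof
  show "cls act ` Hom H KM N \<subseteq> carrier (quot_module (G act) ext)" using cls_closed by blast
  show "carrier (quot_module (G act) ext) \<subseteq> cls act ` Hom H KM N"
  proof
    fix X assume "X \<in> carrier (quot_module (G act) ext)"
    then obtain \<phi> where f: "\<phi> \<in> Hom H \<Omega> N" "X = ext +>\<^bsub>G act\<^esub> \<phi>"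
      unfolding GG.quot_carrier[OF esub] by (auto simp: Hom_module_simps)
    obtain \<psi> where p: "\<psi> \<in> Hom H KM N" "(\<lambda>c\<in>carrier \<Omega>. \<phi> c \<ominus>\<^bsub>N\<^esub> \<psi> (\<theta> c)) \<in> ext"
      by (rule class_surj[OF f(1)])
    then have "X = cls act \<psi>"
      unfolding f(2) cls_def using f(1) compose_theta by (intro coset_eqI) (auto simp: compose_def cong: restrict_cong)
    then show "X \<in> cls act ` Hom H KM N" using p(1) by (rule image_eqI)
  qed
qed

lemma cls_zero_iff:
  "\<psi> \<in> Hom H KM N \<Longrightarrow> cls act \<psi> = \<zero>\<^bsub>quot_module (G act) ext\<^esub> \<longleftrightarrow> (\<exists>\<eta>\<in>Hom H M N. \<psi> = restrict \<eta> L)"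
  unfolding cls_def GG.quot_zero[OF esub]
  using GG.quot_eq_zero_iff[OF esub, of "compose (carrier \<Omega>) \<psi> \<theta>"] compose_theta class_ker
  by (simp add: Hom_module_simps)

end

end

abbreviation post_module :: "('h, 'x) ring_scheme \<Rightarrow> ('h, 'm) module \<Rightarrow> ('h, 'k) module \<Rightarrow> ('k \<Rightarrow> 'k, 'm \<Rightarrow> 'k) module" where
  "post_module H M N \<equiv> Hom_module H M N (\<lambda>g f. compose (carrier M) g f)"

abbreviation pre_module :: "('h, 'x) ring_scheme \<Rightarrow> ('h, 'm) module \<Rightarrow> 'm set \<Rightarrow> ('h, 'k) module \<Rightarrow> ('m \<Rightarrow> 'm, 'm \<Rightarrow> 'k) module" where
  "pre_module H P K N \<equiv> Hom_module H (P\<lparr>carrier := K\<rparr>) N (\<lambda>u f. compose K f u)"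

context presentation
begin

abbreviation "lact \<equiv> (\<lambda>g \<phi>. compose (carrier \<Omega>) g \<phi>)"

lemma left_og: "operator_group (End_ring H N) (G lact)"
  by (rule post_operator_group[OF Omega_og N.og])

lemma left_esub: "submodule ext (End_ring H N) (G lact)"
proof (rule ext_submodule[OF left_og])
  fix g \<phi> assume g: "g \<in> carrier (End_ring H N)" and "\<phi> \<in> ext"
  then obtain \<eta> where c: "\<eta> \<in> Hom H F N" "\<phi> = restrict \<eta> (carrier \<Omega>)" by (blast elim: extD)
  show "compose (carrier \<Omega>) g \<phi> \<in> ext"
    by (rule extI[OF Hom_compose[OF c(1) _ F.og]])
      (use g in \<open>auto simp: End_ring_simps compose_def c(2) dest: OmF\<close>)
qed

lemma Ext1_left_eq: "Ext1_left H S N = quot_module (G lact) ext"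
  by (simp add: Ext1_left_def)

lemma Ext1_left_og: "operator_group (End_ring H N) (Ext1_left H S N)"
  unfolding Ext1_left_eq by (rule operator_group.quot_operator_group[OF left_og left_esub])

lemma cls_smult_left:
  assumes "g \<in> Hom H N N" "\<psi> \<in> Hom H KM N"
  shows "cls lact (compose L g \<psi>) = g \<odot>\<^bsub>Ext1_left H S N\<^esub> cls lact \<psi>"
proof -
  have "compose (carrier \<Omega>) (compose L g \<psi>) \<theta> = g \<odot>\<^bsub>G lact\<^esub> compose (carrier \<Omega>) \<psi> \<theta>"
    by (auto simp: Hom_module_simps compose_def theta_L(1) intro!: restrict_ext)
  then show ?thesis
    unfolding cls_def Ext1_left_eq
    using operator_group.quot_smult[OF left_og left_esub, of g "compose (carrier \<Omega>) \<psi> \<theta>"] assms compose_theta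
    by (simp add: Hom_module_simps End_ring_simps)
qed

lemma cls_Hom_left:
  "(\<lambda>\<psi>\<in>carrier (post_module H KM N). cls lact \<psi>) \<in> Hom (End_ring H N) (post_module H KM N) (Ext1_left H S N)"
proof (rule HomI[OF _ _ _ post_operator_group[OF L_og N.og]])
  show "cls lact \<psi> \<in> carrier (Ext1_left H S N)" if "\<psi> \<in> carrier (post_module H KM N)" for \<psi>
    using cls_closed[OF left_og left_esub] that by (simp add: Hom_module_simps Ext1_left_eq)
  show "cls lact (\<psi> \<oplus>\<^bsub>post_module H KM N\<^esub> \<psi>') = cls lact \<psi> \<oplus>\<^bsub>Ext1_left H S N\<^esub> cls lact \<psi>'"
    if "\<psi> \<in> carrier (post_module H KM N)" "\<psi>' \<in> carrier (post_module H KM N)" for \<psi> \<psi>'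
    using cls_add[OF left_og left_esub, of \<psi> \<psi>'] that by (simp add: Hom_module_simps Ext1_left_eq)
  show "cls lact (g \<odot>\<^bsub>post_module H KM N\<^esub> \<psi>) = g \<odot>\<^bsub>Ext1_left H S N\<^esub> cls lact \<psi>"
    if "g \<in> carrier (End_ring H N)" "\<psi> \<in> carrier (post_module H KM N)" for g \<psi>
    using cls_smult_left[of g \<psi>] that by (simp add: Hom_module_simps End_ring_simps)
qed

lemma cls_surj_left:
  "(\<lambda>\<psi>\<in>carrier (post_module H KM N). cls lact \<psi>) ` carrier (post_module H KM N) = carrier (Ext1_left H S N)"
  using cls_surj[OF left_og left_esub] by (simp add: Hom_module_simps Ext1_left_eq)

lemma Ext1_left_left_module: "left_module (End_ring H N) (Ext1_left H S N)"
  by (rule surj_left_module[OF post_left_module[OF L_og N.og] Ext1_left_og cls_Hom_left cls_surj_left])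

text \<open>Exactness at \<open>Hom(S, N)\<close> and at \<open>Hom(M, N)\<close>: maps that vanish
  on the kernel of the surjection \<open>\<epsilon>\<close> factor uniquely through it.\<close>

lemma factor_bij:
  "bij_betw (\<lambda>g. compose (carrier M) g \<epsilon>) (Hom H S N) {\<eta> \<in> Hom H M N. \<forall>x\<in>L. \<eta> x = \<zero>\<^bsub>N\<^esub>}"
proof (rule bij_betw_imageI)
  show "inj_on (\<lambda>g. compose (carrier M) g \<epsilon>) (Hom H S N)"
  proof (rule inj_onI)
    fix g h assume g: "g \<in> Hom H S N" and h: "h \<in> Hom H S N" and eq: "compose (carrier M) g \<epsilon> = compose (carrier M) h \<epsilon>"
    have "g (\<epsilon> x) = h (\<epsilon> x)" if "x \<in> carrier M" for x using fun_cong[OF eq, of x] that by (simp add: compose_def)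
    then show "g = h" using \<epsilon>(2) by (intro Hom_eqI[OF g h]) (metis imageE)
  qed
  show "(\<lambda>g. compose (carrier M) g \<epsilon>) ` Hom H S N = {\<eta> \<in> Hom H M N. \<forall>x\<in>L. \<eta> x = \<zero>\<^bsub>N\<^esub>}"
  proof
    show "(\<lambda>g. compose (carrier M) g \<epsilon>) ` Hom H S N \<subseteq> {\<eta> \<in> Hom H M N. \<forall>x\<in>L. \<eta> x = \<zero>\<^bsub>N\<^esub>}"
    proof (rule image_subsetI)
      fix g assume g: "g \<in> Hom H S N"
      interpret g: semilinear_map H S H N g by (intro Hom_semilinear_map S.og N.og g)
      show "compose (carrier M) g \<epsilon> \<in> {\<eta> \<in> Hom H M N. \<forall>x\<in>L. \<eta> x = \<zero>\<^bsub>N\<^esub>}"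
        using Hom_compose[OF \<epsilon>(1) g M.og] by (simp add: compose_def L_def)
    qed
    show "{\<eta> \<in> Hom H M N. \<forall>x\<in>L. \<eta> x = \<zero>\<^bsub>N\<^esub>} \<subseteq> (\<lambda>g. compose (carrier M) g \<epsilon>) ` Hom H S N"
    proof
      fix \<eta> assume "\<eta> \<in> {\<eta> \<in> Hom H M N. \<forall>x\<in>L. \<eta> x = \<zero>\<^bsub>N\<^esub>}"
      then have c: "\<eta> \<in> Hom H M N" "\<And>x. x \<in> carrier M \<Longrightarrow> \<epsilon> x = \<zero>\<^bsub>S\<^esub> \<Longrightarrow> \<eta> x = \<zero>\<^bsub>N\<^esub>" by (auto simp: L_def)
      obtain h where h: "h \<in> Hom H S N" "\<forall>x\<in>carrier M. h (\<epsilon> x) = \<eta> x"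
        using Hom_factor[OF M.og S.og N.og \<epsilon> c] by blast
      then have "\<eta> = compose (carrier M) h \<epsilon>"
        by (intro Hom_eqI[OF c(1) Hom_compose[OF \<epsilon>(1) h(1) M.og]]) (simp add: compose_def)
      then show "\<eta> \<in> (\<lambda>g. compose (carrier M) g \<epsilon>) ` Hom H S N" using h(1) by (rule image_eqI)
    qed
  qed
qed

text \<open>The exact sequence
  \<open>0 \<rightarrow> Hom(S, N) \<rightarrow> Hom(M, N) \<rightarrow> Hom(L, N) \<rightarrow> Ext\<^sup>1(S, N) \<rightarrow> 0\<close>.\<close>

lemma Ext1_left_length:
  assumes d: "len (End_ring H N) (post_module H S N) d" and m: "len (End_ring H N) (post_module H KM N) m"
  shows "\<exists>e a. len (End_ring H N) (Ext1_left H S N) e \<and> len (End_ring H N) (post_module H M N) a \<and> a + e = d + m"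
proof -
  let ?D = "End_ring H N" let ?V = "post_module H KM N" and ?W = "post_module H M N"
  interpret V: operator_group ?D ?V by (rule post_operator_group[OF L_og N.og])
  interpret W: operator_group ?D ?W by (rule post_operator_group[OF M.og N.og])
  interpret c: semilinear_map ?D ?V ?D "Ext1_left H S N" "\<lambda>\<psi>\<in>carrier ?V. cls lact \<psi>"
    by (intro Hom_semilinear_map V.operator_group_axioms Ext1_left_og cls_Hom_left)
  obtain i e where i: "len ?D (?V\<lparr>carrier := c.ker\<rparr>) i" and e: "len ?D (Ext1_left H S N) e" and m': "m = i + e"
    by (rule c.len_surj[OF cls_surj_left m])
  let ?r = "\<lambda>\<eta>. restrict \<eta> L"
  \<comment> \<open>Exactness at \<open>Hom(L, N)\<close>: a class vanishes precisely for the
    restrictions of homomorphisms from \<open>M\<close>.\<close>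
  have ker: "c.ker = ?r ` Hom H M N"
  proof -
    have "c.ker = {\<psi> \<in> Hom H KM N. \<exists>\<eta>\<in>Hom H M N. \<psi> = restrict \<eta> L}"
      using cls_zero_iff[OF left_og left_esub]
      unfolding c.ker_def by (auto simp: Hom_module_simps Ext1_left_eq)
    moreover have "restrict \<eta> L \<in> Hom H KM N" if "\<eta> \<in> Hom H M N" for \<eta>
      by (rule Hom_restrict[OF that L_submodule M.og])
    ultimately show ?thesis by auto
  qed
  let ?I = "?V\<lparr>carrier := c.ker\<rparr>"
  interpret I: operator_group ?D ?I by (rule V.sub_operator_group[OF c.ker_submodule])
  have r: "(\<lambda>\<eta>\<in>carrier ?W. ?r \<eta>) \<in> Hom ?D ?W ?I"
  proof (rule HomI[OF _ _ _ W.operator_group_axioms])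
    show "?r \<eta> \<in> carrier ?I" if "\<eta> \<in> carrier ?W" for \<eta>
      using ker that by (simp add: Hom_module_simps)
    show "?r (\<eta> \<oplus>\<^bsub>?W\<^esub> \<eta>') = ?r \<eta> \<oplus>\<^bsub>?I\<^esub> ?r \<eta>'" for \<eta> \<eta>'
      by (auto simp: Hom_module_simps restrict_def fun_eq_iff dest: LM)
    show "?r (g \<odot>\<^bsub>?W\<^esub> \<eta>) = g \<odot>\<^bsub>?I\<^esub> ?r \<eta>" for g \<eta>
      by (auto simp: Hom_module_simps compose_def restrict_def fun_eq_iff dest: LM)
  qed
  interpret r: semilinear_map ?D ?W ?D ?I "\<lambda>\<eta>\<in>carrier ?W. ?r \<eta>"
    by (intro Hom_semilinear_map W.operator_group_axioms I.operator_group_axioms r)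
  have rs: "(\<lambda>\<eta>\<in>carrier ?W. ?r \<eta>) ` carrier ?W = carrier ?I" using ker by (simp add: Hom_module_simps)
  have rk: "r.ker = {\<eta> \<in> Hom H M N. \<forall>x\<in>L. \<eta> x = \<zero>\<^bsub>N\<^esub>}"
    unfolding r.ker_def by (auto simp: Hom_module_simps restrict_def fun_eq_iff)
  let ?K = "?W\<lparr>carrier := r.ker\<rparr>" let ?S = "post_module H S N"
  interpret K: operator_group ?D ?K by (rule W.sub_operator_group[OF r.ker_submodule])
  have cK: "carrier ?K = {\<eta> \<in> Hom H M N. \<forall>x\<in>L. \<eta> x = \<zero>\<^bsub>N\<^esub>}" unfolding rk[symmetric] by simp
  have "semilinear ?D ?S ?D ?K (\<lambda>g. compose (carrier M) g \<epsilon>)"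
    unfolding semilinear_def
  proof (intro conjI ballI)
    show "(\<lambda>g. compose (carrier M) g \<epsilon>) \<in> carrier ?S \<rightarrow> carrier ?K"
      unfolding cK unfolding Hom_module_simps by (rule bij_betw_imp_funcset[OF factor_bij])
    fix g h
    show "compose (carrier M) (g \<oplus>\<^bsub>?S\<^esub> h) \<epsilon> = compose (carrier M) g \<epsilon> \<oplus>\<^bsub>?K\<^esub> compose (carrier M) h \<epsilon>"
      by (auto simp: Hom_module_simps compose_def intro!: restrict_ext)
  next
    have *: "compose (carrier M) (d \<odot>\<^bsub>?S\<^esub> g) \<epsilon> = d \<odot>\<^bsub>?K\<^esub> compose (carrier M) g \<epsilon>" for d g
      by (auto simp: Hom_module_simps compose_def intro!: restrict_ext)
    fix d assume "d \<in> carrier ?D"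
    then show "\<exists>e\<in>carrier ?D. \<forall>g\<in>carrier ?S. compose (carrier M) (d \<odot>\<^bsub>?S\<^esub> g) \<epsilon> = e \<odot>\<^bsub>?K\<^esub> compose (carrier M) g \<epsilon>"
      "\<exists>e\<in>carrier ?D. \<forall>g\<in>carrier ?S. compose (carrier M) (e \<odot>\<^bsub>?S\<^esub> g) \<epsilon> = d \<odot>\<^bsub>?K\<^esub> compose (carrier M) g \<epsilon>"
      using * by blast+
  qed
  then interpret k: semilinear_map ?D ?S ?D ?K "\<lambda>g. compose (carrier M) g \<epsilon>"
    by (intro semilinear_map.intro semilinear_map_axioms.intro post_operator_group[OF S.og N.og] K.operator_group_axioms)
  have "bij_betw (\<lambda>g. compose (carrier M) g \<epsilon>) (carrier ?S) (carrier ?K)"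
    unfolding cK unfolding Hom_module_simps by (rule factor_bij)
  from iffD1[OF k.len_bij[OF this] d] have "len ?D ?K d" .
  from r.len_add[OF rs this i] have "len ?D ?W (d + i)" .
  then show ?thesis using e m' by (intro exI[of _ e] exI[of _ "d + i"]) simp
qed

subsection \<open>The right action\<close>

text \<open>The free module functor applied to \<open>f\<close>. \<open>syzygy_map\<close> is its
  restriction to \<open>\<Omega>\<close> with the coefficients written out, a form in which
  linearity is not visible.\<close>

definition "free_map f = lin_hom H S F (\<lambda>x. unit_vec H (carrier S) (f x))"

lemma free_map_Hom: "free_map f \<in> Hom H F F"
  unfolding free_map_def by (rule F.lin_hom_Hom) (rule M.R.unit_vec_closed)

lemma ev_free_map:
  assumes f: "f \<in> Hom H S S" and c: "c \<in> carrier F"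
  shows "ev (free_map f c) = f (ev c)"
proof -
  have c': "\<And>x. x \<in> carrier S \<Longrightarrow> c x \<in> carrier H" "finite {x \<in> carrier S. c x \<noteq> \<zero>\<^bsub>H\<^esub>}"
    using c by (auto simp: free_carrier)
  have u: "ev (unit_vec H (carrier S) (f x)) = f x" if "x \<in> carrier S" for x
    using S.lin_comb_unit[of "\<lambda>x. x" "f x" "carrier S"] HomD(4)[OF f that] M.R.unit_vec_closed[of S "f x"]
    by (simp add: ev_def lin_hom_def)
  have "ev (free_map f c) = ev (lin_comb H F (carrier S) (\<lambda>x. unit_vec H (carrier S) (f x)) c)"
    using c by (simp add: free_map_def lin_hom_def)
  also have "\<dots> = lin_comb H S (carrier S) (\<lambda>x. ev (unit_vec H (carrier S) (f x))) c"
    by (rule Hom_lin_comb[OF F.left_module_axioms S_lm ev c'(1) _ c'(2)]) (auto intro: M.R.unit_vec_closed)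
  also have "\<dots> = lin_comb H S (carrier S) f c"
    unfolding lin_comb_def using c' u HomD(4)[OF f] by (intro S.M.finsum_cong') auto
  also have "\<dots> = f (lin_comb H S (carrier S) (\<lambda>x. x) c)"
    using c' by (intro Hom_lin_comb[symmetric] S_lm f) auto
  finally show ?thesis using c by (simp add: ev_def lin_hom_def)
qed

lemma free_map_apply:
  assumes f: "f \<in> Hom H S S" and c: "c \<in> carrier F" and y: "y \<in> carrier S"
  shows "free_map f c y = (\<Oplus>\<^bsub>H\<^esub>x\<in>{x \<in> carrier S. c x \<noteq> \<zero>\<^bsub>H\<^esub> \<and> f x = y}. c x)"
proof -
  have c': "\<And>x. x \<in> carrier S \<Longrightarrow> c x \<in> carrier H" "finite {x \<in> carrier S. c x \<noteq> \<zero>\<^bsub>H\<^esub>}"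
    using c by (auto simp: free_carrier)
  have "free_map f c y = lin_comb H F (carrier S) (\<lambda>x. unit_vec H (carrier S) (f x)) c y"
    using c by (simp add: free_map_def lin_hom_def)
  also have "\<dots> = lin_comb H (regular_module H) (carrier S) (\<lambda>x. unit_vec H (carrier S) (f x) y) c"
    by (rule lin_comb_apply[OF M.R.ring_axioms y c]) (rule M.R.unit_vec_closed)
  also have "\<dots> = (\<Oplus>\<^bsub>H\<^esub>x\<in>{x \<in> carrier S. c x \<noteq> \<zero>\<^bsub>H\<^esub>}. c x \<otimes>\<^bsub>H\<^esub> unit_vec H (carrier S) (f x) y)"
    by (simp add: lin_comb_def finsum_regular regular_simps)
  also have "\<dots> = (\<Oplus>\<^bsub>H\<^esub>x\<in>{x \<in> carrier S. c x \<noteq> \<zero>\<^bsub>H\<^esub> \<and> f x = y}. c x)"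
    using c' y by (intro M.R.add.finprod_mono_neutral_cong_right) (auto simp: unit_vec_def)
  finally show ?thesis .
qed

lemma syzygy_map_eq:
  assumes f: "f \<in> Hom H S S"
  shows "syzygy_map H S f = restrict (free_map f) (carrier \<Omega>)"
proof (rule extensionalityI[of _ "carrier \<Omega>"])
  fix c assume c: "c \<in> carrier \<Omega>"
  have "free_map f c \<in> carrier F" by (rule HomD(4)[OF free_map_Hom OmF[OF c]])
  then have e: "free_map f c \<in> extensional (carrier S)" by (simp add: free_carrier PiE_def)
  show "syzygy_map H S f c = restrict (free_map f) (carrier \<Omega>) c"
    by (rule extensionalityI[of _ "carrier S"])
      (use c e in \<open>simp_all add: syzygy_map_def free_map_apply[OF f OmF[OF c]]\<close>)
qed (simp_all add: syzygy_map_def)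

lemma free_map_Omega: "f \<in> Hom H S S \<Longrightarrow> c \<in> carrier \<Omega> \<Longrightarrow> free_map f c \<in> carrier \<Omega>"
proof -
  assume f: "f \<in> Hom H S S" and c: "c \<in> carrier \<Omega>"
  interpret f: semilinear_map H S H S f by (intro Hom_semilinear_map S.og f)
  show "free_map f c \<in> carrier \<Omega>"
    using ev_free_map[OF f OmF[OF c]] HomD(4)[OF free_map_Hom OmF[OF c]] c
    by (simp add: Omega_eq(1) ev.ker_def)
qed

lemma syzygy_map_Hom: "f \<in> Hom H S S \<Longrightarrow> syzygy_map H S f \<in> Hom H \<Omega> \<Omega>"
proof -
  assume f: "f \<in> Hom H S S"
  have "restrict (free_map f) (carrier \<Omega>) \<in> Hom H \<Omega> F"
    using Hom_restrict[OF free_map_Hom Omega_submodule F.og] Omega_eq by simp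
  then have "restrict (free_map f) (carrier \<Omega>) \<in> Hom H \<Omega> (F\<lparr>carrier := carrier \<Omega>\<rparr>)"
    using free_map_Omega[OF f] by (intro Hom_codomain) auto
  then show ?thesis unfolding syzygy_map_eq[OF f] using Omega_eq by simp
qed

abbreviation "ract \<equiv> (\<lambda>f \<phi>. compose (carrier \<Omega>) \<phi> (syzygy_map H S f))"

lemma right_og: "operator_group (opposite_ring (End_ring H S)) (G ract)"
proof (rule Hom_module_operator_group[OF Omega_og N.og], unfold opposite_ring_simps End_ring_simps)
  fix f \<phi> assume f: "f \<in> Hom H S S" and p: "\<phi> \<in> Hom H \<Omega> N"
  show "ract f \<phi> \<in> Hom H \<Omega> N" by (rule Hom_compose[OF syzygy_map_Hom[OF f] p Omega_og])
  fix \<phi>' assume "\<phi>' \<in> Hom H \<Omega> N"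
  show "ract f (\<lambda>x\<in>carrier \<Omega>. \<phi> x \<oplus>\<^bsub>N\<^esub> \<phi>' x) = (\<lambda>x\<in>carrier \<Omega>. ract f \<phi> x \<oplus>\<^bsub>N\<^esub> ract f \<phi>' x)"
    using HomD(4)[OF syzygy_map_Hom[OF f]] by (auto simp: compose_def intro!: restrict_ext)
qed

lemma right_esub: "submodule ext (opposite_ring (End_ring H S)) (G ract)"
proof (rule ext_submodule[OF right_og])
  fix f \<phi> assume f: "f \<in> carrier (opposite_ring (End_ring H S))" and "\<phi> \<in> ext"
  then obtain \<eta> where c: "\<eta> \<in> Hom H F N" "\<phi> = restrict \<eta> (carrier \<Omega>)" by (blast elim: extD)
  have f': "f \<in> Hom H S S" using f by (simp add: opposite_ring_simps End_ring_simps)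
  show "ract f \<phi> \<in> ext"
    by (rule extI[OF Hom_compose[OF free_map_Hom c(1) F.og]])
      (auto simp: compose_def c(2) syzygy_map_eq[OF f'] free_map_Omega[OF f'] dest: OmF)
qed

lemma Ext1_right_eq: "Ext1_right H S N = quot_module (G ract) ext"
  by (simp add: Ext1_right_def)

lemma Ext1_right_og: "operator_group (opposite_ring (End_ring H S)) (Ext1_right H S N)"
  unfolding Ext1_right_eq by (rule operator_group.quot_operator_group[OF right_og right_esub])

definition "covers u f \<longleftrightarrow> u \<in> Hom H M M \<and> f \<in> Hom H S S \<and> (\<forall>x\<in>carrier M. \<epsilon> (u x) = f (\<epsilon> x))"

lemma covers_ex: "f \<in> Hom H S S \<Longrightarrow> \<exists>u. covers u f"
proof -
  assume f: "f \<in> Hom H S S"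
  obtain h where "h \<in> Hom H M M" "\<And>q. q \<in> carrier M \<Longrightarrow> \<epsilon> (h q) = compose (carrier M) f \<epsilon> q"
    using dual_basis_lift[OF M_dual M_lm S_lm \<epsilon> Hom_compose[OF \<epsilon>(1) f M.og]] by blast
  then show ?thesis unfolding covers_def using f by (intro exI[of _ h]) (simp add: compose_def)
qed

lemma covers_L: "covers u f \<Longrightarrow> x \<in> L \<Longrightarrow> u x \<in> L"
proof -
  assume u: "covers u f" and x: "x \<in> L"
  then have f: "f \<in> Hom H S S" by (simp add: covers_def)
  interpret f: semilinear_map H S H S f by (intro Hom_semilinear_map S.og f)
  show "u x \<in> L" using u x HomD(4)[of u H M M x] by (simp add: covers_def L_def)
qed

lemma covers_pre: "covers u f \<Longrightarrow> \<psi> \<in> Hom H KM N \<Longrightarrow> compose L \<psi> u \<in> Hom H KM N"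
proof -
  assume u: "covers u f" and p: "\<psi> \<in> Hom H KM N"
  have "restrict u L \<in> Hom H KM M" using u by (intro Hom_restrict L_submodule M.og) (simp add: covers_def)
  then have "restrict u L \<in> Hom H KM KM" using Hom_codomain[of "restrict u L" H KM M L] covers_L[OF u] by auto
  from Hom_compose[OF this p L_og] show ?thesis by (simp add: compose_def cong: restrict_cong)
qed

text \<open>\<open>u\<close> after \<open>\<theta>\<close> and \<open>\<theta>\<close> after
  \<open>free_map f\<close> both lift the map \<open>f\<close> after \<open>ev\<close>. They differ
  by a map from \<open>F\<close> to \<open>L\<close>, so the two representatives differ by an
  extendable homomorphism.\<close>

lemma cls_smult_right:
  assumes u: "covers u f" and p: "\<psi> \<in> Hom H KM N"
  shows "cls ract (compose L \<psi> u) = f \<odot>\<^bsub>Ext1_right H S N\<^esub> cls ract \<psi>"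
proof -
  have u': "u \<in> Hom H M M" "f \<in> Hom H S S" "\<And>x. x \<in> carrier M \<Longrightarrow> \<epsilon> (u x) = f (\<epsilon> x)"
    using u by (auto simp: covers_def)
  interpret p: semilinear_map H KM H N \<psi> by (intro Hom_semilinear_map L_og N.og p)
  let ?a = "compose (carrier F) u \<theta>" and ?b = "compose (carrier F) \<theta> (free_map f)"
  have a: "?a \<in> Hom H F M" by (rule Hom_compose[OF theta(1) u'(1) F.og])
  have b: "?b \<in> Hom H F M" by (rule Hom_compose[OF free_map_Hom theta(1) F.og])
  have e: "\<epsilon> (?a c) = \<epsilon> (?b c)" if "c \<in> carrier F" for c
    using that u'(3) theta theta_L(2) HomD(4)[OF free_map_Hom that] ev_free_map[OF u'(2) that]
    by (simp add: compose_def)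
  note d = Hom_difference[OF F.og a b e p]
  have pu: "compose L \<psi> u \<in> Hom H KM N" by (rule covers_pre[OF u p])
  have pt: "compose (carrier \<Omega>) \<psi> \<theta> \<in> Hom H \<Omega> N" by (rule compose_theta[OF p])
  have rp: "ract f (compose (carrier \<Omega>) \<psi> \<theta>) \<in> Hom H \<Omega> N"
    by (rule Hom_compose[OF syzygy_map_Hom[OF u'(2)] pt Omega_og])
  have "ext +>\<^bsub>G ract\<^esub> compose (carrier \<Omega>) (compose L \<psi> u) \<theta> = ext +>\<^bsub>G ract\<^esub> ract f (compose (carrier \<Omega>) \<psi> \<theta>)"
  proof (rule coset_eqI[OF right_og right_esub compose_theta[OF pu] rp], rule extI[OF d(1)])
    fix c assume c: "c \<in> carrier \<Omega>"
    note cF = OmF[OF c] and t = theta_L(1)[OF c] and fc = free_map_Omega[OF u'(2) c]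
    note ut = covers_L[OF u t] and tf = theta_L(1)[OF fc]
    have "u (\<theta> c) \<ominus>\<^bsub>M\<^esub> \<theta> (free_map f c) = u (\<theta> c) \<ominus>\<^bsub>KM\<^esub> \<theta> (free_map f c)"
      using OM.a_inv_sub[OF L_submodule tf] unfolding a_minus_def by simp
    then show "(\<lambda>c\<in>carrier \<Omega>. compose (carrier \<Omega>) (compose L \<psi> u) \<theta> c \<ominus>\<^bsub>N\<^esub>
         ract f (compose (carrier \<Omega>) \<psi> \<theta>) c) c = (\<lambda>x\<in>carrier F. \<psi> (?a x \<ominus>\<^bsub>M\<^esub> ?b x)) c"
      using c cF t fc ut tf p.minus[of "u (\<theta> c)" "\<theta> (free_map f c)"]
      by (simp add: compose_def syzygy_map_eq[OF u'(2)])
  qed auto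
  then show ?thesis
    unfolding cls_def Ext1_right_eq
    using operator_group.quot_smult[OF right_og right_esub, of f "compose (carrier \<Omega>) \<psi> \<theta>"] u'(2) pt
    by (simp add: Hom_module_simps opposite_ring_simps End_ring_simps)
qed

text \<open>On representatives the action is not additive in \<open>f\<close>, since
  \<open>free_map\<close> sends basis elements to basis elements. On classes it can be computed with
  any lift of \<open>f\<close> to \<open>M\<close>, and lifts may be added and composed.\<close>

lemma Ext1_right_left_module: "left_module (opposite_ring (End_ring H S)) (Ext1_right H S N)"
proof (rule left_moduleI'[OF opposite_ring_ring[OF End_ring_ring[OF S.og]] Ext1_right_og])
  let ?E = "Ext1_right H S N"
  have ex: "\<exists>\<psi>\<in>Hom H KM N. X = cls ract \<psi>" if "X \<in> carrier ?E" for X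
    using that cls_surj[OF right_og right_esub] unfolding Ext1_right_eq by blast
  fix X assume "X \<in> carrier ?E"
  then obtain \<psi> where p: "\<psi> \<in> Hom H KM N" "X = cls ract \<psi>" using ex by blast
  interpret p: semilinear_map H KM H N \<psi> by (intro Hom_semilinear_map L_og N.og p)
  have "covers (\<lambda>x\<in>carrier M. x) (\<lambda>x\<in>carrier S. x)"
    using Hom_id[OF M.og] Hom_id[OF S.og] by (simp add: covers_def)
  from cls_smult_right[OF this p(1)]
  have "(\<lambda>x\<in>carrier S. x) \<odot>\<^bsub>?E\<^esub> X = cls ract (compose L \<psi> (\<lambda>x\<in>carrier M. x))" using p(2) by simp
  also have "compose L \<psi> (\<lambda>x\<in>carrier M. x) = \<psi>"
    by (rule extensionalityI[of _ L]) (use HomD(3)[OF p(1)] in \<open>auto simp: compose_def dest: LM\<close>)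
  finally show "\<one>\<^bsub>opposite_ring (End_ring H S)\<^esub> \<odot>\<^bsub>?E\<^esub> X = X"
    using p(2) by (simp only: opposite_ring_simps End_ring_simps)
  fix f g assume "f \<in> carrier (opposite_ring (End_ring H S))" "g \<in> carrier (opposite_ring (End_ring H S))"
  then have fg: "f \<in> Hom H S S" "g \<in> Hom H S S" by (simp_all add: opposite_ring_simps End_ring_simps)
  obtain u v where u: "covers u f" and v: "covers v g" using covers_ex fg by blast
  have u': "u \<in> Hom H M M" "\<And>x. x \<in> carrier M \<Longrightarrow> \<epsilon> (u x) = f (\<epsilon> x)"
    and v': "v \<in> Hom H M M" "\<And>x. x \<in> carrier M \<Longrightarrow> \<epsilon> (v x) = g (\<epsilon> x)" using u v by (auto simp: covers_def)
  have "covers (\<lambda>x\<in>carrier M. u x \<oplus>\<^bsub>M\<^esub> v x) (\<lambda>x\<in>carrier S. f x \<oplus>\<^bsub>S\<^esub> g x)"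
    using Hom_add[OF M.og M.og u'(1) v'(1)] Hom_add[OF S.og S.og fg] u' v' HomD(4)[OF u'(1)] HomD(4)[OF v'(1)]
    by (simp add: covers_def eps.add)
  from cls_smult_right[OF this p(1)]
  have "(\<lambda>x\<in>carrier S. f x \<oplus>\<^bsub>S\<^esub> g x) \<odot>\<^bsub>?E\<^esub> X = cls ract (compose L \<psi> (\<lambda>x\<in>carrier M. u x \<oplus>\<^bsub>M\<^esub> v x))"
    using p(2) by simp
  also have "compose L \<psi> (\<lambda>x\<in>carrier M. u x \<oplus>\<^bsub>M\<^esub> v x) = (\<lambda>x\<in>L. compose L \<psi> u x \<oplus>\<^bsub>N\<^esub> compose L \<psi> v x)"
    using covers_L[OF u] covers_L[OF v] LM p.add by (auto simp: compose_def intro!: restrict_ext)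
  also have "cls ract \<dots> = cls ract (compose L \<psi> u) \<oplus>\<^bsub>?E\<^esub> cls ract (compose L \<psi> v)"
    unfolding Ext1_right_eq
    by (rule cls_add[OF right_og right_esub covers_pre[OF u p(1)] covers_pre[OF v p(1)]])
  finally show "(f \<oplus>\<^bsub>opposite_ring (End_ring H S)\<^esub> g) \<odot>\<^bsub>?E\<^esub> X = f \<odot>\<^bsub>?E\<^esub> X \<oplus>\<^bsub>?E\<^esub> g \<odot>\<^bsub>?E\<^esub> X"
    using cls_smult_right[OF u p(1)] cls_smult_right[OF v p(1)] p(2)
    by (simp only: opposite_ring_simps End_ring_simps)
  \<comment> \<open>The product of \<open>f\<close> and \<open>g\<close> in the opposite ring is
    \<open>g\<close> after \<open>f\<close>, and so the lifts are composed in this order.\<close>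
  have "covers (compose (carrier M) v u) (compose (carrier S) g f)"
    using Hom_compose[OF u'(1) v'(1) M.og] Hom_compose[OF fg S.og] u' v' HomD(4)[OF u'(1)]
    by (simp add: covers_def compose_def)
  from cls_smult_right[OF this p(1)]
  have "compose (carrier S) g f \<odot>\<^bsub>?E\<^esub> X = cls ract (compose L \<psi> (compose (carrier M) v u))" using p(2) by simp
  also have "compose L \<psi> (compose (carrier M) v u) = compose L (compose L \<psi> v) u"
    using covers_L[OF u] LM by (auto simp: compose_def intro!: restrict_ext)
  also have "cls ract \<dots> = f \<odot>\<^bsub>?E\<^esub> (g \<odot>\<^bsub>?E\<^esub> X)"
    using cls_smult_right[OF u covers_pre[OF v p(1)]] cls_smult_right[OF v p(1)] p(2) by simp
  finally show "(f \<otimes>\<^bsub>opposite_ring (End_ring H S)\<^esub> g) \<odot>\<^bsub>?E\<^esub> X = f \<odot>\<^bsub>?E\<^esub> (g \<odot>\<^bsub>?E\<^esub> X)"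
    by (simp only: opposite_ring_simps End_ring_simps)
qed

end

section \<open>Lengths of homomorphism groups\<close>

lemma Hom_zero_iff:
  assumes "simple_module H S" "simple_module H T" "\<not> isomorphic_modules H S T" "f \<in> Hom H S T"
  shows "f = (\<lambda>x\<in>carrier S. \<zero>\<^bsub>T\<^esub>)"
  by (rule Hom_eqI[OF assms(4) Hom_zero[OF simple_moduleD(2)[OF assms(1)] simple_moduleD(2)[OF assms(2)]]])
    (use simple_iso[OF assms(1,2,4)] assms(3) in auto)

lemma len_post_simple:
  assumes S: "simple_module H S"
  shows "len (End_ring H S) (post_module H S S) 1"
proof -
  note So = simple_moduleD(2)[OF S]
  interpret V: operator_group "End_ring H S" "post_module H S S" by (rule post_operator_group[OF So So])
  interpret R: operator_group "End_ring H S" "regular_module (End_ring H S)"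
    by (intro left_module_operator_group regular_left_module End_ring_ring So)
  have "semilinear (End_ring H S) (post_module H S S) (End_ring H S) (regular_module (End_ring H S)) (\<lambda>x. x)"
    unfolding semilinear_def by (auto simp: regular_simps End_ring_simps Hom_module_simps)
  then interpret f: semilinear_map "End_ring H S" "post_module H S S" "End_ring H S" "regular_module (End_ring H S)" "\<lambda>x. x"
    by (intro semilinear_map.intro semilinear_map_axioms.intro V.operator_group_axioms R.operator_group_axioms)
  show ?thesis
    using f.len_bij[of 1] division_ring_len_regular[OF End_simple_division(1)[OF S]]
    by (simp add: regular_simps End_ring_simps Hom_module_simps bij_betw_def)
qed

text \<open>Every homomorphism from \<open>M\<close> to \<open>N\<close> factors through
  \<open>S\<close> here, so the bijection \<open>factor_bij\<close> reaches all of
  \<open>Hom(M, N)\<close>.\<close>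

lemma (in presentation) len_post_vanish:
  assumes d: "len (End_ring H N) (post_module H S N) d"
    and van: "\<And>\<eta> x. \<eta> \<in> Hom H M N \<Longrightarrow> x \<in> L \<Longrightarrow> \<eta> x = \<zero>\<^bsub>N\<^esub>"
  shows "len (End_ring H N) (post_module H M N) d"
proof -
  let ?D = "End_ring H N" and ?W = "post_module H M N" and ?S = "post_module H S N"
  let ?f = "\<lambda>g. compose (carrier M) g \<epsilon>"
  have set: "{\<eta> \<in> Hom H M N. \<forall>x\<in>L. \<eta> x = \<zero>\<^bsub>N\<^esub>} = Hom H M N" using van by blast
  have b: "bij_betw ?f (carrier ?S) (carrier ?W)"
    unfolding Hom_module_simps by (rule factor_bij[unfolded set])
  have "semilinear ?D ?S ?D ?W ?f"
    unfolding semilinear_def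
  proof (intro conjI ballI)
    show "?f \<in> carrier ?S \<rightarrow> carrier ?W" by (rule bij_betw_imp_funcset[OF b])
    show "?f (g \<oplus>\<^bsub>?S\<^esub> h) = ?f g \<oplus>\<^bsub>?W\<^esub> ?f h" for g h
      by (auto simp: Hom_module_simps compose_def intro!: restrict_ext)
  next
    have *: "?f (d \<odot>\<^bsub>?S\<^esub> g) = d \<odot>\<^bsub>?W\<^esub> ?f g" for d g
      by (auto simp: Hom_module_simps compose_def intro!: restrict_ext)
    fix d assume "d \<in> carrier ?D"
    then show "\<exists>e\<in>carrier ?D. \<forall>g\<in>carrier ?S. ?f (d \<odot>\<^bsub>?S\<^esub> g) = e \<odot>\<^bsub>?W\<^esub> ?f g"
      "\<exists>e\<in>carrier ?D. \<forall>g\<in>carrier ?S. ?f (e \<odot>\<^bsub>?S\<^esub> g) = d \<odot>\<^bsub>?W\<^esub> ?f g"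
      using * by blast+
  qed
  then interpret k: semilinear_map ?D ?S ?D ?W ?f
    by (intro semilinear_map.intro semilinear_map_axioms.intro post_operator_group S.og M.og N.og)
  show ?thesis by (rule iffD1[OF k.len_bij[OF b] d])
qed

lemma Hom_from_zero:
  assumes "operator_group H M" "operator_group H N" "carrier M = {\<zero>\<^bsub>M\<^esub>}"
  shows "Hom H M N = {\<lambda>x\<in>carrier M. \<zero>\<^bsub>N\<^esub>}"
proof -
  have "f = (\<lambda>x\<in>carrier M. \<zero>\<^bsub>N\<^esub>)" if f: "f \<in> Hom H M N" for f
  proof -
    interpret f: semilinear_map H M H N f by (intro Hom_semilinear_map assms f)
    show ?thesis by (rule Hom_eqI[OF f Hom_zero[OF assms(1,2)]]) (use assms(3) in auto)
  qed
  then show ?thesis using Hom_zero[OF assms(1,2)] by blast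
qed

lemma Hom_to_zero:
  assumes "operator_group H M" "operator_group H N" "carrier N = {\<zero>\<^bsub>N\<^esub>}"
  shows "Hom H M N = {\<lambda>x\<in>carrier M. \<zero>\<^bsub>N\<^esub>}"
proof -
  have "f = (\<lambda>x\<in>carrier M. \<zero>\<^bsub>N\<^esub>)" if f: "f \<in> Hom H M N" for f
    by (rule Hom_eqI[OF f Hom_zero[OF assms(1,2)]]) (use assms(3) HomD(4)[OF f] in auto)
  then show ?thesis using Hom_zero[OF assms(1,2)] by blast
qed

section \<open>Multiplicities\<close>

lemma composition_seriesD:
  assumes "composition_series H M c l"
  shows "c 0 = {\<zero>\<^bsub>M\<^esub>}" "c l = carrier M" "\<And>k. k \<le> l \<Longrightarrow> submodule (c k) H M"
    "\<And>k. k < l \<Longrightarrow> c k \<subseteq> c (Suc k)" "\<And>k. k < l \<Longrightarrow> simple_module H (series_factor M c k)"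
  using assms unfolding composition_series_def by blast+

lemma factor_hom:
  assumes "left_module H M" "composition_series H M c l" "k < l"
    and S: "operator_group H S" "isomorphic_modules H (series_factor M c k) S"
  obtains \<epsilon> where "\<epsilon> \<in> Hom H (M\<lparr>carrier := c (Suc k)\<rparr>) S" "\<epsilon> ` c (Suc k) = carrier S"
    "{x \<in> c (Suc k). \<epsilon> x = \<zero>\<^bsub>S\<^esub>} = c k"
proof -
  note c = composition_seriesD[OF assms(2)]
  let ?B = "M\<lparr>carrier := c (Suc k)\<rparr>" let ?Q = "quot_module ?B (c k)"
  interpret M: operator_group H M by (rule left_module_operator_group) fact
  have cs: "submodule (c (Suc k)) H M" using c(3) assms(3) by simp
  interpret B: operator_group H ?B by (rule M.sub_operator_group[OF cs])
  have sub: "submodule (c k) H ?B" using M.submodule_sub_iff[OF cs] c(3,4) assms(3) by simp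
  obtain f where f: "f \<in> Hom H ?Q S" "bij_betw f (carrier ?Q) (carrier S)"
    using S(2) unfolding isomorphic_modules_def series_factor_def by blast
  let ?p = "\<lambda>x\<in>carrier ?B. c k +>\<^bsub>?B\<^esub> x"
  interpret Q: operator_group H ?Q by (rule B.quot_operator_group[OF sub])
  interpret f: semilinear_map H ?Q H S f by (intro Hom_semilinear_map Q.operator_group_axioms S f)
  have p: "?p \<in> Hom H ?B ?Q" by (rule B.quot_proj[OF sub])
  let ?e = "compose (carrier ?B) f ?p"
  have e: "?e \<in> Hom H ?B S" by (rule Hom_compose[OF p f(1) B.operator_group_axioms])
  have ex: "?e x = f (c k +>\<^bsub>?B\<^esub> x)" if "x \<in> c (Suc k)" for x using that by (simp add: compose_def)
  have im: "?e ` c (Suc k) = carrier S"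
  proof -
    have "?e ` c (Suc k) = f ` carrier ?Q"
      unfolding B.quot_carrier[OF sub] image_image using ex by (intro image_cong) auto
    then show ?thesis using f(2) by (simp add: bij_betw_def)
  qed
  have "f.ker = {\<zero>\<^bsub>?Q\<^esub>}" using f(2) f.inj_iff by (simp add: bij_betw_def)
  then have f0: "f X = \<zero>\<^bsub>S\<^esub> \<longleftrightarrow> X = \<zero>\<^bsub>?Q\<^esub>" if "X \<in> carrier ?Q" for X
    using that unfolding f.ker_def by (auto simp: set_eq_iff)
  have "?e x = \<zero>\<^bsub>S\<^esub> \<longleftrightarrow> x \<in> c k" if x: "x \<in> c (Suc k)" for x
  proof -
    have "c k +>\<^bsub>?B\<^esub> x \<in> carrier ?Q" using x unfolding B.quot_carrier[OF sub] by simp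
    then show ?thesis unfolding ex[OF x]
      using f0 B.quot_eq_zero_iff[OF sub, of x] B.quot_zero(1)[OF sub] x by simp
  qed
  then have "{x \<in> c (Suc k). ?e x = \<zero>\<^bsub>S\<^esub>} = c k" using c(4)[OF assms(3)] by blast
  then show ?thesis using that e im by blast
qed

text \<open>The series selected inside \<open>multiplicity_in\<close> does not depend on
  \<open>T\<close>, so one and the same series yields all multiplicities in
  \<open>M\<close>.\<close>

lemma multiplicity_count:
  assumes "composition_series H M c0 l0"
  obtains c l where "composition_series H M c l"
    "\<And>T. multiplicity_in H T M = card {k. k < l \<and> isomorphic_modules H (series_factor M c k) T}"
proof -
  obtain cl where cl: "cl = (SOME (c, l). composition_series H M c l)" by simp
  have "\<exists>cl. case cl of (c, l) \<Rightarrow> composition_series H M c l" using assms by auto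
  then have cs: "case cl of (c, l) \<Rightarrow> composition_series H M c l" unfolding cl by (rule someI_ex)
  obtain c l where c: "cl = (c, l)" by (cases cl)
  have "multiplicity_in H T M = card {k. k < l \<and> isomorphic_modules H (series_factor M c k) T}" for T
    unfolding multiplicity_in_def cl[symmetric] c by simp
  moreover have "composition_series H M c l" using cs unfolding c by simp
  ultimately show ?thesis using that by blast
qed

context
  fixes H :: "('h, 'x) ring_scheme" and S :: "'n::finite \<Rightarrow> ('h, 's) module"
  assumes cs: "complete_simples H S"
begin

lemma cs_simple: "simple_module H (S i)" using cs by (simp add: complete_simples_def)

lemma cs_og: "operator_group H (S i)" by (rule simple_moduleD[OF cs_simple])

lemma cs_inj: "isomorphic_modules H (S i) (S j) \<Longrightarrow> i = j" using cs unfolding complete_simples_def by blast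

lemma cs_unique:
  assumes "simple_module H T"
  shows "\<exists>!i. isomorphic_modules H T (S i)"
proof -
  obtain i where i: "isomorphic_modules H T (S i)" using complete_simples_iso[OF cs assms] by blast
  note T = simple_moduleD(2)[OF assms]
  show ?thesis
    using i cs_inj isomorphic_modules_trans[OF cs_og isomorphic_modules_sym[OF T cs_og i]] by blast
qed

lemma sum_factors:
  fixes g :: "'n \<Rightarrow> int"
  assumes "composition_series H M c l"
    and mult: "\<And>T :: ('h, 's) module. multiplicity_in H T M = card {k. k < l \<and> isomorphic_modules H (series_factor M c k) T}"
    and idx: "\<And>k. k < l \<Longrightarrow> isomorphic_modules H (series_factor M c k) (S (idx k))"
  shows "(\<Sum>k<l. g (idx k)) = (\<Sum>i\<in>UNIV. int (multiplicity_in H (S i) M) * g i)"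
proof -
  have "{k. k < l \<and> isomorphic_modules H (series_factor M c k) (S i)} = {k \<in> {..<l}. idx k = i}" for i
    using idx cs_unique[OF composition_seriesD(5)[OF assms(1)]] by auto
  then have "int (multiplicity_in H (S i) M) * g i = (\<Sum>k\<in>{k \<in> {..<l}. idx k = i}. g (idx k))" for i
    unfolding mult by simp
  moreover have "(\<Sum>k<l. g (idx k)) = (\<Sum>i\<in>UNIV. \<Sum>k\<in>{k \<in> {..<l}. idx k = i}. g (idx k))"
    by (rule sum.group[symmetric]) auto
  ultimately show ?thesis by (simp only:)
qed

subsection \<open>Composition factors of projectives\<close>

text \<open>Unspecified until a length is known to exist, which \<open>projective_step\<close> and
  \<open>projective_cartan\<close> establish; the name allows sums of these lengths to be written
  down beforehand.\<close>

definition "lext i k = (SOME e. len (End_ring H (S k)) (Ext1_left H (S i) (S k)) e)"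

lemma lextI: "len (End_ring H (S k)) (Ext1_left H (S i) (S k)) e \<Longrightarrow> lext i k = e"
  unfolding lext_def by (rule len_unique[OF someI])

abbreviation "kron i k \<equiv> (if i = k then 1 else 0 :: int)"

lemma post_simple_len: "len (End_ring H (S k)) (post_module H (S i) (S k)) (if i = k then 1 else 0)"
proof (cases "i = k")
  case True then show ?thesis using len_post_simple[OF cs_simple, of k] by simp
next
  case False
  then have n: "\<not> isomorphic_modules H (S i) (S k)" using cs_inj by blast
  interpret V: operator_group "End_ring H (S k)" "post_module H (S i) (S k)"
    by (rule post_operator_group[OF cs_og cs_og])
  have "carrier (post_module H (S i) (S k)) = {\<zero>\<^bsub>post_module H (S i) (S k)\<^esub>}"
    using Hom_zero_iff[OF cs_simple cs_simple n] V.zero_closed unfolding Hom_module_simps by blast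
  then show ?thesis using V.len_zero_module False by simp
qed

text \<open>\<open>c (Suc t)\<close> is projective as a submodule of \<open>P\<close>; its map onto
  \<open>S (idx t)\<close> with kernel \<open>c t\<close> is a projective presentation, so the exact
  sequence of Hom and Ext relates consecutive members of the series.\<close>

lemma projective_step:
  assumes P: "simple_cover H P (S i) \<pi>" and c: "composition_series H P c l"
    and idx: "\<And>k. k < l \<Longrightarrow> isomorphic_modules H (series_factor P c k) (S (idx k))"
    and t: "t < l" and m: "len (End_ring H (S k)) (post_module H (P\<lparr>carrier := c t\<rparr>) (S k)) m"
  shows "\<exists>a. len (End_ring H (S k)) (Ext1_left H (S (idx t)) (S k)) (lext (idx t) k) \<and>
     len (End_ring H (S k)) (post_module H (P\<lparr>carrier := c (Suc t)\<rparr>) (S k)) a \<and>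
     int a + int (lext (idx t) k) = kron (idx t) k + int m"
proof -
  interpret P: simple_cover H P "S i" \<pi> by (rule P)
  note c' = composition_seriesD[OF c]
  let ?B = "P\<lparr>carrier := c (Suc t)\<rparr>"
  have sub: "submodule (c (Suc t)) H P" using c'(3) t by simp
  obtain \<epsilon> where e: "\<epsilon> \<in> Hom H ?B (S (idx t))" "\<epsilon> ` c (Suc t) = carrier (S (idx t))"
    "{x \<in> c (Suc t). \<epsilon> x = \<zero>\<^bsub>S (idx t)\<^esub>} = c t"
    by (rule factor_hom[OF P.P_left_module c t cs_og idx[OF t]])
  interpret Q: presentation H ?B "S (idx t)" "S k" \<epsilon>
    by (rule presentation.intro[OF P.sub_dual_basis[OF sub] simple_moduleD(1)[OF cs_simple]
          simple_moduleD(1)[OF cs_simple] e(1)]) (use e(2) in simp)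
  have L: "Q.L = c t" using e(3) by (simp add: Q.L_def)
  have "?B\<lparr>carrier := Q.L\<rparr> = P\<lparr>carrier := c t\<rparr>" using L by simp
  then have m': "len (End_ring H (S k)) (post_module H (?B\<lparr>carrier := Q.L\<rparr>) (S k)) m" using m by simp
  obtain x a where "len (End_ring H (S k)) (Ext1_left H (S (idx t)) (S k)) x"
    "len (End_ring H (S k)) (post_module H ?B (S k)) a" "a + x = (if idx t = k then 1 else 0) + m"
    using Q.Ext1_left_length[OF post_simple_len m'] by blast
  moreover then have "lext (idx t) k = x" by (intro lextI)
  ultimately show ?thesis by (intro exI[of _ a]) (auto split: if_splits)
qed

lemma projective_chain:
  assumes P: "simple_cover H P (S i) \<pi>" and c: "composition_series H P c l"
    and idx: "\<And>k. k < l \<Longrightarrow> isomorphic_modules H (series_factor P c k) (S (idx k))"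
    and t: "t \<le> l"
  shows "\<exists>m. len (End_ring H (S k)) (post_module H (P\<lparr>carrier := c t\<rparr>) (S k)) m \<and>
     int m = (\<Sum>s<t. kron (idx s) k - int (lext (idx s) k))"
  using t
proof (induction t)
  case 0
  interpret P: simple_cover H P "S i" \<pi> by (rule P)
  note c' = composition_seriesD[OF c]
  let ?B = "P\<lparr>carrier := c 0\<rparr>"
  have og: "operator_group H ?B" using P.OP.sub_operator_group c'(3) by simp
  interpret V: operator_group "End_ring H (S k)" "post_module H ?B (S k)"
    by (rule post_operator_group[OF og cs_og])
  have "carrier (post_module H ?B (S k)) = {\<zero>\<^bsub>post_module H ?B (S k)\<^esub>}"
    using Hom_from_zero[OF og cs_og[of k]] c'(1) by (simp add: Hom_module_simps)
  then show ?case using V.len_zero_module by (intro exI[of _ 0]) simp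
next
  case (Suc t)
  then obtain m where m: "len (End_ring H (S k)) (post_module H (P\<lparr>carrier := c t\<rparr>) (S k)) m"
    "int m = (\<Sum>s<t. kron (idx s) k - int (lext (idx s) k))" by auto
  obtain a where "len (End_ring H (S k)) (post_module H (P\<lparr>carrier := c (Suc t)\<rparr>) (S k)) a"
     "int a + int (lext (idx t) k) = kron (idx t) k + int m"
    using projective_step[OF P c idx _ m(1)] Suc.prems by auto
  then show ?case using m(2) by (intro exI[of _ a]) simp
qed

text \<open>\<open>Hom(P, S k)\<close> is \<open>Hom(S i, S k)\<close>, as homomorphisms to simple
  modules vanish on \<open>K\<close>; its length is compared with the sum that
  \<open>projective_chain\<close> gives at the end of the series. The second claim comes from the
  last factor of the series.\<close>

lemma projective_cartan:
  assumes P: "simple_cover H P (S i) \<pi>" and len: "len H P n"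
  shows "(\<Sum>j\<in>UNIV. int (multiplicity_in H (S j) P) * (kron j k - int (lext j k))) = kron i k"
    "len (End_ring H (S k)) (Ext1_left H (S i) (S k)) (lext i k)"
proof -
  interpret P: simple_cover H P "S i" \<pi> by (rule P)
  obtain c0 where "composition_series H P c0 n" using len_composition_series[OF P.P_left_module len] by blast
  then obtain c l where c: "composition_series H P c l"
    and mult: "\<And>T :: ('h, 's) module. multiplicity_in H T P = card {k. k < l \<and> isomorphic_modules H (series_factor P c k) T}"
    by (rule multiplicity_count) blast
  note c' = composition_seriesD[OF c]
  define idx where "idx k = (THE j. isomorphic_modules H (series_factor P c k) (S j))" for k
  have idx: "isomorphic_modules H (series_factor P c k) (S (idx k))" if "k < l" for k
    unfolding idx_def by (rule theI'[OF cs_unique[OF c'(5)[OF that]]])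
  interpret Q: presentation H P "S i" "S k" \<pi>
    by (rule presentation.intro[OF P.P_dual_basis simple_moduleD(1)[OF cs_simple]
          simple_moduleD(1)[OF cs_simple] P.\<pi>])
  have L: "Q.L = P.K" by (simp add: Q.L_def P.K_def)
  have d: "len (End_ring H (S k)) (post_module H P (S k)) (if i = k then 1 else 0)"
    by (rule Q.len_post_vanish[OF post_simple_len]) (use P.Hom_simple_vanish[OF cs_simple] L in blast)
  obtain m where m: "len (End_ring H (S k)) (post_module H (P\<lparr>carrier := c l\<rparr>) (S k)) m"
     "int m = (\<Sum>s<l. kron (idx s) k - int (lext (idx s) k))"
    using projective_chain[OF P c idx, of l k] by auto
  have "P\<lparr>carrier := c l\<rparr> = P" using c'(2) by simp
  then have "m = (if i = k then 1 else 0)" using len_unique[OF d] m(1) by simp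
  then have "kron i k = (\<Sum>s<l. kron (idx s) k - int (lext (idx s) k))" using m(2) by auto
  also have "\<dots> = (\<Sum>j\<in>UNIV. int (multiplicity_in H (S j) P) * (kron j k - int (lext j k)))"
    by (rule sum_factors[OF c mult idx])
  finally show "(\<Sum>j\<in>UNIV. int (multiplicity_in H (S j) P) * (kron j k - int (lext j k))) = kron i k" by simp
  have "l \<noteq> 0"
  proof
    assume "l = 0"
    then have "carrier P = {\<zero>\<^bsub>P\<^esub>}" using c'(1,2) by simp
    moreover have "\<zero>\<^bsub>P\<^esub> \<in> P.K" by (simp add: P.K_def)
    ultimately show False using P.K_neq by (auto simp: P.K_def)
  qed
  then obtain t where t: "l = Suc t" by (cases l) auto
  then have tl: "t < l" by simp
  let ?B = "P\<lparr>carrier := c (Suc t)\<rparr>"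
  have B: "?B = P" using c'(2) t by simp
  obtain \<epsilon> where e: "\<epsilon> \<in> Hom H ?B (S (idx t))" "\<epsilon> ` c (Suc t) = carrier (S (idx t))"
    "{x \<in> c (Suc t). \<epsilon> x = \<zero>\<^bsub>S (idx t)\<^esub>} = c t"
    by (rule factor_hom[OF P.P_left_module c tl cs_og idx[OF tl]])
  have eP: "\<epsilon> \<in> Hom H P (S (idx t))" using e(1) B by simp
  have "\<exists>g\<in>Hom H (S i) (S (idx t)). \<forall>x\<in>carrier P. g (\<pi> x) = \<epsilon> x"
    by (rule Hom_factor[OF P.P_og cs_og cs_og P.\<pi> eP])
      (use P.Hom_simple_vanish[OF cs_simple eP] in \<open>auto simp: P.K_def\<close>)
  then obtain g where g: "g \<in> Hom H (S i) (S (idx t))" "\<And>x. x \<in> carrier P \<Longrightarrow> g (\<pi> x) = \<epsilon> x" by blast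
  \<comment> \<open>The last factor is the top of \<open>P\<close>: the projection to it is nonzero
    and factors through \<open>S i\<close>. Hence \<open>projective_step\<close> at the last place
    concerns the extension group of \<open>S i\<close> itself.\<close>
  have "i = idx t"
  proof (rule cs_inj, rule ccontr)
    assume "\<not> isomorphic_modules H (S i) (S (idx t))"
    from Hom_zero_iff[OF cs_simple cs_simple this g(1)] have "\<epsilon> x = \<zero>\<^bsub>S (idx t)\<^esub>" if "x \<in> carrier P" for x
      using g(2)[OF that] that by simp
    then have "carrier (S (idx t)) \<subseteq> {\<zero>\<^bsub>S (idx t)\<^esub>}" unfolding e(2)[symmetric] using c'(2) t by auto
    then show False using simple_moduleD(3)[OF cs_simple] operator_group.submoduleD(2)[OF cs_og operator_group.submodule_carrier[OF cs_og]] by blast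
  qed
  moreover obtain m' where "len (End_ring H (S k)) (post_module H (P\<lparr>carrier := c t\<rparr>) (S k)) m'"
    using projective_chain[OF P c idx, of t k] t by auto
  ultimately show "len (End_ring H (S k)) (Ext1_left H (S i) (S k)) (lext i k)"
    using projective_step[OF P c idx, of t k] t by auto
qed

end

subsection \<open>Composition factors of injectives\<close>

context simple_cover
begin

abbreviation "EP \<equiv> End_ring H P"

text \<open>The two instances that matter are \<open>P\<close> and \<open>K\<close>; stability lets
  \<open>End P\<close> act by precomposition on the homomorphisms from them.\<close>

definition "end_stable Q \<longleftrightarrow> submodule Q H P \<and> (\<forall>u\<in>Hom H P P. \<forall>x\<in>Q. u x \<in> Q)"

lemma stable_P: "end_stable (carrier P)"
  using OP.submodule_carrier HomD(4) by (auto simp: end_stable_def)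

lemma stable_K: "end_stable K"
  using K_submodule End_stable by (auto simp: end_stable_def)

lemma end_stableD: "end_stable Q \<Longrightarrow> submodule Q H P" "end_stable Q \<Longrightarrow> u \<in> Hom H P P \<Longrightarrow> x \<in> Q \<Longrightarrow> u x \<in> Q"
  "end_stable Q \<Longrightarrow> operator_group H (P\<lparr>carrier := Q\<rparr>)"
  using OP.sub_operator_group by (auto simp: end_stable_def)

lemma pre_og: "end_stable Q \<Longrightarrow> operator_group H N \<Longrightarrow> operator_group EP (pre_module H P Q N)"
  by (rule pre_operator_group[OF P_og _ end_stableD(1)]) (auto intro: end_stableD)

lemma pre_compose:
  assumes Q: "end_stable Q" and X: "operator_group H X" and Y: "operator_group H Y" and e: "\<epsilon> \<in> Hom H X Y"
  shows "semilinear_map EP (pre_module H P Q X) EP (pre_module H P Q Y) (\<lambda>f. compose Q \<epsilon> f)"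
proof (intro semilinear_map.intro semilinear_map_axioms.intro pre_og Q X Y, unfold semilinear_def, intro conjI ballI)
  let ?X = "pre_module H P Q X" and ?Y = "pre_module H P Q Y"
  show "compose Q \<epsilon> \<in> carrier ?X \<rightarrow> carrier ?Y"
    using Hom_compose[OF _ e end_stableD(3)[OF Q]] by (auto simp: Hom_module_simps)
  show "compose Q \<epsilon> (f \<oplus>\<^bsub>?X\<^esub> g) = compose Q \<epsilon> f \<oplus>\<^bsub>?Y\<^esub> compose Q \<epsilon> g"
    if "f \<in> carrier ?X" "g \<in> carrier ?X" for f g
  proof -
    have "f \<in> Hom H (P\<lparr>carrier := Q\<rparr>) X" "g \<in> Hom H (P\<lparr>carrier := Q\<rparr>) X"
      using that by (simp_all add: Hom_module_simps)
    note fg = HomD(4)[OF this(1)] HomD(4)[OF this(2)]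
    show ?thesis using fg HomD(5)[OF e] by (auto simp: Hom_module_simps compose_def intro!: restrict_ext)
  qed
next
  let ?X = "pre_module H P Q X" and ?Y = "pre_module H P Q Y"
  have *: "compose Q \<epsilon> (u \<odot>\<^bsub>?X\<^esub> f) = u \<odot>\<^bsub>?Y\<^esub> compose Q \<epsilon> f" if "u \<in> carrier EP" for u f
    using end_stableD(2)[OF Q, of u] that by (auto simp: Hom_module_simps End_ring_simps compose_def intro!: restrict_ext)
  fix d assume "d \<in> carrier EP"
  then show "\<exists>e\<in>carrier EP. \<forall>x\<in>carrier ?X. compose Q \<epsilon> (d \<odot>\<^bsub>?X\<^esub> x) = e \<odot>\<^bsub>?Y\<^esub> compose Q \<epsilon> x"
    "\<exists>e\<in>carrier EP. \<forall>x\<in>carrier ?X. compose Q \<epsilon> (e \<odot>\<^bsub>?X\<^esub> x) = d \<odot>\<^bsub>?Y\<^esub> compose Q \<epsilon> x"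
    using * by blast+
qed

text \<open>\<open>Hom(Q, _)\<close> is exact because \<open>Q\<close>, as a submodule of
  \<open>P\<close>, is projective.\<close>

lemma pre_step:
  assumes Q: "end_stable Q" and X: "left_module H X" and Y: "left_module H Y" and e: "\<epsilon> \<in> Hom H X Y" "\<epsilon> ` carrier X = carrier Y"
    and m: "len EP (pre_module H P Q (X\<lparr>carrier := {x \<in> carrier X. \<epsilon> x = \<zero>\<^bsub>Y\<^esub>}\<rparr>)) m"
    and b: "len EP (pre_module H P Q Y) b"
  shows "len EP (pre_module H P Q X) (m + b)"
proof -
  note oX = left_module_operator_group[OF X] and oY = left_module_operator_group[OF Y]
  let ?X = "pre_module H P Q X" and ?Y = "pre_module H P Q Y" and ?f = "\<lambda>f. compose Q \<epsilon> f"
  let ?X' = "X\<lparr>carrier := {x \<in> carrier X. \<epsilon> x = \<zero>\<^bsub>Y\<^esub>}\<rparr>"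
  interpret f: semilinear_map EP ?X EP ?Y ?f by (rule pre_compose[OF Q oX oY e(1)])
  have surj: "?f ` carrier ?X = carrier ?Y"
  proof
    show "?f ` carrier ?X \<subseteq> carrier ?Y" by (rule image_subsetI) (rule f.closed)
    show "carrier ?Y \<subseteq> ?f ` carrier ?X"
    proof
      fix g assume "g \<in> carrier ?Y"
      then have g: "g \<in> Hom H (P\<lparr>carrier := Q\<rparr>) Y" by (simp add: Hom_module_simps)
      obtain h where h: "h \<in> Hom H (P\<lparr>carrier := Q\<rparr>) X" "\<And>q. q \<in> carrier (P\<lparr>carrier := Q\<rparr>) \<Longrightarrow> \<epsilon> (h q) = g q"
        using dual_basis_lift[OF sub_dual_basis[OF end_stableD(1)[OF Q]] X Y e g] by blast
      have "compose Q \<epsilon> h \<in> Hom H (P\<lparr>carrier := Q\<rparr>) Y"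
        using Hom_compose[OF h(1) e(1) end_stableD(3)[OF Q]] by simp
      then have "g = compose Q \<epsilon> h" using h(2) by (intro Hom_eqI[OF g]) (auto simp: compose_def)
      then show "g \<in> ?f ` carrier ?X" using h(1) by (intro image_eqI[of _ _ h]) (auto simp: Hom_module_simps)
    qed
  qed
  have "f.ker = Hom H (P\<lparr>carrier := Q\<rparr>) ?X'"
  proof
    show "f.ker \<subseteq> Hom H (P\<lparr>carrier := Q\<rparr>) ?X'"
    proof
      fix g assume "g \<in> f.ker"
      then have g: "g \<in> Hom H (P\<lparr>carrier := Q\<rparr>) X" and z: "compose Q \<epsilon> g = (\<lambda>x\<in>Q. \<zero>\<^bsub>Y\<^esub>)"
        by (simp_all add: f.ker_def Hom_module_simps)
      have "\<epsilon> (g x) = \<zero>\<^bsub>Y\<^esub>" if "x \<in> Q" for x using fun_cong[OF z, of x] that by (simp add: compose_def)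
      then show "g \<in> Hom H (P\<lparr>carrier := Q\<rparr>) ?X'"
        using Hom_codomain[OF g, of "carrier ?X'"] HomD(4)[OF g] by auto
    qed
    show "Hom H (P\<lparr>carrier := Q\<rparr>) ?X' \<subseteq> f.ker"
    proof
      fix g assume g: "g \<in> Hom H (P\<lparr>carrier := Q\<rparr>) ?X'"
      then have "g \<in> Hom H (P\<lparr>carrier := Q\<rparr>) X" by (rule Hom_codomain_sub) auto
      moreover have "compose Q \<epsilon> g = (\<lambda>x\<in>Q. \<zero>\<^bsub>Y\<^esub>)"
        using HomD(4)[OF g] by (auto simp: compose_def intro!: restrict_ext)
      ultimately show "g \<in> f.ker" by (simp add: f.ker_def Hom_module_simps)
    qed
  qed
  then have "?X\<lparr>carrier := f.ker\<rparr> = pre_module H P Q ?X'" by (simp add: Hom_module_def)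
  then show ?thesis using f.len_add[OF surj _ b, of m] m by simp
qed

lemma pre_zero:
  assumes Q: "end_stable Q" and N: "operator_group H N" "carrier N = {\<zero>\<^bsub>N\<^esub>}"
  shows "len EP (pre_module H P Q N) 0"
proof -
  interpret V: operator_group EP "pre_module H P Q N" by (rule pre_og[OF Q N(1)])
  have "carrier (pre_module H P Q N) = {\<zero>\<^bsub>pre_module H P Q N\<^esub>}"
    using Hom_to_zero[OF end_stableD(3)[OF Q] N] by (simp add: Hom_module_simps)
  then show ?thesis by (rule V.len_zero_module)
qed

text \<open>Any nonzero \<open>g\<close> is onto \<open>S\<close>, so every \<open>h\<close> lifts
  through it: \<open>h\<close> is \<open>g\<close> after some endomorphism of \<open>P\<close>. Thus
  each nonzero element generates the whole group.\<close>

lemma len_pre_self: "len EP (pre_module H P (carrier P) S) 1"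
proof -
  let ?V = "pre_module H P (carrier P) S"
  interpret V: operator_group EP ?V by (rule pre_og[OF stable_P S_og])
  have V: "carrier ?V = Hom H P S" "\<zero>\<^bsub>?V\<^esub> = (\<lambda>x\<in>carrier P. \<zero>\<^bsub>S\<^esub>)" by (simp_all add: Hom_module_simps)
  show ?thesis
  proof (rule V.len_one)
    show "carrier ?V \<noteq> {\<zero>\<^bsub>?V\<^esub>}"
    proof
      assume "carrier ?V = {\<zero>\<^bsub>?V\<^esub>}"
      then have "\<pi> = (\<lambda>x\<in>carrier P. \<zero>\<^bsub>S\<^esub>)" using \<pi>(1) V by auto
      then have "K = carrier P" unfolding K_def by auto
      then show False using K_neq by simp
    qed
    fix A assume A: "submodule A EP ?V"
    note A' = V.submoduleD[OF A]
    show "A = {\<zero>\<^bsub>?V\<^esub>} \<or> A = carrier ?V"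
    proof (rule ccontr)
      assume n: "\<not> ?thesis"
      then obtain g where g: "g \<in> A" "g \<noteq> \<zero>\<^bsub>?V\<^esub>" using A'(2) by blast
      then have gH: "g \<in> Hom H P S" using A'(6) V by auto
      have "\<exists>x\<in>carrier P. g x \<noteq> \<zero>\<^bsub>S\<^esub>" using g(2) Hom_eqI[OF gH Hom_zero[OF P_og S_og]] V(2) by auto
      then have gs: "g ` carrier P = carrier S" using simple_hom_surj[OF P_og simple gH] by blast
      have "h \<in> A" if "h \<in> carrier ?V" for h
      proof -
        have h: "h \<in> Hom H P S" using that V by simp
        obtain u where u: "u \<in> Hom H P P" "\<And>q. q \<in> carrier P \<Longrightarrow> g (u q) = h q"
          using dual_basis_lift[OF P_dual_basis P_left_module simple_moduleD(1)[OF simple] gH gs h] by blast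
        have "h = compose (carrier P) g u"
          by (rule Hom_eqI[OF h Hom_compose[OF u(1) gH P_og]]) (use u(2) in \<open>simp add: compose_def\<close>)
        then have "h = u \<odot>\<^bsub>?V\<^esub> g" by (simp add: Hom_module_simps)
        then show "h \<in> A" using A'(5)[of u g] u(1) g(1) by (simp add: End_ring_simps)
      qed
      then show False using n A'(1) by blast
    qed
  qed
qed

lemma len_pre_other:
  assumes T: "simple_module H T" "\<not> isomorphic_modules H S T"
  shows "len EP (pre_module H P (carrier P) T) 0"
proof -
  let ?V = "pre_module H P (carrier P) T"
  note To = simple_moduleD(2)[OF T(1)]
  interpret V: operator_group EP ?V by (rule pre_og[OF stable_P To])
  have "f = (\<lambda>x\<in>carrier P. \<zero>\<^bsub>T\<^esub>)" if f: "f \<in> Hom H P T" for f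
  proof -
    have "\<exists>g\<in>Hom H S T. \<forall>x\<in>carrier P. g (\<pi> x) = f x"
      by (rule Hom_factor[OF P_og S_og To \<pi> f])
        (use Hom_simple_vanish[OF T(1) f] in \<open>auto simp: K_def\<close>)
    then obtain g where g: "g \<in> Hom H S T" "\<And>x. x \<in> carrier P \<Longrightarrow> g (\<pi> x) = f x" by blast
    show ?thesis
    proof (rule Hom_eqI[OF f Hom_zero[OF P_og To]])
      fix x assume x: "x \<in> carrier P"
      have "g (\<pi> x) = \<zero>\<^bsub>T\<^esub>" using Hom_zero_iff[OF simple T g(1)] HomD(4)[OF \<pi>(1) x] by simp
      then show "f x = (\<lambda>x\<in>carrier P. \<zero>\<^bsub>T\<^esub>) x" using g(2)[OF x] x by simp
    qed
  qed
  then have "Hom H P T = {\<lambda>x\<in>carrier P. \<zero>\<^bsub>T\<^esub>}" using Hom_zero[OF P_og To] by blast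
  then have "carrier ?V = {\<zero>\<^bsub>?V\<^esub>}" by (simp add: Hom_module_simps)
  then show ?thesis by (rule V.len_zero_module)
qed

subsubsection \<open>Restriction to the kernel of the cover\<close>

lemma restrict_pre:
  assumes N: "operator_group H N"
  shows "semilinear_map EP (pre_module H P (carrier P) N) EP (pre_module H P K N) (\<lambda>f. restrict f K)"
proof (intro semilinear_map.intro semilinear_map_axioms.intro pre_og stable_P stable_K N, unfold semilinear_def, intro conjI ballI)
  let ?X = "pre_module H P (carrier P) N" and ?Y = "pre_module H P K N"
  have KP: "\<And>x. x \<in> K \<Longrightarrow> x \<in> carrier P" by (simp add: K_def)
  show "(\<lambda>f. restrict f K) \<in> carrier ?X \<rightarrow> carrier ?Y"
    using Hom_restrict[OF _ K_submodule P_og] by (auto simp: Hom_module_simps)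
  show "restrict (f \<oplus>\<^bsub>?X\<^esub> g) K = restrict f K \<oplus>\<^bsub>?Y\<^esub> restrict g K" for f g
    using KP by (auto simp: Hom_module_simps restrict_def fun_eq_iff)
  have *: "restrict (u \<odot>\<^bsub>?X\<^esub> f) K = u \<odot>\<^bsub>?Y\<^esub> restrict f K" if "u \<in> carrier EP" for u f
    using End_stable[of u] that KP
    by (auto simp: Hom_module_simps End_ring_simps compose_def restrict_def fun_eq_iff)
  fix d assume "d \<in> carrier EP"
  then show "\<exists>e\<in>carrier EP. \<forall>x\<in>carrier ?X. restrict (d \<odot>\<^bsub>?X\<^esub> x) K = e \<odot>\<^bsub>?Y\<^esub> restrict x K"
    "\<exists>e\<in>carrier EP. \<forall>x\<in>carrier ?X. restrict (e \<odot>\<^bsub>?X\<^esub> x) K = d \<odot>\<^bsub>?Y\<^esub> restrict x K"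
    using * by blast+
qed

text \<open>Injectivity of \<open>I\<close> extends homomorphisms from \<open>K\<close> to
  \<open>P\<close>; \<open>K\<close> is finitely generated by heredity, as
  \<open>injective_extend\<close> demands.\<close>

lemma restrict_surj:
  assumes I: "injective_module H I"
  shows "(\<lambda>f. restrict f K) ` carrier (pre_module H P (carrier P) I) = carrier (pre_module H P K I)"
proof -
  have Io: "operator_group H I" using I by (auto simp: injective_module_def fg_module_def intro: left_module_operator_group)
  let ?X = "pre_module H P (carrier P) I" and ?Y = "pre_module H P K I" let ?r = "\<lambda>f. restrict f K"
  interpret r: semilinear_map EP ?X EP ?Y ?r by (rule restrict_pre[OF Io])
  have KP: "\<And>x. x \<in> K \<Longrightarrow> x \<in> carrier P" by (simp add: K_def)
  have inc: "(\<lambda>x\<in>K. x) \<in> Hom H (P\<lparr>carrier := K\<rparr>) P"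
    using Hom_restrict[OF Hom_id[OF P_og] K_submodule P_og] KP by (simp add: restrict_def cong: if_cong)
  show ?thesis
  proof
    show "?r ` carrier ?X \<subseteq> carrier ?Y" by (rule image_subsetI) (rule r.closed)
    show "carrier ?Y \<subseteq> ?r ` carrier ?X"
    proof
      fix g assume "g \<in> carrier ?Y"
      then have g: "g \<in> Hom H (P\<lparr>carrier := K\<rparr>) I" by (simp add: Hom_module_simps)
      obtain h where h: "h \<in> Hom H P I" "\<And>x. x \<in> carrier (P\<lparr>carrier := K\<rparr>) \<Longrightarrow> h ((\<lambda>x\<in>K. x) x) = g x"
        using injective_extend[OF I K_fg P_fg inc _ g] by (auto simp: inj_on_def)
      have "g = restrict h K"
        by (rule Hom_eqI[OF g Hom_restrict[OF h(1) K_submodule P_og]]) (use h(2) in auto)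
      then show "g \<in> ?r ` carrier ?X" using h(1) by (intro image_eqI[of _ _ h]) (auto simp: Hom_module_simps)
    qed
  qed
qed

text \<open>A homomorphism from \<open>P\<close> to the injective envelope of \<open>T\<close> that vanishes on \<open>K\<close> takes its values in the socle.\<close>

lemma restrict_kernel_length:
  assumes I: "injective_module H I" and T: "simple_module H T" and f: "f \<in> Hom H T I" "inj_on f (carrier T)"
    and ess: "\<And>U. submodule U H I \<Longrightarrow> U \<inter> f ` carrier T = {\<zero>\<^bsub>I\<^esub>} \<Longrightarrow> U = {\<zero>\<^bsub>I\<^esub>}"
    and d: "len EP (pre_module H P (carrier P) T) d" and m: "len EP (pre_module H P K I) m"
  shows "len EP (pre_module H P (carrier P) I) (d + m)"
proof -
  have Io: "operator_group H I" using I by (auto simp: injective_module_def fg_module_def intro: left_module_operator_group)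
  note To = simple_moduleD(2)[OF T]
  let ?X = "pre_module H P (carrier P) I" and ?Y = "pre_module H P K I" let ?r = "\<lambda>f. restrict f K"
  interpret r: semilinear_map EP ?X EP ?Y ?r by (rule restrict_pre[OF Io])
  interpret f: semilinear_map H T H I f by (intro Hom_semilinear_map To Io f)
  have KP: "\<And>x. x \<in> K \<Longrightarrow> x \<in> carrier P" by (simp add: K_def)
  have rk: "r.ker = {\<phi> \<in> Hom H P I. \<forall>x\<in>K. \<phi> x = \<zero>\<^bsub>I\<^esub>}"
    unfolding r.ker_def by (auto simp: Hom_module_simps restrict_def fun_eq_iff)
  let ?U = "f ` carrier T" let ?IU = "I\<lparr>carrier := ?U\<rparr>"
  have U: "submodule ?U H I" by (rule f.image[OF f.V.submodule_carrier])
  \<comment> \<open>If \<open>\<phi> x\<close> lay outside the socle \<open>?U\<close>, the preimage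
    of the socle would be proper and contain \<open>K\<close>, hence equal \<open>K\<close>. The
    image of \<open>\<phi>\<close> would then meet the socle in zero only, and be zero by
    essentiality.\<close>
  have soc: "\<phi> x \<in> ?U" if p: "\<phi> \<in> Hom H P I" "\<forall>x\<in>K. \<phi> x = \<zero>\<^bsub>I\<^esub>" and x: "x \<in> carrier P" for \<phi> x
  proof (rule ccontr)
    assume nx: "\<phi> x \<notin> ?U"
    interpret p: semilinear_map H P H I \<phi> by (intro Hom_semilinear_map P_og Io p)
    let ?B = "{x \<in> carrier P. \<phi> x \<in> ?U}"
    have B: "submodule ?B H P" by (rule p.preimage[OF U])
    have "K \<subseteq> ?B" using p(2) f.W.submoduleD(2)[OF U] KP by auto
    then have BK: "?B = K" using K_max_cover[OF B] x nx by blast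
    have "\<phi> ` carrier P \<inter> ?U = {\<zero>\<^bsub>I\<^esub>}"
    proof
      show "\<phi> ` carrier P \<inter> ?U \<subseteq> {\<zero>\<^bsub>I\<^esub>}" using BK p(2) by blast
      show "{\<zero>\<^bsub>I\<^esub>} \<subseteq> \<phi> ` carrier P \<inter> ?U"
        using f.W.submoduleD(2)[OF U] f.W.submoduleD(2)[OF p.image[OF OP.submodule_carrier]] by blast
    qed
    then have "\<phi> ` carrier P = {\<zero>\<^bsub>I\<^esub>}" by (rule ess[OF p.image[OF OP.submodule_carrier]])
    then have "\<phi> x = \<zero>\<^bsub>I\<^esub>" using x by blast
    then show False using nx f.W.submoduleD(2)[OF U] by simp
  qed
  have IUo: "operator_group H ?IU" by (rule f.W.sub_operator_group[OF U])
  have fU: "f \<in> Hom H T ?IU" by (rule Hom_codomain[OF f(1)]) simp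
  have "bij_betw f (carrier T) (carrier ?IU)" using f(2) by (simp add: bij_betw_def)
  then obtain g where g: "g \<in> Hom H ?IU T" "\<And>y. y \<in> carrier ?IU \<Longrightarrow> f (g y) = y"
    using isomorphic_inverse[OF To IUo fU] by metis
  let ?Z = "pre_module H P (carrier P) T" and ?Ker = "?X\<lparr>carrier := r.ker\<rparr>"
  let ?c = "\<lambda>h. compose (carrier P) f h"
  interpret c: semilinear_map EP ?Z EP ?X ?c by (rule pre_compose[OF stable_P To Io f(1)])
  have cH: "?c h \<in> Hom H P I" if "h \<in> Hom H P T" for h by (rule Hom_compose[OF that f(1) P_og])
  have im: "?c ` carrier ?Z = r.ker"
  proof
    show "?c ` carrier ?Z \<subseteq> r.ker"
    proof (rule image_subsetI)
      fix h assume "h \<in> carrier ?Z"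
      then have h: "h \<in> Hom H P T" by (simp add: Hom_module_simps)
      show "?c h \<in> r.ker" unfolding rk using cH[OF h] Hom_simple_vanish[OF T h] KP by (auto simp: compose_def)
    qed
    show "r.ker \<subseteq> ?c ` carrier ?Z"
    proof
      fix \<phi> assume "\<phi> \<in> r.ker"
      then have p: "\<phi> \<in> Hom H P I" "\<forall>x\<in>K. \<phi> x = \<zero>\<^bsub>I\<^esub>" unfolding rk by auto
      have pU: "\<phi> \<in> Hom H P ?IU" using soc[OF p] by (intro Hom_codomain[OF p(1)]) auto
      have h: "compose (carrier P) g \<phi> \<in> Hom H P T" by (rule Hom_compose[OF pU g(1) P_og])
      have "\<phi> = ?c (compose (carrier P) g \<phi>)"
        by (rule Hom_eqI[OF p(1) cH[OF h]]) (use g(2) soc[OF p] in \<open>auto simp: compose_def\<close>)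
      then show "\<phi> \<in> ?c ` carrier ?Z" using h by (intro image_eqI) (auto simp: Hom_module_simps)
    qed
  qed
  have inj: "inj_on ?c (carrier ?Z)"
  proof (rule inj_onI)
    fix h h' assume "h \<in> carrier ?Z" "h' \<in> carrier ?Z" and eq: "?c h = ?c h'"
    then have h: "h \<in> Hom H P T" "h' \<in> Hom H P T" by (simp_all add: Hom_module_simps)
    show "h = h'"
    proof (rule Hom_eqI[OF h])
      fix x assume x: "x \<in> carrier P"
      have "f (h x) = f (h' x)" using fun_cong[OF eq, of x] x by (simp add: compose_def)
      then show "h x = h' x" using f(2) HomD(4)[OF h(1) x] HomD(4)[OF h(2) x] by (simp add: inj_on_eq_iff)
    qed
  qed
  have Kero: "operator_group EP ?Ker" by (rule r.V.sub_operator_group[OF r.ker_submodule])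
  have b: "bij_betw ?c (carrier ?Z) (carrier ?Ker)" using inj im by (simp add: bij_betw_def)
  have "semilinear EP ?Z EP ?Ker ?c"
    using c.f bij_betw_imp_funcset[OF b] unfolding semilinear_def by (auto simp: Hom_module_def)
  then interpret c': semilinear_map EP ?Z EP ?Ker ?c
    by (intro semilinear_map.intro semilinear_map_axioms.intro c.V.operator_group_axioms Kero)
  have "len EP ?Ker d" by (rule iffD1[OF c'.len_bij[OF b] d])
  then show ?thesis by (rule r.len_add[OF restrict_surj[OF I] _ m])
qed

text \<open>\<open>Hom(K, T)\<close> embeds into \<open>Hom(K, I)\<close>, which is a quotient of
  \<open>Hom(P, I)\<close>. With \<open>I\<close> an injective envelope of \<open>T\<close> this
  makes the second valuation finite.\<close>

lemma pre_K_finite: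
  assumes I: "injective_module H I" and T: "operator_group H T" and f: "f \<in> Hom H T I" "inj_on f (carrier T)"
    and n: "len EP (pre_module H P (carrier P) I) n"
  shows "\<exists>b. len EP (pre_module H P K T) b"
proof -
  have Io: "operator_group H I" using I by (auto simp: injective_module_def fg_module_def intro: left_module_operator_group)
  interpret r: semilinear_map EP "pre_module H P (carrier P) I" EP "pre_module H P K I" "\<lambda>f. restrict f K"
    by (rule restrict_pre[OF Io])
  obtain m where m: "len EP (pre_module H P K I) m" using r.len_surj_ex[OF restrict_surj[OF I] n] by blast
  let ?Z = "pre_module H P K T" and ?Y = "pre_module H P K I" and ?c = "\<lambda>h. compose K f h"
  interpret c: semilinear_map EP ?Z EP ?Y ?c by (rule pre_compose[OF stable_K T Io f(1)])
  let ?Im = "?Y\<lparr>carrier := ?c ` carrier ?Z\<rparr>"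
  have sub: "submodule (?c ` carrier ?Z) EP ?Y" by (rule c.image[OF c.V.submodule_carrier])
  obtain b where b: "len EP ?Im b" using r.W.len_sub_ex[OF m sub] by blast
  have "inj_on ?c (carrier ?Z)"
  proof (rule inj_onI)
    fix h h' assume "h \<in> carrier ?Z" "h' \<in> carrier ?Z" and eq: "?c h = ?c h'"
    then have h: "h \<in> Hom H (P\<lparr>carrier := K\<rparr>) T" "h' \<in> Hom H (P\<lparr>carrier := K\<rparr>) T" by (simp_all add: Hom_module_simps)
    show "h = h'"
    proof (rule Hom_eqI[OF h])
      fix x assume x: "x \<in> carrier (P\<lparr>carrier := K\<rparr>)"
      have "f (h x) = f (h' x)" using fun_cong[OF eq, of x] x by (simp add: compose_def)
      then show "h x = h' x" using f(2) HomD(4)[OF h(1) x] HomD(4)[OF h(2) x] by (simp add: inj_on_eq_iff)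
    qed
  qed
  then have bij: "bij_betw ?c (carrier ?Z) (carrier ?Im)" by (simp add: bij_betw_def)
  have "semilinear EP ?Z EP ?Im ?c"
    using c.f unfolding semilinear_def by (auto simp: Hom_module_def)
  then interpret c': semilinear_map EP ?Z EP ?Im ?c
    by (intro semilinear_map.intro semilinear_map_axioms.intro c.V.operator_group_axioms r.W.sub_operator_group[OF sub])
  show ?thesis using iffD2[OF c'.len_bij[OF bij] b] by blast
qed

text \<open>Homomorphisms from \<open>P\<close> to \<open>T\<close> vanish on \<open>K\<close>, so
  the connecting map from \<open>Hom(K, T)\<close> is bijective. Every endomorphism of
  \<open>P\<close> induces one of \<open>S\<close>, and every endomorphism of \<open>S\<close>
  lifts; this makes the map semilinear from \<open>End P\<close> to the opposite of
  \<open>End S\<close>.\<close>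

lemma Ext1_right_length:
  assumes T: "simple_module H T" and n: "len EP (pre_module H P K T) n"
  shows "len (opposite_ring (End_ring H S)) (Ext1_right H S T) n"
    "left_module (opposite_ring (End_ring H S)) (Ext1_right H S T)"
proof -
  interpret Q: presentation H P S T \<pi>
    by (rule presentation.intro[OF P_dual_basis simple_moduleD(1)[OF simple] simple_moduleD(1)[OF T] \<pi>])
  have L: "Q.L = K" by (simp add: Q.L_def K_def)
  let ?V = "pre_module H P K T" and ?W = "Ext1_right H S T" and ?O = "opposite_ring (End_ring H S)"
  show "left_module ?O ?W" by (rule Q.Ext1_right_left_module)
  note o = Q.right_og Q.right_esub
  have V: "carrier ?V = Hom H (P\<lparr>carrier := Q.L\<rparr>) T" by (simp add: Hom_module_simps L)
  have "semilinear EP ?V ?O ?W (Q.cls Q.ract)"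
    unfolding semilinear_def
  proof (intro conjI ballI)
    show "Q.cls Q.ract \<in> carrier ?V \<rightarrow> carrier ?W"
      using Q.cls_closed[OF o] unfolding V Q.Ext1_right_eq by blast
    show "Q.cls Q.ract (f \<oplus>\<^bsub>?V\<^esub> g) = Q.cls Q.ract f \<oplus>\<^bsub>?W\<^esub> Q.cls Q.ract g"
      if "f \<in> carrier ?V" "g \<in> carrier ?V" for f g
      using Q.cls_add[OF o, of f g] that unfolding V Q.Ext1_right_eq by (simp add: Hom_module_simps L)
  next
    fix u assume "u \<in> carrier EP"
    then have u: "u \<in> Hom H P P" by (simp add: End_ring_simps)
    note pu = Hom_compose[OF u \<pi>(1) P_og]
    have "\<exists>g\<in>Hom H S S. \<forall>x\<in>carrier P. g (\<pi> x) = compose (carrier P) \<pi> u x"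
      by (rule Hom_factor[OF P_og S_og S_og \<pi> pu])
        (use Hom_simple_vanish[OF simple pu] in \<open>auto simp: K_def\<close>)
    then obtain g where "g \<in> Hom H S S" "\<forall>x\<in>carrier P. g (\<pi> x) = \<pi> (u x)" by (auto simp: compose_def)
    then have cv: "Q.covers u g" "g \<in> carrier ?O" using u by (auto simp: Q.covers_def opposite_ring_simps End_ring_simps)
    then show "\<exists>e\<in>carrier ?O. \<forall>x\<in>carrier ?V. Q.cls Q.ract (u \<odot>\<^bsub>?V\<^esub> x) = e \<odot>\<^bsub>?W\<^esub> Q.cls Q.ract x"
      using Q.cls_smult_right[OF cv(1)] unfolding V by (intro bexI[of _ g]) (auto simp: Hom_module_simps L)
  next
    fix g assume "g \<in> carrier ?O"
    then have "g \<in> Hom H S S" by (simp add: opposite_ring_simps End_ring_simps)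
    then obtain u where u: "Q.covers u g" using Q.covers_ex by blast
    then have "u \<in> carrier EP" by (simp add: Q.covers_def End_ring_simps)
    then show "\<exists>d\<in>carrier EP. \<forall>x\<in>carrier ?V. Q.cls Q.ract (d \<odot>\<^bsub>?V\<^esub> x) = g \<odot>\<^bsub>?W\<^esub> Q.cls Q.ract x"
      using Q.cls_smult_right[OF u] unfolding V by (intro bexI[of _ u]) (auto simp: Hom_module_simps L)
  qed
  then interpret c: semilinear_map EP ?V ?O ?W "Q.cls Q.ract"
    by (intro semilinear_map.intro semilinear_map_axioms.intro pre_og stable_K Q.N.og Q.Ext1_right_og)
  have "c.ker = {\<zero>\<^bsub>?V\<^esub>}"
  proof
    show "c.ker \<subseteq> {\<zero>\<^bsub>?V\<^esub>}"
    proof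
      fix \<psi> assume "\<psi> \<in> c.ker"
      then have p: "\<psi> \<in> Hom H (P\<lparr>carrier := Q.L\<rparr>) T" "Q.cls Q.ract \<psi> = \<zero>\<^bsub>?W\<^esub>" by (auto simp: c.ker_def V)
      then obtain \<eta> where e: "\<eta> \<in> Hom H P T" "\<psi> = restrict \<eta> Q.L"
        using Q.cls_zero_iff[OF o p(1)] unfolding Q.Ext1_right_eq by blast
      then have "\<psi> = (\<lambda>x\<in>K. \<zero>\<^bsub>T\<^esub>)" using Hom_simple_vanish[OF T e(1)] L by auto
      then show "\<psi> \<in> {\<zero>\<^bsub>?V\<^esub>}" by (simp add: Hom_module_simps)
    qed
    show "{\<zero>\<^bsub>?V\<^esub>} \<subseteq> c.ker" using c.V.submoduleD(2)[OF c.ker_submodule] by simp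
  qed
  then have "bij_betw (Q.cls Q.ract) (carrier ?V) (carrier ?W)"
    using c.inj_iff Q.cls_surj[OF o] unfolding bij_betw_def V Q.Ext1_right_eq by blast
  from iffD1[OF c.len_bij[OF this] n] show "len ?O ?W n" .
qed

end

context
  fixes H :: "('h, 'x) ring_scheme" and S :: "'n::finite \<Rightarrow> ('h, 's) module"
  assumes cs: "complete_simples H S"
begin

lemma injective_chain:
  assumes P: "simple_cover H P (S k) \<pi>" and Q: "simple_cover.end_stable H P Q"
    and b: "\<And>i. len (End_ring H P) (pre_module H P Q (S i)) (b i)"
    and J: "left_module H J" and c: "composition_series H J c l"
    and idx: "\<And>s. s < l \<Longrightarrow> isomorphic_modules H (series_factor J c s) (S (idx s))"
    and t: "t \<le> l"
  shows "len (End_ring H P) (pre_module H P Q (J\<lparr>carrier := c t\<rparr>)) (\<Sum>s<t. b (idx s))"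
  using t
proof (induction t)
  case 0
  interpret P: simple_cover H P "S k" \<pi> by (rule P)
  note c' = composition_seriesD[OF c]
  have "operator_group H (J\<lparr>carrier := c 0\<rparr>)"
    using operator_group.sub_operator_group[OF left_module_operator_group[OF J] c'(3)] by simp
  then have "len (End_ring H P) (pre_module H P Q (J\<lparr>carrier := c 0\<rparr>)) 0"
    by (rule P.pre_zero[OF Q]) (simp add: c'(1))
  then show ?case by simp
next
  case (Suc t)
  interpret P: simple_cover H P "S k" \<pi> by (rule P)
  note c' = composition_seriesD[OF c]
  have t: "t < l" using Suc.prems by simp
  let ?X = "J\<lparr>carrier := c (Suc t)\<rparr>"
  have X: "left_module H ?X" using sub_left_module[OF J c'(3)] t by simp
  obtain \<epsilon> where e: "\<epsilon> \<in> Hom H ?X (S (idx t))" "\<epsilon> ` c (Suc t) = carrier (S (idx t))"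
    "{x \<in> c (Suc t). \<epsilon> x = \<zero>\<^bsub>S (idx t)\<^esub>} = c t"
    by (rule factor_hom[OF J c t cs_og[OF cs] idx[OF t]])
  have "?X\<lparr>carrier := {x \<in> carrier ?X. \<epsilon> x = \<zero>\<^bsub>S (idx t)\<^esub>}\<rparr> = J\<lparr>carrier := c t\<rparr>" using e(3) by simp
  then show ?case
    using P.pre_step[OF Q X simple_moduleD(1)[OF cs_simple[OF cs]] e(1) _ _ b, of "\<Sum>s<t. b (idx s)"] Suc e(2)
    by simp
qed

lemma injective_length:
  assumes P: "simple_cover H P (S k) \<pi>" and Q: "simple_cover.end_stable H P Q"
    and b: "\<And>i. len (End_ring H P) (pre_module H P Q (S i)) (b i)"
    and J: "left_module H J" and len: "len H J n"
  shows "\<exists>m. len (End_ring H P) (pre_module H P Q J) m \<and>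
     int m = (\<Sum>i\<in>UNIV. int (multiplicity_in H (S i) J) * int (b i))"
proof -
  obtain c0 where "composition_series H J c0 n" using len_composition_series[OF J len] by blast
  then obtain c l where c: "composition_series H J c l"
    and mult: "\<And>T :: ('h, 's) module. multiplicity_in H T J = card {k. k < l \<and> isomorphic_modules H (series_factor J c k) T}"
    by (rule multiplicity_count) blast
  note c' = composition_seriesD[OF c]
  define idx where "idx k = (THE j. isomorphic_modules H (series_factor J c k) (S j))" for k
  have idx: "isomorphic_modules H (series_factor J c k) (S (idx k))" if "k < l" for k
    unfolding idx_def by (rule theI'[OF cs_unique[OF cs c'(5)[OF that]]])
  have "J\<lparr>carrier := c l\<rparr> = J" using c'(2) by simp
  then have "len (End_ring H P) (pre_module H P Q J) (\<Sum>s<l. b (idx s))"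
    using injective_chain[OF P Q b J c idx order_refl] by simp
  moreover have "int (\<Sum>s<l. b (idx s)) = (\<Sum>i\<in>UNIV. int (multiplicity_in H (S i) J) * int (b i))"
    using sum_factors[OF cs c mult idx, of "\<lambda>i. int (b i)"] by simp
  ultimately show ?thesis by blast
qed

lemma pre_simple_len:
  assumes P: "simple_cover H P (S k) \<pi>"
  shows "len (End_ring H P) (pre_module H P (carrier P) (S i)) (if i = k then 1 else 0)"
proof -
  interpret P: simple_cover H P "S k" \<pi> by (rule P)
  show ?thesis
    using P.len_pre_self P.len_pre_other[OF cs_simple[OF cs]] cs_inj[OF cs] by (cases "i = k") auto
qed

end

section \<open>Relations between dimension vectors and valuations\<close>

lemma Ext1_carrier:
  "carrier (Ext1_left H M N) = carrier (Ext1_right H M N)"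
  "\<zero>\<^bsub>Ext1_left H M N\<^esub> = \<zero>\<^bsub>Ext1_right H M N\<^esub>"
  by (simp_all add: Ext1_left_def Ext1_right_def quot_module_def A_RCOSETS_def' a_r_coset_def' Hom_module_def)

text \<open>In matrix form: the dimension vectors of the \<open>P i\<close> are the rows of the
  inverse of \<open>1 - A\<close>, and those of the \<open>I j\<close> are the rows of the inverse
  of the transpose of \<open>1 - B\<close>. For the second relation \<open>Hom (P k) (I j)\<close>
  is measured twice over \<open>End (P k)\<close>, along a series of \<open>I j\<close> and by
  restriction to the kernel of the cover.\<close>

theorem cartan_relations:
  fixes R :: "'r ring" and H :: "('r, 'h) module" and S :: "'n::finite \<Rightarrow> ('h, 's) module"
    and P :: "'n \<Rightarrow> ('h, 'p) module" and I :: "'n \<Rightarrow> ('h, 'i) module"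
  assumes art: "artin_algebra R H" and hered: "hereditary H" and cs: "complete_simples H S"
    and P: "\<And>i. projective_cover H (P i) (S i)" and I: "\<And>i. injective_envelope H (I i) (S i)"
  obtains a b :: "'n \<Rightarrow> 'n \<Rightarrow> nat" where
    "\<And>i k. (\<Sum>j\<in>UNIV. dim_vector H S (P i) $ j * ((if j = k then 1 else 0) - int (a j k))) = (if i = k then 1 else 0)"
    "\<And>j k. dim_vector H S (I j) $ k = (if j = k then 1 else 0) + (\<Sum>i\<in>UNIV. dim_vector H S (I j) $ i * int (b k i))"
    "ext_quiver H S = {(i, (a i j, b i j), j) | i j. a i j \<noteq> 0}"
    "\<And>i j. a i j = 0 \<Longrightarrow> b i j = 0"
proof -
  note simp_S = cs_simple[OF cs] and og_S = cs_og[OF cs]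
  obtain n0 where n0: "len H (regular_module H) n0" using hereditary_artin_finite_length[OF art hered] by blast
  have "\<exists>\<pi>. simple_cover H (P i) (S i) \<pi>" for i
    using projective_cover_simple_cover[OF hered simp_S P] by metis
  then obtain \<pi> where cover: "\<And>i. simple_cover H (P i) (S i) (\<pi> i)" by metis
  have "\<exists>n. len H (P i) n" for i
    using fg_finite_length[OF n0] P unfolding projective_cover_def projective_module_def by blast
  then obtain lP where lP: "\<And>i. len H (P i) (lP i)" by metis
  have inj: "injective_module H (I i)" for i using I unfolding injective_envelope_def by blast
  then have fgI: "fg_module H (I i)" for i unfolding injective_module_def by blast
  then have lmI: "left_module H (I i)" for i by (simp add: fg_module_def)
  have "\<exists>n. len H (I i) n" for i using fg_finite_length[OF n0 fgI] .
  then obtain lI where lI: "\<And>i. len H (I i) (lI i)" by metis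
  have "\<exists>f\<in>Hom H (S i) (I i). inj_on f (carrier (S i)) \<and>
      (\<forall>U. submodule U H (I i) \<and> U \<inter> f ` carrier (S i) = {\<zero>\<^bsub>I i\<^esub>} \<longrightarrow> U = {\<zero>\<^bsub>I i\<^esub>})" for i
    using I unfolding injective_envelope_def by blast
  then obtain f where f: "\<And>i. f i \<in> Hom H (S i) (I i)" "\<And>i. inj_on (f i) (carrier (S i))"
    and ess: "\<And>i U. submodule U H (I i) \<Longrightarrow> U \<inter> f i ` carrier (S i) = {\<zero>\<^bsub>I i\<^esub>} \<Longrightarrow> U = {\<zero>\<^bsub>I i\<^esub>}"
    by metis
  define a where "a i k = lext H S i k" for i k
  have a: "len (End_ring H (S k)) (Ext1_left H (S i) (S k)) (a i k)" for i k
    unfolding a_def by (rule projective_cartan(2)[OF cs cover lP])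
  let ?K = "\<lambda>k. simple_cover.K (P k) (S k) (\<pi> k)" and ?E = "\<lambda>k. End_ring H (P k)"
  \<comment> \<open>Only the factors isomorphic to \<open>S k\<close> contribute to
    \<open>Hom (P k) (I j)\<close>, so its length is the multiplicity of \<open>S k\<close> in
    \<open>I j\<close>.\<close>
  have PP: "\<exists>m. len (?E k) (pre_module H (P k) (carrier (P k)) (I j)) m \<and>
      int m = (\<Sum>i\<in>UNIV. int (multiplicity_in H (S i) (I j)) * int (if i = k then 1 else 0))" for j k
    by (rule injective_length[OF cs cover simple_cover.stable_P[OF cover] pre_simple_len[OF cs cover] lmI lI])
  have "\<exists>b. len (?E k) (pre_module H (P k) (?K k) (S i)) b" for i k
    using simple_cover.pre_K_finite[OF cover inj og_S f, of k i] PP[of k i] by blast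
  then obtain b where b: "\<And>i k. len (?E k) (pre_module H (P k) (?K k) (S i)) (b k i)" by metis
  have ex: "left_module (End_ring H (S k)) (Ext1_left H (S i) (S k))" for i k
  proof -
    interpret Pi: simple_cover H "P i" "S i" "\<pi> i" by (rule cover)
    interpret Q: presentation H "P i" "S i" "S k" "\<pi> i"
      by (rule presentation.intro[OF Pi.P_dual_basis simple_moduleD(1)[OF simp_S] simple_moduleD(1)[OF simp_S] Pi.\<pi>])
    show ?thesis by (rule Q.Ext1_left_left_module)
  qed
  note br = simple_cover.Ext1_right_length[OF cover simp_S b]
  have va: "vdim (End_ring H (S k)) (Ext1_left H (S i) (S k)) = a i k" for i k
    by (rule vdim_len[OF End_simple_division(1)[OF simp_S] ex a])
  have vb: "vdim (opposite_ring (End_ring H (S i))) (Ext1_right H (S i) (S k)) = b i k" for i k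
    by (rule vdim_len[OF End_simple_division(2)[OF simp_S] br(2,1)])
  have z: "carrier (Ext1_left H (S i) (S k)) = {\<zero>\<^bsub>Ext1_left H (S i) (S k)\<^esub>} \<longleftrightarrow> a i k = 0" for i k
    using operator_group.len_0D operator_group.len_zero_module left_module_operator_group[OF ex] a len_unique[OF a] by metis
  have "(\<Sum>j\<in>UNIV. dim_vector H S (P i) $ j * ((if j = k then 1 else 0) - int (a j k))) = (if i = k then 1 else 0)" for i k
    using projective_cartan(1)[OF cs cover lP, of i k] by (simp add: dim_vector_def a_def)
  moreover have "dim_vector H S (I j) $ k = (if j = k then 1 else 0) + (\<Sum>i\<in>UNIV. dim_vector H S (I j) $ i * int (b k i))" for j k
  proof -
    obtain m where m: "len (?E k) (pre_module H (P k) (carrier (P k)) (I j)) m"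
      "int m = (\<Sum>i\<in>UNIV. int (multiplicity_in H (S i) (I j)) * int (if i = k then 1 else 0))" using PP by blast
    have m': "int m = int (multiplicity_in H (S k) (I j))"
      unfolding m(2) by (simp add: if_distrib[of int] if_distrib[of "(*) x" for x] cong: if_cong)
    obtain r where r: "len (?E k) (pre_module H (P k) (?K k) (I j)) r"
      "int r = (\<Sum>i\<in>UNIV. int (multiplicity_in H (S i) (I j)) * int (b k i))"
      using injective_length[OF cs cover simple_cover.stable_K[OF cover] b lmI lI] by blast
    have "len (?E k) (pre_module H (P k) (carrier (P k)) (I j)) ((if j = k then 1 else 0) + r)"
      by (rule simple_cover.restrict_kernel_length[OF cover inj simp_S f ess pre_simple_len[OF cs cover] r(1)])
    then have "m = (if j = k then 1 else 0) + r" using len_unique[OF m(1)] by simp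
    then show ?thesis using m' r(2) by (cases "j = k") (simp_all add: dim_vector_def)
  qed
  moreover have "ext_quiver H S = {(i, (a i j, b i j), j) | i j. a i j \<noteq> 0}"
    unfolding ext_quiver_def using va vb z by simp
  \<comment> \<open>The left and the right extension module have the same underlying group, so they
    vanish together.\<close>
  moreover have "b i j = 0" if "a i j = 0" for i j
  proof -
    have "carrier (Ext1_right H (S i) (S j)) = {\<zero>\<^bsub>Ext1_right H (S i) (S j)\<^esub>}"
      using z[of i j] that by (simp add: Ext1_carrier)
    then have "len (opposite_ring (End_ring H (S i))) (Ext1_right H (S i) (S j)) 0"
      by (rule operator_group.len_zero_module[OF left_module_operator_group[OF br(2)]])
    then show ?thesis using len_unique[OF br(1)] by blast
  qed
  ultimately show ?thesis by (rule that)
qed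

section \<open>The Coxeter transformation in coordinates\<close>

text \<open>An integer identity may be checked after casting to the reals, where one-sided inverses
  of square matrices are two-sided.\<close>

lemma int_matrix_right_inverse:
  fixes A B :: "int^'n::finite^'n"
  assumes "A ** B = mat 1" shows "B ** A = mat 1"
proof -
  let ?r = "\<lambda>M :: int^'n^'n. (\<chi> i j. real_of_int (M $ i $ j))"
  have mult: "?r (M ** N) = ?r M ** ?r N" for M N by (simp add: matrix_matrix_mult_def vec_eq_iff)
  have one: "?r (mat 1) = mat 1" by (simp add: mat_def vec_eq_iff)
  have "?r A ** ?r B = mat 1" using assms mult one by metis
  then have "?r B ** ?r A = mat 1" by (simp add: matrix_left_right_inverse)
  then have "?r (B ** A) = ?r (mat 1)" using mult one by simp
  then show ?thesis by (simp add: vec_eq_iff)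
qed

lemma additive_scale:
  fixes f :: "int^'n \<Rightarrow> int^'n"
  assumes add: "\<And>x y. f (x + y) = f x + f y"
  shows "f (c *s x) = c *s f x"
proof -
  have 0: "f 0 = 0" using add[of 0 0] by simp
  have neg: "f (- x) = - f x" for x using add[of x "- x"] 0 by (simp add: eq_neg_iff_add_eq_0 add.commute)
  have sucv: "int (Suc n) *s y = int n *s y + y" for n and y :: "int^'n" by (simp add: vec_eq_iff distrib_right)
  have nat: "f (int n *s x) = int n *s f x" for n
  proof (induction n)
    case 0 then show ?case using \<open>f 0 = 0\<close> by (simp add: vec_eq_iff zero_vec_def[symmetric])
  next
    case (Suc n) then show ?case by (simp only: sucv add)
  qed
  show ?thesis
  proof (cases c)
    case (nonneg n) then show ?thesis using nat by simp
  next
    case (neg n)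
    have "f (- (int (Suc n) *s x)) = - (int (Suc n) *s f x)" using nat[of "Suc n"] \<open>\<And>x. f (- x) = - f x\<close> by metis
    moreover have "- (int (Suc n) *s z) = c *s z" for z :: "int^'n" unfolding neg by (simp add: vec_eq_iff algebra_simps)
    ultimately show ?thesis by (simp only:)
  qed
qed

text \<open>With the \<open>p i\<close> as rows of \<open>M\<close> and the \<open>q i\<close> as
  rows of \<open>N\<close>, the relations say \<open>M X = 1\<close> and \<open>N Y = 1\<close>. So
  \<open>C\<close> sends \<open>x\<close> to \<open>- x X N\<close>, and \<open>C x = y\<close>
  means \<open>y Y = - x X\<close>. The \<open>p i\<close> form a basis of the lattice, hence only
  one additive map has the prescribed values.\<close>

lemma coxeter_characterization:
  fixes p q :: "'n::finite \<Rightarrow> int^'n" and A B :: "'n \<Rightarrow> 'n \<Rightarrow> int"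
  assumes p: "\<And>i k. (\<Sum>j\<in>UNIV. p i $ j * ((if j = k then 1 else 0) - A j k)) = (if i = k then 1 else 0)"
    and q: "\<And>j k. q j $ k = (if j = k then 1 else 0) + (\<Sum>i\<in>UNIV. q j $ i * B k i)"
    and C: "C = (THE C. (\<forall>x y. C (x + y) = C x + C y) \<and> bij C \<and> (\<forall>i. C (p i) = - q i))"
  shows "bij C"
    "C x = y \<longleftrightarrow> (\<forall>k. y $ k + x $ k = (\<Sum>j\<in>UNIV. A j k * x $ j) + (\<Sum>j\<in>UNIV. B k j * y $ j))"
proof -
  define M X N Y :: "int^'n^'n" where "M = (\<chi> i j. p i $ j)" and "X = (\<chi> j k. (if j = k then 1 else 0) - A j k)"
    and "N = (\<chi> i j. q i $ j)" and "Y = (\<chi> j k. (if j = k then 1 else 0) - B k j)"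
  have MX: "M ** X = mat 1" using p by (simp add: M_def X_def matrix_matrix_mult_def mat_def vec_eq_iff)
  have "(\<Sum>i\<in>UNIV. q j $ i * ((if i = k then 1 else 0) - B k i)) = (if j = k then 1 else 0)" for j k
    using q[of j k] by (simp add: right_diff_distrib sum_subtractf if_distrib[of "(*) x" for x] cong: if_cong)
  then have NY: "N ** Y = mat 1" by (simp add: N_def Y_def matrix_matrix_mult_def mat_def vec_eq_iff)
  have XM: "X ** M = mat 1" and YN: "Y ** N = mat 1" using MX NY int_matrix_right_inverse by blast+
  define C0 where "C0 x = - ((x v* X) v* N)" for x
  have assoc: "x v* K v* L = x v* (K ** L)" for x :: "int^'n" and K L :: "int^'n^'n"
    by (simp add: vector_matrix_mul_assoc)
  have negv: "(- x) v* K = - (x v* K)" for x :: "int^'n" and K :: "int^'n^'n"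
    by (simp add: vector_matrix_mult_def vec_eq_iff sum_negf)
  have eq: "C0 x = y \<longleftrightarrow> y v* Y = - (x v* X)" for x y
  proof
    assume "C0 x = y"
    then show "y v* Y = - (x v* X)" unfolding C0_def by (auto simp: negv assoc NY matrix_mul_assoc[symmetric])
  next
    assume "y v* Y = - (x v* X)"
    then have "y v* Y v* N = - (x v* X) v* N" by simp
    then show "C0 x = y" by (simp add: assoc YN negv C0_def)
  qed
  have add: "C0 (x + y) = C0 x + C0 y" for x y
    unfolding C0_def by (simp add: vector_matrix_left_distrib)
  have pM: "p i = axis i 1 v* M" for i by (simp add: vec_eq_iff vector_matrix_mult_def M_def axis_def if_distrib[of "\<lambda>x. x * _"] cong: if_cong)
  have qN: "q i = axis i 1 v* N" for i by (simp add: vec_eq_iff vector_matrix_mult_def N_def axis_def if_distrib[of "\<lambda>x. x * _"] cong: if_cong)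
  have Cp: "C0 (p i) = - q i" for i
    unfolding C0_def pM qN by (simp add: assoc MX)
  have bij: "bij C0"
  proof (rule bij_betw_byWitness[of _ "\<lambda>y. - ((y v* Y) v* M)"])
    show "\<forall>x\<in>UNIV. - ((C0 x v* Y) v* M) = x"
      using eq by (metis (no_types, lifting) XM assoc minus_minus negv vector_matrix_mul_rid)
    show "\<forall>y\<in>UNIV. C0 (- ((y v* Y) v* M)) = y" by (simp add: eq negv assoc MX matrix_mul_assoc[symmetric])
  qed auto
  have "C = C0"
    unfolding C
  proof (rule the_equality)
    show "(\<forall>x y. C0 (x + y) = C0 x + C0 y) \<and> bij C0 \<and> (\<forall>i. C0 (p i) = - q i)" using add bij Cp by blast
    fix C' assume C': "(\<forall>x y. C' (x + y) = C' x + C' y) \<and> bij C' \<and> (\<forall>i. C' (p i) = - q i)"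
    then have add': "\<And>x y. C' (x + y) = C' x + C' y" and Cp': "\<And>i. C' (p i) = - q i" by auto
    have sum: "C' (\<Sum>i\<in>F. g i) = (\<Sum>i\<in>F. C' (g i))" if "finite F" for F and g :: "'n \<Rightarrow> int^'n"
      using that by (induction F rule: finite_induct) (use add'[of 0 0] in \<open>simp_all add: add'\<close>)
    show "C' = C0"
    proof
      fix x
      let ?c = "x v* X"
      have "x = ?c v* M" by (simp add: assoc XM)
      also have "\<dots> = (\<Sum>i\<in>UNIV. ?c $ i *s p i)"
        by (simp add: vec_eq_iff vector_matrix_mult_def[of ?c] M_def mult.commute)
      finally have "C' x = (\<Sum>i\<in>UNIV. ?c $ i *s C' (p i))"
        using sum[of UNIV "\<lambda>i. ?c $ i *s p i"] additive_scale[OF add'] by (metis (no_types, lifting) finite sum.cong)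
      also have "\<dots> = - (?c v* N)"
        by (simp add: Cp' vec_eq_iff vector_matrix_mult_def[of ?c] N_def mult.commute sum_negf)
      finally show "C' x = C0 x" by (simp add: C0_def)
    qed
  qed
  then show "bij C" using bij by simp
  have "(y v* Y) $ k = y $ k - (\<Sum>j\<in>UNIV. B k j * y $ j)" for k
    by (simp add: vector_matrix_mult_def Y_def right_diff_distrib sum_subtractf if_distrib[of "(*) x" for x] mult.commute[of "B _ _"] cong: if_cong)
  moreover have "(x v* X) $ k = x $ k - (\<Sum>j\<in>UNIV. A j k * x $ j)" for k
    by (simp add: vector_matrix_mult_def X_def right_diff_distrib sum_subtractf if_distrib[of "(*) x" for x] mult.commute[of "A _ _"] cong: if_cong)
  ultimately have "(y v* Y) $ k = (- (x v* X)) $ k \<longleftrightarrow>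
      y $ k + x $ k = (\<Sum>j\<in>UNIV. A j k * x $ j) + (\<Sum>j\<in>UNIV. B k j * y $ j)" for k
    unfolding vector_uminus_component by (intro iffI) simp_all
  then show "C x = y \<longleftrightarrow> (\<forall>k. y $ k + x $ k = (\<Sum>j\<in>UNIV. A j k * x $ j) + (\<Sum>j\<in>UNIV. B k j * y $ j))"
    unfolding \<open>C = C0\<close> eq vec_eq_iff[of "y v* Y"] by simp
qed

text \<open>The mesh relations run over all integer times, so an orbit has to be continued backwards
  as well.\<close>

lemma two_sided_orbit:
  assumes "bij C"
  obtains x :: "int \<Rightarrow> 'a" where "x 0 = x0" "\<And>m. x (m + 1) = C (x m)" "\<And>n. x (int n) = (C ^^ n) x0"
proof -
  define x where "x m = (if m \<ge> 0 then (C ^^ nat m) x0 else (inv_into UNIV C ^^ nat (- m)) x0)" for m :: int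
  have "x (m + 1) = C (x m)" for m
  proof (cases "m \<ge> 0")
    case True
    then have "nat (m + 1) = Suc (nat m)" by simp
    then show ?thesis using True by (simp add: x_def)
  next
    case False
    then obtain n where n: "m = - int (Suc n)" by (metis int_cases not_le of_nat_0_le_iff)
    have "C (inv_into UNIV C y) = y" for y using assms by (simp add: bij_is_surj f_inv_into_f)
    then show ?thesis unfolding n x_def by (cases "n = 0") (simp_all add: nat_add_distrib)
  qed
  moreover have "x (int n) = (C ^^ n) x0" for n by (simp add: x_def)
  ultimately show ?thesis using that[of x] by (metis funpow_0 of_nat_0)
qed

section \<open>The mesh relations\<close>

text \<open>Up to sign the off-diagonal Cartan matrix: the first component of the label of the edge
  read from \<open>j\<close> to \<open>k\<close>, and 0 where there is no edge. In type E the
  consecutive nodes 4 and 5 are not joined, both being attached to 3.\<close>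

fun weight :: "dynkin_type \<Rightarrow> nat \<Rightarrow> nat \<Rightarrow> int" where
  "weight (TypeA n) j k = (if j = Suc k \<or> k = Suc j then 1 else 0)"
| "weight (TypeB n) j k = (if j = 2 \<and> k = 1 then 2 else if j = Suc k \<or> k = Suc j then 1 else 0)"
| "weight (TypeC n) j k = (if j = 1 \<and> k = 2 then 2 else if j = Suc k \<or> k = Suc j then 1 else 0)"
| "weight (TypeD n) j k = (if j = 1 \<and> k = 3 \<or> j = 3 \<and> k = 1 \<or> 2 \<le> j \<and> 2 \<le> k \<and> (j = Suc k \<or> k = Suc j) then 1 else 0)"
| "weight (TypeE n) j k =
    (if j = 3 \<and> k = 5 \<or> j = 5 \<and> k = 3 \<or> {j, k} \<noteq> {4, 5} \<and> (j = Suc k \<or> k = Suc j) then 1 else 0)"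
| "weight TypeF4 j k = (if j = 3 \<and> k = 2 then 2 else if j = Suc k \<or> k = Suc j then 1 else 0)"
| "weight TypeG2 j k = (if j = 2 \<and> k = 1 then 3 else if j = 1 \<and> k = 2 then 1 else 0)"

definition mesh :: "dynkin_type \<Rightarrow> (nat \<Rightarrow> int \<Rightarrow> int) \<Rightarrow> bool" where
  "mesh X u \<longleftrightarrow> (\<forall>k\<in>{1..type_rank X}. \<forall>t.
     u k (t + 1) + u k (t - 1) = (\<Sum>j\<in>{1..type_rank X}. weight X j k * u j t))"

text \<open>The orbits of \<open>C\<close>, read along a section \<open>\<xi>\<close> of the translation quiver, are the solutions of the mesh
  relations. These no longer depend on the orientation.\<close>

lemma coxeter_mesh:
  fixes a b :: "'n::finite \<Rightarrow> 'n \<Rightarrow> nat" and \<xi> :: "'n \<Rightarrow> int" and \<sigma> :: "'n \<Rightarrow> nat"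
  assumes bijC: "bij C"
    and C: "\<And>x y. C x = y \<longleftrightarrow> (\<forall>k. y $ k + x $ k =
      (\<Sum>j\<in>UNIV. int (a j k) * x $ j) + (\<Sum>j\<in>UNIV. int (b k j) * (y :: int^'n) $ j))"
    and \<sigma>: "bij_betw \<sigma> UNIV {1..type_rank X}"
    and weight: "\<And>j k. weight X (\<sigma> j) (\<sigma> k) = int (a j k) + int (b k j)"
    and \<xi>: "\<And>i j. a i j \<noteq> 0 \<Longrightarrow> \<xi> j = \<xi> i - 1" and b: "\<And>i j. b i j \<noteq> 0 \<Longrightarrow> a i j \<noteq> 0"
  shows "C ^^ m = id \<longleftrightarrow>
    (\<forall>u. mesh X u \<longrightarrow> (\<forall>k\<in>{1..type_rank X}. \<forall>t. u k (t + 2 * int m) = u k t))"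
proof -
  have sum: "(\<Sum>j\<in>{1..type_rank X}. g j) = (\<Sum>j\<in>UNIV. g (\<sigma> j))" for g :: "nat \<Rightarrow> int"
    using sum.reindex_bij_betw[OF \<sigma>, of g] by simp
  have mesh: "mesh X u \<longleftrightarrow> (\<forall>k t. u (\<sigma> k) (t + 1) + u (\<sigma> k) (t - 1) =
      (\<Sum>j\<in>UNIV. (int (a j k) + int (b k j)) * u (\<sigma> j) t))" for u
  proof -
    have "{1..type_rank X} = range \<sigma>" using \<sigma> by (simp add: bij_betw_def)
    then show ?thesis unfolding mesh_def sum weight by (simp add: weight)
  qed
  show ?thesis
  proof (intro iffI allI impI ballI)
    fix u k t assume Cm: "C ^^ m = id" and u: "mesh X u" and k: "k \<in> {1..type_rank X}"
    have "k \<in> range \<sigma>" using k bij_betw_imp_surj_on[OF \<sigma>] by simp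
    then obtain i where i: "k = \<sigma> i" by blast
    \<comment> \<open>Heights drop by one along arrows. At the time that belongs to the relation for
      \<open>k\<close>, the neighbours with an arrow to \<open>k\<close> are therefore read in the
      vector \<open>x n\<close>, and those with an arrow from \<open>k\<close> already in
      \<open>x (Suc n)\<close>.\<close>
    define x :: "nat \<Rightarrow> int^'n" where "x n = (\<chi> j. u (\<sigma> j) (\<xi> j + 2 * int n + (t - \<xi> i)))" for n
    have "C (x n) = x (Suc n)" for n
      unfolding C
    proof
      fix k
      let ?s = "\<xi> k + 2 * int n + 1 + (t - \<xi> i)"
      have "u (\<sigma> k) (?s + 1) + u (\<sigma> k) (?s - 1) = (\<Sum>j\<in>UNIV. (int (a j k) + int (b k j)) * u (\<sigma> j) ?s)"
        using u unfolding mesh by blast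
      also have "\<dots> = (\<Sum>j\<in>UNIV. int (a j k) * x n $ j + int (b k j) * x (Suc n) $ j)"
      proof (rule sum.cong[OF refl])
        fix j
        have "int (a j k) * u (\<sigma> j) ?s = int (a j k) * x n $ j"
        proof (cases "a j k = 0")
          case False
          then have s: "?s = \<xi> j + 2 * int n + (t - \<xi> i)" using \<xi>[OF False] by simp
          show ?thesis unfolding s x_def by simp
        qed simp
        moreover have "int (b k j) * u (\<sigma> j) ?s = int (b k j) * x (Suc n) $ j"
        proof (cases "b k j = 0")
          case False
          then have s: "?s = \<xi> j + 2 * int (Suc n) + (t - \<xi> i)" using \<xi>[OF b[OF False]] by simp
          show ?thesis unfolding s x_def by simp
        qed simp
        ultimately show "(int (a j k) + int (b k j)) * u (\<sigma> j) ?s = int (a j k) * x n $ j + int (b k j) * x (Suc n) $ j"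
          by (simp only: distrib_right)
      qed
      finally show "x (Suc n) $ k + x n $ k = (\<Sum>j\<in>UNIV. int (a j k) * x n $ j) + (\<Sum>j\<in>UNIV. int (b k j) * x (Suc n) $ j)"
        by (simp add: x_def sum.distrib algebra_simps)
    qed
    then have step: "x (Suc n) = C (x n)" for n by simp
    have orbit: "x n = (C ^^ n) (x 0)" for n
    proof (induction n)
      case (Suc n)
      show ?case unfolding step[of n] funpow.simps o_apply by (rule arg_cong[OF Suc.IH])
    qed simp
    have "x m = x 0" using orbit[of m] unfolding Cm by simp
    then have "x m $ i = x 0 $ i" by simp
    then show "u k (t + 2 * int m) = u k t" by (simp add: x_def i algebra_simps)
  next
    assume per: "\<forall>u. mesh X u \<longrightarrow> (\<forall>k\<in>{1..type_rank X}. \<forall>t. u k (t + 2 * int m) = u k t)"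
    show "C ^^ m = id"
    proof
      fix x0
      obtain x :: "int \<Rightarrow> int^'n" where x: "x 0 = x0" "\<And>m. x (m + 1) = C (x m)" "\<And>n. x (int n) = (C ^^ n) x0"
        using two_sided_orbit[OF bijC, of x0] by blast
      define \<tau> where "\<tau> = inv_into UNIV \<sigma>"
      have \<tau>: "\<tau> (\<sigma> j) = j" for j using \<sigma> by (simp add: \<tau>_def bij_betw_def)
      \<comment> \<open>The mesh relations link times of opposite parity at neighbouring nodes, so
        an orbit fills one of two independent parity classes and the other may be set to
        zero.\<close>
      define u where "u k t = (if even (t - \<xi> (\<tau> k)) then x ((t - \<xi> (\<tau> k)) div 2) $ \<tau> k else 0)" for k t
      have us: "u (\<sigma> j) (\<xi> j + 2 * r) = x r $ j" for j r by (simp add: u_def \<tau>)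
      have uo: "u (\<sigma> j) t = 0" if "odd (t - \<xi> j)" for j t using that by (simp add: u_def \<tau>)
      have "mesh X u"
        unfolding mesh
      proof (intro allI)
        fix k t
        show "u (\<sigma> k) (t + 1) + u (\<sigma> k) (t - 1) = (\<Sum>j\<in>UNIV. (int (a j k) + int (b k j)) * u (\<sigma> j) t)"
        proof (cases "even (t - \<xi> k)")
          case True
          have z: "(int (a j k) + int (b k j)) * u (\<sigma> j) t = 0" for j
          proof (cases "a j k \<noteq> 0 \<or> b k j \<noteq> 0")
            case c: True
            then have "odd (t - \<xi> j)" using \<xi>[of j k] \<xi>[OF b, of k j] True by auto
            then show ?thesis using uo by simp
          qed auto
          have "odd (t + 1 - \<xi> k)" "odd (t - 1 - \<xi> k)" using True by auto
          then have "u (\<sigma> k) (t + 1) + u (\<sigma> k) (t - 1) = 0" using uo by simp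
          moreover have "(\<Sum>j\<in>UNIV. (int (a j k) + int (b k j)) * u (\<sigma> j) t) = 0"
            by (rule sum.neutral) (use z in blast)
          ultimately show ?thesis by (simp only:)
        next
          case False
          then obtain r where r: "t - \<xi> k = 2 * r + 1" by (elim oddE)
          then have t: "t = \<xi> k + 2 * r + 1" by simp
          have "u (\<sigma> k) (t + 1) + u (\<sigma> k) (t - 1) = x (r + 1) $ k + x r $ k"
            using us[of k "r + 1"] us[of k r] unfolding t by (simp add: algebra_simps)
          also have "\<dots> = (\<Sum>j\<in>UNIV. int (a j k) * x r $ j) + (\<Sum>j\<in>UNIV. int (b k j) * x (r + 1) $ j)"
            using C[of "x r" "x (r + 1)"] x(2)[of r] by simp
          also have "\<dots> = (\<Sum>j\<in>UNIV. int (a j k) * x r $ j + int (b k j) * x (r + 1) $ j)"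
            by (simp add: sum.distrib)
          also have "\<dots> = (\<Sum>j\<in>UNIV. (int (a j k) + int (b k j)) * u (\<sigma> j) t)"
          proof (rule sum.cong[OF refl])
            fix j
            have "int (a j k) * x r $ j = int (a j k) * u (\<sigma> j) t"
            proof (cases "a j k = 0")
              case False
              then have t': "t = \<xi> j + 2 * r" using \<xi>[OF False] t by simp
              show ?thesis unfolding t' us ..
            qed simp
            moreover have "int (b k j) * x (r + 1) $ j = int (b k j) * u (\<sigma> j) t"
            proof (cases "b k j = 0")
              case False
              then have t': "t = \<xi> j + 2 * (r + 1)" using \<xi>[OF b[OF False]] t by simp
              show ?thesis unfolding t' us ..
            qed simp
            ultimately show "int (a j k) * x r $ j + int (b k j) * x (r + 1) $ j = (int (a j k) + int (b k j)) * u (\<sigma> j) t"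
              by (simp only: distrib_right)
          qed
          finally show ?thesis .
        qed
      qed
      then have "u (\<sigma> j) (\<xi> j + 2 * int m) = u (\<sigma> j) (\<xi> j)" for j
        using per bij_betw_apply[OF \<sigma>, of j] by blast
      then have "x (int m) $ j = x 0 $ j" for j using us[of j "int m"] us[of j 0] by simp
      then have "x (int m) = x 0" by (simp add: vec_eq_iff)
      then show "(C ^^ m) x0 = id x0" using x by simp
    qed
  qed
qed

section \<open>Heights on the Dynkin trees and weights of their edges\<close>

lemma orientation_section:
  fixes c :: "nat \<Rightarrow> nat \<Rightarrow> int"
  assumes "valid_type X"
  shows "\<exists>\<xi>. \<forall>j l k. (j, l, k) \<in> type_edges X \<longrightarrow> \<xi> k = \<xi> j + c j k"
proof -
  \<comment> \<open>A potential along the numbering; prescribed differences across all edges are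
    possible because the graph is a tree. The types D and E need a correction, as the edges 1 - 3
    and 3 - 5 do not join consecutive nodes.\<close>
  define s where "s k = (\<Sum>i<k. c i (Suc i))" for k
  have path: "s (Suc k) = s k + c k (Suc k)" for k by (simp add: s_def)
  have path': "s 2 = s 1 + c 1 2" "s 3 = s 2 + c 2 3" "s 4 = s 3 + c 3 4"
    using path[of 1] path[of 2] path[of 3] by (simp_all add: numeral_eq_Suc)
  show ?thesis
  proof (cases X)
    case (TypeD n)
    show ?thesis
      by (rule exI[of _ "s(1 := s 3 - c 1 3)"]) (use path path' TypeD in \<open>auto simp: path_edges_def\<close>)
  next
    case (TypeE n)
    show ?thesis
      by (rule exI[of _ "\<lambda>k. if k < 5 then s k else s k - s 5 + s 3 + c 3 5"])
        (use path path' TypeE in \<open>auto simp: path_edges_def\<close>)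
  qed (use path path' in \<open>auto simp: path_edges_def intro!: exI[of _ s]\<close>)
qed

lemma path_edges_iff: "(j, (\<alpha>, \<beta>), k) \<in> path_edges m n \<longleftrightarrow> \<alpha> = 1 \<and> \<beta> = 1 \<and> k = Suc j \<and> m \<le> j \<and> j < n"
  by (auto simp: path_edges_def)

lemma dynkin_graph_iff:
  "(j, (\<alpha>, \<beta>), k) \<in> dynkin_graph X \<longleftrightarrow> (j, (\<alpha>, \<beta>), k) \<in> type_edges X \<or> (k, (\<beta>, \<alpha>), j) \<in> type_edges X"
  by (auto simp: dynkin_graph_def underlying_graph_def)

lemma weight_edge:
  assumes "valid_type X" "(j, (\<alpha>, \<beta>), k) \<in> dynkin_graph X"
  shows "weight X j k = int \<alpha>"
  using assms by (cases X) (simp add: dynkin_graph_iff path_edges_iff; (elim disjE conjE)?; force simp: doubleton_eq_iff)+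

lemma weight_no_edge:
  assumes "valid_type X" "j \<in> {1..type_rank X}" "k \<in> {1..type_rank X}"
    and ne: "\<And>\<alpha> \<beta>. (j, (\<alpha>, \<beta>), k) \<notin> dynkin_graph X"
  shows "weight X j k = 0"
proof (rule ccontr)
  assume w: "weight X j k \<noteq> 0"
  \<comment> \<open>These five labels are the only ones that occur on Dynkin graphs, so these
    instances exhaust the absence of an edge.\<close>
  note ne = ne[of 1 1] ne[of 1 2] ne[of 2 1] ne[of 1 3] ne[of 3 1]
  note hyps = w assms(1-3) ne[unfolded dynkin_graph_iff]
  show False
  proof (cases X)
    case (TypeA n)
    show ?thesis using hyps unfolding TypeA by (simp add: path_edges_iff split: if_splits)
  next
    case (TypeB n)
    show ?thesis using hyps unfolding TypeB by (simp add: path_edges_iff split: if_splits) arith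
  next
    case (TypeC n)
    show ?thesis using hyps unfolding TypeC by (simp add: path_edges_iff split: if_splits) arith
  next
    case (TypeD n)
    show ?thesis using hyps unfolding TypeD by (simp add: path_edges_iff split: if_splits) arith
  next
    case (TypeE n)
    consider "j = 3" "k = 5" | "j = 5" "k = 3" | "k = Suc j" "j \<noteq> 4" | "j = Suc k" "k \<noteq> 4"
      using w unfolding TypeE by (auto simp: doubleton_eq_iff split: if_splits)
    then show ?thesis
    proof cases
      case 3
      then have "j = 1 \<or> j = 2 \<or> j = 3 \<or> 5 \<le> j" and "j < n" using assms(2,3) TypeE by auto
      with ne(1) 3 show ?thesis unfolding TypeE dynkin_graph_iff
        by (elim disjE) (simp_all add: path_edges_iff)
    next
      case 4
      then have "k = 1 \<or> k = 2 \<or> k = 3 \<or> 5 \<le> k" and "k < n" using assms(2,3) TypeE by auto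
      with ne(1) 4 show ?thesis unfolding TypeE dynkin_graph_iff
        by (elim disjE) (simp_all add: path_edges_iff)
    qed (use ne(1) TypeE in \<open>auto simp: dynkin_graph_iff\<close>)
  next
    case TypeF4
    have small: "x = 1 \<or> x = 2 \<or> x = 3" if "1 \<le> x" "Suc x \<le> 4" for x :: nat using that by arith
    have "k = Suc j \<or> j = Suc k" using w unfolding TypeF4 by (auto split: if_splits)
    then show ?thesis
    proof
      assume "k = Suc j"
      moreover then have "j = 1 \<or> j = 2 \<or> j = 3" using assms(2,3) small[of j] TypeF4 by simp
      ultimately show ?thesis using ne unfolding TypeF4 dynkin_graph_iff by (elim disjE) simp_all
    next
      assume "j = Suc k"
      moreover then have "k = 1 \<or> k = 2 \<or> k = 3" using assms(2,3) small[of k] TypeF4 by simp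
      ultimately show ?thesis using ne unfolding TypeF4 dynkin_graph_iff by (elim disjE) simp_all
    qed
  next
    case TypeG2
    show ?thesis using hyps unfolding TypeG2 by (simp add: path_edges_iff split: if_splits)
  qed
qed

section \<open>Periods of the solutions\<close>

text \<open>\<open>c = 1\<close> expresses a period and \<open>c = - 1\<close> an antiperiod; both
  propagate along the mesh relations in the same way.\<close>

definition quasi_periodic :: "int \<Rightarrow> int \<Rightarrow> (int \<Rightarrow> int) \<Rightarrow> bool" where
  "quasi_periodic p c f \<longleftrightarrow> (\<forall>t. f (t + p) = c * f t)"

lemma quasi_periodicD: "quasi_periodic p c f \<Longrightarrow> f (t + p) = c * f t"
  by (simp add: quasi_periodic_def)

text \<open>The shape of a mesh relation solved for one neighbour: with \<open>a = 1\<close> it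
  passes a period on from two nodes to the next one on an arm.\<close>

lemma quasi_periodic_shifts:
  assumes "quasi_periodic p c f" "quasi_periodic p c g" "\<And>t. h t = f (t + a) + f (t - a) - g t"
  shows "quasi_periodic p c h"
  unfolding quasi_periodic_def
proof
  fix t
  have "h (t + p) = f (t + a + p) + f (t - a + p) - g (t + p)" using assms(3)[of "t + p"] by (simp add: algebra_simps)
  also have "\<dots> = c * f (t + a) + c * f (t - a) - c * g t"
    by (simp only: quasi_periodicD[OF assms(1)] quasi_periodicD[OF assms(2)])
  also have "\<dots> = c * h t" by (simp add: assms(3) right_diff_distrib distrib_left)
  finally show "h (t + p) = c * h t" .
qed

lemma quasi_periodic_zero: "quasi_periodic p c (\<lambda>t. 0)"
  by (simp add: quasi_periodic_def)

lemma quasi_periodic_add: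
  assumes "quasi_periodic p c f" "quasi_periodic p c g"
  shows "quasi_periodic p c (\<lambda>t. f t + g t)"
  using assms by (simp add: quasi_periodic_def algebra_simps)

lemma antiperiodic_double: "quasi_periodic p (- 1) f \<Longrightarrow> quasi_periodic (2 * p) 1 f"
  unfolding quasi_periodic_def
proof
  fix t assume "\<forall>t. f (t + p) = - 1 * f t"
  then have "f (t + p + p) = - 1 * (- 1 * f t)" by (simp only:)
  moreover have "t + 2 * p = t + p + p" by simp
  ultimately show "f (t + 2 * p) = 1 * f t" by (simp only: mult_1 mult_minus1 minus_minus)
qed

lemma periodic_multiple: "quasi_periodic p 1 f \<Longrightarrow> quasi_periodic (p * n) 1 f" for n :: int
proof (induction n rule: int_induct[where k = 0])
  case (step1 i)
  then show ?case unfolding quasi_periodic_def by (metis (no_types, opaque_lifting) add.assoc distrib_left mult.right_neutral mult_1)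
next
  case (step2 i)
  then show ?case unfolding quasi_periodic_def
    by (metis (no_types, opaque_lifting) diff_add_cancel add.assoc right_diff_distrib mult.right_neutral mult_1)
qed (simp add: quasi_periodic_def)

lemma periodic_gcd:
  assumes "quasi_periodic p 1 f" "quasi_periodic q 1 f"
  shows "quasi_periodic (gcd p q) 1 f"
proof -
  obtain x y where xy: "x * p + y * q = gcd p q" using bezout_int by blast
  have "f (t + (x * p + y * q)) = f t" for t
    using periodic_multiple[OF assms(1), of x] periodic_multiple[OF assms(2), of y]
    unfolding quasi_periodic_def by (metis (no_types, opaque_lifting) add.assoc mult.commute mult_1)
  then show ?thesis unfolding xy by (simp add: quasi_periodic_def)
qed

text \<open>The simplest function with antiperiod \<open>N\<close>, supported on the multiples of
  \<open>N\<close> with alternating signs. Combinations of its shifts are the test solutions for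
  exactness.\<close>

definition impulse :: "int \<Rightarrow> int \<Rightarrow> int" where
  "impulse N t = (if 2 * N dvd t then 1 else if N dvd t then - 1 else 0)"

lemma impulse_antiperiodic:
  assumes "N > 0" shows "quasi_periodic N (- 1) (impulse N)"
  unfolding quasi_periodic_def
proof
  fix t
  show "impulse N (t + N) = - 1 * impulse N t"
  proof (cases "N dvd t")
    case True
    then obtain r where "t = N * r" by auto
    moreover have "2 * N dvd N * x \<longleftrightarrow> even x" for x using assms by (metis dvd_times_left_cancel_iff less_irrefl mult.commute)
    moreover have "N \<noteq> 0" using assms by simp
    moreover have "t + N = N * (r + 1)" using \<open>t = N * r\<close> by (simp add: algebra_simps)
    ultimately show ?thesis by (simp add: impulse_def)
  next
    case False
    then have "\<not> 2 * N dvd t" "\<not> 2 * N dvd t + N" "\<not> N dvd t + N"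
      by (auto dest: dvd_mult_right)
    with False show ?thesis by (simp add: impulse_def)
  qed
qed

subsection \<open>Paths\<close>

text \<open>The discrete wave equation with a fixed end. In terms of the shift, \<open>v i\<close>
  is a Chebyshev polynomial of the second kind applied to \<open>v 1\<close>, which expands into a
  sum of equally spaced shifts.\<close>

lemma chain_solution:
  fixes v :: "nat \<Rightarrow> int \<Rightarrow> int"
  assumes "\<And>t. v 0 t = 0" "\<And>i t. \<lbrakk>1 \<le> i; i < M\<rbrakk> \<Longrightarrow> v (Suc i) t = v i (t + 1) + v i (t - 1) - v (i - 1) t"
  shows "i \<le> M \<Longrightarrow> v i t = (\<Sum>l<i. v 1 (t - int i + 1 + 2 * int l))"
proof (induction i arbitrary: t rule: less_induct)
  case (less i)
  consider "i = 0" | "i = 1" | j where "i = Suc (Suc j)" by (metis One_nat_def not0_implies_Suc)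
  then show ?case
  proof cases
    case (3 j)
    have "v i t = v (Suc j) (t + 1) + v (Suc j) (t - 1) - v j t" using assms(2)[of "Suc j" t] less.prems 3 by simp
    also have "v (Suc j) (t + 1) = (\<Sum>l<Suc j. v 1 (t + 1 - int (Suc j) + 1 + 2 * int l))"
      using less.IH[of "Suc j" "t + 1"] less.prems 3 by simp
    also have "\<dots> = (\<Sum>l<j. v 1 (t - int j + 1 + 2 * int l)) + v 1 (t + 1 + int j)"
      by (simp add: algebra_simps)
    also have "v (Suc j) (t - 1) = (\<Sum>l<Suc j. v 1 (t - 1 - int (Suc j) + 1 + 2 * int l))"
      using less.IH[of "Suc j" "t - 1"] less.prems 3 by simp
    also have "v j t = (\<Sum>l<j. v 1 (t - int j + 1 + 2 * int l))"
      using less.IH[of j t] less.prems 3 by simp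
    finally have "v i t = (\<Sum>l<Suc j. v 1 (t - 1 - int (Suc j) + 1 + 2 * int l)) + v 1 (t + 1 + int j)" by simp
    then show ?thesis using 3 by (simp add: algebra_simps)
  qed (simp_all add: assms(1))
qed

lemma quasi_periodic_chain:
  fixes v :: "nat \<Rightarrow> int \<Rightarrow> int"
  assumes "\<And>t. v 0 t = 0" "\<And>i t. \<lbrakk>1 \<le> i; i < M\<rbrakk> \<Longrightarrow> v (Suc i) t = v i (t + 1) + v i (t - 1) - v (i - 1) t"
    and "quasi_periodic p c (v 1)"
  shows "i \<le> M \<Longrightarrow> quasi_periodic p c (v i)"
  unfolding quasi_periodic_def
proof
  fix t assume i: "i \<le> M"
  have "v 1 (t + p - int i + 1 + 2 * int l) = c * v 1 (t - int i + 1 + 2 * int l)" for l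
    using quasi_periodicD[OF assms(3), of "t - int i + 1 + 2 * int l"] by (simp add: algebra_simps)
  then show "v i (t + p) = c * v i t"
    using chain_solution[of v M, OF assms(1,2) i] by (simp add: sum_distrib_left)
qed

lemma sum_shift: "(\<Sum>l<k. g (s + 2 + 2 * int l)) + g s = (\<Sum>l<k. g (s + 2 * int l)) + g (s + 2 * int k)"
  for g :: "int \<Rightarrow> int"
  by (induction k) (simp_all add: algebra_simps)

text \<open>Vanishing at \<open>Suc n\<close> says that any \<open>n + 1\<close> values of
  \<open>v 1\<close> at distance 2 add up to zero. Moving this window by one place exchanges its
  first value for the one after its last, so these two are equal.\<close>

lemma closed_chain_periodic:
  fixes v :: "nat \<Rightarrow> int \<Rightarrow> int"
  assumes v: "\<And>t. v 0 t = 0" "\<And>i t. \<lbrakk>1 \<le> i; i < Suc n\<rbrakk> \<Longrightarrow> v (Suc i) t = v i (t + 1) + v i (t - 1) - v (i - 1) t"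
    and z: "\<And>t. v (Suc n) t = 0" and i: "i \<le> Suc n"
  shows "quasi_periodic (2 * (int n + 1)) 1 (v i)"
proof (rule quasi_periodic_chain[of v "Suc n", OF v _ i])
  show "quasi_periodic (2 * (int n + 1)) 1 (v 1)"
    unfolding quasi_periodic_def
  proof
    fix t
    have s: "(\<Sum>l<Suc n. v 1 (r - int n + 2 * int l)) = 0" for r
      using chain_solution[of v "Suc n", OF v order_refl, of r] z[of r] by simp
    show "v 1 (t + 2 * (int n + 1)) = 1 * v 1 t"
      using sum_shift[of "v 1" t "Suc n"] s[of "t + 2 + int n"] s[of "t + int n"] by (simp add: algebra_simps)
  qed
qed

text \<open>The end relation with the factor 2 is that of a path continued by reflection at
  \<open>Suc n\<close>. Inserting the sums of \<open>chain_solution\<close> leaves just two values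
  of \<open>v 1\<close>, which must cancel.\<close>

lemma folded_chain_antiperiodic:
  fixes v :: "nat \<Rightarrow> int \<Rightarrow> int"
  assumes v: "\<And>t. v 0 t = 0" "\<And>i t. \<lbrakk>1 \<le> i; i < Suc n\<rbrakk> \<Longrightarrow> v (Suc i) t = v i (t + 1) + v i (t - 1) - v (i - 1) t"
    and e: "\<And>t. v (Suc n) (t + 1) + v (Suc n) (t - 1) = 2 * v n t" and i: "i \<le> Suc n"
  shows "quasi_periodic (2 * int (Suc n)) (- 1) (v i)"
proof (rule quasi_periodic_chain[of v "Suc n", OF v _ i])
  show "quasi_periodic (2 * int (Suc n)) (- 1) (v 1)"
    unfolding quasi_periodic_def
  proof
    fix t
    let ?r = "t + int (Suc n)"
    have "v (Suc n) (?r + 1) = (\<Sum>l<Suc n. v 1 (t + 2 + 2 * int l))"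
      using chain_solution[of v "Suc n", OF v order_refl, of "?r + 1"] by (simp add: algebra_simps)
    moreover have "v (Suc n) (?r - 1) = (\<Sum>l<Suc n. v 1 (t + 2 * int l))"
      using chain_solution[of v "Suc n", OF v order_refl, of "?r - 1"] by (simp add: algebra_simps)
    moreover have "v n ?r = (\<Sum>l<n. v 1 (t + 2 + 2 * int l))"
      using chain_solution[of v "Suc n" n, OF v, of ?r] by (simp add: algebra_simps)
    moreover have "(\<Sum>l<Suc n. v 1 (t + 2 + 2 * int l)) = (\<Sum>l<n. v 1 (t + 2 + 2 * int l)) + v 1 (t + 2 + 2 * int n)"
      by simp
    ultimately have "v 1 (t + 2 + 2 * int n) + v 1 t = 0"
      using e[of ?r] sum_shift[of "v 1" t "Suc n"] by (simp add: algebra_simps)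
    then show "v 1 (t + 2 * int (Suc n)) = - 1 * v 1 t" by (simp add: algebra_simps)
  qed
qed

section \<open>The mesh relations of the classical types\<close>

lemma sum_adjacent:
  fixes f :: "nat \<Rightarrow> int"
  assumes "k \<ge> 1"
  shows "(\<Sum>j\<in>{a..n}. (if j = Suc k \<or> k = Suc j then 1 else 0) * f j) =
    (if a \<le> Suc k \<and> Suc k \<le> n then f (Suc k) else 0) + (if a \<le> k - 1 \<and> k - 1 \<le> n then f (k - 1) else 0)"
proof -
  have "(if j = Suc k \<or> k = Suc j then 1 else 0) * f j =
      (if j = Suc k then f j else 0) + (if j = k - 1 then f j else 0)" for j
    using assms by auto
  then show ?thesis by (simp add: sum.distrib)
qed

lemma sum_point:
  fixes f :: "nat \<Rightarrow> int"
  shows "(\<Sum>j\<in>{a..n}. (if j = m \<and> Q then 1 else 0) * f j) = (if a \<le> m \<and> m \<le> n \<and> Q then f m else 0)"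
proof -
  have "(if j = m \<and> Q then 1 else 0) * f j = (if j = m then if Q then f j else 0 else 0)" for j by auto
  then show ?thesis by simp
qed

lemma mesh_A:
  "mesh (TypeA n) u \<longleftrightarrow> (\<forall>k\<in>{1..n}. \<forall>t. u k (t + 1) + u k (t - 1) =
     (if k < n then u (Suc k) t else 0) + (if 1 < k then u (k - 1) t else 0))"
  unfolding mesh_def type_rank.simps
proof (rule ball_cong[OF refl])
  fix k assume "k \<in> {1..n}"
  then have k: "1 \<le> k" "k \<le> n" by auto
  show "(\<forall>t. u k (t + 1) + u k (t - 1) = (\<Sum>j\<in>{1..n}. weight (TypeA n) j k * u j t)) \<longleftrightarrow>
      (\<forall>t. u k (t + 1) + u k (t - 1) = (if k < n then u (Suc k) t else 0) + (if 1 < k then u (k - 1) t else 0))"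
    using sum_adjacent[OF k(1), where a = 1 and n = n and f = "\<lambda>j. u j _"] k by (auto simp: Suc_le_eq)
qed

lemma mesh_B:
  assumes "n \<ge> 2"
  shows "mesh (TypeB n) u \<longleftrightarrow> (\<forall>k\<in>{1..n}. \<forall>t. u k (t + 1) + u k (t - 1) =
     (if k = 1 then 2 * u 2 t else (if k < n then u (Suc k) t else 0) + u (k - 1) t))"
  unfolding mesh_def type_rank.simps
proof (rule ball_cong[OF refl])
  fix k assume "k \<in> {1..n}"
  then have k: "1 \<le> k" "k \<le> n" by auto
  have "weight (TypeB n) j k = (if j = Suc k \<or> k = Suc j then 1 else 0) + (if j = 2 \<and> k = 1 then 1 else 0)" for j by auto
  then have "(\<Sum>j\<in>{1..n}. weight (TypeB n) j k * u j t) =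
     (if k = 1 then 2 * u 2 t else (if k < n then u (Suc k) t else 0) + u (k - 1) t)" for t
    using sum_adjacent[OF k(1), where a = 1 and n = n and f = "\<lambda>j. u j t"] sum_point[where a = 1 and n = n and m = 2 and Q = "k = 1" and f = "\<lambda>j. u j t"] k assms
    by (auto simp: distrib_right sum.distrib Suc_le_eq numeral_2_eq_2)
  then show "(\<forall>t. u k (t + 1) + u k (t - 1) = (\<Sum>j\<in>{1..n}. weight (TypeB n) j k * u j t)) \<longleftrightarrow>
      (\<forall>t. u k (t + 1) + u k (t - 1) = (if k = 1 then 2 * u 2 t else (if k < n then u (Suc k) t else 0) + u (k - 1) t))"
    by (simp del: weight.simps)
qed

lemma mesh_C:
  assumes "n \<ge> 2"
  shows "mesh (TypeC n) u \<longleftrightarrow> (\<forall>k\<in>{1..n}. \<forall>t. u k (t + 1) + u k (t - 1) =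
     (if k < n then u (Suc k) t else 0) + (if k = 1 then 0 else if k = 2 then 2 * u 1 t else u (k - 1) t))"
  unfolding mesh_def type_rank.simps
proof (rule ball_cong[OF refl])
  fix k assume "k \<in> {1..n}"
  then have k: "1 \<le> k" "k \<le> n" by auto
  have "weight (TypeC n) j k = (if j = Suc k \<or> k = Suc j then 1 else 0) + (if j = 1 \<and> k = 2 then 1 else 0)" for j by auto
  then have "(\<Sum>j\<in>{1..n}. weight (TypeC n) j k * u j t) =
     (if k < n then u (Suc k) t else 0) + (if k = 1 then 0 else if k = 2 then 2 * u 1 t else u (k - 1) t)" for t
    using sum_adjacent[OF k(1), where a = 1 and n = n and f = "\<lambda>j. u j t"] sum_point[where a = 1 and n = n and m = 1 and Q = "k = 2" and f = "\<lambda>j. u j t"] k assms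
    by (auto simp: distrib_right sum.distrib Suc_le_eq numeral_2_eq_2)
  then show "(\<forall>t. u k (t + 1) + u k (t - 1) = (\<Sum>j\<in>{1..n}. weight (TypeC n) j k * u j t)) \<longleftrightarrow>
      (\<forall>t. u k (t + 1) + u k (t - 1) =
       (if k < n then u (Suc k) t else 0) + (if k = 1 then 0 else if k = 2 then 2 * u 1 t else u (k - 1) t))"
    by (simp del: weight.simps)
qed

lemma mesh_D:
  assumes "n \<ge> 4"
  shows "mesh (TypeD n) u \<longleftrightarrow> (\<forall>k\<in>{1..n}. \<forall>t. u k (t + 1) + u k (t - 1) =
     (if k = 1 then u 3 t else (if k < n then u (Suc k) t else 0) +
       (if k = 2 then 0 else if k = 3 then u 1 t + u 2 t else u (k - 1) t)))"
  unfolding mesh_def type_rank.simps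
proof (rule ball_cong[OF refl])
  fix k assume "k \<in> {1..n}"
  then have k: "1 \<le> k" "k \<le> n" by auto
  have split: "(\<Sum>j\<in>{1..n}. f j) = f 1 + (\<Sum>j\<in>{2..n}. f j)" for f :: "nat \<Rightarrow> int"
    using assms sum.atLeast_Suc_atMost[of 1 n f] by (simp add: numeral_2_eq_2)
  have "(\<Sum>j\<in>{1..n}. weight (TypeD n) j k * u j t) =
     (if k = 1 then u 3 t else (if k < n then u (Suc k) t else 0) +
       (if k = 2 then 0 else if k = 3 then u 1 t + u 2 t else u (k - 1) t))" for t
  proof (cases "k = 1")
    case True
    have "(\<Sum>j\<in>{2..n}. weight (TypeD n) j k * u j t) = (\<Sum>j\<in>{2..n}. (if j = 3 \<and> True then 1 else 0) * u j t)"
      using True by (intro sum.cong) auto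
    then show ?thesis unfolding split sum_point using True assms by simp
  next
    case False
    have "(\<Sum>j\<in>{2..n}. weight (TypeD n) j k * u j t) = (\<Sum>j\<in>{2..n}. (if j = Suc k \<or> k = Suc j then 1 else 0) * u j t)"
      using False k by (intro sum.cong) auto
    then show ?thesis unfolding split sum_adjacent[OF k(1)] using False k assms by auto
  qed
  then show "(\<forall>t. u k (t + 1) + u k (t - 1) = (\<Sum>j\<in>{1..n}. weight (TypeD n) j k * u j t)) \<longleftrightarrow>
      (\<forall>t. u k (t + 1) + u k (t - 1) =
       (if k = 1 then u 3 t else (if k < n then u (Suc k) t else 0) +
         (if k = 2 then 0 else if k = 3 then u 1 t + u 2 t else u (k - 1) t)))"
    by (simp del: weight.simps)
qed

section \<open>Periods in the classical types\<close>

lemma period_A: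
  assumes u: "mesh (TypeA n) u" and k: "k \<in> {1..n}"
  shows "quasi_periodic (2 * (int n + 1)) 1 (u k)"
proof -
  \<comment> \<open>Nodes \<open>0\<close> and \<open>n + 1\<close> are added with value zero, so
    that the end relations take the form of the inner ones.\<close>
  define v where "v i = (if 1 \<le> i \<and> i \<le> n then u i else (\<lambda>t. 0))" for i
  have "quasi_periodic (2 * (int n + 1)) 1 (v k)"
  proof (rule closed_chain_periodic)
    fix i t assume i: "1 \<le> i" "i < Suc n"
    then have "u i (t + 1) + u i (t - 1) = (if i < n then u (Suc i) t else 0) + (if 1 < i then u (i - 1) t else 0)"
      using u unfolding mesh_A by simp
    then show "v (Suc i) t = v i (t + 1) + v i (t - 1) - v (i - 1) t" using i by (auto simp: v_def)
  qed (use k in \<open>auto simp: v_def\<close>)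
  then show ?thesis using k by (simp add: v_def)
qed

lemma period_B:
  assumes n: "n \<ge> 2" and u: "mesh (TypeB n) u" and k: "k \<in> {1..n}"
  shows "quasi_periodic (4 * int n) 1 (u k)"
proof -
  obtain N where N: "n = Suc N" using n by (cases n) auto
  \<comment> \<open>The numbering is reversed: the chain starts at the free end \<open>n\<close>,
    and the edge between 1 and 2 with its label becomes the folded end.\<close>
  define v where "v i = (if i = 0 then (\<lambda>t. 0) else u (Suc n - i))" for i
  have m: "u k (t + 1) + u k (t - 1) = (if k = 1 then 2 * u 2 t else (if k < n then u (Suc k) t else 0) + u (k - 1) t)"
    if "1 \<le> k" "k \<le> n" for k t using u that unfolding mesh_B[OF n] by simp
  have "quasi_periodic (2 * int (Suc N)) (- 1) (v (Suc n - k))"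
  proof (rule folded_chain_antiperiodic)
    fix i t assume i: "1 \<le> i" "i < Suc N"
    then have "Suc n - i \<noteq> 1" "1 \<le> Suc n - i" "Suc n - i \<le> n" using N by auto
    moreover have "Suc (Suc n - i) = Suc n - (i - 1)" "Suc n - i - 1 = Suc n - Suc i" using i N by auto
    ultimately show "v (Suc i) t = v i (t + 1) + v i (t - 1) - v (i - 1) t"
      using m[of "Suc n - i" t] i N by (auto simp: v_def)
  next
    fix t
    have "Suc n - N = 2" using N by simp
    then show "v (Suc N) (t + 1) + v (Suc N) (t - 1) = 2 * v N t" using m[of 1 t] N n by (auto simp: v_def)
  qed (use k N in \<open>auto simp: v_def\<close>)
  then have "quasi_periodic (2 * int (Suc N)) (- 1) (u k)" using k by (simp add: v_def)
  from antiperiodic_double[OF this] show ?thesis using N by (simp add: algebra_simps)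
qed

lemma period_C:
  assumes n: "n \<ge> 2" and u: "mesh (TypeC n) u" and k: "k \<in> {1..n}"
  shows "quasi_periodic (4 * int n) 1 (u k)"
proof -
  obtain N where N: "n = Suc N" using n by (cases n) auto
  \<comment> \<open>Doubling the component at node 1 turns these relations into those of type B,
    with the same reversed numbering.\<close>
  define v where "v i = (if i = 0 then (\<lambda>t. 0) else if i = n then (\<lambda>t. 2 * u 1 t) else u (Suc n - i))" for i
  have m: "u k (t + 1) + u k (t - 1) =
     (if k < n then u (Suc k) t else 0) + (if k = 1 then 0 else if k = 2 then 2 * u 1 t else u (k - 1) t)"
    if "1 \<le> k" "k \<le> n" for k t using u that unfolding mesh_C[OF n] by simp
  have "quasi_periodic (2 * int (Suc N)) (- 1) (v (Suc n - k))"
  proof (rule folded_chain_antiperiodic)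
    fix i t assume i: "1 \<le> i" "i < Suc N"
    then have "Suc n - i \<noteq> 1" "1 \<le> Suc n - i" "Suc n - i \<le> n" using N by auto
    note 1 = this
    have 2: "Suc (Suc n - i) = Suc n - (i - 1)" "Suc n - i - 1 = Suc n - Suc i" "(Suc n - i = 2) = (Suc i = n)"
      using i N by auto
    have "v i = u (Suc n - i)" "v (i - 1) t = (if Suc n - i < n then u (Suc n - (i - 1)) t else 0)"
      "v (Suc i) t = (if Suc i = n then 2 * u 1 t else u (Suc n - Suc i) t)"
      using i N by (auto simp: v_def)
    with m[OF 1(2,3), of t] show "v (Suc i) t = v i (t + 1) + v i (t - 1) - v (i - 1) t"
      unfolding if_not_P[OF 1(1)] 2 by simp
  next
    fix t
    have "Suc n - N = 2" using N by simp
    then show "v (Suc N) (t + 1) + v (Suc N) (t - 1) = 2 * v N t"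
      using m[of 1 t] N n by (auto simp: v_def numeral_2_eq_2)
  qed (use k N in \<open>auto simp: v_def\<close>)
  moreover have "v (Suc n - k) = (if k = 1 then (\<lambda>t. 2 * u 1 t) else u k)" using k n by (auto simp: v_def)
  ultimately have "quasi_periodic (2 * int (Suc N)) (- 1) (u k)"
    by (auto simp: quasi_periodic_def split: if_splits)
  from antiperiodic_double[OF this] show ?thesis using N by (simp add: algebra_simps)
qed

text \<open>The sum and the difference of the components on the two short arms decouple: the sum
  ends a folded chain of length \<open>n - 1\<close>, the difference obeys a relation of its own.
  Periods of both give that of \<open>u 1\<close> and \<open>u 2\<close>.\<close>

lemma period_D:
  assumes n: "n \<ge> 4" and u: "mesh (TypeD n) u" and k: "k \<in> {1..n}"
  shows "quasi_periodic (4 * (int n - 1)) 1 (u k)"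
proof -
  have N': "n = Suc (Suc (n - 2))" using n by simp
  then obtain N where N: "n = Suc (Suc N)" ..
  define v where "v i = (if i = 0 then (\<lambda>t. 0) else if i = Suc N then (\<lambda>t. u 1 t + u 2 t) else u (Suc n - i))" for i
  have m: "u k (t + 1) + u k (t - 1) = (if k = 1 then u 3 t else (if k < n then u (Suc k) t else 0) +
       (if k = 2 then 0 else if k = 3 then u 1 t + u 2 t else u (k - 1) t))"
    if "1 \<le> k" "k \<le> n" for k t using u that unfolding mesh_D[OF n] by simp
  have v: "quasi_periodic (2 * int (Suc N)) (- 1) (v i)" if "i \<le> Suc N" for i
  proof (rule folded_chain_antiperiodic[OF _ _ _ that])
    fix i t assume i: "1 \<le> i" "i < Suc N"
    then have 1: "Suc n - i \<noteq> 1" "Suc n - i \<noteq> 2" "1 \<le> Suc n - i" "Suc n - i \<le> n" using N by auto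
    have 2: "Suc (Suc n - i) = Suc n - (i - 1)" "Suc n - i - 1 = Suc n - Suc i" "(Suc n - i = 3) = (i = N)"
      using i N by auto
    have "v i = u (Suc n - i)" "v (i - 1) t = (if Suc n - i < n then u (Suc n - (i - 1)) t else 0)"
      "v (Suc i) t = (if i = N then u 1 t + u 2 t else u (Suc n - Suc i) t)"
      using i N by (auto simp: v_def)
    with m[OF 1(3,4), of t] show "v (Suc i) t = v i (t + 1) + v i (t - 1) - v (i - 1) t"
      unfolding if_not_P[OF 1(1)] if_not_P[OF 1(2)] 2 by simp
  next
    fix t
    have "Suc n - N = 3" "N \<noteq> 0" using N n by auto
    then show "v (Suc N) (t + 1) + v (Suc N) (t - 1) = 2 * v N t"
      using m[of 1 t] m[of 2 t] N n by (simp add: v_def)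
  qed (auto simp: v_def)
  have p: "4 * (int n - 1) = 2 * (2 * int (Suc N))" using N by simp
  have 3: "quasi_periodic (4 * (int n - 1)) 1 (u k)" if "3 \<le> k" "k \<le> n" for k
  proof -
    have "Suc n - k \<le> Suc N" "Suc n - k \<noteq> Suc N" "Suc n - k \<noteq> 0" "Suc n - (Suc n - k) = k" using that N by auto
    then show ?thesis using antiperiodic_double[OF v[of "Suc n - k"]] unfolding p by (simp add: v_def)
  qed
  have s: "quasi_periodic (4 * (int n - 1)) 1 (\<lambda>t. u 1 t + u 2 t)"
    using antiperiodic_double[OF v[of "Suc N"]] unfolding p by (simp add: v_def)
  \<comment> \<open>Both nodes have 3 as their only neighbour, which cancels in the difference. The
    resulting period 4 divides the period claimed.\<close>
  have "quasi_periodic 2 (- 1) (\<lambda>t. u 1 t - u 2 t)"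
    unfolding quasi_periodic_def
  proof
    fix t
    show "u 1 (t + 2) - u 2 (t + 2) = - 1 * (u 1 t - u 2 t)"
      using m[of 1 "t + 1"] m[of 2 "t + 1"] n by (simp add: add.commute[of 2 t])
  qed
  from periodic_multiple[OF antiperiodic_double[OF this], of "int n - 1"]
  have d: "quasi_periodic (4 * (int n - 1)) 1 (\<lambda>t. u 1 t - u 2 t)" by simp
  have "u 1 (t + 4 * (int n - 1)) = u 1 t" "u 2 (t + 4 * (int n - 1)) = u 2 t" for t
    using quasi_periodicD[OF s, of t] quasi_periodicD[OF d, of t] by simp_all
  then have "quasi_periodic (4 * (int n - 1)) 1 (u k)" if "k = 1 \<or> k = 2"
    using that by (auto simp: quasi_periodic_def)
  then show ?thesis using 3[of k] k by fastforce
qed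

subsection \<open>Exceptional types\<close>

lemma mesh_E6:
  "mesh (TypeE 6) u \<longleftrightarrow> (\<forall>t. u 1 (t + 1) + u 1 (t - 1) = u 2 t \<and> u 2 (t + 1) + u 2 (t - 1) = u 1 t + u 3 t \<and>
     u 3 (t + 1) + u 3 (t - 1) = u 2 t + u 4 t + u 5 t \<and> u 4 (t + 1) + u 4 (t - 1) = u 3 t \<and>
     u 5 (t + 1) + u 5 (t - 1) = u 3 t + u 6 t \<and> u 6 (t + 1) + u 6 (t - 1) = u 5 t)"
proof -
  have "{1..6 :: nat} = {1, 2, 3, 4, 5, 6}" by auto
  then show ?thesis by (auto simp: mesh_def doubleton_eq_iff)
qed

lemma mesh_E7:
  "mesh (TypeE 7) u \<longleftrightarrow> (\<forall>t. u 1 (t + 1) + u 1 (t - 1) = u 2 t \<and> u 2 (t + 1) + u 2 (t - 1) = u 1 t + u 3 t \<and>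
     u 3 (t + 1) + u 3 (t - 1) = u 2 t + u 4 t + u 5 t \<and> u 4 (t + 1) + u 4 (t - 1) = u 3 t \<and>
     u 5 (t + 1) + u 5 (t - 1) = u 3 t + u 6 t \<and> u 6 (t + 1) + u 6 (t - 1) = u 5 t + u 7 t \<and>
     u 7 (t + 1) + u 7 (t - 1) = u 6 t)"
proof -
  have "{1..7 :: nat} = {1, 2, 3, 4, 5, 6, 7}" by auto
  then show ?thesis by (auto simp: mesh_def doubleton_eq_iff)
qed

lemma mesh_E8:
  "mesh (TypeE 8) u \<longleftrightarrow> (\<forall>t. u 1 (t + 1) + u 1 (t - 1) = u 2 t \<and> u 2 (t + 1) + u 2 (t - 1) = u 1 t + u 3 t \<and>
     u 3 (t + 1) + u 3 (t - 1) = u 2 t + u 4 t + u 5 t \<and> u 4 (t + 1) + u 4 (t - 1) = u 3 t \<and>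
     u 5 (t + 1) + u 5 (t - 1) = u 3 t + u 6 t \<and> u 6 (t + 1) + u 6 (t - 1) = u 5 t + u 7 t \<and>
     u 7 (t + 1) + u 7 (t - 1) = u 6 t + u 8 t \<and> u 8 (t + 1) + u 8 (t - 1) = u 7 t)"
proof -
  have "{1..8 :: nat} = {1, 2, 3, 4, 5, 6, 7, 8}" by auto
  then show ?thesis by (auto simp: mesh_def doubleton_eq_iff)
qed

lemma mesh_F4:
  "mesh TypeF4 u \<longleftrightarrow> (\<forall>t. u 1 (t + 1) + u 1 (t - 1) = u 2 t \<and> u 2 (t + 1) + u 2 (t - 1) = u 1 t + 2 * u 3 t \<and>
     u 3 (t + 1) + u 3 (t - 1) = u 2 t + u 4 t \<and> u 4 (t + 1) + u 4 (t - 1) = u 3 t)"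
proof -
  have "{1..4 :: nat} = {1, 2, 3, 4}" by auto
  then show ?thesis by (auto simp: mesh_def)
qed

lemma mesh_G2:
  "mesh TypeG2 u \<longleftrightarrow> (\<forall>t. u 1 (t + 1) + u 1 (t - 1) = 3 * u 2 t \<and> u 2 (t + 1) + u 2 (t - 1) = u 1 t)"
proof -
  have "{1..2 :: nat} = {1, 2}" by auto
  then show ?thesis by (auto simp: mesh_def)
qed

text \<open>With \<open>y\<close> the shift by \<open>2 * a\<close>, the assumption says that
  \<open>y^2 - y + 1\<close> annihilates \<open>g\<close>; this sixth cyclotomic polynomial divides
  \<open>y^3 + 1\<close>.\<close>

lemma cyclotomic_antiperiodic:
  fixes g :: "int \<Rightarrow> int"
  assumes "\<And>t. g (t + 2 * a) + g (t - 2 * a) = g t" shows "quasi_periodic (6 * a) (- 1) g"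
  unfolding quasi_periodic_def
proof
  fix t
  show "g (t + 6 * a) = - 1 * g t"
    using assms[of "t + 4 * a"] assms[of "t + 2 * a"] by (simp add: algebra_simps)
qed

text \<open>All components are expressed by the component \<open>g\<close> at the end of the longest arm; the relation at the
  node 4 then says that a polynomial in the shift annihilates \<open>g\<close>. It divides \<open>x\<^sup>1\<^sup>2 - 1\<close> for E6,
  \<open>x\<^sup>9 + 1\<close> for E7 and \<open>x\<^sup>1\<^sup>5 + 1\<close> for E8, where \<open>x\<close> is the shift by 2.\<close>

lemma period_E6:
  assumes u: "mesh (TypeE 6) u" and k: "k \<in> {1..6}"
  shows "quasi_periodic 24 1 (u k)"
proof -
  note m = u[unfolded mesh_E6, rule_format]
  define g where "g = u 6"
  have u5: "u 5 t = g (t + 1) + g (t - 1)" for t using m[of t] by (simp add: g_def)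
  have u3: "u 3 t = g (t + 2) + g t + g (t - 2)" for t
    using m[of t] u5[of "t + 1"] u5[of "t - 1"] by (simp add: g_def algebra_simps)
  have s: "u 2 t + u 4 t = g (t + 3) + g (t + 1) + g (t - 1) + g (t - 3)" for t
    using m[of t] u3[of "t + 1"] u3[of "t - 1"] u5[of t] by (simp add: algebra_simps)
  have u1: "u 1 t = g (t + 4) + g (t - 4)" for t
    using m[of t] s[of "t + 1"] s[of "t - 1"] u3[of t] by (simp add: algebra_simps)
  have u2: "u 2 t = g (t + 5) + g (t + 3) + g (t - 3) + g (t - 5)" for t
    using m[of t] u1[of "t + 1"] u1[of "t - 1"] by (simp add: algebra_simps)
  have u4: "u 4 t = g (t + 1) + g (t - 1) - g (t + 5) - g (t - 5)" for t using s[of t] u2[of t] by simp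
  have R: "g (t + 6) + g (t + 4) - g t + g (t - 4) + g (t - 6) = 0" for t
    using m[of t] u4[of "t + 1"] u4[of "t - 1"] u3[of t] by (simp add: algebra_simps)
  \<comment> \<open>With \<open>z\<close> the shift by 2, \<open>R\<close> is the product of the
    cyclotomic polynomials \<open>z^2 + z + 1\<close> and \<open>z^4 - z^2 + 1\<close>, up to a
    shift. The second one applied to \<open>g\<close> gives \<open>w\<close>, which is annihilated
    by the first and so has period 6.\<close>
  define w where "w t = g (t + 4) - g t + g (t - 4)" for t
  have w2: "w (t + 4) + w (t + 2) + w t = 0" for t using R[of "t + 2"] by (simp add: w_def algebra_simps)
  have w6: "w (t + 6) = w t" for t using w2[of t] w2[of "t + 2"] by (simp add: algebra_simps)
  have w12: "w (t + 12) = w t" for t using w6[of t] w6[of "t + 6"] by (simp add: add.commute)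
  \<comment> \<open>\<open>z^6 + 1\<close> is \<open>z^4 - z^2 + 1\<close> times
    \<open>z^2 + 1\<close>. As \<open>w\<close> has period 12, applying this twice shows that
    \<open>g\<close> has period 24.\<close>
  have D: "g (t + 12) + g t = w (t + 8) + w (t + 4)" for t by (simp add: w_def add.commute)
  have 6: "quasi_periodic 24 1 (u 6)"
    unfolding quasi_periodic_def g_def[symmetric]
  proof
    fix t
    show "g (t + 24) = 1 * g t"
      using D[of t] D[of "t + 12"] w12[of "t + 8"] w12[of "t + 4"] by (simp add: add.commute)
  qed
  have 5: "quasi_periodic 24 1 (u 5)"
    by (rule quasi_periodic_shifts[OF 6 quasi_periodic_zero, where a = 1]) (simp add: u5 g_def)
  have 3: "quasi_periodic 24 1 (u 3)"
    by (rule quasi_periodic_shifts[OF 5 6, where a = 1]) (use m in \<open>simp add: algebra_simps\<close>)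
  have 1: "quasi_periodic 24 1 (u 1)"
    by (rule quasi_periodic_shifts[OF 6 quasi_periodic_zero, where a = 4]) (use u1 in \<open>simp add: g_def\<close>)
  have 2: "quasi_periodic 24 1 (u 2)"
    by (rule quasi_periodic_shifts[OF 1 quasi_periodic_zero, where a = 1]) (use m in simp)
  have 4: "quasi_periodic 24 1 (u 4)"
    by (rule quasi_periodic_shifts[OF 3 quasi_periodic_add[OF 2 5], where a = 1]) (use m in \<open>simp add: algebra_simps\<close>)
  have "k \<in> {1, 2, 3, 4, 5, 6}" using k by auto
  then show ?thesis using 1 2 3 4 5 6 by (elim insertE emptyE) simp_all
qed

lemma period_E7:
  assumes u: "mesh (TypeE 7) u" and k: "k \<in> {1..7}"
  shows "quasi_periodic 36 1 (u k)"
proof -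
  note m = u[unfolded mesh_E7, rule_format]
  define g where "g = u 7"
  have u6: "u 6 t = g (t + 1) + g (t - 1)" for t using m[of t] by (simp add: g_def)
  have u5: "u 5 t = g (t + 2) + g t + g (t - 2)" for t
    using m[of t] u6[of "t + 1"] u6[of "t - 1"] by (simp add: g_def algebra_simps)
  have u3: "u 3 t = g (t + 3) + g (t + 1) + g (t - 1) + g (t - 3)" for t
    using m[of t] u5[of "t + 1"] u5[of "t - 1"] u6[of t] by (simp add: algebra_simps)
  have s: "u 2 t + u 4 t = g (t + 4) + g (t + 2) + g t + g (t - 2) + g (t - 4)" for t
    using m[of t] u3[of "t + 1"] u3[of "t - 1"] u5[of t] by (simp add: algebra_simps)
  have u1: "u 1 t = g (t + 5) + g (t - 5)" for t
    using m[of t] s[of "t + 1"] s[of "t - 1"] u3[of t] by (simp add: algebra_simps)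
  have u2: "u 2 t = g (t + 6) + g (t + 4) + g (t - 4) + g (t - 6)" for t
    using m[of t] u1[of "t + 1"] u1[of "t - 1"] by (simp add: algebra_simps)
  have u4: "u 4 t = g (t + 2) + g t + g (t - 2) - g (t + 6) - g (t - 6)" for t using s[of t] u2[of t] by simp
  have R: "g (t + 7) + g (t + 5) - g (t + 1) - g (t - 1) + g (t - 5) + g (t - 7) = 0" for t
    using m[of t] u4[of "t + 1"] u4[of "t - 1"] u3[of t] by (simp add: algebra_simps)
  have R': "g (t + 14) + g (t + 12) - g (t + 8) - g (t + 6) + g (t + 2) + g t = 0" for t
    using R[of "t + 7"] by (simp add: add.commute)
  \<comment> \<open>With \<open>z\<close> the shift by 2, \<open>R'\<close> is \<open>z + 1\<close>
    times \<open>z^6 - z^3 + 1\<close>. The three instances of \<open>R'\<close> supply the cofactor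
    \<open>z^2 - z + 1\<close> in \<open>z^9 + 1\<close>.\<close>
  have "quasi_periodic 18 (- 1) (u 7)"
    unfolding quasi_periodic_def g_def[symmetric]
  proof
    fix t
    show "g (t + 18) = - 1 * g t"
      using R'[of "t + 4"] R'[of "t + 2"] R'[of t]
      by (simp only: add.assoc numeral_plus_numeral add_num_simps)
  qed
  from antiperiodic_double[OF this] have 7: "quasi_periodic 36 1 (u 7)" by simp
  have 6: "quasi_periodic 36 1 (u 6)"
    by (rule quasi_periodic_shifts[OF 7 quasi_periodic_zero, where a = 1]) (simp add: u6 g_def)
  have 5: "quasi_periodic 36 1 (u 5)"
    by (rule quasi_periodic_shifts[OF 6 7, where a = 1]) (use m in \<open>simp add: algebra_simps\<close>)
  have 3: "quasi_periodic 36 1 (u 3)"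
    by (rule quasi_periodic_shifts[OF 5 6, where a = 1]) (use m in \<open>simp add: algebra_simps\<close>)
  have 1: "quasi_periodic 36 1 (u 1)"
    by (rule quasi_periodic_shifts[OF 7 quasi_periodic_zero, where a = 5]) (use u1 in \<open>simp add: g_def\<close>)
  have 2: "quasi_periodic 36 1 (u 2)"
    by (rule quasi_periodic_shifts[OF 1 quasi_periodic_zero, where a = 1]) (use m in simp)
  have 4: "quasi_periodic 36 1 (u 4)"
    by (rule quasi_periodic_shifts[OF 3 quasi_periodic_add[OF 2 5], where a = 1]) (use m in \<open>simp add: algebra_simps\<close>)
  have "k \<in> {1, 2, 3, 4, 5, 6, 7}" using k by auto
  then show ?thesis using 1 2 3 4 5 6 7 by (elim insertE emptyE) simp_all
qed

lemma period_E8: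
  assumes u: "mesh (TypeE 8) u" and k: "k \<in> {1..8}"
  shows "quasi_periodic 60 1 (u k)"
proof -
  note m = u[unfolded mesh_E8, rule_format]
  define g where "g = u 8"
  have u7: "u 7 t = g (t + 1) + g (t - 1)" for t using m[of t] by (simp add: g_def)
  have u6: "u 6 t = g (t + 2) + g t + g (t - 2)" for t
    using m[of t] u7[of "t + 1"] u7[of "t - 1"] by (simp add: g_def algebra_simps)
  have u5: "u 5 t = g (t + 3) + g (t + 1) + g (t - 1) + g (t - 3)" for t
    using m[of t] u6[of "t + 1"] u6[of "t - 1"] u7[of t] by (simp add: algebra_simps)
  have u3: "u 3 t = g (t + 4) + g (t + 2) + g t + g (t - 2) + g (t - 4)" for t
    using m[of t] u5[of "t + 1"] u5[of "t - 1"] u6[of t] by (simp add: algebra_simps)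
  have s: "u 2 t + u 4 t = g (t + 5) + g (t + 3) + g (t + 1) + g (t - 1) + g (t - 3) + g (t - 5)" for t
    using m[of t] u3[of "t + 1"] u3[of "t - 1"] u5[of t] by (simp add: algebra_simps)
  have u1: "u 1 t = g (t + 6) + g (t - 6)" for t
    using m[of t] s[of "t + 1"] s[of "t - 1"] u3[of t] by (simp add: algebra_simps)
  have u2: "u 2 t = g (t + 7) + g (t + 5) + g (t - 5) + g (t - 7)" for t
    using m[of t] u1[of "t + 1"] u1[of "t - 1"] by (simp add: algebra_simps)
  have u4: "u 4 t = g (t + 3) + g (t + 1) + g (t - 1) + g (t - 3) - g (t + 7) - g (t - 7)" for t
    using s[of t] u2[of t] by simp
  have R: "g (t + 8) + g (t + 6) - g (t + 2) - g t - g (t - 2) + g (t - 6) + g (t - 8) = 0" for t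
    using m[of t] u4[of "t + 1"] u4[of "t - 1"] u3[of t] by (simp add: algebra_simps)
  have R': "g (t + 16) + g (t + 14) - g (t + 10) - g (t + 8) - g (t + 6) + g (t + 2) + g t = 0" for t
    using R[of "t + 8"] by (simp add: add.commute)
  \<comment> \<open>\<open>R'\<close> is the thirtieth cyclotomic polynomial in the shift
    \<open>z\<close> by 2. Its cofactor in \<open>z^15 + 1\<close> is
    \<open>z^7 - z^6 + z^5 + z^2 - z + 1\<close>, which dictates the six instances of
    \<open>R'\<close>.\<close>
  have "quasi_periodic 30 (- 1) (u 8)"
    unfolding quasi_periodic_def g_def[symmetric]
  proof
    fix t
    show "g (t + 30) = - 1 * g t"
      using R'[of "t + 14"] R'[of "t + 12"] R'[of "t + 10"] R'[of "t + 4"] R'[of "t + 2"] R'[of t]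
      by (simp only: add.assoc numeral_plus_numeral add_num_simps)
  qed
  from antiperiodic_double[OF this] have 8: "quasi_periodic 60 1 (u 8)" by simp
  have 7: "quasi_periodic 60 1 (u 7)"
    by (rule quasi_periodic_shifts[OF 8 quasi_periodic_zero, where a = 1]) (simp add: u7 g_def)
  have 6: "quasi_periodic 60 1 (u 6)"
    by (rule quasi_periodic_shifts[OF 7 8, where a = 1]) (use m in \<open>simp add: algebra_simps\<close>)
  have 5: "quasi_periodic 60 1 (u 5)"
    by (rule quasi_periodic_shifts[OF 6 7, where a = 1]) (use m in \<open>simp add: algebra_simps\<close>)
  have 3: "quasi_periodic 60 1 (u 3)"
    by (rule quasi_periodic_shifts[OF 5 6, where a = 1]) (use m in \<open>simp add: algebra_simps\<close>)
  have 1: "quasi_periodic 60 1 (u 1)"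
    by (rule quasi_periodic_shifts[OF 8 quasi_periodic_zero, where a = 6]) (use u1 in \<open>simp add: g_def\<close>)
  have 2: "quasi_periodic 60 1 (u 2)"
    by (rule quasi_periodic_shifts[OF 1 quasi_periodic_zero, where a = 1]) (use m in simp)
  have 4: "quasi_periodic 60 1 (u 4)"
    by (rule quasi_periodic_shifts[OF 3 quasi_periodic_add[OF 2 5], where a = 1]) (use m in \<open>simp add: algebra_simps\<close>)
  have "k \<in> {1, 2, 3, 4, 5, 6, 7, 8}" using k by auto
  then show ?thesis using 1 2 3 4 5 6 7 8 by (elim insertE emptyE) simp_all
qed

lemma period_F4:
  assumes u: "mesh TypeF4 u" and k: "k \<in> {1..4}"
  shows "quasi_periodic 24 1 (u k)"
proof -
  note m = u[unfolded mesh_F4, rule_format]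
  define g where "g = u 4"
  have u3: "u 3 t = g (t + 1) + g (t - 1)" for t using m[of t] by (simp add: g_def)
  have u2: "u 2 t = g (t + 2) + g t + g (t - 2)" for t
    using m[of t] u3[of "t + 1"] u3[of "t - 1"] by (simp add: g_def algebra_simps)
  have u1: "u 1 t = g (t + 3) + g (t - 3)" for t
    using m[of t] u2[of "t + 1"] u2[of "t - 1"] u3[of t] by (simp add: algebra_simps)
  have "g (t + 4) + g (t - 4) = g t" for t
    using m[of t] u1[of "t + 1"] u1[of "t - 1"] u2[of t] by (simp add: algebra_simps)
  then have "quasi_periodic 12 (- 1) (u 4)" using cyclotomic_antiperiodic[of g 2] by (simp add: g_def)
  from antiperiodic_double[OF this] have 4: "quasi_periodic 24 1 (u 4)" by simp
  have 3: "quasi_periodic 24 1 (u 3)"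
    by (rule quasi_periodic_shifts[OF 4 quasi_periodic_zero, where a = 1]) (simp add: u3 g_def)
  have 2: "quasi_periodic 24 1 (u 2)"
    by (rule quasi_periodic_shifts[OF 3 4, where a = 1]) (use m in \<open>simp add: algebra_simps\<close>)
  have 1: "quasi_periodic 24 1 (u 1)"
    by (rule quasi_periodic_shifts[OF 4 quasi_periodic_zero, where a = 3]) (use u1 in \<open>simp add: g_def\<close>)
  have "k \<in> {1, 2, 3, 4}" using k by auto
  then show ?thesis using 1 2 3 4 by (elim insertE emptyE) simp_all
qed

lemma period_G2:
  assumes u: "mesh TypeG2 u" and k: "k \<in> {1..2}"
  shows "quasi_periodic 12 1 (u k)"
proof -
  note m = u[unfolded mesh_G2, rule_format]
  have u1: "u 1 t = u 2 (t + 1) + u 2 (t - 1)" for t using m[of t] by simp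
  have "u 2 (t + 2) + u 2 (t - 2) = u 2 t" for t
    using m[of t] u1[of "t + 1"] u1[of "t - 1"] by (simp add: algebra_simps)
  then have "quasi_periodic 6 (- 1) (u 2)" using cyclotomic_antiperiodic[of "u 2" 1] by simp
  from antiperiodic_double[OF this] have 2: "quasi_periodic 12 1 (u 2)" by simp
  have 1: "quasi_periodic 12 1 (u 1)"
    by (rule quasi_periodic_shifts[OF 2 quasi_periodic_zero, where a = 1]) (use u1 in simp)
  have "k \<in> {1, 2}" using k by auto
  then show ?thesis using 1 2 by (elim insertE emptyE) simp_all
qed

subsection \<open>Exactness\<close>

definition mesh_periodic :: "dynkin_type \<Rightarrow> nat \<Rightarrow> bool" where
  "mesh_periodic X m \<longleftrightarrow> (\<forall>u. mesh X u \<longrightarrow> (\<forall>k\<in>{1..type_rank X}. \<forall>t. u k (t + 2 * int m) = u k t))"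

lemma mesh_periodicD:
  "\<lbrakk>mesh_periodic X m; mesh X u; 1 \<le> k; k \<le> type_rank X\<rbrakk> \<Longrightarrow> u k (t + 2 * int m) = u k t"
  by (simp add: mesh_periodic_def)

lemma mesh_periodicI:
  assumes "\<And>u k. \<lbrakk>mesh X u; k \<in> {1..type_rank X}\<rbrakk> \<Longrightarrow> quasi_periodic (2 * int h) 1 (u k)" and "h dvd m"
  shows "mesh_periodic X m"
  unfolding mesh_periodic_def
proof (intro allI impI ballI)
  fix u k t assume "mesh X u" "k \<in> {1..type_rank X}"
  from assms(1)[OF this] have p: "quasi_periodic (2 * int h) 1 (u k)" .
  obtain r where r: "m = h * r" using assms(2) by blast
  show "u k (t + 2 * int m) = u k t"
    using quasi_periodicD[OF periodic_multiple[OF p, of "int r"], of t] by (simp add: r mult.assoc)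
qed

text \<open>If \<open>h\<close> did not divide \<open>m\<close>, the greatest common divisor of the
  two would be a proper divisor of \<open>h\<close>, and twice it a period of \<open>g\<close>. Any
  multiple \<open>e\<close> of it may serve to refute this, so only the maximal proper divisors of
  \<open>h\<close> have to be inspected.\<close>

lemma period_dvd:
  fixes g :: "int \<Rightarrow> int" and h m :: nat
  assumes "quasi_periodic (2 * int h) 1 g" "\<And>t. g (t + 2 * int m) = g t"
    and "\<And>d. \<lbrakk>d dvd h; d \<noteq> h\<rbrakk> \<Longrightarrow> \<exists>e. d dvd e \<and> g (2 * int e) \<noteq> g 0"
  shows "h dvd m"
proof (rule ccontr)
  assume "\<not> h dvd m"
  then have "gcd h m \<noteq> h" by (metis gcd_dvd2)
  with assms(3)[of "gcd h m"] obtain r where r: "g (2 * int (gcd h m * r)) \<noteq> g 0" by (metis dvdE gcd_dvd1)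
  have "quasi_periodic (2 * int m) 1 g" using assms(2) by (simp add: quasi_periodic_def)
  from periodic_gcd[OF assms(1) this] have "quasi_periodic (2 * int (gcd h m)) 1 g" by (simp add: gcd_mult_left)
  from quasi_periodicD[OF periodic_multiple[OF this, of "int r"], of 0] r show False by (simp add: mult.assoc)
qed

lemma exact_A:
  assumes n: "n \<ge> 1" and p: "mesh_periodic (TypeA n) m"
  shows "n + 1 dvd m"
proof -
  define f :: "int \<Rightarrow> int" where "f t = (if 2 * (int n + 1) dvd t then 1 else 0)" for t
  \<comment> \<open>The solution of the wave equation by two travelling waves, with a fixed end at
    0; as \<open>f\<close> has period \<open>2 * (n + 1)\<close>, it also vanishes at the node
    \<open>n + 1\<close>.\<close>
  define u where "u k t = f (t + int k) - f (t - int k)" for k t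
  have f: "f (t + 2 * (int n + 1)) = f t" for t unfolding f_def by (subst dvd_add_left_iff) auto
  have rec: "u (Suc k) t + u (k - 1) t = u k (t + 1) + u k (t - 1)" if "k \<ge> 1" for k t
    using that by (simp add: u_def of_nat_diff algebra_simps)
  have 0: "u 0 t = 0" "u (Suc n) t = 0" for t
    using f[of "t - (int n + 1)"] by (simp_all add: u_def algebra_simps)
  have "mesh (TypeA n) u"
    unfolding mesh_A
  proof (intro ballI allI)
    fix k t assume k: "k \<in> {1..n}"
    have "(if k < n then u (Suc k) t else 0) = u (Suc k) t" using k 0 by (cases "k = n") auto
    moreover have "(if 1 < k then u (k - 1) t else 0) = u (k - 1) t" using k 0 by (cases "k = 1") auto
    ultimately show "u k (t + 1) + u k (t - 1) = (if k < n then u (Suc k) t else 0) + (if 1 < k then u (k - 1) t else 0)"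
      using rec[of k t] k by simp
  qed
  \<comment> \<open>At node 1 and time \<open>- 1\<close> the solution has the value
    \<open>f 0 - f (- 2) = 1\<close>; a difference of two values 0 or 1 can be 1 only if the first
    of them is.\<close>
  from mesh_periodicD[OF p this, of 1 "- 1"] n have "f (2 * int m) - f (2 * int m - 2) = f 0 - f (- 2)"
    by (simp add: u_def algebra_simps)
  moreover have "f 0 = 1" "f (- 2) = 0"
    using n zdvd_imp_le[of "2 * (int n + 1)" 2] by (auto simp: f_def)
  ultimately have "f (2 * int m) = 1" by (auto simp: f_def split: if_splits)
  then have "2 * (int n + 1) dvd 2 * int m" by (simp add: f_def split: if_splits)
  then have "int n + 1 dvd int m" by (simp only: dvd_mult_cancel_left) simp
  then have "int (n + 1) dvd int m" by (simp add: add.commute)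
  then show ?thesis by (simp only: int_dvd_int_iff)
qed

text \<open>By antiperiodicity \<open>folded N (N + 1) = folded N (N - 1)\<close>: a solution on the path with \<open>2 N - 1\<close> nodes
  that is invariant under the flip. It descends to solutions of types B, C and D.\<close>

definition folded :: "nat \<Rightarrow> nat \<Rightarrow> int \<Rightarrow> int" where
  "folded N i t = impulse (2 * int N) (t + int i) - impulse (2 * int N) (t - int i)"

lemma folded_mesh:
  shows "folded N 0 t = 0"
    and "1 \<le> i \<Longrightarrow> folded N i (t + 1) + folded N i (t - 1) = folded N (Suc i) t + folded N (i - 1) t"
    and "1 \<le> N \<Longrightarrow> folded N N (t + 1) + folded N N (t - 1) = 2 * folded N (N - 1) t"
proof -
  show "folded N 0 t = 0" by (simp add: folded_def)
  show rec: "folded N i (t + 1) + folded N i (t - 1) = folded N (Suc i) t + folded N (i - 1) t" if "1 \<le> i" for i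
    using that by (simp add: folded_def of_nat_diff algebra_simps)
  assume N: "1 \<le> N"
  then have a: "quasi_periodic (2 * int N) (- 1) (impulse (2 * int N))" by (intro impulse_antiperiodic) simp
  have "folded N (Suc N) t = folded N (N - 1) t"
    using quasi_periodicD[OF a, of "t + 1 - int N"] quasi_periodicD[OF a, of "t - 1 - int N"] N
    by (simp add: folded_def of_nat_diff algebra_simps)
  then show "folded N N (t + 1) + folded N N (t - 1) = 2 * folded N (N - 1) t" using rec[OF N] by simp
qed

text \<open>A period \<open>2 * m\<close> of \<open>folded N 1\<close> means that the increment
  \<open>d\<close> of the impulse over \<open>2 * m\<close> has period 2. It also changes sign after
  \<open>2 * N\<close> steps, hence \<open>d 0 = 0\<close> and the impulse returns to the value
  1.\<close>

lemma folded_exact: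
  assumes N: "1 \<le> N" and p: "\<And>t. folded N 1 (t + 2 * int m) = folded N 1 t"
  shows "2 * N dvd m"
proof -
  define f where "f = impulse (2 * int N)"
  have a: "f (t + 2 * int N) = - f t" for t
    using quasi_periodicD[OF impulse_antiperiodic, of "2 * int N" t] N by (simp add: f_def)
  define d where "d t = f (t + 2 * int m) - f t" for t
  have d2: "quasi_periodic 2 1 d"
    unfolding quasi_periodic_def
  proof
    fix t
    show "d (t + 2) = 1 * d t" using p[of "t + 1"] by (simp add: folded_def d_def f_def algebra_simps)
  qed
  have "d (0 + 2 * int N) = - d 0" using a[of "2 * int m"] a[of 0] by (simp add: d_def algebra_simps)
  then have "d 0 = 0" using quasi_periodicD[OF periodic_multiple[OF d2, of "int N"], of 0] by simp
  then have "f (2 * int m) = 1" by (simp add: d_def f_def impulse_def)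
  then have "2 * (2 * int N) dvd 2 * int m" by (simp add: f_def impulse_def split: if_splits)
  then have "2 * int N dvd int m" by (simp only: dvd_mult_cancel_left) simp
  then have "int (2 * N) dvd int m" by simp
  then show ?thesis by (simp only: int_dvd_int_iff)
qed

lemma exact_B:
  assumes n: "n \<ge> 2" and p: "mesh_periodic (TypeB n) m"
  shows "2 * n dvd m"
proof (rule folded_exact)
  define u where "u k = folded n (Suc n - k)" for k
  have "mesh (TypeB n) u"
    unfolding mesh_B[OF n]
  proof (intro ballI allI)
    fix k t assume k: "k \<in> {1..n}"
    show "u k (t + 1) + u k (t - 1) = (if k = 1 then 2 * u 2 t else (if k < n then u (Suc k) t else 0) + u (k - 1) t)"
    proof (cases "k = 1")
      case True
      have "Suc n - 2 = n - 1" by simp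
      then show ?thesis using folded_mesh(3)[of n t] n True by (simp add: u_def)
    next
      case False
      then have "Suc n - (k - 1) = Suc (Suc n - k)" "Suc n - Suc k = Suc n - k - 1" using k by auto
      then show ?thesis using folded_mesh(2)[of "Suc n - k" n t] folded_mesh(1)[of n t] False k by (auto simp: u_def)
    qed
  qed
  from mesh_periodicD[OF p this, of n] n show "folded n 1 (t + 2 * int m) = folded n 1 t" for t by (simp add: u_def)
qed (use n in simp)

lemma exact_C:
  assumes n: "n \<ge> 2" and p: "mesh_periodic (TypeC n) m"
  shows "2 * n dvd m"
proof (rule folded_exact)
  \<comment> \<open>Node 1 is left undoubled, which is where the solution absorbs the factor 2 that
    the relation at node 2 puts on \<open>u 1\<close>.\<close>
  define u where "u k t = (if k = 1 then 1 else 2) * folded n (Suc n - k) t" for k t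
  have "mesh (TypeC n) u"
    unfolding mesh_C[OF n]
  proof (intro ballI allI)
    fix k t assume k: "k \<in> {1..n}"
    show "u k (t + 1) + u k (t - 1) =
      (if k < n then u (Suc k) t else 0) + (if k = 1 then 0 else if k = 2 then 2 * u 1 t else u (k - 1) t)"
    proof (cases "k = 1")
      case True
      then show ?thesis using folded_mesh(3)[of n t] n by (simp add: u_def)
    next
      case False
      then have "Suc n - (k - 1) = Suc (Suc n - k)" "Suc n - Suc k = Suc n - k - 1" using k by auto
      moreover have "k - 1 = 1 \<longleftrightarrow> k = 2" using False k by auto
      moreover have "1 \<le> Suc n - k" using k by auto
      ultimately show ?thesis
        using folded_mesh(2)[of "Suc n - k" n t] folded_mesh(1)[of n t] False k by (auto simp: u_def)
    qed
  qed
  from mesh_periodicD[OF p this, of n] n show "folded n 1 (t + 2 * int m) = folded n 1 t" for t by (simp add: u_def)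
qed (use n in simp)

lemma exact_D:
  assumes n: "n \<ge> 4" and p: "mesh_periodic (TypeD n) m"
  shows "2 * (n - 1) dvd m"
proof (rule folded_exact)
  obtain N where N: "n = Suc N" using n by (cases n) auto
  \<comment> \<open>With \<open>N = n - 1\<close>, both short arms carry the end of the folded path;
    the other nodes are doubled so that they match the sum of these two components.\<close>
  define u where "u k t = (if k \<le> 2 then folded N N t else 2 * folded N (Suc n - k) t)" for k t
  have "mesh (TypeD n) u"
    unfolding mesh_D[OF n]
  proof (intro ballI allI)
    fix k t assume k: "k \<in> {1..n}"
    show "u k (t + 1) + u k (t - 1) = (if k = 1 then u 3 t else (if k < n then u (Suc k) t else 0) +
       (if k = 2 then 0 else if k = 3 then u 1 t + u 2 t else u (k - 1) t))"
    proof (cases "k \<le> 2")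
      case True
      then have "k = 1 \<or> k = 2" "Suc n - 3 = N - 1" using k N by auto
      then show ?thesis using folded_mesh(3)[of N t] n N by (auto simp: u_def)
    next
      case False
      have 2: "Suc n - (k - 1) = Suc (Suc n - k)" "Suc n - Suc k = Suc n - k - 1" using False k by auto
      have "(if k = 3 then u 1 t + u 2 t else u (k - 1) t) = 2 * folded N (Suc n - (k - 1)) t"
        using False N by (auto simp: u_def)
      moreover have "(if k < n then u (Suc k) t else 0) = 2 * folded N (Suc n - Suc k) t"
        using False k folded_mesh(1)[of N t] by (auto simp: u_def)
      moreover have "1 \<le> Suc n - k" using k by auto
      ultimately show ?thesis
        using folded_mesh(2)[of "Suc n - k" N t] False unfolding 2 by (simp add: u_def)
    qed
  qed
  from mesh_periodicD[OF p this, of n] n show "folded (n - 1) 1 (t + 2 * int m) = folded (n - 1) 1 t" for t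
    by (simp add: u_def N)
qed (use n in simp)

text \<open>Here and in the next three facts: a proper divisor of a number \<open>h\<close> divides
  \<open>h / p\<close> for some prime divisor \<open>p\<close> of \<open>h\<close>.\<close>

lemma proper_divisor_6: "\<lbrakk>d dvd 6; d \<noteq> 6\<rbrakk> \<Longrightarrow> d dvd 3 \<or> d dvd 2" for d :: nat
proof -
  assume d: "d dvd 6" "d \<noteq> 6"
  then have "d \<in> set [0..<7]" using dvd_imp_le[of d 6] by auto
  moreover have "\<forall>d\<in>set [0..<7]. d dvd 6 \<longrightarrow> d \<noteq> 6 \<longrightarrow> d dvd 3 \<or> d dvd 2" by code_simp
  ultimately show ?thesis using d by blast
qed

lemma proper_divisor_12: "\<lbrakk>d dvd 12; d \<noteq> 12\<rbrakk> \<Longrightarrow> d dvd 6 \<or> d dvd 4" for d :: nat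
proof -
  assume d: "d dvd 12" "d \<noteq> 12"
  then have "d \<in> set [0..<13]" using dvd_imp_le[of d 12] by auto
  moreover have "\<forall>d\<in>set [0..<13]. d dvd 12 \<longrightarrow> d \<noteq> 12 \<longrightarrow> d dvd 6 \<or> d dvd 4" by code_simp
  ultimately show ?thesis using d by blast
qed

lemma proper_divisor_18: "\<lbrakk>d dvd 18; d \<noteq> 18\<rbrakk> \<Longrightarrow> d dvd 9 \<or> d dvd 6" for d :: nat
proof -
  assume d: "d dvd 18" "d \<noteq> 18"
  then have "d \<in> set [0..<19]" using dvd_imp_le[of d 18] by auto
  moreover have "\<forall>d\<in>set [0..<19]. d dvd 18 \<longrightarrow> d \<noteq> 18 \<longrightarrow> d dvd 9 \<or> d dvd 6" by code_simp
  ultimately show ?thesis using d by blast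
qed

lemma proper_divisor_30: "\<lbrakk>d dvd 30; d \<noteq> 30\<rbrakk> \<Longrightarrow> d dvd 15 \<or> d dvd 10 \<or> d dvd 6" for d :: nat
proof -
  assume d: "d dvd 30" "d \<noteq> 30"
  then have "d \<in> set [0..<31]" using dvd_imp_le[of d 30] by auto
  moreover have "\<forall>d\<in>set [0..<31]. d dvd 30 \<longrightarrow> d \<noteq> 30 \<longrightarrow> d dvd 15 \<or> d dvd 10 \<or> d dvd 6" by code_simp
  ultimately show ?thesis using d by blast
qed

text \<open>With \<open>y\<close> the shift by \<open>2 * a\<close>, the impulse is annihilated by
  \<open>y^3 + 1\<close>; applying the factor \<open>y + 1\<close> leaves a function annihilated by
  \<open>y^2 - y + 1\<close>.\<close>

lemma cyclotomic_solution:
  assumes "a > 0" and g: "\<And>t. g t = impulse (6 * a) (t + 2 * a) + impulse (6 * a) t"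
  shows "g (t + 2 * a) + g (t - 2 * a) = g t"
  using quasi_periodicD[OF impulse_antiperiodic[of "6 * a"], of "t - 2 * a"] assms(1)
  by (simp add: g algebra_simps)

text \<open>The solution is invariant under the flip of the graph that exchanges 1 with 6 and 2 with
  5; its components are those of the solution used for F4.\<close>

lemma exact_E6:
  assumes p: "mesh_periodic (TypeE 6) m" shows "12 dvd m"
proof (rule period_dvd)
  define g where "g t = impulse 12 (t + 4) + impulse 12 t" for t
  have R: "g (t + 4) + g (t - 4) = g t" for t using cyclotomic_solution[where a = 2 and g = g and t = t] by (simp add: g_def)
  define u where "u k t = (if k = (6::nat) then g t else if k = 5 then g (t + 1) + g (t - 1)
    else if k = 3 then g (t + 2) + g t + g (t - 2) else if k = 1 then g t else if k = 2 then g (t + 1) + g (t - 1)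
    else g (t + 3) + g (t - 3))" for k t
  have "mesh (TypeE 6) u"
    unfolding mesh_E6 u_def using R by (simp add: algebra_simps)
  from mesh_periodicD[OF p this, of 6] show "g (t + 2 * int m) = g t" for t by (simp add: u_def)
  show "quasi_periodic (2 * int 12) 1 g"
    using antiperiodic_double[OF cyclotomic_antiperiodic[of g 2]] R by simp
  show "\<exists>e. d dvd e \<and> g (2 * int e) \<noteq> g 0" if "d dvd 12" "d \<noteq> 12" for d
    using proper_divisor_12[OF that] by (elim disjE) (intro exI conjI, assumption, simp add: g_def impulse_def)+
qed

lemma exact_F4:
  assumes p: "mesh_periodic TypeF4 m" shows "12 dvd m"
proof (rule period_dvd)
  define g where "g t = impulse 12 (t + 4) + impulse 12 t" for t
  have R: "g (t + 4) + g (t - 4) = g t" for t using cyclotomic_solution[where a = 2 and g = g and t = t] by (simp add: g_def)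
  define u where "u k t = (if k = (4::nat) then g t else if k = 3 then g (t + 1) + g (t - 1)
    else if k = 2 then g (t + 2) + g t + g (t - 2) else g (t + 3) + g (t - 3))" for k t
  have "mesh TypeF4 u"
    unfolding mesh_F4 u_def using R by (simp add: algebra_simps)
  from mesh_periodicD[OF p this, of 4] show "g (t + 2 * int m) = g t" for t by (simp add: u_def)
  show "quasi_periodic (2 * int 12) 1 g"
    using antiperiodic_double[OF cyclotomic_antiperiodic[of g 2]] R by simp
  show "\<exists>e. d dvd e \<and> g (2 * int e) \<noteq> g 0" if "d dvd 12" "d \<noteq> 12" for d
    using proper_divisor_12[OF that] by (elim disjE) (intro exI conjI, assumption, simp add: g_def impulse_def)+
qed

lemma exact_G2:
  assumes p: "mesh_periodic TypeG2 m" shows "6 dvd m"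
proof (rule period_dvd)
  define g where "g t = impulse 6 (t + 2) + impulse 6 t" for t
  have R: "g (t + 2) + g (t - 2) = g t" for t using cyclotomic_solution[where a = 1 and g = g and t = t] by (simp add: g_def)
  define u where "u k t = (if k = (2::nat) then g t else g (t + 1) + g (t - 1))" for k t
  have "mesh TypeG2 u"
    unfolding mesh_G2 u_def using R by (simp add: algebra_simps)
  from mesh_periodicD[OF p this, of 2] show "g (t + 2 * int m) = g t" for t by (simp add: u_def)
  show "quasi_periodic (2 * int 6) 1 g"
    using antiperiodic_double[OF cyclotomic_antiperiodic[of g 1]] R by simp
  show "\<exists>e. d dvd e \<and> g (2 * int e) \<noteq> g 0" if "d dvd 6" "d \<noteq> 6" for d
    using proper_divisor_6[OF that] by (elim disjE) (intro exI conjI, assumption, simp add: g_def impulse_def)+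
qed

lemma exact_E7:
  assumes p: "mesh_periodic (TypeE 7) m" shows "18 dvd m"
proof (rule period_dvd)
  define e where "e = impulse 18"
  \<comment> \<open>\<open>z^3 + 1\<close> applied to the impulse, with \<open>z\<close> the shift
    by 2. The impulse is annihilated by \<open>z^9 + 1\<close>, so \<open>g\<close> is annihilated
    by \<open>z^6 - z^3 + 1\<close>, a factor of the relation \<open>R\<close>.\<close>
  define g where "g t = e (t + 6) + e t" for t
  have e: "e (t + 18) = - e t" for t using quasi_periodicD[OF impulse_antiperiodic[of 18], of t] by (simp add: e_def)
  have R: "g (t + 7) + g (t + 5) - g (t + 1) - g (t - 1) + g (t - 5) + g (t - 7) = 0" for t
    using e[of "t - 5"] e[of "t - 7"] by (simp add: g_def add.commute)
  \<comment> \<open>The expressions by the component at the end of the long arm, as in the bound for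
    the period; \<open>R\<close> is then the one relation with content.\<close>
  define u where "u k t = (if k = (7::nat) then g t else if k = 6 then g (t + 1) + g (t - 1)
    else if k = 5 then g (t + 2) + g t + g (t - 2) else if k = 3 then g (t + 3) + g (t + 1) + g (t - 1) + g (t - 3)
    else if k = 1 then g (t + 5) + g (t - 5) else if k = 2 then g (t + 6) + g (t + 4) + g (t - 4) + g (t - 6)
    else g (t + 2) + g t + g (t - 2) - g (t + 6) - g (t - 6))" for k t
  have "mesh (TypeE 7) u"
    unfolding mesh_E7 u_def
  proof (intro allI, goal_cases)
    case (1 t)
    show ?case using R[of t] by (simp add: algebra_simps)
  qed
  from mesh_periodicD[OF p this, of 7] show "g (t + 2 * int m) = g t" for t by (simp add: u_def)
  have "quasi_periodic 18 (- 1) g"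
    unfolding quasi_periodic_def
  proof
    fix t
    show "g (t + 18) = - 1 * g t" using e[of t] e[of "t + 6"] by (simp add: g_def add.commute)
  qed
  from antiperiodic_double[OF this] show "quasi_periodic (2 * int 18) 1 g" by simp
  show "\<exists>c. d dvd c \<and> g (2 * int c) \<noteq> g 0" if "d dvd 18" "d \<noteq> 18" for d
    using proper_divisor_18[OF that] by (elim disjE) (intro exI conjI, assumption, simp add: g_def e_def impulse_def)+
qed

lemma exact_E8:
  assumes p: "mesh_periodic (TypeE 8) m" shows "30 dvd m"
proof (rule period_dvd)
  define e where "e = impulse 30"
  \<comment> \<open>The cofactor of the thirtieth cyclotomic polynomial in \<open>z^15 + 1\<close>,
    applied to the impulse, with \<open>z\<close> the shift by 2; hence \<open>g\<close> satisfies
    \<open>R\<close>.\<close>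
  define g where "g t = e (t + 14) - e (t + 12) + e (t + 10) + e (t + 4) - e (t + 2) + e t" for t
  have e: "e (t + 30) = - e t" for t using quasi_periodicD[OF impulse_antiperiodic[of 30], of t] by (simp add: e_def)
  have R: "g (t + 8) + g (t + 6) - g (t + 2) - g t - g (t - 2) + g (t - 6) + g (t - 8) = 0" for t
    using e[of "t - 8"] by (simp add: g_def add.commute)
  define u where "u k t = (if k = (8::nat) then g t else if k = 7 then g (t + 1) + g (t - 1)
    else if k = 6 then g (t + 2) + g t + g (t - 2) else if k = 5 then g (t + 3) + g (t + 1) + g (t - 1) + g (t - 3)
    else if k = 3 then g (t + 4) + g (t + 2) + g t + g (t - 2) + g (t - 4)
    else if k = 1 then g (t + 6) + g (t - 6) else if k = 2 then g (t + 7) + g (t + 5) + g (t - 5) + g (t - 7)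
    else g (t + 3) + g (t + 1) + g (t - 1) + g (t - 3) - g (t + 7) - g (t - 7))" for k t
  have "mesh (TypeE 8) u"
    unfolding mesh_E8 u_def
  proof (intro allI, goal_cases)
    case (1 t)
    show ?case using R[of t] by (simp add: algebra_simps)
  qed
  from mesh_periodicD[OF p this, of 8] show "g (t + 2 * int m) = g t" for t by (simp add: u_def)
  have "quasi_periodic 30 (- 1) g"
    unfolding quasi_periodic_def
  proof
    fix t
    have "g (t + 30) = e (t + 14 + 30) - e (t + 12 + 30) + e (t + 10 + 30) + e (t + 4 + 30) - e (t + 2 + 30) + e (t + 30)"
      by (simp add: g_def)
    also have "\<dots> = - 1 * g t" unfolding e g_def by simp
    finally show "g (t + 30) = - 1 * g t" .
  qed
  from antiperiodic_double[OF this] show "quasi_periodic (2 * int 30) 1 g" by simp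
  show "\<exists>c. d dvd c \<and> g (2 * int c) \<noteq> g 0" if "d dvd 30" "d \<noteq> 30" for d
    using proper_divisor_30[OF that] by (elim disjE) (intro exI conjI, assumption, simp add: g_def e_def impulse_def)+
qed

section \<open>Exact periods for all types\<close>

definition coxeter_number :: "dynkin_type \<Rightarrow> nat" where
  "coxeter_number X = (case X of
       TypeA n \<Rightarrow> n + 1
     | TypeB n \<Rightarrow> 2 * n
     | TypeC n \<Rightarrow> 2 * n
     | TypeD n \<Rightarrow> 2 * (n - 1)
     | TypeE n \<Rightarrow> (if n = 6 then 12 else if n = 7 then 18 else 30)
     | TypeF4 \<Rightarrow> 12
     | TypeG2 \<Rightarrow> 6)"

lemma mesh_period:
  assumes "valid_type X" "mesh X u" "k \<in> {1..type_rank X}"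
  shows "quasi_periodic (2 * int (coxeter_number X)) 1 (u k)"
proof (cases X)
  case (TypeA n)
  then show ?thesis using period_A[of n u k] assms by (simp add: coxeter_number_def add.commute)
next
  case (TypeB n)
  then show ?thesis using period_B[of n u k] assms by (simp add: coxeter_number_def)
next
  case (TypeC n)
  then show ?thesis using period_C[of n u k] assms by (simp add: coxeter_number_def)
next
  case (TypeD n)
  then show ?thesis using period_D[of n u k] assms by (simp add: coxeter_number_def of_nat_diff)
next
  case (TypeE n)
  then have "n = 6 \<or> n = 7 \<or> n = 8" using assms by simp
  then show ?thesis using TypeE period_E6[of u k] period_E7[of u k] period_E8[of u k] assms
    by (elim disjE) (simp_all add: coxeter_number_def)
next
  case TypeF4
  then show ?thesis using period_F4[of u k] assms by (simp add: coxeter_number_def)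
next
  case TypeG2
  then show ?thesis using period_G2[of u k] assms by (simp add: coxeter_number_def)
qed

lemma mesh_periodic_iff:
  assumes "valid_type X"
  shows "mesh_periodic X m \<longleftrightarrow> coxeter_number X dvd m"
proof
  assume p: "mesh_periodic X m"
  show "coxeter_number X dvd m"
  proof (cases X)
    case (TypeA n)
    then show ?thesis using exact_A[of n m] p assms by (simp add: coxeter_number_def)
  next
    case (TypeB n)
    then show ?thesis using exact_B[of n m] p assms by (simp add: coxeter_number_def)
  next
    case (TypeC n)
    then show ?thesis using exact_C[of n m] p assms by (simp add: coxeter_number_def)
  next
    case (TypeD n)
    then show ?thesis using exact_D[of n m] p assms by (simp add: coxeter_number_def)
  next
    case (TypeE n)
    then have "n = 6 \<or> n = 7 \<or> n = 8" using assms by simp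
    then show ?thesis using TypeE exact_E6[of m] exact_E7[of m] exact_E8[of m] p
      by (elim disjE) (simp_all add: coxeter_number_def)
  next
    case TypeF4
    then show ?thesis using exact_F4[of m] p by (simp add: coxeter_number_def)
  next
    case TypeG2
    then show ?thesis using exact_G2[of m] p by (simp add: coxeter_number_def)
  qed
next
  assume "coxeter_number X dvd m"
  then show "mesh_periodic X m" by (rule mesh_periodicI[rotated]) (rule mesh_period[OF assms])
qed

section \<open>The order of the Coxeter transformation\<close>

lemma map_order_eqI:
  assumes "h > 0" "\<And>m. C ^^ m = id \<longleftrightarrow> h dvd m"
  shows "map_order C = h"
proof -
  have "(LEAST k. k > 0 \<and> C ^^ k = id) = h"
    using assms by (intro Least_equality) (auto dest: dvd_imp_le)
  then show ?thesis using assms by (auto simp: map_order_def)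
qed

text \<open>Without 2-cycles each edge comes from exactly one arrow, so at most one of
  \<open>a j k\<close> and \<open>b k j\<close> is nonzero, and it is the first label of the edge
  read from \<open>j\<close> to \<open>k\<close>. The heights are pulled back from the tree.\<close>

lemma dynkin_section:
  fixes a b :: "'n::finite \<Rightarrow> 'n \<Rightarrow> nat"
  assumes "dynkin_quiver_of_type {(i, (a i j, b i j), j) | i j. a i j \<noteq> 0} X"
    and b: "\<And>i j. a i j = 0 \<Longrightarrow> b i j = 0"
  obtains \<sigma> :: "'n \<Rightarrow> nat" and \<xi> :: "'n \<Rightarrow> int" where
    "bij_betw \<sigma> UNIV {1..type_rank X}" "\<And>j k. weight X (\<sigma> j) (\<sigma> k) = int (a j k) + int (b k j)"
    "\<And>i j. a i j \<noteq> 0 \<Longrightarrow> \<xi> j = \<xi> i - 1"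
proof -
  let ?Q = "{(i, (a i j, b i j), j) | i j. a i j \<noteq> 0}"
  from assms(1) obtain \<sigma> :: "'n \<Rightarrow> nat" where X: "valid_type X" and no2: "\<not> has_2_cycle ?Q"
    and \<sigma>: "bij_betw \<sigma> UNIV {1..type_rank X}"
    and iso: "\<And>x \<alpha> \<beta> y. (x, (\<alpha>, \<beta>), y) \<in> underlying_graph ?Q \<longleftrightarrow> (\<sigma> x, (\<alpha>, \<beta>), \<sigma> y) \<in> dynkin_graph X"
    unfolding dynkin_quiver_of_type_def by blast
  \<comment> \<open>Loops are excluded as well: with \<open>i = j\<close> a loop forms a 2-cycle
    with itself.\<close>
  have oneway: "a j i = 0" if "a i j \<noteq> 0" for i j
    using no2 that unfolding has_2_cycle_def by fastforce
  have edge: "(\<sigma> i, (a i j, b i j), \<sigma> j) \<in> dynkin_graph X" "(\<sigma> j, (b i j, a i j), \<sigma> i) \<in> dynkin_graph X"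
    if "a i j \<noteq> 0" for i j
    using that unfolding iso[symmetric] by (auto simp: underlying_graph_def)
  have weight: "weight X (\<sigma> j) (\<sigma> k) = int (a j k) + int (b k j)" for j k
  proof -
    consider "a j k \<noteq> 0" | "a k j \<noteq> 0" | "a j k = 0" "a k j = 0" by blast
    then show ?thesis
    proof cases
      case 1
      then show ?thesis using weight_edge[OF X edge(1)] b[OF oneway] by simp
    next
      case 2
      then show ?thesis using weight_edge[OF X edge(2)] oneway by simp
    next
      case 3
      then have "(\<sigma> j, (\<alpha>, \<beta>), \<sigma> k) \<notin> dynkin_graph X" for \<alpha> \<beta>
        unfolding iso[symmetric] by (auto simp: underlying_graph_def)
      then show ?thesis
        using weight_no_edge[OF X, of "\<sigma> j" "\<sigma> k"] bij_betw_apply[OF \<sigma>] b 3 by simp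
    qed
  qed
  define \<tau> where "\<tau> = inv_into UNIV \<sigma>"
  have \<tau>: "\<tau> (\<sigma> j) = j" for j using \<sigma> by (simp add: \<tau>_def bij_betw_def)
  \<comment> \<open>Each edge is listed once in \<open>type_edges\<close>, in an arbitrary
    direction; the increment is \<open>- 1\<close> if the arrow of the quiver agrees with it and 1
    if it is opposite.\<close>
  obtain \<xi> :: "nat \<Rightarrow> int" where
    \<xi>: "\<And>j l k. (j, l, k) \<in> type_edges X \<Longrightarrow> \<xi> k = \<xi> j + (if a (\<tau> j) (\<tau> k) \<noteq> 0 then - 1 else 1)"
    using orientation_section[OF X, of "\<lambda>j k. if a (\<tau> j) (\<tau> k) \<noteq> 0 then - 1 else 1"] by blast
  have "\<xi> (\<sigma> j) = \<xi> (\<sigma> i) - 1" if a: "a i j \<noteq> 0" for i j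
    using edge(1)[OF a] \<xi>[of "\<sigma> i" _ "\<sigma> j"] \<xi>[of "\<sigma> j" _ "\<sigma> i"] a oneway[OF a]
    unfolding dynkin_graph_iff by (auto simp: \<tau>)
  with \<sigma> weight show ?thesis by (rule that[of \<sigma> "\<lambda>i. \<xi> (\<sigma> i)"])
qed

text \<open>No module enters any more: the argument rests on the two relations and the valued
  quiver, and the orientation disappears with the passage to \<open>mesh_periodic\<close>.\<close>

lemma map_order_coxeter:
  fixes p q :: "'n::finite \<Rightarrow> int^'n" and a b :: "'n \<Rightarrow> 'n \<Rightarrow> nat"
  assumes p: "\<And>i k. (\<Sum>j\<in>UNIV. p i $ j * ((if j = k then 1 else 0) - int (a j k))) = (if i = k then 1 else 0)"
    and q: "\<And>j k. q j $ k = (if j = k then 1 else 0) + (\<Sum>i\<in>UNIV. q j $ i * int (b k i))"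
    and Q: "dynkin_quiver_of_type {(i, (a i j, b i j), j) | i j. a i j \<noteq> 0} X"
    and b: "\<And>i j. a i j = 0 \<Longrightarrow> b i j = 0"
    and C: "C = (THE C. (\<forall>x y. C (x + y) = C x + C y) \<and> bij C \<and> (\<forall>i. C (p i) = - q i))"
  shows "map_order C = coxeter_number X"
proof (rule map_order_eqI)
  have X: "valid_type X" using Q by (simp add: dynkin_quiver_of_type_def)
  then show "coxeter_number X > 0" by (cases X) (auto simp: coxeter_number_def)
  obtain \<sigma> :: "'n \<Rightarrow> nat" and \<xi> :: "'n \<Rightarrow> int" where \<sigma>\<xi>: "bij_betw \<sigma> UNIV {1..type_rank X}"
    "\<And>j k. weight X (\<sigma> j) (\<sigma> k) = int (a j k) + int (b k j)" "\<And>i j. a i j \<noteq> 0 \<Longrightarrow> \<xi> j = \<xi> i - 1"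
    using dynkin_section[OF Q b] by blast
  have "b i j \<noteq> 0 \<Longrightarrow> a i j \<noteq> 0" for i j using b by metis
  then have "C ^^ m = id \<longleftrightarrow> mesh_periodic X m" for m
    unfolding mesh_periodic_def by (intro coxeter_mesh[OF coxeter_characterization[OF p q C] \<sigma>\<xi>])
  then show "C ^^ m = id \<longleftrightarrow> coxeter_number X dvd m" for m using mesh_periodic_iff[OF X] by simp
qed

theorem proposition4p4p2:
  fixes R :: "'r ring"
    and H :: "('r, 'h) module"
    and S :: "'n::finite \<Rightarrow> ('h, 's) module"
    and P :: "'n \<Rightarrow> ('h, 'p) module"
    and I :: "'n \<Rightarrow> ('h, 'i) module"
    and X :: dynkin_type
  assumes "artin_algebra R H"
    and "hereditary H"
    and "complete_simples H S"
    and "\<And>i. projective_cover H (P i) (S i)"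
    and "\<And>i. injective_envelope H (I i) (S i)"
    and "dynkin_quiver_of_type (ext_quiver H S) X"
  shows "map_order (coxeter_transformation H S P I) =
    (case X of
       TypeA n \<Rightarrow> n + 1
     | TypeB n \<Rightarrow> 2 * n
     | TypeC n \<Rightarrow> 2 * n
     | TypeD n \<Rightarrow> 2 * (n - 1)
     | TypeE n \<Rightarrow> (if n = 6 then 12 else if n = 7 then 18 else 30)
     | TypeF4 \<Rightarrow> 12
     | TypeG2 \<Rightarrow> 6)"
proof -
  obtain a b where ab:
    "\<And>i k. (\<Sum>j\<in>UNIV. dim_vector H S (P i) $ j * ((if j = k then 1 else 0) - int (a j k))) = (if i = k then 1 else 0)"
    "\<And>j k. dim_vector H S (I j) $ k = (if j = k then 1 else 0) + (\<Sum>i\<in>UNIV. dim_vector H S (I j) $ i * int (b k i))"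
    "ext_quiver H S = {(i, (a i j, b i j), j) | i j. a i j \<noteq> 0}" "\<And>i j. a i j = 0 \<Longrightarrow> b i j = 0"
    using cartan_relations[OF assms(1-5)] by blast
  show ?thesis
    using map_order_coxeter[OF ab(1,2) assms(6)[unfolded ab(3)] ab(4) coxeter_transformation_def]
    by (simp only: coxeter_number_def)
qed

end
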